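(* There exist constants $c,C\ge1$ such that for all $t>0$ and $x,y\in\mathbb{R}^{d+n}$, \[p(t,x,y)\le C t^{-d/\alpha-n/2}\prod_{i=1}^d\Big(1\wedge\frac{t^{1/\alpha}}{|x^i-y^i|}\Big)^{\alpha/3}\exp\Big(-\frac{|\widetilde x-\widetilde y|^2}{ct}\Big).\]
   Context: Standing setup. Let $d,n\in\mathbb{N}$, $\alpha\in(0,2)$, $\kappa\ge1$. Points of $\mathbb{R}^{d+n}$ are written $x=(x^1,\dots,x^{d+n})=\sum_i x^i e^i$ with $e^i$ the standard unit vectors; $x'=(x^1,\dots,x^d,0,\dots,0)$ and $\widetilde x=(0,\dots,0,x^{d+1},\dots,x^{d+n})$. Define $\mathscr J(x,y)=|x^i-y^i|^{-1-\alpha}$ if $y-x=ae^i$ for some $a\ne0$ and some $i\in\{1,\dots,d\}$, and $\mathscr J(x,y)=0$ otherwise. For a nonnegative function $F$ set $\int_{\mathbb{R}^{d+n}}F(x,y)\,m(dy):=\sum_{i=1}^d\int_{\mathbb{R}}F(x,x+he^i)\,dh$. Let $J$ be symmetric, measurable, with $\kappa^{-1}\mathscr J\le J\le\kappa\mathscr J$. Let $\mathscr A(x)=(a_{ij}(x))$ be measurable with $a_{ij}=a_{ji}$ a.e. and $\kappa^{-1}|\widetilde\xi|^2\le\sum_{i,j}a_{ij}(x)\xi^i\xi^j\le\kappa|\widetilde\xi|^2$ for all $x,\xi$. Define $\mathcal E(u,v)=\int\int(u(y)-u(x))(v(y)-v(x))J(x,y)\,m(dy)\,dx+\int\nabla u\cdot\mathscr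 A\nabla v\,dx$, $\mathcal F=\{u\in L^2(\mathbb{R}^{d+n}):\mathcal E(u,u)<\infty\}$ (a regular Dirichlet form), and let $X$ be the associated symmetric Hunt process with laws $\mathbb P^x$ and continuous transition density (heat kernel) $p(t,x,y)$ with respect to Lebesgue measure. *)

theory Defs
  imports "HOL-Analysis.Analysis"
begin

text \<open>Points of R^(d+n) are modelled as pairs (x', x~) in (real^'d) \<times> (real^'n),
  with d = CARD('d) and n = CARD('n).  The first component carries the coordinates
  x^1..x^d (jump directions), the second the coordinates x^(d+1)..x^(d+n).\<close>

type_synonym ('d, 'n) pt = "(real^'d) \<times> (real^'n)"

definition ejump :: "'d::finite \<Rightarrow> ('d::finite, 'n::finite) pt" where
  "ejump i = (axis i 1, 0)"

definition ediff :: "'n::finite \<Rightarrow> ('d::finite, 'n::finite) pt" where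
  "ediff j = (0, axis j 1)"

text \<open>The model kernel script-J(x,y): |x^i-y^i|^(-1-alpha) if y - x = a e^i, a \<noteq> 0,
  i in {1..d}; 0 otherwise.  (At most one i can match, so the sum has at most one
  nonzero term.)\<close>
definition Jmodel :: "real \<Rightarrow> ('d::finite, 'n::finite) pt \<Rightarrow> ('d, 'n) pt \<Rightarrow> real" where
  "Jmodel \<alpha> x y = (\<Sum>i\<in>UNIV. if (\<exists>a. a \<noteq> 0 \<and> y - x = a *\<^sub>R ejump i)
                       then \<bar>fst x $ i - fst y $ i\<bar> powr (-1 - \<alpha>) else 0)"

definition L2 :: "('a::euclidean_space \<Rightarrow> real) set" where
  "L2 = {u. u \<in> borel_measurable lborel \<and> integrable lborel (\<lambda>x. (u x)\<^sup>2)}"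

definition test_fun :: "('a::euclidean_space \<Rightarrow> real) \<Rightarrow> bool" where
  "test_fun \<phi> \<longleftrightarrow> (\<forall>x. \<phi> differentiable (at x))
     \<and> (\<forall>b. continuous_on UNIV (\<lambda>x. frechet_derivative \<phi> (at x) b))
     \<and> compact (closure {x. \<phi> x \<noteq> 0})"

definition loc_integrable :: "('a::euclidean_space \<Rightarrow> real) \<Rightarrow> bool" where
  "loc_integrable u \<longleftrightarrow> u \<in> borel_measurable lborel \<and>
     (\<forall>K. compact K \<longrightarrow> set_integrable lborel K u)"

definition weak_deriv :: "('a::euclidean_space \<Rightarrow> real) \<Rightarrow> 'a \<Rightarrow> ('a \<Rightarrow> real) \<Rightarrow> bool" where
  "weak_deriv u b g \<longleftrightarrow> loc_integrable u \<and> loc_integrable g \<and>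
     (\<forall>\<phi>. test_fun \<phi> \<longrightarrow>
        integrable lborel (\<lambda>x. u x * frechet_derivative \<phi> (at x) b) \<and>
        integrable lborel (\<lambda>x. g x * \<phi> x) \<and>
        (LINT x|lborel. u x * frechet_derivative \<phi> (at x) b) = - (LINT x|lborel. g x * \<phi> x))"

definition wgrad :: "('a::euclidean_space \<Rightarrow> real) \<Rightarrow> 'a \<Rightarrow> 'a \<Rightarrow> real" where
  "wgrad u b = (SOME g. weak_deriv u b g)"

text \<open>Jump part of the form: int int (u(y)-u(x))(v(y)-v(x)) J(x,y) m(dy) dx, where
  int F(x,y) m(dy) = sum_{i=1}^d int F(x, x + h e^i) dh.\<close>
definition form_jump :: "(('d::finite, 'n::finite) pt \<Rightarrow> ('d, 'n) pt \<Rightarrow> real)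
    \<Rightarrow> (('d, 'n) pt \<Rightarrow> real) \<Rightarrow> (('d, 'n) pt \<Rightarrow> real) \<Rightarrow> real" where
  "form_jump J u v = (LINT x|lborel. (\<Sum>i\<in>UNIV. LINT h|lborel.
      (u (x + h *\<^sub>R ejump i) - u x) * (v (x + h *\<^sub>R ejump i) - v x) * J x (x + h *\<^sub>R ejump i)))"

text \<open>Diffusion part: int grad u . A grad v dx.  The coefficient matrix A(x) is given by
  a x b1 b2 for b1, b2 in Basis.  By the ellipticity hypothesis, A(x) vanishes (a.e.) on
  all rows/columns belonging to the first d coordinates, so only the weak derivatives in
  the last n coordinates enter.\<close>
definition form_diff :: "(('d::finite, 'n::finite) pt \<Rightarrow> ('d, 'n) pt \<Rightarrow> ('d, 'n) pt \<Rightarrow> real)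
    \<Rightarrow> (('d, 'n) pt \<Rightarrow> real) \<Rightarrow> (('d, 'n) pt \<Rightarrow> real) \<Rightarrow> real" where
  "form_diff a u v = (LINT x|lborel. (\<Sum>i\<in>UNIV. \<Sum>j\<in>UNIV.
      a x (ediff i) (ediff j) * wgrad u (ediff i) x * wgrad v (ediff j) x))"

definition form_E where
  "form_E J a u v = form_jump J u v + form_diff a u v"

text \<open>The energy E(u,u) as an extended nonnegative real (to express finiteness).\<close>
definition energy :: "(('d::finite, 'n::finite) pt \<Rightarrow> ('d, 'n) pt \<Rightarrow> real)
    \<Rightarrow> (('d, 'n) pt \<Rightarrow> ('d, 'n) pt \<Rightarrow> ('d, 'n) pt \<Rightarrow> real)
    \<Rightarrow> (('d, 'n) pt \<Rightarrow> real) \<Rightarrow> ennreal" where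
  "energy J a u =
     (\<integral>\<^sup>+x. (\<Sum>i\<in>UNIV. \<integral>\<^sup>+h. ennreal ((u (x + h *\<^sub>R ejump i) - u x)\<^sup>2 * J x (x + h *\<^sub>R ejump i)) \<partial>lborel) \<partial>lborel)
   + (\<integral>\<^sup>+x. ennreal (\<Sum>i\<in>UNIV. \<Sum>j\<in>UNIV.
        a x (ediff i) (ediff j) * wgrad u (ediff i) x * wgrad u (ediff j) x) \<partial>lborel)"

definition form_dom where
  "form_dom J a = {u \<in> L2. (\<forall>j. \<exists>g. weak_deriv u (ediff j) g) \<and> energy J a u < \<infinity>}"

definition L2_inner :: "('a::euclidean_space \<Rightarrow> real) \<Rightarrow> ('a \<Rightarrow> real) \<Rightarrow> real" where
  "L2_inner u v = (LINT x|lborel. u x * v x)"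

text \<open>U t = P_t f, where (P_t) is the strongly continuous symmetric L^2 semigroup
  associated with (E,F): U is continuous at 0+ in L^2 with U 0+ = f, U t in F for t>0,
  U is strongly differentiable in L^2 on (0,infinity) with derivative U' t, and
  (U' t, v) + E(U t, v) = 0 for all v in F.  Such U is unique (energy argument).\<close>
definition semigroup_orbit where
  "semigroup_orbit J a f U \<longleftrightarrow>
     ((\<lambda>t. \<integral>\<^sup>+x. ennreal ((U t x - f x)\<^sup>2) \<partial>lborel) \<longlongrightarrow> 0) (at_right 0) \<and>
     (\<forall>t>0. U t \<in> form_dom J a) \<and>
     (\<exists>U'. \<forall>t>0. U' t \<in> L2 \<and>
        ((\<lambda>s. \<integral>\<^sup>+x. ennreal (((U s x - U t x) / (s - t) - U' t x)\<^sup>2) \<partial>lborel) \<longlongrightarrow> 0) (at t) \<and>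
        (\<forall>v\<in>form_dom J a. L2_inner (U' t) v + form_E J a (U t) v = 0))"

definition is_heat_kernel where
  "is_heat_kernel J a p \<longleftrightarrow>
     continuous_on ({0<..} \<times> UNIV) (\<lambda>(t, x, y). p t x y) \<and>
     (\<forall>f\<in>L2. \<exists>U. semigroup_orbit J a f U \<and>
        (\<forall>t>0. AE x in lborel. integrable lborel (\<lambda>y. p t x y * f y) \<and>
                 U t x = (LINT y|lborel. p t x y * f y)))"

end

theory Submission
  imports Defs
begin

text \<open>Davies' method. For a bounded smooth weight \<open>\<psi>\<close> and an orbit \<open>U\<close>, the integral \<open>y\<^sub>p\<close> of
  \<open>(exp \<psi> * U) ^ (2 p)\<close> satisfies \<open>y\<^sub>p' \<le> - c E(v\<^sup>p, v\<^sup>p) + C p\<^sup>2 \<Gamma> y\<^sub>p\<close> with \<open>v = exp \<psi> * U\<close>, where \<open>\<Gamma>\<close>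
  bounds the energy density of \<open>\<psi>\<close>. Together with the Nash inequality for \<open>v\<^sup>p\<close>, which compares \<open>y\<^sub>p\<close> with
  the square of \<open>y\<close> at \<open>p / 2\<close>, iterating over \<open>p = 2\<^sup>k\<close> bounds \<open>exp \<psi> * U\<close> uniformly by its initial \<open>L2\<close> norm.
  Duality turns this into a bound for the heat kernel times \<open>exp (\<psi> x - \<psi> y)\<close>. Jumps move one coordinate at a time, so a weight
  that is a sum of functions of the single coordinates \<open>x\<^sup>i\<close> and of a function of the diffusive variable can be optimised
  in each coordinate separately, which gives the product form of the estimate.\<close>

section \<open>Square-integrable functions and test functions\<close>

text \<open>The equation of an orbit may only be tested with members of the form domain, and powers
  are not globally Lipschitz. Hence an orbit with bounded datum is first shown to be bounded, and
  every chain rule is stated on an interval \<open>I\<close> containing the values. Only the n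
  diffusive weak derivatives exist, so regularity is treated one direction at a time. The moments of
  order 2^k are controlled only for t > 0 and blow up as t tends to 0. Each doubling therefore
  carries a power of t; its constants grow geometrically in k, which is harmless once the root of
  order 2^k is taken. A weight \<psi> costs exp (K \<Gamma> t) and gains exp (\<psi> y - \<psi> x).
  A profile of oscillation l over a distance R has jump cost of order exp (3 l) R^(-\<alpha>); one
  third of ln (R^\<alpha> / t) is the largest l that keeps its product with t bounded, and the gain
  is (t^(1/\<alpha>) / R)^(\<alpha>/3). For the diffusion the cost is quadratic in the slope and the
  gain linear, so a small slope leaves a Gaussian factor. All of this is an estimate in integrated
  form; the pointwise bound uses the continuity of the kernel.\<close>

definition sqn :: "('a::euclidean_space \<Rightarrow> real) \<Rightarrow> ennreal" where
  "sqn f = (\<integral>\<^sup>+x. ennreal ((f x)\<^sup>2) \<partial>lborel)"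

lemma L2_measurable [measurable_dest]: "f \<in> L2 \<Longrightarrow> f \<in> borel_measurable borel"
  by (simp add: L2_def)

lemma L2_iff_sqn: "f \<in> L2 \<longleftrightarrow> f \<in> borel_measurable borel \<and> sqn f < \<infinity>"
proof -
  have "integrable lborel (\<lambda>x. (f x)\<^sup>2) \<longleftrightarrow> sqn f < \<infinity>" if [measurable]: "f \<in> borel_measurable borel"
    unfolding integrable_iff_bounded sqn_def by simp
  then show ?thesis unfolding L2_def by auto
qed

lemma sqn_eq_integral: "f \<in> L2 \<Longrightarrow> sqn f = ennreal (LINT x|lborel. (f x)\<^sup>2)"
  unfolding sqn_def L2_def by (intro nn_integral_eq_integral) auto

lemma integral_sq_nonneg: "0 \<le> (LINT x|lborel. (f x :: real)\<^sup>2)"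
  by (rule Bochner_Integration.integral_nonneg) simp

lemma sqn_mono_AE: "AE x in lborel. \<bar>f x\<bar> \<le> \<bar>g x\<bar> \<Longrightarrow> sqn f \<le> sqn g"
  unfolding sqn_def
  by (rule nn_integral_mono_AE) (auto simp: abs_le_square_iff elim: eventually_mono)

lemma sqn_cong_AE: "AE x in lborel. f x = g x \<Longrightarrow> sqn f = sqn g"
  unfolding sqn_def by (rule nn_integral_cong_AE) (auto elim: eventually_mono)

lemma sqn_cmult:
  assumes [measurable]: "f \<in> borel_measurable borel"
  shows "sqn (\<lambda>x. c * f x) = ennreal (c\<^sup>2) * sqn f"
  unfolding sqn_def by (simp add: power_mult_distrib ennreal_mult nn_integral_cmult)

lemma sqn_add_le:
  assumes [measurable]: "f \<in> borel_measurable borel" "g \<in> borel_measurable borel"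
  shows "sqn (\<lambda>x. f x + g x) \<le> 2 * sqn f + 2 * sqn g"
proof -
  have "sqn (\<lambda>x. f x + g x) \<le> (\<integral>\<^sup>+x. 2 * ennreal ((f x)\<^sup>2) + 2 * ennreal ((g x)\<^sup>2) \<partial>lborel)"
    unfolding sqn_def
  proof (rule nn_integral_mono)
    fix x
    have "(f x + g x)\<^sup>2 \<le> 2 * (f x)\<^sup>2 + 2 * (g x)\<^sup>2"
      using sum_squares_bound[of "f x" "g x"] by (simp add: power2_eq_square algebra_simps)
    then show "ennreal ((f x + g x)\<^sup>2) \<le> 2 * ennreal ((f x)\<^sup>2) + 2 * ennreal ((g x)\<^sup>2)"
      by (simp flip: ennreal_numeral ennreal_mult ennreal_plus add: ennreal_leI)
  qed
  also have "\<dots> = 2 * sqn f + 2 * sqn g"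
    unfolding sqn_def by (simp add: nn_integral_add nn_integral_cmult)
  finally show ?thesis .
qed

lemma sqn_diff_le:
  assumes [measurable]: "f \<in> borel_measurable borel" "g \<in> borel_measurable borel"
  shows "sqn (\<lambda>x. f x - g x) \<le> 2 * sqn f + 2 * sqn g"
  using sqn_add_le[of f "\<lambda>x. - g x"] by (simp add: sqn_def)

lemma nn_integral_lborel_shift:
  fixes v :: "'a::euclidean_space"
  assumes [measurable]: "f \<in> borel_measurable borel"
  shows "(\<integral>\<^sup>+x. f (x + v) \<partial>lborel) = (\<integral>\<^sup>+x. f x \<partial>lborel)"
proof -
  have "(\<integral>\<^sup>+x. f x \<partial>lborel) = (\<integral>\<^sup>+x. f x \<partial>distr lborel borel ((+) v))"
    by (simp add: lborel_distr_plus)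
  also have "\<dots> = (\<integral>\<^sup>+x. f (v + x) \<partial>lborel)"
    by (subst nn_integral_distr) auto
  finally show ?thesis by (simp add: add.commute)
qed

lemma integral_lborel_shift:
  fixes v :: "'a::euclidean_space" and f :: "'a \<Rightarrow> real"
  assumes [measurable]: "f \<in> borel_measurable borel"
  shows "(LINT x|lborel. f (x + v)) = (LINT x|lborel. f x)"
proof -
  have "(LINT x|lborel. f x) = (LINT x|distr lborel borel ((+) v). f x)"
    by (simp add: lborel_distr_plus)
  also have "\<dots> = (LINT x|lborel. f (v + x))"
    by (subst integral_distr) auto
  finally show ?thesis by (simp add: add.commute)
qed

lemma AE_lborel_shift:
  fixes v :: "'a::euclidean_space"
  assumes "AE x in lborel. P x"
  shows "AE x in lborel. P (x + v)"
proof -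
  have "AE x in distr lborel borel ((+) v). P x"
    unfolding lborel_distr_plus by (rule assms)
  then have "AE x in lborel. P (v + x)"
    by (rule AE_distrD[rotated]) simp
  then show ?thesis by (simp add: add.commute)
qed

lemma sqn_shift:
  fixes f :: "'a::euclidean_space \<Rightarrow> real"
  assumes [measurable]: "f \<in> borel_measurable borel"
  shows "sqn (\<lambda>x. f (x + v)) = sqn f"
  unfolding sqn_def by (rule nn_integral_lborel_shift) auto

lemma L2_shift: "f \<in> L2 \<Longrightarrow> (\<lambda>x. f (x + v)) \<in> L2"
  unfolding L2_iff_sqn using sqn_shift[of f v] by auto

lemma L2_add: "f \<in> L2 \<Longrightarrow> g \<in> L2 \<Longrightarrow> (\<lambda>x. f x + g x) \<in> L2"
  unfolding L2_iff_sqn using sqn_add_le[of f g]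
  by (auto simp: ennreal_mult_less_top intro!: le_less_trans[OF sqn_add_le])

lemma L2_cmult: "f \<in> L2 \<Longrightarrow> (\<lambda>x. c * f x) \<in> L2"
  unfolding L2_iff_sqn using sqn_cmult[of f c] by (auto simp: ennreal_mult_less_top)

lemma L2_diff: "f \<in> L2 \<Longrightarrow> g \<in> L2 \<Longrightarrow> (\<lambda>x. f x - g x) \<in> L2"
  using L2_add[of f "\<lambda>x. -1 * g x"] L2_cmult[of g "-1"] by simp

lemma L2_dominated:
  assumes "g \<in> L2" "f \<in> borel_measurable borel" "AE x in lborel. \<bar>f x\<bar> \<le> B * \<bar>g x\<bar>"
  shows "f \<in> L2"
proof -
  have "sqn f \<le> sqn (\<lambda>x. B * g x)"
  proof (rule sqn_mono_AE)
    show "AE x in lborel. \<bar>f x\<bar> \<le> \<bar>B * g x\<bar>"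
      using assms(3)
    proof eventually_elim
      case (elim x)
      have "B * \<bar>g x\<bar> \<le> \<bar>B\<bar> * \<bar>g x\<bar>" by (intro mult_right_mono) auto
      with elim show ?case by (simp add: abs_mult)
    qed
  qed
  then show ?thesis
    using L2_cmult[OF assms(1), of B] assms(2) unfolding L2_iff_sqn by auto
qed

lemma integrable_mult_L2:
  assumes "f \<in> L2" "g \<in> L2"
  shows "integrable lborel (\<lambda>x. f x * g x)"
proof (rule Bochner_Integration.integrable_bound)
  show "integrable lborel (\<lambda>x. (f x)\<^sup>2 + (g x)\<^sup>2)"
    using assms by (auto simp: L2_def)
  show "(\<lambda>x. f x * g x) \<in> borel_measurable lborel"
    using assms by (auto simp: L2_def)
  have "\<bar>f x * g x\<bar> \<le> (f x)\<^sup>2 + (g x)\<^sup>2" for x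
    using sum_squares_bound[of "\<bar>f x\<bar>" "\<bar>g x\<bar>"] mult_nonneg_nonneg[of "\<bar>f x\<bar>" "\<bar>g x\<bar>"]
    unfolding abs_mult power2_abs by linarith
  then show "AE x in lborel. norm (f x * g x) \<le> norm ((f x)\<^sup>2 + (g x)\<^sup>2)"
    by auto
qed

lemma Cauchy_Schwarz_L2:
  assumes "f \<in> L2" "g \<in> L2"
  shows "(LINT x|lborel. f x * g x)\<^sup>2 \<le> (LINT x|lborel. (f x)\<^sup>2) * (LINT x|lborel. (g x)\<^sup>2)"
proof -
  note [measurable] = assms[THEN L2_measurable]
  let ?I = "LINT x|lborel. \<bar>f x * g x\<bar>"
  have i: "integrable lborel (\<lambda>x. \<bar>f x * g x\<bar>)"
    using integrable_mult_L2[OF assms] by simp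
  have "(\<integral>\<^sup>+x. ennreal \<bar>f x\<bar> * ennreal \<bar>g x\<bar> \<partial>lborel)\<^sup>2
      \<le> (\<integral>\<^sup>+x. (ennreal \<bar>f x\<bar>)\<^sup>2 \<partial>lborel) * (\<integral>\<^sup>+x. (ennreal \<bar>g x\<bar>)\<^sup>2 \<partial>lborel)"
    by (rule Cauchy_Schwarz_nn_integral) auto
  also have "(\<integral>\<^sup>+x. (ennreal \<bar>f x\<bar>)\<^sup>2 \<partial>lborel) = ennreal (LINT x|lborel. (f x)\<^sup>2)"
    using sqn_eq_integral[OF assms(1)] by (simp add: sqn_def ennreal_power)
  also have "(\<integral>\<^sup>+x. (ennreal \<bar>g x\<bar>)\<^sup>2 \<partial>lborel) = ennreal (LINT x|lborel. (g x)\<^sup>2)"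
    using sqn_eq_integral[OF assms(2)] by (simp add: sqn_def ennreal_power)
  also have "(\<integral>\<^sup>+x. ennreal \<bar>f x\<bar> * ennreal \<bar>g x\<bar> \<partial>lborel) = ennreal ?I"
    using i by (subst nn_integral_eq_integral[symmetric]) (auto simp: abs_mult ennreal_mult)
  finally have "?I\<^sup>2 \<le> (LINT x|lborel. (f x)\<^sup>2) * (LINT x|lborel. (g x)\<^sup>2)"
    by (simp add: ennreal_power integral_sq_nonneg flip: ennreal_mult)
  moreover have "\<bar>LINT x|lborel. f x * g x\<bar> \<le> ?I"
    using integral_norm_bound[of lborel "\<lambda>x. f x * g x"] by simp
  then have "(LINT x|lborel. f x * g x)\<^sup>2 \<le> ?I\<^sup>2"
    by (rule power2_le_iff_abs_le[THEN iffD2, rotated]) (auto intro: Bochner_Integration.integral_nonneg)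
  ultimately show ?thesis by linarith
qed

lemma sqn_tendsto_0_dominated:
  fixes f :: "nat \<Rightarrow> 'a::euclidean_space \<Rightarrow> real"
  assumes [measurable]: "\<And>n. f n \<in> borel_measurable borel" and g: "g \<in> L2"
    and le: "\<And>n. AE x in lborel. \<bar>f n x\<bar> \<le> \<bar>g x\<bar>"
    and lim: "AE x in lborel. (\<lambda>n. f n x) \<longlonglongrightarrow> 0"
  shows "(\<lambda>n. sqn (f n)) \<longlonglongrightarrow> 0"
proof -
  note [measurable] = g[THEN L2_measurable]
  have "(\<lambda>n. \<integral>\<^sup>+x. ennreal ((f n x)\<^sup>2) \<partial>lborel) \<longlonglongrightarrow> (\<integral>\<^sup>+(x::'a). 0 \<partial>lborel)"
  proof (rule nn_integral_dominated_convergence[where w = "\<lambda>x. ennreal ((g x)\<^sup>2)"])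
    show "AE x in lborel. ennreal ((f n x)\<^sup>2) \<le> ennreal ((g x)\<^sup>2)" for n
      using le[of n] by eventually_elim (simp add: abs_le_square_iff)
    show "(\<integral>\<^sup>+ x. ennreal ((g x)\<^sup>2) \<partial>lborel) < \<infinity>"
      using g unfolding L2_iff_sqn sqn_def by simp
    show "AE x in lborel. (\<lambda>n. ennreal ((f n x)\<^sup>2)) \<longlonglongrightarrow> 0"
      using lim
    proof eventually_elim
      case (elim x)
      then have "(\<lambda>n. (f n x)\<^sup>2) \<longlonglongrightarrow> 0"
        using tendsto_power[of "\<lambda>n. f n x" 0 _ 2] by simp
      then have "(\<lambda>n. ennreal ((f n x)\<^sup>2)) \<longlonglongrightarrow> ennreal 0" by (rule tendsto_ennrealI)
      then show ?case by simp
    qed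
  qed auto
  then show ?thesis by (simp add: sqn_def)
qed

lemma sqn_AE_subseq:
  fixes f :: "nat \<Rightarrow> 'a::euclidean_space \<Rightarrow> real"
  assumes [measurable]: "\<And>n. f n \<in> L2" and lim: "(\<lambda>n. sqn (f n)) \<longlonglongrightarrow> 0"
  shows "\<exists>r::nat\<Rightarrow>nat. strict_mono r \<and> (AE x in lborel. (\<lambda>n. f (r n) x) \<longlonglongrightarrow> 0)"
proof -
  have "\<exists>r::nat\<Rightarrow>nat. strict_mono r \<and> (AE x in lborel. (\<lambda>n. (f (r n) x)\<^sup>2) \<longlonglongrightarrow> 0)"
  proof (rule tendsto_L1_AE_subseq)
    show "integrable lborel (\<lambda>x. (f n x)\<^sup>2)" for n using assms(1)[of n] by (simp add: L2_def)
    have "(\<lambda>n. ennreal (LINT x|lborel. (f n x)\<^sup>2)) \<longlonglongrightarrow> ennreal 0"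
      using lim sqn_eq_integral[OF assms(1)] by simp
    then show "(\<lambda>n. LINT x|lborel. norm ((f n x)\<^sup>2)) \<longlonglongrightarrow> 0"
      by (subst (asm) tendsto_ennreal_iff) (auto simp: integral_sq_nonneg)
  qed
  then obtain r :: "nat \<Rightarrow> nat" where r: "strict_mono r" "AE x in lborel. (\<lambda>n. (f (r n) x)\<^sup>2) \<longlonglongrightarrow> 0"
    by auto
  from r(2) have "AE x in lborel. (\<lambda>n. f (r n) x) \<longlonglongrightarrow> 0"
  proof eventually_elim
    case (elim x)
    then have "(\<lambda>n. sqrt ((f (r n) x)\<^sup>2)) \<longlonglongrightarrow> sqrt 0" by (rule tendsto_real_sqrt)
    then show ?case by (simp add: tendsto_rabs_zero_iff)
  qed
  with r(1) show ?thesis by auto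
qed

section \<open>C1 functions, cutoffs and test functions\<close>

definition C1_fun :: "('a::euclidean_space \<Rightarrow> real) \<Rightarrow> bool" where
  "C1_fun \<phi> \<longleftrightarrow> (\<forall>x. \<phi> differentiable (at x))
     \<and> (\<forall>b. continuous_on UNIV (\<lambda>x. frechet_derivative \<phi> (at x) b))"

lemma test_fun_iff: "test_fun \<phi> \<longleftrightarrow> C1_fun \<phi> \<and> compact (closure {x. \<phi> x \<noteq> 0})"
  unfolding test_fun_def C1_fun_def by auto

lemma C1_fun_has_derivative: "C1_fun \<phi> \<Longrightarrow> (\<phi> has_derivative frechet_derivative \<phi> (at x)) (at x)"
  unfolding C1_fun_def by (simp add: frechet_derivative_works)

lemma C1_fun_continuous: "C1_fun \<phi> \<Longrightarrow> continuous_on S \<phi>"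
  unfolding C1_fun_def by (metis differentiable_imp_continuous_within continuous_at_imp_continuous_on)

lemma C1_fun_continuous_deriv: "C1_fun \<phi> \<Longrightarrow> continuous_on UNIV (\<lambda>x. frechet_derivative \<phi> (at x) b)"
  unfolding C1_fun_def by simp

lemma C1_fun_measurable [measurable_dest]: "C1_fun \<phi> \<Longrightarrow> \<phi> \<in> borel_measurable borel"
  by (rule borel_measurable_continuous_onI) (rule C1_fun_continuous)

lemma C1_fun_measurable_deriv:
  "C1_fun \<phi> \<Longrightarrow> (\<lambda>x. frechet_derivative \<phi> (at x) b) \<in> borel_measurable borel"
  by (rule borel_measurable_continuous_onI) (rule C1_fun_continuous_deriv)

lemma C1_funI:
  assumes "\<And>x. (\<phi> has_derivative D x) (at x)" "\<And>b. continuous_on UNIV (\<lambda>x. D x b)"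
  shows "C1_fun \<phi>"
proof -
  have "frechet_derivative \<phi> (at x) = D x" for x
    using frechet_derivative_at[OF assms(1)] by simp
  then show ?thesis
    using assms unfolding C1_fun_def differentiable_def by auto
qed

lemma frechet_derivative_eq: "(f has_derivative D) (at x) \<Longrightarrow> frechet_derivative f (at x) = D"
  using frechet_derivative_at by metis

lemma C1_fun_mult:
  assumes "C1_fun f" "C1_fun g"
  shows "C1_fun (\<lambda>x. f x * g x)"
    and "frechet_derivative (\<lambda>x. f x * g x) (at x) b
      = f x * frechet_derivative g (at x) b + frechet_derivative f (at x) b * g x"
proof -
  have d: "((\<lambda>x. f x * g x) has_derivative
      (\<lambda>b. f x * frechet_derivative g (at x) b + frechet_derivative f (at x) b * g x)) (at x)" for x
    by (intro has_derivative_mult C1_fun_has_derivative assms)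
  show "C1_fun (\<lambda>x. f x * g x)"
    by (rule C1_funI[OF d])
      (intro continuous_intros C1_fun_continuous C1_fun_continuous_deriv assms)
  show "frechet_derivative (\<lambda>x. f x * g x) (at x) b
      = f x * frechet_derivative g (at x) b + frechet_derivative f (at x) b * g x"
    using frechet_derivative_eq[OF d] by simp
qed

lemma C1_fun_add:
  assumes "C1_fun f" "C1_fun g"
  shows "C1_fun (\<lambda>x. f x + g x)"
    and "frechet_derivative (\<lambda>x. f x + g x) (at x) b
      = frechet_derivative f (at x) b + frechet_derivative g (at x) b"
proof -
  have d: "((\<lambda>x. f x + g x) has_derivative
      (\<lambda>b. frechet_derivative f (at x) b + frechet_derivative g (at x) b)) (at x)" for x
    by (intro has_derivative_add C1_fun_has_derivative assms)
  show "C1_fun (\<lambda>x. f x + g x)"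
    by (rule C1_funI[OF d]) (intro continuous_intros C1_fun_continuous_deriv assms)
  show "frechet_derivative (\<lambda>x. f x + g x) (at x) b
      = frechet_derivative f (at x) b + frechet_derivative g (at x) b"
    using frechet_derivative_eq[OF d] by simp
qed

lemma C1_fun_const: "C1_fun (\<lambda>x. c)" "frechet_derivative (\<lambda>x. c) (at x) b = 0"
  by (auto intro!: C1_funI[where D = "\<lambda>x b. 0"] derivative_eq_intros)

lemma C1_fun_linear:
  assumes "bounded_linear f"
  shows "C1_fun f" "frechet_derivative f (at x) b = f b"
proof -
  have d: "(f has_derivative f) (at x)" for x
    by (rule bounded_linear_imp_has_derivative[OF assms])
  show "C1_fun f" by (rule C1_funI[OF d]) simp
  show "frechet_derivative f (at x) b = f b" using frechet_derivative_eq[OF d] by simp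
qed

lemma C1_fun_compose:
  fixes k :: "real \<Rightarrow> real"
  assumes "C1_fun f" and k: "\<And>s. (k has_real_derivative k' s) (at s)" "continuous_on UNIV k'"
  shows "C1_fun (\<lambda>x. k (f x))"
    and "frechet_derivative (\<lambda>x. k (f x)) (at x) b = k' (f x) * frechet_derivative f (at x) b"
proof -
  have d: "((\<lambda>x. k (f x)) has_derivative (\<lambda>b. k' (f x) * frechet_derivative f (at x) b)) (at x)" for x
    using has_derivative_compose[OF C1_fun_has_derivative[OF assms(1)] k(1)[unfolded has_field_derivative_def]]
    by simp
  show "C1_fun (\<lambda>x. k (f x))"
    by (rule C1_funI[OF d])
      (intro continuous_intros C1_fun_continuous_deriv assms continuous_on_compose2[OF k(2)] C1_fun_continuous | simp)+
  show "frechet_derivative (\<lambda>x. k (f x)) (at x) b = k' (f x) * frechet_derivative f (at x) b"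
    using frechet_derivative_eq[OF d] by simp
qed

lemma C1_fun_polynomial: "real_polynomial_function q \<Longrightarrow> C1_fun q"
  by (induction rule: real_polynomial_function.induct)
    (auto intro: C1_fun_mult C1_fun_add C1_fun_const C1_fun_linear)

text \<open>\<open>F 0 = 0\<close> and \<open>F' 0 = 0\<close> make the two branches match to first
  order at 0. Differentiability of \<open>F\<close> is asked for only at s \<ge> 0, so that
  \<open>F\<close> may contain ln (1 + s), as in the maximum principle; another instance is the
  square in \<open>cutoff\<close>.\<close>

lemma has_real_derivative_positive_part:
  fixes F :: "real \<Rightarrow> real"
  assumes F: "\<And>s. s \<ge> 0 \<Longrightarrow> (F has_real_derivative F' s) (at s)" and 0: "F 0 = 0" "F' 0 = 0"
  shows "((\<lambda>s. F (max 0 s)) has_real_derivative F' (max 0 s)) (at s)"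
proof (cases s "0::real" rule: linorder_cases)
  case less
  have "((\<lambda>s. 0) has_real_derivative 0) (at s)" by simp
  then have "((\<lambda>s. F (max 0 s)) has_real_derivative 0) (at s)"
    by (rule has_field_derivative_transform_within_open[where S = "{..<0}"]) (use less 0 in auto)
  then show ?thesis using less 0 by simp
next
  case greater
  have "(F has_real_derivative F' s) (at s)" using F greater by simp
  then have "((\<lambda>s. F (max 0 s)) has_real_derivative F' s) (at s)"
    by (rule has_field_derivative_transform_within_open[where S = "{0<..}"]) (use greater in auto)
  then show ?thesis using greater by simp
next
  case equal
  have "((\<lambda>h. F h / h) \<longlongrightarrow> 0) (at 0)"
    using F[of 0] 0 by (simp add: DERIV_def)
  then have "((\<lambda>h. F (max 0 h) / h) \<longlongrightarrow> 0) (at 0)"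
  proof (rule Lim_null_comparison[rotated, OF tendsto_rabs_zero])
    show "\<forall>\<^sub>F h in at 0. norm (F (max 0 h) / h) \<le> \<bar>F h / h\<bar>"
    proof (intro always_eventually allI)
      fix h show "norm (F (max 0 h) / h) \<le> \<bar>F h / h\<bar>"
        by (cases "h \<le> 0") (simp_all add: max_absorb1 max_absorb2 0 divide_nonneg_nonpos)
    qed
  qed
  then show ?thesis
    using equal 0 by (simp add: DERIV_def)
qed

text \<open>The C1 bump (1 - |x|^2 / R^2)^2 inside the ball of radius \<open>R\<close>. The square
  flattens the contact with 0 at the sphere, and the dependence on x \<bullet> x keeps it
  differentiable at the origin.\<close>

definition cutoff :: "real \<Rightarrow> 'a::euclidean_space \<Rightarrow> real" where
  "cutoff R x = (max 0 (1 - (x \<bullet> x) / R\<^sup>2))\<^sup>2"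

lemma cutoff_range: "0 \<le> cutoff R x" "cutoff R x \<le> 1"
  unfolding cutoff_def by (auto simp: power_le_one)

lemma cutoff_eq_0: "R > 0 \<Longrightarrow> norm x \<ge> R \<Longrightarrow> cutoff R x = 0"
  unfolding cutoff_def by (simp add: max_def field_simps power_mono flip: power2_norm_eq_inner)

lemma cutoff_pos: "R > 0 \<Longrightarrow> norm x < R \<Longrightarrow> cutoff R x > 0"
  unfolding cutoff_def
  by (simp add: max_def field_simps power_strict_mono flip: power2_norm_eq_inner)

lemma C1_fun_cutoff: "C1_fun (cutoff R)"
proof -
  have "C1_fun (\<lambda>x::'a. 1 - (x \<bullet> x) / R\<^sup>2)"
  proof (rule C1_funI)
    show "((\<lambda>x::'a. 1 - (x \<bullet> x) / R\<^sup>2) has_derivative (\<lambda>b. 0 - (x \<bullet> b + b \<bullet> x) / R\<^sup>2)) (at x)" for x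
      by (intro has_derivative_diff has_derivative_const has_derivative_divide' has_derivative_inner
          has_derivative_ident bounded_linear.has_derivative[OF bounded_linear_divide])
    show "continuous_on UNIV (\<lambda>x. 0 - (x \<bullet> b + b \<bullet> x) / R\<^sup>2)" for b :: 'a
      unfolding divide_inverse by (intro continuous_intros)
  qed
  moreover have "((\<lambda>s::real. (max 0 s)\<^sup>2) has_real_derivative 2 * max 0 s) (at s)" for s
    by (rule has_real_derivative_positive_part[where F = "\<lambda>s. s\<^sup>2" and F' = "\<lambda>s. 2 * s"])
      (auto intro!: derivative_eq_intros)
  moreover have "continuous_on UNIV (\<lambda>s::real. 2 * max 0 s)"
    by (intro continuous_intros)
  ultimately show ?thesis
    unfolding cutoff_def by (rule C1_fun_compose)
qed

lemma cutoff_tendsto_1: "(\<lambda>n. cutoff (real (Suc n)) x) \<longlonglongrightarrow> 1"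
proof -
  have "(\<lambda>n. (x \<bullet> x) * (inverse (real (Suc n)))\<^sup>2) \<longlonglongrightarrow> (x \<bullet> x) * 0\<^sup>2"
    by (intro tendsto_mult tendsto_const tendsto_power LIMSEQ_inverse_real_of_nat)
  then have "(\<lambda>n. (max 0 (1 - (x \<bullet> x) * (inverse (real (Suc n)))\<^sup>2))\<^sup>2) \<longlonglongrightarrow> (max 0 (1 - (x \<bullet> x) * 0\<^sup>2))\<^sup>2"
    by (rule tendsto_power[OF tendsto_max[OF tendsto_const tendsto_diff[OF tendsto_const]]])
  then show ?thesis
    unfolding cutoff_def by (simp add: field_simps)
qed

lemma test_fun_mult_cutoff:
  assumes "C1_fun f" "R > 0"
  shows "test_fun (\<lambda>x. cutoff R x * f x)"
proof -
  have "{x. cutoff R x * f x \<noteq> 0} \<subseteq> cball 0 R"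
    using cutoff_eq_0[OF assms(2)] by (force simp: not_le)
  then have "bounded {x. cutoff R x * f x \<noteq> 0}"
    by (rule bounded_subset[OF bounded_cball])
  then show ?thesis
    unfolding test_fun_iff by (auto intro: C1_fun_mult C1_fun_cutoff assms)
qed

lemma test_fun_C1: "test_fun \<phi> \<Longrightarrow> C1_fun \<phi>"
  by (simp add: test_fun_iff)

lemma test_fun_bounded:
  fixes \<phi> :: "'a::euclidean_space \<Rightarrow> real"
  assumes "test_fun \<phi>"
  obtains B R where "B \<ge> 0" "R > 0" "\<And>x. \<bar>\<phi> x\<bar> \<le> B" "\<And>x. \<bar>frechet_derivative \<phi> (at x) b\<bar> \<le> B"
    "\<And>x. norm x > R \<Longrightarrow> \<phi> x = 0" "\<And>x. norm x > R \<Longrightarrow> frechet_derivative \<phi> (at x) b = 0"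
proof -
  let ?K = "closure {x. \<phi> x \<noteq> 0}"
  have K: "compact ?K" and C: "C1_fun \<phi>" using assms by (auto simp: test_fun_iff)
  obtain R where R: "R > 0" "\<And>x. x \<in> ?K \<Longrightarrow> norm x \<le> R"
    using compact_imp_bounded[OF K] by (auto simp: bounded_pos)
  have z: "\<phi> x = 0" if "norm x > R" for x
    using R(2)[of x] that closure_subset[of "{x. \<phi> x \<noteq> 0}"] by force
  have dz: "frechet_derivative \<phi> (at x) b = 0" if "norm x > R" for x
  proof -
    have "((\<lambda>x. 0) has_derivative (\<lambda>b. 0)) (at x)" by simp
    then have "(\<phi> has_derivative (\<lambda>b. 0)) (at x)"
      by (rule has_derivative_transform_within_open[where s = "- cball 0 R"]) (use that z in auto)
    from frechet_derivative_eq[OF this] show ?thesis by simp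
  qed
  have cb: "compact (cball (0::'a) R)" by simp
  obtain B1 where B1: "\<And>x. x \<in> cball 0 R \<Longrightarrow> \<bar>\<phi> x\<bar> \<le> B1"
    using compact_imp_bounded[OF compact_continuous_image[OF C1_fun_continuous[OF C] cb]]
    unfolding bounded_iff by fastforce
  obtain B2 where B2: "\<And>x. x \<in> cball 0 R \<Longrightarrow> \<bar>frechet_derivative \<phi> (at x) b\<bar> \<le> B2"
    using compact_imp_bounded[OF compact_continuous_image[OF continuous_on_subset[OF C1_fun_continuous_deriv[OF C, of b] subset_UNIV] cb]]
    unfolding bounded_iff by fastforce
  show ?thesis
  proof (rule that[of "max 0 (max B1 B2)" R])
    show "\<bar>\<phi> x\<bar> \<le> max 0 (max B1 B2)" for x
      using B1[of x] z[of x] by (cases "norm x > R") (auto simp: le_max_iff_disj)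
    show "\<bar>frechet_derivative \<phi> (at x) b\<bar> \<le> max 0 (max B1 B2)" for x
      using B2[of x] dz[of x] by (cases "norm x > R") (auto simp: le_max_iff_disj)
  qed (use R z dz in auto)
qed

lemma indicator_ball_L2: "indicator (cball (0::'a::euclidean_space) R) \<in> (L2 :: ('a \<Rightarrow> real) set)"
proof -
  have "(\<lambda>x. (indicator (cball (0::'a) R) x :: real)\<^sup>2) = indicator (cball 0 R)"
    by (auto simp: fun_eq_iff indicator_def)
  moreover have "integrable lborel (indicator (cball (0::'a) R) :: 'a \<Rightarrow> real)"
    by (rule integrable_real_indicator) (use emeasure_lborel_cball_finite[of 0 R] in \<open>auto simp: less_top\<close>)
  ultimately show ?thesis by (simp add: L2_def)
qed

lemma test_fun_L2: "test_fun \<phi> \<Longrightarrow> \<phi> \<in> L2"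
  and test_fun_deriv_L2: "test_fun \<phi> \<Longrightarrow> (\<lambda>x. frechet_derivative \<phi> (at x) b) \<in> L2"
  for \<phi> :: "'a::euclidean_space \<Rightarrow> real"
proof -
  assume t: "test_fun \<phi>"
  obtain B R where B: "B \<ge> 0" "R > 0" "\<And>x. \<bar>\<phi> x\<bar> \<le> B" "\<And>x. \<bar>frechet_derivative \<phi> (at x) b\<bar> \<le> B"
    "\<And>x. norm x > R \<Longrightarrow> \<phi> x = 0" "\<And>x. norm x > R \<Longrightarrow> frechet_derivative \<phi> (at x) b = 0"
    using test_fun_bounded[OF t] by metis
  show "\<phi> \<in> L2"
    by (rule L2_dominated[OF indicator_ball_L2[of R], where B = B])
      (use B test_fun_C1[OF t] in \<open>auto intro: C1_fun_measurable simp: indicator_def not_le\<close>)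
  show "(\<lambda>x. frechet_derivative \<phi> (at x) b) \<in> L2"
    by (rule L2_dominated[OF indicator_ball_L2[of R], where B = B])
      (use B test_fun_C1[OF t] in \<open>auto intro: C1_fun_measurable_deriv simp: indicator_def not_le\<close>)
qed

section \<open>Local integrability and density of test functions\<close>

lemma loc_integrable_L2:
  fixes f :: "'a::euclidean_space \<Rightarrow> real"
  assumes "f \<in> L2"
  shows "loc_integrable f"
  unfolding loc_integrable_def
proof (intro conjI allI impI)
  note [measurable] = assms[THEN L2_measurable]
  show "f \<in> borel_measurable lborel" using assms by (simp add: L2_def)
  fix K :: "'a set" assume "compact K"
  then have [measurable]: "K \<in> sets borel" by (rule borel_compact)
  obtain R where R: "\<And>x. x \<in> K \<Longrightarrow> norm x \<le> R"
    using compact_imp_bounded[OF \<open>compact K\<close>] unfolding bounded_iff by fastforce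
  then have K: "K \<subseteq> cball 0 R" by auto
  have "integrable lborel (\<lambda>x. indicator (cball 0 R) x * f x)"
    by (rule integrable_mult_L2[OF indicator_ball_L2 assms])
  then show "set_integrable lborel K f"
    unfolding set_integrable_def
    by (rule Bochner_Integration.integrable_bound) (use R in \<open>auto simp: indicator_def\<close>)
qed

lemma loc_integrable_mult_test_fun:
  fixes f :: "'a::euclidean_space \<Rightarrow> real"
  assumes f: "loc_integrable f" and [measurable]: "\<phi> \<in> borel_measurable borel"
    and B: "\<And>x. \<bar>\<phi> x\<bar> \<le> B" "\<And>x. norm x > R \<Longrightarrow> \<phi> x = 0"
  shows "integrable lborel (\<lambda>x. f x * \<phi> x)"
proof (rule Bochner_Integration.integrable_bound)
  have [measurable]: "f \<in> borel_measurable borel" using f by (simp add: loc_integrable_def)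
  have "set_integrable lborel (cball 0 R) f" using f by (simp add: loc_integrable_def)
  then show "integrable lborel (\<lambda>x. B * (indicator (cball 0 R) x *\<^sub>R f x))"
    unfolding set_integrable_def by (intro integrable_mult_right)
  show "(\<lambda>x. f x * \<phi> x) \<in> borel_measurable lborel" by simp
  have "B \<ge> 0" using B(1)[of 0] by linarith
  show "AE x in lborel. norm (f x * \<phi> x) \<le> norm (B * (indicator (cball 0 R) x *\<^sub>R f x))"
    using B \<open>B \<ge> 0\<close> by (auto simp: indicator_def abs_mult mult.commute[of B] intro!: mult_left_mono)
qed

text \<open>Measurable functions are a.e. limits of continuous ones. By Stone-Weierstrass the n-th
  of these is replaced by a polynomial within 1 / (n + 1) on the ball of radius n, and every point
  eventually lies in these balls. Polynomials are C1, so composing them with arctan and multiplying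
  by \<open>cutoff\<close> produces the test functions of the next two lemmas.\<close>

lemma measurable_imp_polynomial_limit:
  fixes f :: "'a::euclidean_space \<Rightarrow> real"
  assumes "f \<in> borel_measurable borel"
  obtains q where "\<And>n. real_polynomial_function (q n)" "AE x in lborel. (\<lambda>n::nat. q n x) \<longlonglongrightarrow> f x"
proof -
  have "f \<in> borel_measurable lebesgue"
    using assms by (intro measurable_completion) simp
  then have "f measurable_on UNIV"
    by (rule lebesgue_measurable_imp_measurable_on) simp
  then obtain N g where N: "negligible N" and g: "\<And>n. continuous_on UNIV (g n)"
    and lim: "\<And>x. x \<notin> N \<Longrightarrow> (\<lambda>n::nat. g n x) \<longlonglongrightarrow> f x"
    unfolding measurable_on_def by auto
  have "\<exists>q. real_polynomial_function q \<and> (\<forall>x\<in>cball 0 (real n). \<bar>g n x - q x\<bar> < inverse (real (Suc n)))" for n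
    using Stone_Weierstrass_real_polynomial_function[OF compact_cball continuous_on_subset[OF g subset_UNIV],
        of "inverse (real (Suc n))" 0 "real n" n]
    by (metis inverse_positive_iff_positive of_nat_0_less_iff zero_less_Suc)
  then obtain q where q: "\<And>n. real_polynomial_function (q n)"
    "\<And>n x. x \<in> cball 0 (real n) \<Longrightarrow> \<bar>g n x - q n x\<bar> < inverse (real (Suc n))"
    by metis
  have "(\<lambda>n. q n x) \<longlonglongrightarrow> f x" if "x \<notin> N" for x
  proof -
    have "(\<lambda>n. g n x - q n x) \<longlonglongrightarrow> 0"
    proof (rule Lim_null_comparison[OF _ LIMSEQ_inverse_real_of_nat])
      obtain n0 :: nat where "norm x \<le> real n0" using real_arch_simple by blast
      then show "\<forall>\<^sub>F n in sequentially. norm (g n x - q n x) \<le> inverse (real (Suc n))"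
        using q(2)[of x] by (intro eventually_sequentiallyI[of n0]) (fastforce intro: less_imp_le)
    qed
    from tendsto_diff[OF lim[OF that] this] show ?thesis by simp
  qed
  then have "AE x in lebesgue. (\<lambda>n. q n x) \<longlonglongrightarrow> f x"
    using N by (intro AE_I'[of N]) (auto simp: negligible_iff_null_sets)
  then have "AE x in lborel. (\<lambda>n. q n x) \<longlonglongrightarrow> f x"
    by (simp add: AE_completion_iff)
  with q(1) show ?thesis by (rule that[of q])
qed

text \<open>The test functions \<open>cutoff R x * arctan (q n x)\<close> converge boundedly to
  \<open>cutoff R x * arctan (f x)\<close>, so \<open>f\<close> is orthogonal to the latter. Here
  arctan is a bounded smooth substitute for the sign: s * arctan s is positive for s \<noteq> 0, so
  the integrand is nonnegative and, inside the ball, vanishes only where \<open>f\<close>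
  does.\<close>

lemma AE_eq_0_if_test_fun_orthogonal:
  fixes f :: "'a::euclidean_space \<Rightarrow> real"
  assumes f: "loc_integrable f" and 0: "\<And>\<phi>. test_fun \<phi> \<Longrightarrow> (LINT x|lborel. f x * \<phi> x) = 0"
  shows "AE x in lborel. f x = 0"
proof -
  have [measurable]: "f \<in> borel_measurable borel" using f by (simp add: loc_integrable_def)
  obtain q where q: "\<And>n. real_polynomial_function (q n)" "AE x in lborel. (\<lambda>n::nat. q n x) \<longlonglongrightarrow> f x"
    using measurable_imp_polynomial_limit[of f] by auto
  have C: "C1_fun (\<lambda>x. arctan (q n x))" for n
    by (rule C1_fun_compose[OF C1_fun_polynomial[OF q(1)], where k' = "\<lambda>s. inverse (1 + s\<^sup>2)"])
      (auto intro!: derivative_eq_intros continuous_intros simp: add_nonneg_eq_0_iff)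
  note [measurable] = C1_fun_measurable[OF C] C1_fun_measurable[OF C1_fun_cutoff]
  have "AE x in lborel. norm x < R \<longrightarrow> f x = 0" if R: "R > 0" for R
  proof -
    have test: "test_fun (\<lambda>x. cutoff R x * arctan (q n x))" for n
      by (rule test_fun_mult_cutoff[OF C R])
    have b: "\<bar>cutoff R x * arctan s\<bar> \<le> 2" for x s
    proof -
      have "\<bar>arctan s\<bar> \<le> 2"
        using arctan_lbound[of s] arctan_ubound[of s] pi_less_4 by linarith
      then show ?thesis using mult_mono[of "cutoff R x" 1 "\<bar>arctan s\<bar>" 2] cutoff_range[of R x]
        by (simp add: abs_mult)
    qed
    have z: "cutoff R x * arctan s = 0" if "norm x > R" for x s
      using cutoff_eq_0[OF R, of x] that by simp
    have int: "integrable lborel (\<lambda>x. f x * (cutoff R x * arctan (f x)))"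
      by (rule loc_integrable_mult_test_fun[OF f _ b z]) auto
    have "(\<lambda>n. LINT x|lborel. f x * (cutoff R x * arctan (q n x)))
        \<longlonglongrightarrow> (LINT x|lborel. f x * (cutoff R x * arctan (f x)))"
    proof (rule integral_dominated_convergence)
      show "integrable lborel (\<lambda>x. 2 * \<bar>indicator (cball 0 R) x *\<^sub>R f x\<bar>)"
        using f unfolding loc_integrable_def set_integrable_def by simp
      show "AE x in lborel. (\<lambda>n. f x * (cutoff R x * arctan (q n x))) \<longlonglongrightarrow> f x * (cutoff R x * arctan (f x))"
        using q(2) by eventually_elim (intro tendsto_intros)
      show "AE x in lborel. norm (f x * (cutoff R x * arctan (q n x))) \<le> 2 * \<bar>indicator (cball 0 R) x *\<^sub>R f x\<bar>" for n
      proof (rule AE_I2)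
        fix x
        show "norm (f x * (cutoff R x * arctan (q n x))) \<le> 2 * \<bar>indicator (cball 0 R) x *\<^sub>R f x\<bar>"
          using b[of x "q n x"] z[of x "q n x"] mult_right_mono[OF b[of x "q n x"], of "\<bar>f x\<bar>"]
          by (cases "norm x > R") (auto simp: abs_mult mult_ac)
      qed
    qed auto
    then have "(LINT x|lborel. f x * (cutoff R x * arctan (f x))) = 0"
      using 0[OF test] by (simp add: LIMSEQ_const_iff)
    moreover have "0 \<le> f x * (cutoff R x * arctan (f x))" for x
      using cutoff_range(1)[of R x] by (cases "f x \<ge> 0") (auto simp: zero_le_mult_iff not_le intro: mult_nonneg_nonpos)
    ultimately have "AE x in lborel. f x * (cutoff R x * arctan (f x)) = 0"
      using integral_nonneg_eq_0_iff_AE[OF int] by simp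
    then show ?thesis
    proof eventually_elim
      case (elim x)
      then show ?case using cutoff_pos[OF R, of x] by (auto simp: arctan_eq_zero_iff)
    qed
  qed
  then have "AE x in lborel. \<forall>n::nat. norm x < real (Suc n) \<longrightarrow> f x = 0"
    by (subst AE_all_countable) auto
  then show ?thesis
  proof eventually_elim
    case (elim x)
    obtain n :: nat where "norm x < real n" using reals_Archimedean2 by blast
    with elim[rule_format, of n] show ?case by simp
  qed
qed

text \<open>Two limits in succession. With N large, \<open>f\<close> is truncated in height by
  \<open>?T N\<close> and in space by \<open>cutoff\<close>, the error being dominated by 2 |f|.
  With N then fixed, a polynomial replaces \<open>f\<close> inside the truncation, where everything
  is bounded and supported in one ball. Two errors e / 5, each doubled by \<open>sqn_add_le\<close>,
  give 4 e / 5 < e.\<close>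

lemma test_fun_dense_L2:
  fixes f :: "'a::euclidean_space \<Rightarrow> real"
  assumes f: "f \<in> L2" and e: "(e::real) > 0"
  obtains \<phi> where "test_fun \<phi>" "sqn (\<lambda>x. f x - \<phi> x) < ennreal e"
proof -
  note [measurable] = f[THEN L2_measurable]
  obtain q where q: "\<And>n. real_polynomial_function (q n)" "AE x in lborel. (\<lambda>n::nat. q n x) \<longlonglongrightarrow> f x"
    using measurable_imp_polynomial_limit[of f] by auto
  \<comment> \<open>A smooth truncation: it tends to s as N grows, and its modulus is at most |s|
    and at most 2 (N + 1).\<close>
  let ?T = "\<lambda>N s. real (Suc N) * arctan (s / real (Suc N))"
  have C: "C1_fun (\<lambda>x. ?T N (q n x))" for N n
    by (rule C1_fun_compose[OF C1_fun_polynomial[OF q(1)], where k' = "\<lambda>s. inverse (1 + (s / real (Suc N))\<^sup>2)"])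
      (auto intro!: derivative_eq_intros continuous_intros simp: add_nonneg_eq_0_iff field_simps simp del: of_nat_Suc)
  note [measurable] = C1_fun_measurable[OF C] C1_fun_measurable[OF C1_fun_cutoff] C1_fun_measurable[OF C1_fun_polynomial[OF q(1)]]
  have arc: "\<bar>arctan s\<bar> \<le> \<bar>s\<bar>" for s
    using arctan_le_self[of s] arctan_le_self[of "-s"] by (cases "s \<ge> 0") (auto simp: arctan_minus)
  have Tle: "\<bar>?T N s\<bar> \<le> \<bar>s\<bar>" for N s
    using mult_left_mono[OF arc[of "s / real (Suc N)"], of "real (Suc N)"] by (simp add: abs_mult del: of_nat_Suc)
  have Tb: "\<bar>?T N s\<bar> \<le> 2 * real (Suc N)" for N s
  proof -
    have "\<bar>arctan t\<bar> \<le> 2" for t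
      using arctan_lbound[of t] arctan_ubound[of t] pi_less_4 by linarith
    then show ?thesis by (simp add: abs_mult del: of_nat_Suc)
  qed
  have Tlim: "(\<lambda>N. ?T N s) \<longlonglongrightarrow> s" for s
  proof (cases "s = 0")
    case False
    have "((\<lambda>h. arctan h / h) \<longlongrightarrow> 1) (at 0)"
      using DERIV_arctan[of 0] by (simp add: DERIV_def)
    moreover have "filterlim (\<lambda>N. s * inverse (real (Suc N))) (at 0) sequentially"
      unfolding filterlim_at using tendsto_mult[OF tendsto_const LIMSEQ_inverse_real_of_nat, of s] False
      by (auto simp del: of_nat_Suc)
    ultimately have "(\<lambda>N. arctan (s * inverse (real (Suc N))) / (s * inverse (real (Suc N)))) \<longlonglongrightarrow> 1"
      by (rule filterlim_compose)
    from tendsto_mult[OF tendsto_const this, of s] show ?thesis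
      using False by (simp add: field_simps del: of_nat_Suc)
  qed simp
  let ?h = "\<lambda>N x. cutoff (real (Suc N)) x * ?T N (f x)"
  let ?g = "\<lambda>N n x. cutoff (real (Suc N)) x * ?T N (q n x)"
  have cle: "\<bar>cutoff R x * s\<bar> \<le> \<bar>s\<bar>" for R s and x :: 'a
    using mult_right_mono[OF cutoff_range(2)[of R x], of "\<bar>s\<bar>"] cutoff_range(1)[of R x] by (simp add: abs_mult)
  have "(\<lambda>N. sqn (\<lambda>x. f x - ?h N x)) \<longlonglongrightarrow> 0"
  proof (rule sqn_tendsto_0_dominated[OF _ L2_cmult[OF f, of 2]])
    show "AE x in lborel. \<bar>f x - ?h N x\<bar> \<le> \<bar>2 * f x\<bar>" for N
      using cle[of "real (Suc N)" _ "?T N (f _)"] Tle[of N "f _"] by (intro AE_I2) (smt (verit))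
    have "(\<lambda>N. f x - ?h N x) \<longlonglongrightarrow> f x - 1 * f x" for x
      by (intro tendsto_diff tendsto_const tendsto_mult Tlim cutoff_tendsto_1)
    then show "AE x in lborel. (\<lambda>N. f x - ?h N x) \<longlonglongrightarrow> 0" by simp
  qed measurable
  then have "\<forall>\<^sub>F N in sequentially. sqn (\<lambda>x. f x - ?h N x) < ennreal (e / 5)"
    by (rule order_tendstoD) (use e in simp)
  then obtain N where N: "sqn (\<lambda>x. f x - ?h N x) < ennreal (e / 5)"
    by (auto simp: eventually_sequentially)
  have "(\<lambda>n. sqn (\<lambda>x. ?h N x - ?g N n x)) \<longlonglongrightarrow> 0"
  proof (rule sqn_tendsto_0_dominated[OF _ L2_cmult[OF indicator_ball_L2[of "real (Suc N)"], of "4 * real (Suc N)"]])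
    show "AE x in lborel. \<bar>?h N x - ?g N n x\<bar> \<le> \<bar>4 * real (Suc N) * indicator (cball 0 (real (Suc N))) x\<bar>" for n
    proof (rule AE_I2)
      fix x :: 'a
      have "\<bar>?h N x\<bar> \<le> 2 * real (Suc N)" "\<bar>?g N n x\<bar> \<le> 2 * real (Suc N)"
        using order_trans[OF cle Tb] by blast+
      then show "\<bar>?h N x - ?g N n x\<bar> \<le> \<bar>4 * real (Suc N) * indicator (cball 0 (real (Suc N))) x\<bar>"
        using cutoff_eq_0[of "real (Suc N)" x]
        by (cases "norm x \<ge> real (Suc N)") (auto simp: indicator_def simp del: of_nat_Suc)
    qed
    show "AE x in lborel. (\<lambda>n. ?h N x - ?g N n x) \<longlonglongrightarrow> 0"
      using q(2)
    proof eventually_elim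
      case (elim x)
      then have "(\<lambda>n. ?h N x - ?g N n x) \<longlonglongrightarrow> ?h N x - ?h N x"
        by (intro tendsto_intros) auto
      then show ?case by simp
    qed
  qed measurable
  then have "\<forall>\<^sub>F n in sequentially. sqn (\<lambda>x. ?h N x - ?g N n x) < ennreal (e / 5)"
    by (rule order_tendstoD) (use e in simp)
  then obtain n where n: "sqn (\<lambda>x. ?h N x - ?g N n x) < ennreal (e / 5)"
    by (auto simp: eventually_sequentially)
  have "sqn (\<lambda>x. f x - ?g N n x) \<le> 2 * sqn (\<lambda>x. f x - ?h N x) + 2 * sqn (\<lambda>x. ?h N x - ?g N n x)"
    using sqn_add_le[of "\<lambda>x. f x - ?h N x" "\<lambda>x. ?h N x - ?g N n x"] by simp
  also have "\<dots> \<le> 2 * ennreal (e / 5) + 2 * ennreal (e / 5)"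
    using N n by (intro add_mono mult_left_mono) auto
  also have "\<dots> = ennreal (4 * e / 5)"
    using e by (simp flip: ennreal_numeral ennreal_mult ennreal_plus)
  also have "\<dots> < ennreal e"
    using e by (intro ennreal_lessI) auto
  finally have "sqn (\<lambda>x. f x - ?g N n x) < ennreal e" .
  with test_fun_mult_cutoff[OF C, of "real (Suc N)" N n] show ?thesis
    using that by simp
qed

section \<open>Derivatives as limits of difference quotients\<close>

lemma ennreal_tendsto_0I:
  fixes f :: "'b \<Rightarrow> ennreal"
  assumes "\<And>e::real. e > 0 \<Longrightarrow> \<forall>\<^sub>F x in F. f x \<le> ennreal e"
  shows "(f \<longlongrightarrow> 0) F"
proof (rule order_tendstoI)
  fix a :: ennreal assume a: "0 < a"
  obtain e :: real where e: "e > 0" "ennreal e < a"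
  proof (cases a)
    case (real r)
    then have "r > 0" using a by simp
    then show ?thesis using real that[of "r / 2"] by (simp add: ennreal_lessI)
  next
    case top
    then show ?thesis using that[of 1] by simp
  qed
  show "\<forall>\<^sub>F x in F. f x < a"
    using assms[OF e(1)] by eventually_elim (use e(2) in auto)
qed simp

lemma tendsto_0_ennrealD:
  fixes f :: "'b \<Rightarrow> ennreal" and e :: real
  assumes "(f \<longlongrightarrow> 0) F" "e > 0"
  shows "\<forall>\<^sub>F x in F. f x < ennreal e"
  using assms by (intro order_tendstoD) auto

lemma sqn_tendsto_0_add:
  assumes "\<forall>\<^sub>F n in F. f n \<in> borel_measurable borel" "\<forall>\<^sub>F n in F. g n \<in> borel_measurable borel"
    and "((\<lambda>n. sqn (f n)) \<longlongrightarrow> 0) F" "((\<lambda>n. sqn (g n)) \<longlongrightarrow> 0) F"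
  shows "((\<lambda>n. sqn (\<lambda>x. f n x + g n x)) \<longlongrightarrow> 0) F"
proof (rule tendsto_sandwich[OF always_eventually _ tendsto_const])
  show "\<forall>\<^sub>F n in F. sqn (\<lambda>x. f n x + g n x) \<le> 2 * sqn (f n) + 2 * sqn (g n)"
    using assms(1,2) by eventually_elim (rule sqn_add_le)
  have "((\<lambda>n. 2 * sqn (f n) + 2 * sqn (g n)) \<longlongrightarrow> 2 * 0 + 2 * 0) F"
    by (intro tendsto_add tendsto_mult_ennreal tendsto_const assms) auto
  then show "((\<lambda>n. 2 * sqn (f n) + 2 * sqn (g n)) \<longlongrightarrow> 0) F" by simp
qed simp

lemma integral_sq_tendsto_0:
  assumes "\<forall>\<^sub>F n in F. f n \<in> L2" "((\<lambda>n. sqn (f n)) \<longlongrightarrow> 0) F"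
  shows "((\<lambda>n. LINT x|lborel. (f n x)\<^sup>2) \<longlongrightarrow> 0) F"
proof -
  have "((\<lambda>n. ennreal (LINT x|lborel. (f n x)\<^sup>2)) \<longlongrightarrow> ennreal 0) F"
  proof (rule Lim_transform_eventually)
    show "((\<lambda>n. sqn (f n)) \<longlongrightarrow> ennreal 0) F" using assms(2) by simp
    show "\<forall>\<^sub>F n in F. sqn (f n) = ennreal (LINT x|lborel. (f n x)\<^sup>2)"
      using assms(1) by eventually_elim (rule sqn_eq_integral)
  qed
  then show ?thesis
    by (subst (asm) tendsto_ennreal_iff) (auto simp: integral_sq_nonneg)
qed

lemma L2_inner_abs_le:
  assumes "f \<in> L2" "g \<in> L2"
  shows "\<bar>LINT x|lborel. f x * g x\<bar> \<le> sqrt (LINT x|lborel. (f x)\<^sup>2) * sqrt (LINT x|lborel. (g x)\<^sup>2)"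
  using real_sqrt_le_mono[OF Cauchy_Schwarz_L2[OF assms]] by (simp add: real_sqrt_mult)

lemma L2_inner_tendsto_0:
  assumes "\<forall>\<^sub>F n in F. f n \<in> L2" "\<forall>\<^sub>F n in F. g n \<in> L2"
    "((\<lambda>n. sqn (f n)) \<longlongrightarrow> 0) F" "((\<lambda>n. LINT x|lborel. (g n x)\<^sup>2) \<longlongrightarrow> c) F"
  shows "((\<lambda>n. LINT x|lborel. f n x * g n x) \<longlongrightarrow> 0) F"
proof (rule Lim_null_comparison)
  show "\<forall>\<^sub>F n in F. norm (LINT x|lborel. f n x * g n x) \<le> sqrt (LINT x|lborel. (f n x)\<^sup>2) * sqrt (LINT x|lborel. (g n x)\<^sup>2)"
    using assms(1,2) by eventually_elim (simp add: L2_inner_abs_le)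
  have "((\<lambda>n. sqrt (LINT x|lborel. (f n x)\<^sup>2) * sqrt (LINT x|lborel. (g n x)\<^sup>2)) \<longlongrightarrow> sqrt 0 * sqrt c) F"
    by (intro tendsto_intros integral_sq_tendsto_0 assms)
  then show "((\<lambda>n. sqrt (LINT x|lborel. (f n x)\<^sup>2) * sqrt (LINT x|lborel. (g n x)\<^sup>2)) \<longlongrightarrow> 0) F" by simp
qed

text \<open>With a = f - f0 and b = g - g0 the product is a b + a g0 + b f0 + f0 g0, and each of the
  first three terms has a factor that tends to 0 in L2.\<close>

lemma L2_inner_tendsto:
  assumes fn: "\<forall>\<^sub>F n in F. f n \<in> L2" and gn: "\<forall>\<^sub>F n in F. g n \<in> L2" and f: "f0 \<in> L2" and g: "g0 \<in> L2"
    and lf: "((\<lambda>n. sqn (\<lambda>x. f n x - f0 x)) \<longlongrightarrow> 0) F" and lg: "((\<lambda>n. sqn (\<lambda>x. g n x - g0 x)) \<longlongrightarrow> 0) F"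
  shows "((\<lambda>n. LINT x|lborel. f n x * g n x) \<longlongrightarrow> (LINT x|lborel. f0 x * g0 x)) F"
proof -
  let ?a = "\<lambda>n x. f n x - f0 x" and ?b = "\<lambda>n x. g n x - g0 x"
  have a: "\<forall>\<^sub>F n in F. ?a n \<in> L2" using fn by eventually_elim (rule L2_diff[OF _ f])
  have b: "\<forall>\<^sub>F n in F. ?b n \<in> L2" using gn by eventually_elim (rule L2_diff[OF _ g])
  have "((\<lambda>n. (LINT x|lborel. ?a n x * ?b n x) + (LINT x|lborel. ?a n x * g0 x) + (LINT x|lborel. ?b n x * f0 x)
      + (LINT x|lborel. f0 x * g0 x)) \<longlongrightarrow> 0 + 0 + 0 + (LINT x|lborel. f0 x * g0 x)) F"
    by (intro tendsto_add tendsto_const L2_inner_tendsto_0[OF a b lf integral_sq_tendsto_0[OF b lg]]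
        L2_inner_tendsto_0[OF a _ lf tendsto_const] L2_inner_tendsto_0[OF b _ lg tendsto_const]) (auto simp: f g)
  then show ?thesis
  proof (rule Lim_transform_eventually[THEN tendsto_eq_rhs])
    show "\<forall>\<^sub>F n in F. (LINT x|lborel. ?a n x * ?b n x) + (LINT x|lborel. ?a n x * g0 x) + (LINT x|lborel. ?b n x * f0 x)
      + (LINT x|lborel. f0 x * g0 x) = (LINT x|lborel. f n x * g n x)"
      using a b
    proof eventually_elim
      case (elim n)
      have "(LINT x|lborel. f n x * g n x) = (LINT x|lborel. ?a n x * ?b n x + ?a n x * g0 x + ?b n x * f0 x + f0 x * g0 x)"
        by (rule Bochner_Integration.integral_cong) (auto simp: algebra_simps)
      then show ?case
        using elim f g by (simp add: integrable_mult_L2)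
    qed
  qed simp
qed

text \<open>Along test functions \<phi> that converge to \<open>f\<close> in L2 the hypothesis
  becomes |f|^4 \<le> e |f|^2 for the L2 norm. Thus an L2 bound on a difference quotient can be
  checked against test functions only.\<close>

lemma integral_sq_le_if_test_fun_bound:
  fixes f :: "'a::euclidean_space \<Rightarrow> real"
  assumes f: "f \<in> L2" and e: "e \<ge> 0"
    and le: "\<And>\<phi>. test_fun \<phi> \<Longrightarrow> (LINT x|lborel. f x * \<phi> x)\<^sup>2 \<le> e * (LINT x|lborel. (\<phi> x)\<^sup>2)"
  shows "(LINT x|lborel. (f x)\<^sup>2) \<le> e"
proof -
  have "\<exists>\<phi>. test_fun \<phi> \<and> sqn (\<lambda>x. f x - \<phi> x) < ennreal (inverse (real (Suc n)))" for n
  proof -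
    have "inverse (real (Suc n)) > 0" by simp
    then obtain \<phi> where "test_fun \<phi>" "sqn (\<lambda>x. f x - \<phi> x) < ennreal (inverse (real (Suc n)))"
      by (rule test_fun_dense_L2[OF f])
    then show ?thesis by blast
  qed
  then obtain p where p: "\<And>n. test_fun (p n)" "\<And>n. sqn (\<lambda>x. f x - p n x) < ennreal (inverse (real (Suc n)))"
    by metis
  have "sqn (\<lambda>x. p n x - f x) = sqn (\<lambda>x. f x - p n x)" for n
    by (simp add: sqn_def power2_commute)
  then have pl: "(\<lambda>n. sqn (\<lambda>x. p n x - f x)) \<longlonglongrightarrow> 0"
    using p(2)
    by (intro tendsto_sandwich[OF always_eventually always_eventually tendsto_const
          tendsto_ennrealI[OF LIMSEQ_inverse_real_of_nat, simplified ennreal_0]] allI)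
      (simp_all add: less_imp_le)
  have pL: "p n \<in> L2" for n by (rule test_fun_L2[OF p(1)])
  have "(\<lambda>n. LINT x|lborel. f x * p n x) \<longlonglongrightarrow> (LINT x|lborel. f x * f x)"
    by (rule L2_inner_tendsto) (use pL f pl in \<open>simp_all add: sqn_def\<close>)
  moreover have "(\<lambda>n. LINT x|lborel. p n x * p n x) \<longlonglongrightarrow> (LINT x|lborel. f x * f x)"
    by (rule L2_inner_tendsto) (use pL f pl in simp_all)
  ultimately have "(LINT x|lborel. f x * f x)\<^sup>2 \<le> e * (LINT x|lborel. f x * f x)"
  proof (rule LIMSEQ_le[OF tendsto_power tendsto_mult[OF tendsto_const]])
    show "\<exists>N. \<forall>n\<ge>N. (LINT x|lborel. f x * p n x)\<^sup>2 \<le> e * (LINT x|lborel. p n x * p n x)"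
      using le[OF p(1)] by (simp add: power2_eq_square)
  qed
  then have *: "(LINT x|lborel. (f x)\<^sup>2) * (LINT x|lborel. (f x)\<^sup>2) \<le> e * (LINT x|lborel. (f x)\<^sup>2)"
    by (simp add: power2_eq_square)
  show ?thesis
  proof (cases "(LINT x|lborel. (f x)\<^sup>2) = 0")
    case False
    then have "(LINT x|lborel. (f x)\<^sup>2) > 0" using integral_sq_nonneg[of f] by linarith
    with * show ?thesis by (rule mult_right_le_imp_le)
  qed (use e in simp)
qed

section \<open>Translations, difference quotients and weak derivatives\<close>

lemma tendsto_at_0_sequentiallyI:
  fixes f :: "real \<Rightarrow> 'b::first_countable_topology"
  assumes "\<And>X. (\<And>n. X n \<noteq> 0) \<Longrightarrow> X \<longlonglongrightarrow> 0 \<Longrightarrow> (\<lambda>n. f (X n)) \<longlonglongrightarrow> l"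
  shows "(f \<longlongrightarrow> l) (at 0)"
  unfolding tendsto_at_iff_sequentially comp_def using assms by auto

text \<open>For a test function this is dominated convergence, since increments by bounded steps
  live in one ball. A general \<open>f\<close> is within e / 10 of a test function; the factors of 2
  in the splitting add up to 2 * (2 + 2) + 2 = 10.\<close>

lemma sqn_translation_tendsto:
  fixes f :: "'a::euclidean_space \<Rightarrow> real"
  assumes f: "f \<in> L2"
  shows "((\<lambda>h. sqn (\<lambda>x. f (x + h *\<^sub>R b) - f x)) \<longlongrightarrow> 0) (at 0)"
proof (rule ennreal_tendsto_0I)
  fix e :: real assume e: "e > 0"
  note [measurable] = f[THEN L2_measurable]
  obtain p where p: "test_fun p" and pe: "sqn (\<lambda>x. f x - p x) < ennreal (e / 10)"
    using test_fun_dense_L2[OF f, of "e / 10"] e by auto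
  have C: "C1_fun p" by (rule test_fun_C1[OF p])
  note [measurable] = C1_fun_measurable[OF C]
  obtain B R where B: "B \<ge> 0" "R > 0" "\<And>x. \<bar>p x\<bar> \<le> B" "\<And>x. norm x > R \<Longrightarrow> p x = 0"
    using test_fun_bounded[OF p, of 0] by metis
  have "((\<lambda>h. sqn (\<lambda>x. p (x + h *\<^sub>R b) - p x)) \<longlongrightarrow> 0) (at 0)"
  proof (rule tendsto_at_0_sequentiallyI)
    fix X :: "nat \<Rightarrow> real" assume X: "X \<longlonglongrightarrow> 0"
    obtain S where S: "\<And>n. \<bar>X n\<bar> \<le> S"
      using X convergentI[of X] convergent_imp_Bseq[of X] BseqE[of X] by (metis real_norm_def)
    have S0: "S \<ge> 0" using S[of 0] by linarith
    show "(\<lambda>n. sqn (\<lambda>x. p (x + X n *\<^sub>R b) - p x)) \<longlonglongrightarrow> 0"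
    proof (rule sqn_tendsto_0_dominated[OF _ L2_cmult[OF indicator_ball_L2[of "R + S * norm b"], of "2 * B"]])
      show "AE x in lborel. \<bar>p (x + X n *\<^sub>R b) - p x\<bar> \<le> \<bar>2 * B * indicator (cball 0 (R + S * norm b)) x\<bar>" for n
      proof (rule AE_I2)
        fix x
        show "\<bar>p (x + X n *\<^sub>R b) - p x\<bar> \<le> \<bar>2 * B * indicator (cball 0 (R + S * norm b)) x\<bar>"
        proof (cases "norm x > R + S * norm b")
          case True
          have "norm (X n *\<^sub>R b) \<le> S * norm b" using S[of n] by (simp add: mult_right_mono)
          then have "norm (x + X n *\<^sub>R b) > R"
            using True norm_diff_ineq[of x "X n *\<^sub>R b"] by linarith
          moreover have "norm x > R" using True mult_nonneg_nonneg[OF S0 norm_ge_zero[of b]] by linarith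
          ultimately show ?thesis using B(4) by simp
        next
          case False
          then show ?thesis using B(1) B(3)[of x] B(3)[of "x + X n *\<^sub>R b"] by (simp add: indicator_def)
        qed
      qed
      have "(\<lambda>n. p (x + X n *\<^sub>R b) - p x) \<longlonglongrightarrow> p (x + 0 *\<^sub>R b) - p x" for x
        using X by (intro tendsto_intros continuous_on_tendsto_compose[OF C1_fun_continuous[OF C, of UNIV]]) auto
      then show "AE x in lborel. (\<lambda>n. p (x + X n *\<^sub>R b) - p x) \<longlonglongrightarrow> 0" by simp
    qed measurable
  qed
  then have "\<forall>\<^sub>F h in at 0. sqn (\<lambda>x. p (x + h *\<^sub>R b) - p x) < ennreal (e / 10)"
    by (rule tendsto_0_ennrealD) (use e in simp)
  then show "\<forall>\<^sub>F h in at 0. sqn (\<lambda>x. f (x + h *\<^sub>R b) - f x) \<le> ennreal e"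
  proof eventually_elim
    case (elim h)
    let ?d = "\<lambda>x. f x - p x"
    have "sqn (\<lambda>x. f (x + h *\<^sub>R b) - f x)
        = sqn (\<lambda>x. (?d (x + h *\<^sub>R b) - ?d x) + (p (x + h *\<^sub>R b) - p x))" by simp
    also have "\<dots> \<le> 2 * sqn (\<lambda>x. ?d (x + h *\<^sub>R b) - ?d x) + 2 * sqn (\<lambda>x. p (x + h *\<^sub>R b) - p x)"
      by (rule sqn_add_le) measurable
    also have "sqn (\<lambda>x. ?d (x + h *\<^sub>R b) - ?d x) \<le> 2 * sqn (\<lambda>x. ?d (x + h *\<^sub>R b)) + 2 * sqn ?d"
      by (rule sqn_diff_le) measurable
    also have "sqn (\<lambda>x. ?d (x + h *\<^sub>R b)) = sqn ?d"
      by (rule sqn_shift) measurable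
    finally have "sqn (\<lambda>x. f (x + h *\<^sub>R b) - f x)
        \<le> 2 * (2 * sqn ?d + 2 * sqn ?d) + 2 * sqn (\<lambda>x. p (x + h *\<^sub>R b) - p x)"
      by (simp add: add_mono mult_left_mono)
    also have "\<dots> \<le> 2 * (2 * ennreal (e / 10) + 2 * ennreal (e / 10)) + 2 * ennreal (e / 10)"
      using elim pe by (intro add_mono mult_left_mono) auto
    also have "\<dots> = ennreal e"
      using e by (simp flip: ennreal_numeral ennreal_mult ennreal_plus)
    finally show ?case .
  qed
qed

lemma C1_fun_line_derivative:
  assumes "C1_fun \<phi>"
  shows "((\<lambda>k. \<phi> (x + k *\<^sub>R b)) has_real_derivative frechet_derivative \<phi> (at (x + k *\<^sub>R b)) b) (at k)"
proof -
  have "((\<lambda>k. x + k *\<^sub>R b) has_derivative (\<lambda>k. k *\<^sub>R b)) (at k)"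
    by (auto intro!: derivative_eq_intros)
  from has_derivative_compose[OF this C1_fun_has_derivative[OF assms]]
  have "((\<lambda>k. \<phi> (x + k *\<^sub>R b)) has_derivative (\<lambda>h. frechet_derivative \<phi> (at (x + k *\<^sub>R b)) (h *\<^sub>R b))) (at k)" .
  moreover have "linear (frechet_derivative \<phi> (at (x + k *\<^sub>R b)))"
    using C1_fun_has_derivative[OF assms] has_derivative_linear by blast
  ultimately show ?thesis
    by (simp add: has_field_derivative_def linear_cmul mult_commute_abs)
qed

lemma C1_fun_increment_le:
  assumes "C1_fun \<phi>" "\<And>x. \<bar>frechet_derivative \<phi> (at x) b\<bar> \<le> B"
  shows "\<bar>\<phi> (x + h *\<^sub>R b) - \<phi> x\<bar> \<le> B * \<bar>h\<bar>"
proof -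
  have "norm (\<phi> (x + h *\<^sub>R b) - \<phi> (x + 0 *\<^sub>R b)) \<le> B * norm (h - 0)"
    by (rule field_differentiable_bound[where S = UNIV and f = "\<lambda>k. \<phi> (x + k *\<^sub>R b)"])
      (use C1_fun_line_derivative[OF assms(1)] assms(2) in auto)
  then show ?thesis by simp
qed

lemma test_fun_quotient_tendsto:
  fixes f :: "'a::euclidean_space \<Rightarrow> real"
  assumes f: "loc_integrable f" and p: "test_fun p" and X: "\<And>n. X n \<noteq> 0" "X \<longlonglongrightarrow> 0"
  shows "(\<lambda>n. LINT x|lborel. f x * ((p (x + X n *\<^sub>R b) - p x) / X n))
     \<longlonglongrightarrow> (LINT x|lborel. f x * frechet_derivative p (at x) b)"
proof -
  have C: "C1_fun p" by (rule test_fun_C1[OF p])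
  note [measurable] = C1_fun_measurable[OF C] C1_fun_measurable_deriv[OF C]
  have [measurable]: "f \<in> borel_measurable borel" using f by (simp add: loc_integrable_def)
  obtain B R where B: "B \<ge> 0" "R > 0" "\<And>x. \<bar>frechet_derivative p (at x) b\<bar> \<le> B" "\<And>x. norm x > R \<Longrightarrow> p x = 0"
    using test_fun_bounded[OF p, of b] by metis
  obtain S where S: "\<And>n. \<bar>X n\<bar> \<le> S"
    using X convergentI[of X] convergent_imp_Bseq[of X] BseqE[of X] by (metis real_norm_def)
  have S0: "S \<ge> 0" using S[of 0] by linarith
  let ?K = "cball (0::'a) (R + S * norm b)"
  show ?thesis
  proof (rule integral_dominated_convergence)
    show "integrable lborel (\<lambda>x. B * \<bar>indicator ?K x *\<^sub>R f x\<bar>)"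
      using f unfolding loc_integrable_def set_integrable_def by simp
    have "(\<lambda>n. f x * ((p (x + X n *\<^sub>R b) - p x) / X n)) \<longlonglongrightarrow> f x * frechet_derivative p (at x) b" for x
    proof (intro tendsto_mult tendsto_const)
      have "((\<lambda>k. (p (x + k *\<^sub>R b) - p x) / k) \<longlongrightarrow> frechet_derivative p (at x) b) (at 0)"
        using C1_fun_line_derivative[OF C, of x b 0] by (simp add: DERIV_def)
      then show "(\<lambda>n. (p (x + X n *\<^sub>R b) - p x) / X n) \<longlonglongrightarrow> frechet_derivative p (at x) b"
        by (rule filterlim_compose) (use X in \<open>auto simp: filterlim_at\<close>)
    qed
    then show "AE x in lborel. (\<lambda>n. f x * ((p (x + X n *\<^sub>R b) - p x) / X n)) \<longlonglongrightarrow> f x * frechet_derivative p (at x) b"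
      by simp
    show "AE x in lborel. norm (f x * ((p (x + X n *\<^sub>R b) - p x) / X n)) \<le> B * \<bar>indicator ?K x *\<^sub>R f x\<bar>" for n
    proof (rule AE_I2)
      fix x
      show "norm (f x * ((p (x + X n *\<^sub>R b) - p x) / X n)) \<le> B * \<bar>indicator ?K x *\<^sub>R f x\<bar>"
      proof (cases "norm x > R + S * norm b")
        case True
        have "norm (X n *\<^sub>R b) \<le> S * norm b" using S[of n] by (simp add: mult_right_mono)
        then have "norm (x + X n *\<^sub>R b) > R"
          using True norm_diff_ineq[of x "X n *\<^sub>R b"] by linarith
        moreover have "norm x > R" using True mult_nonneg_nonneg[OF S0 norm_ge_zero[of b]] by linarith
        ultimately show ?thesis using B by simp
      next
        case False
        have "\<bar>(p (x + X n *\<^sub>R b) - p x) / X n\<bar> \<le> B"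
          using C1_fun_increment_le[OF C B(3), of x "X n"] X(1)[of n] by (simp add: field_simps)
        then have "\<bar>f x\<bar> * \<bar>(p (x + X n *\<^sub>R b) - p x) / X n\<bar> \<le> \<bar>f x\<bar> * B"
          by (rule mult_left_mono) simp
        then show ?thesis using False by (simp add: indicator_def abs_mult mult.commute)
      qed
    qed
  qed auto
qed

lemma L2_quotient: "u \<in> L2 \<Longrightarrow> (\<lambda>x. (u (x + v) - u x) / h) \<in> L2"
  using L2_cmult[OF L2_diff[OF L2_shift], of u u "1 / h" v] by simp

text \<open>Difference quotients in \<open>L2\<close> replace mollification: with them the product and chain rules
  only need dominated convergence along almost everywhere convergent subsequences.\<close>

definition strong_deriv :: "('a::euclidean_space \<Rightarrow> real) \<Rightarrow> 'a \<Rightarrow> ('a \<Rightarrow> real) \<Rightarrow> bool" where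
  "strong_deriv u b g \<longleftrightarrow> u \<in> L2 \<and> g \<in> L2 \<and>
     ((\<lambda>h. sqn (\<lambda>x. (u (x + h *\<^sub>R b) - u x) / h - g x)) \<longlongrightarrow> 0) (at 0)"

lemma test_fun_shift:
  assumes "test_fun p"
  shows "test_fun (\<lambda>x. p (x + v))"
    and "frechet_derivative (\<lambda>x. p (x + v)) (at x) b = frechet_derivative p (at (x + v)) b"
proof -
  have C: "C1_fun p" by (rule test_fun_C1[OF assms])
  have d: "((\<lambda>x. p (x + v)) has_derivative frechet_derivative p (at (x + v))) (at x)" for x
  proof -
    have "((\<lambda>x. x + v) has_derivative (\<lambda>b. b)) (at x)" by (auto intro!: derivative_eq_intros)
    from has_derivative_compose[OF this C1_fun_has_derivative[OF C]] show ?thesis by simp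
  qed
  obtain B R where B: "\<And>x. norm x > R \<Longrightarrow> p x = 0"
    using test_fun_bounded[OF assms, of 0] by metis
  have "{x. p (x + v) \<noteq> 0} \<subseteq> cball 0 (R + norm v)"
  proof (rule subsetI, rule ccontr)
    fix x assume x: "x \<in> {x. p (x + v) \<noteq> 0}" "x \<notin> cball 0 (R + norm v)"
    then have "norm (x + v) > R" using norm_diff_ineq[of x v] by simp
    with B x(1) show False by simp
  qed
  then have "bounded {x. p (x + v) \<noteq> 0}" by (rule bounded_subset[OF bounded_cball])
  then show "test_fun (\<lambda>x. p (x + v))"
    unfolding test_fun_iff
    by (auto intro!: C1_funI[OF d] continuous_on_compose2[OF C1_fun_continuous_deriv[OF C]] continuous_intros)
  show "frechet_derivative (\<lambda>x. p (x + v)) (at x) b = frechet_derivative p (at (x + v)) b"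
    using frechet_derivative_eq[OF d] by simp
qed

text \<open>\<open>test_fun_quotient_tendsto\<close> is the case h = 0. Applied to the translate of
  \<open>p\<close> by h b it yields the derivative at every h, as the mean value theorem
  requires.\<close>

lemma test_fun_integral_shift_deriv:
  fixes f :: "'a::euclidean_space \<Rightarrow> real"
  assumes f: "loc_integrable f" and p: "test_fun p"
    and int: "\<And>v. integrable lborel (\<lambda>x. f x * p (x + v))"
  shows "((\<lambda>k. LINT x|lborel. f x * p (x + k *\<^sub>R b)) has_real_derivative
     (LINT x|lborel. f x * frechet_derivative p (at (x + h *\<^sub>R b)) b)) (at h)"
  unfolding DERIV_def
proof (rule tendsto_at_0_sequentiallyI)
  fix X :: "nat \<Rightarrow> real" assume X: "\<And>n. X n \<noteq> 0" "X \<longlonglongrightarrow> 0"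
  have "(LINT x|lborel. f x * ((p (x + X n *\<^sub>R b + h *\<^sub>R b) - p (x + h *\<^sub>R b)) / X n))
      = ((LINT x|lborel. f x * p (x + (h + X n) *\<^sub>R b)) - (LINT x|lborel. f x * p (x + h *\<^sub>R b))) / X n" for n
  proof -
    have "(LINT x|lborel. f x * ((p (x + X n *\<^sub>R b + h *\<^sub>R b) - p (x + h *\<^sub>R b)) / X n))
      = (LINT x|lborel. (f x * p (x + (h + X n) *\<^sub>R b) - f x * p (x + h *\<^sub>R b)) / X n)"
      by (rule Bochner_Integration.integral_cong) (auto simp: field_simps scaleR_add_left)
    then show ?thesis using int by simp
  qed
  moreover have "(\<lambda>n. LINT x|lborel. f x * ((p (x + X n *\<^sub>R b + h *\<^sub>R b) - p (x + h *\<^sub>R b)) / X n))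
     \<longlonglongrightarrow> (LINT x|lborel. f x * frechet_derivative p (at (x + h *\<^sub>R b)) b)"
    using test_fun_quotient_tendsto[OF f test_fun_shift(1)[OF p, of "h *\<^sub>R b"] X, of b]
    unfolding test_fun_shift(2)[OF p] .
  ultimately show "(\<lambda>n. ((LINT x|lborel. f x * p (x + (h + X n) *\<^sub>R b)) - (LINT x|lborel. f x * p (x + h *\<^sub>R b))) / X n)
     \<longlonglongrightarrow> (LINT x|lborel. f x * frechet_derivative p (at (x + h *\<^sub>R b)) b)"
    by (simp only:)
qed

text \<open>The derivative of \<open>h \<mapsto> \<integral> u(x) p(x - h b) dx\<close> is \<open>\<integral> g(x) p(x - h b) dx\<close>; by the mean value theorem the
  difference quotient of \<open>u\<close> minus \<open>g\<close>, tested against \<open>p\<close>, is bounded by a translation increment of \<open>g\<close>.\<close>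

lemma weak_deriv_imp_strong_deriv:
  fixes u :: "'a::euclidean_space \<Rightarrow> real"
  assumes u: "u \<in> L2" and g: "g \<in> L2" and w: "weak_deriv u b g"
  shows "strong_deriv u b g"
proof -
  note [measurable] = u[THEN L2_measurable] g[THEN L2_measurable]
  let ?D = "\<lambda>h x. (u (x + h *\<^sub>R b) - u x) / h - g x"
  have "((\<lambda>h. sqn (?D h)) \<longlongrightarrow> 0) (at 0)"
  proof (rule ennreal_tendsto_0I)
    fix e :: real assume e: "e > 0"
    have "\<forall>\<^sub>F h in at 0. sqn (\<lambda>x. g (x + h *\<^sub>R b) - g x) < ennreal e"
      by (rule tendsto_0_ennrealD[OF sqn_translation_tendsto[OF g] e])
    then obtain d where d: "d > 0" "\<And>h. h \<noteq> 0 \<Longrightarrow> \<bar>h\<bar> < d \<Longrightarrow> sqn (\<lambda>x. g (x + h *\<^sub>R b) - g x) < ennreal e"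
      unfolding eventually_at by (auto simp: dist_real_def)
    have d': "(LINT x|lborel. (g (x + h *\<^sub>R b) - g x)\<^sup>2) \<le> e" if "\<bar>h\<bar> < d" for h
    proof (cases "h = 0")
      case False
      then show ?thesis
        using d(2)[OF False that] sqn_eq_integral[OF L2_diff[OF L2_shift[OF g, of "h *\<^sub>R b"] g]] e
        by (simp add: ennreal_less_iff integral_sq_nonneg)
    qed (use e in simp)
    have "sqn (?D h) \<le> ennreal e" if h: "h \<noteq> 0" "\<bar>h\<bar> < d" for h
    proof -
      have DL: "?D h \<in> L2" by (intro L2_diff L2_quotient u g)
      have "(LINT x|lborel. (?D h x)\<^sup>2) \<le> e"
      proof (rule integral_sq_le_if_test_fun_bound[OF DL less_imp_le[OF e]])
        fix p :: "'a \<Rightarrow> real" assume p: "test_fun p"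
        have pL: "p \<in> L2" by (rule test_fun_L2[OF p])
        note [measurable] = pL[THEN L2_measurable]
        have int_u: "integrable lborel (\<lambda>x. u x * p (x + v))" for v
          by (intro integrable_mult_L2 u L2_shift pL)
        \<comment> \<open>Translating the test function by - k b moves \<open>u\<close> by + k b
          after the substitution in \<open>F_eq\<close>, so ?F h - ?F 0 is the tested increment of
          \<open>u\<close>.\<close>
        let ?F = "\<lambda>k. LINT x|lborel. u x * p (x + k *\<^sub>R (- b))"
        let ?G = "\<lambda>k. LINT x|lborel. g x * p (x + k *\<^sub>R (- b))"
        have dF: "(?F has_real_derivative ?G k) (at k)" for k
        proof -
          let ?p = "\<lambda>x. p (x + k *\<^sub>R (- b))"
          have "(?F has_real_derivative (LINT x|lborel. u x * frechet_derivative p (at (x + k *\<^sub>R (- b))) (- b))) (at k)"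
            by (rule test_fun_integral_shift_deriv[OF loc_integrable_L2[OF u] p int_u])
          also have "(LINT x|lborel. u x * frechet_derivative p (at (x + k *\<^sub>R (- b))) (- b))
              = - (LINT x|lborel. u x * frechet_derivative ?p (at x) b)"
            using linear_neg[OF has_derivative_linear[OF C1_fun_has_derivative[OF test_fun_C1[OF p]]], of _ b]
            unfolding test_fun_shift(2)[OF p] by simp
          also have "\<dots> = ?G k"
            using w test_fun_shift(1)[OF p, of "k *\<^sub>R (- b)"] unfolding weak_deriv_def by fastforce
          finally show ?thesis .
        qed
        have F_eq: "?F h = (LINT x|lborel. u (x + h *\<^sub>R b) * p x)"
          using integral_lborel_shift[of "\<lambda>x. u x * p (x + h *\<^sub>R (- b))" "h *\<^sub>R b"] by simp
        have G_eq: "?G k = (LINT x|lborel. g (x + k *\<^sub>R b) * p x)" for k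
          using integral_lborel_shift[of "\<lambda>x. g x * p (x + k *\<^sub>R (- b))" "k *\<^sub>R b"] by simp
        \<comment> \<open>The intermediate point k depends on \<open>p\<close>, but only |k| < d is
          used of it, and there the increment of \<open>g\<close> is small uniformly. Hence the
          bound is uniform in \<open>p\<close>.\<close>
        have "\<exists>k. \<bar>k\<bar> < d \<and> ?F h - ?F 0 = h * ?G k"
        proof (cases "h > 0")
          case True
          from MVT2[OF this dF] obtain k where "0 < k" "k < h" "?F h - ?F 0 = (h - 0) * ?G k" by blast
          then show ?thesis using h by (intro exI[of _ k]) auto
        next
          case False
          then have "h < 0" using h by simp
          from MVT2[OF this dF] obtain k where "h < k" "k < 0" "?F 0 - ?F h = (0 - h) * ?G k" by blast
          then show ?thesis using h by (intro exI[of _ k]) auto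
        qed
        then obtain k where k: "\<bar>k\<bar> < d" "?F h - ?F 0 = h * ?G k" by blast
        have "(LINT x|lborel. ?D h x * p x) = (LINT x|lborel. (u (x + h *\<^sub>R b) * p x - u x * p x) / h - g x * p x)"
          by (rule Bochner_Integration.integral_cong) (auto simp: field_simps h)
        also have "\<dots> = (?F h - ?F 0) / h - ?G 0"
          unfolding F_eq by (simp add: integrable_mult_L2 L2_shift u g pL)
        also have "\<dots> = ?G k - ?G 0" using k h by simp
        also have "\<dots> = (LINT x|lborel. (g (x + k *\<^sub>R b) - g x) * p x)"
          unfolding G_eq by (simp add: integrable_mult_L2 L2_shift g pL left_diff_distrib)
        finally have "(LINT x|lborel. ?D h x * p x)\<^sup>2 = (LINT x|lborel. (g (x + k *\<^sub>R b) - g x) * p x)\<^sup>2"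
          by simp
        also have "\<dots> \<le> (LINT x|lborel. (g (x + k *\<^sub>R b) - g x)\<^sup>2) * (LINT x|lborel. (p x)\<^sup>2)"
          by (intro Cauchy_Schwarz_L2 L2_diff L2_shift g pL)
        also have "\<dots> \<le> e * (LINT x|lborel. (p x)\<^sup>2)"
          by (intro mult_right_mono d' k integral_sq_nonneg)
        finally show "(LINT x|lborel. ?D h x * p x)\<^sup>2 \<le> e * (LINT x|lborel. (p x)\<^sup>2)" .
      qed
      then show ?thesis using sqn_eq_integral[OF DL] by (simp add: ennreal_leI)
    qed
    then show "\<forall>\<^sub>F h in at 0. sqn (?D h) \<le> ennreal e"
      unfolding eventually_at using d(1) by (auto simp: dist_real_def)
  qed
  then show ?thesis unfolding strong_deriv_def using u g by simp
qed

text \<open>Discrete integration by parts: translation invariance moves the difference quotient with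
  step h from \<open>u\<close> to the test function, with step - h and a change of sign. Passing to
  the limit on both sides gives the weak identity.\<close>

lemma strong_deriv_imp_weak_deriv:
  fixes u :: "'a::euclidean_space \<Rightarrow> real"
  assumes s: "strong_deriv u b g"
  shows "weak_deriv u b g"
proof -
  have u: "u \<in> L2" and g: "g \<in> L2"
    and lim: "((\<lambda>h. sqn (\<lambda>x. (u (x + h *\<^sub>R b) - u x) / h - g x)) \<longlongrightarrow> 0) (at 0)"
    using s by (auto simp: strong_deriv_def)
  note [measurable] = u[THEN L2_measurable] g[THEN L2_measurable]
  have "(LINT x|lborel. u x * frechet_derivative p (at x) b) = - (LINT x|lborel. g x * p x)"
    if p: "test_fun p" for p
  proof -
    have pL: "p \<in> L2" by (rule test_fun_L2[OF p])
    note [measurable] = pL[THEN L2_measurable]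
    let ?h = "\<lambda>n. inverse (real (Suc n))"
    have h: "?h n \<noteq> 0" for n by simp
    have hl: "filterlim ?h (at 0) sequentially"
      using LIMSEQ_inverse_real_of_nat by (simp add: filterlim_at)
    have "(\<lambda>n. LINT x|lborel. (u (x + ?h n *\<^sub>R b) - u x) / ?h n * p x) \<longlonglongrightarrow> (LINT x|lborel. g x * p x)"
      by (rule L2_inner_tendsto[OF _ _ g pL filterlim_compose[OF lim hl]])
        (simp_all add: L2_quotient[OF u] pL sqn_def del: of_nat_Suc)
    moreover have "(LINT x|lborel. (u (x + ?h n *\<^sub>R b) - u x) / ?h n * p x)
        = - (LINT x|lborel. u x * ((p (x + (- ?h n) *\<^sub>R b) - p x) / (- ?h n)))" for n
    proof -
      define k where "k = ?h n"
      have k: "k \<noteq> 0" by (simp add: k_def)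
      have i: "integrable lborel (\<lambda>x. u (x + k *\<^sub>R b) * p x)" "integrable lborel (\<lambda>x. u x * p (x + (- k) *\<^sub>R b))"
         "integrable lborel (\<lambda>x. u x * p x)"
        by (intro integrable_mult_L2 L2_shift u pL)+
      have "(LINT x|lborel. (u (x + k *\<^sub>R b) - u x) / k * p x)
          = (LINT x|lborel. (u (x + k *\<^sub>R b) * p x - u x * p x) / k)"
        by (rule Bochner_Integration.integral_cong) (auto simp: field_simps)
      also have "\<dots> = ((LINT x|lborel. u (x + k *\<^sub>R b) * p x) - (LINT x|lborel. u x * p x)) / k"
        using i by simp
      also have "(LINT x|lborel. u (x + k *\<^sub>R b) * p x) = (LINT x|lborel. u x * p (x + (- k) *\<^sub>R b))"
        using integral_lborel_shift[of "\<lambda>x. u x * p (x + (- k) *\<^sub>R b)" "k *\<^sub>R b"] by simp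
      also have "((LINT x|lborel. u x * p (x + (- k) *\<^sub>R b)) - (LINT x|lborel. u x * p x)) / k
          = (LINT x|lborel. (u x * p (x + (- k) *\<^sub>R b) - u x * p x) / k)"
        using Bochner_Integration.integral_diff[OF i(2,3)] by (simp only: integral_divide_zero)
      also have "\<dots> = (LINT x|lborel. - (u x * ((p (x + (- k) *\<^sub>R b) - p x) / (- k))))"
        by (rule Bochner_Integration.integral_cong) (auto simp: field_simps k)
      finally show ?thesis by (simp add: k_def)
    qed
    moreover have "(\<lambda>n. - (LINT x|lborel. u x * ((p (x + (- ?h n) *\<^sub>R b) - p x) / (- ?h n))))
        \<longlonglongrightarrow> - (LINT x|lborel. u x * frechet_derivative p (at x) b)"
    proof (rule tendsto_minus, rule test_fun_quotient_tendsto[OF loc_integrable_L2[OF u] p])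
      show "(\<lambda>n. - ?h n) \<longlonglongrightarrow> 0"
        using tendsto_minus[OF LIMSEQ_inverse_real_of_nat] by simp
    qed simp
    ultimately have "(LINT x|lborel. g x * p x) = - (LINT x|lborel. u x * frechet_derivative p (at x) b)"
      by (simp only:) (rule LIMSEQ_unique)
    then show ?thesis by simp
  qed
  then show ?thesis
    unfolding weak_deriv_def
    by (auto intro!: loc_integrable_L2 integrable_mult_L2 u g test_fun_L2 test_fun_deriv_L2)
qed

lemma sum_square_le_card:
  fixes f :: "'b \<Rightarrow> real"
  assumes "finite I"
  shows "(\<Sum>i\<in>I. f i)\<^sup>2 \<le> real (card I) * (\<Sum>i\<in>I. (f i)\<^sup>2)"
  using Cauchy_Schwarz_ineq_sum[of "\<lambda>_. 1" f I] by simp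

lemma sqn_sum_le:
  assumes "finite I" "\<And>i. i \<in> I \<Longrightarrow> f i \<in> borel_measurable borel"
  shows "sqn (\<lambda>x. \<Sum>i\<in>I. f i x) \<le> of_nat (card I) * (\<Sum>i\<in>I. sqn (f i))"
proof -
  have "sqn (\<lambda>x. \<Sum>i\<in>I. f i x) \<le> (\<integral>\<^sup>+x. of_nat (card I) * (\<Sum>i\<in>I. ennreal ((f i x)\<^sup>2)) \<partial>lborel)"
    unfolding sqn_def
  proof (rule nn_integral_mono)
    fix x
    have "ennreal ((\<Sum>i\<in>I. f i x)\<^sup>2) \<le> ennreal (real (card I) * (\<Sum>i\<in>I. (f i x)\<^sup>2))"
      by (rule ennreal_leI) (rule sum_square_le_card[OF assms(1)])
    also have "\<dots> = of_nat (card I) * (\<Sum>i\<in>I. ennreal ((f i x)\<^sup>2))"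
      by (simp add: ennreal_mult sum_nonneg ennreal_of_nat_eq_real_of_nat)
    finally show "ennreal ((\<Sum>i\<in>I. f i x)\<^sup>2) \<le> of_nat (card I) * (\<Sum>i\<in>I. ennreal ((f i x)\<^sup>2))" .
  qed
  also have "\<dots> = of_nat (card I) * (\<Sum>i\<in>I. sqn (f i))"
    using assms unfolding sqn_def by (subst nn_integral_cmult) (auto simp: nn_integral_sum simp del: sum_ennreal)
  finally show ?thesis .
qed

lemma sqn_tendsto:
  assumes "\<forall>\<^sub>F n in F. f n \<in> L2" "g \<in> L2" "((\<lambda>n. sqn (\<lambda>x. f n x - g x)) \<longlongrightarrow> 0) F"
  shows "((\<lambda>n. sqn (f n)) \<longlongrightarrow> sqn g) F"
proof -
  have "((\<lambda>n. LINT x|lborel. f n x * f n x) \<longlongrightarrow> (LINT x|lborel. g x * g x)) F"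
    by (rule L2_inner_tendsto) (use assms in auto)
  then have "((\<lambda>n. ennreal (LINT x|lborel. (f n x)\<^sup>2)) \<longlongrightarrow> ennreal (LINT x|lborel. (g x)\<^sup>2)) F"
    unfolding power2_eq_square by (rule tendsto_ennrealI)
  then have "((\<lambda>n. sqn (f n)) \<longlongrightarrow> ennreal (LINT x|lborel. (g x)\<^sup>2)) F"
    by (rule Lim_transform_eventually)
      (use assms(1) in \<open>auto elim!: eventually_mono simp: sqn_eq_integral\<close>)
  then show ?thesis by (simp add: sqn_eq_integral assms)
qed

text \<open>The increment by h is a sum of n + 1 increments by h / (n + 1), all of the same L2 norm
  by translation invariance. Cauchy-Schwarz bounds it by (n + 1)^2 times one of them, that is, by
  h^2 times a squared difference quotient, which tends to \<open>sqn g\<close>.\<close>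

lemma strong_deriv_increment_le:
  fixes u :: "'a::euclidean_space \<Rightarrow> real"
  assumes s: "strong_deriv u b g"
  shows "sqn (\<lambda>x. u (x + h *\<^sub>R b) - u x) \<le> ennreal (h\<^sup>2) * sqn g"
proof (cases "h = 0")
  case True
  then show ?thesis by (simp add: sqn_def)
next
  case h: False
  have u: "u \<in> L2" and g: "g \<in> L2"
    and lim: "((\<lambda>h. sqn (\<lambda>x. (u (x + h *\<^sub>R b) - u x) / h - g x)) \<longlongrightarrow> 0) (at 0)"
    using s by (auto simp: strong_deriv_def)
  note [measurable] = u[THEN L2_measurable] g[THEN L2_measurable]
  define k where "k n = h * inverse (real (Suc n))" for n
  have k: "k n \<noteq> 0" for n using h by (simp add: k_def)
  have "k \<longlonglongrightarrow> h * 0" unfolding k_def by (intro tendsto_mult tendsto_const LIMSEQ_inverse_real_of_nat)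
  then have kl: "filterlim k (at 0) sequentially" using k by (simp add: filterlim_at)
  have step: "sqn (\<lambda>x. u (x + h *\<^sub>R b) - u x) \<le> ennreal (h\<^sup>2) * sqn (\<lambda>x. (u (x + k n *\<^sub>R b) - u x) / k n)" for n
  proof -
    let ?N = "Suc n"
    let ?w = "\<lambda>x. u (x + k n *\<^sub>R b) - u x"
    have hk: "h = real ?N * k n" by (simp add: k_def)
    have "u (x + h *\<^sub>R b) - u x = (\<Sum>i<?N. ?w (x + (real i * k n) *\<^sub>R b))" for x
    proof -
      have "u (x + h *\<^sub>R b) - u x = u (x + (real ?N * k n) *\<^sub>R b) - u (x + (real 0 * k n) *\<^sub>R b)"
        by (simp only: hk) simp
      also have "\<dots> = (\<Sum>i<?N. u (x + (real (Suc i) * k n) *\<^sub>R b) - u (x + (real i * k n) *\<^sub>R b))"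
        by (rule sum_lessThan_telescope[symmetric])
      also have "\<dots> = (\<Sum>i<?N. ?w (x + (real i * k n) *\<^sub>R b))"
        by (rule sum.cong) (simp_all add: algebra_simps)
      finally show ?thesis .
    qed
    then have "sqn (\<lambda>x. u (x + h *\<^sub>R b) - u x) = sqn (\<lambda>x. \<Sum>i<?N. ?w (x + (real i * k n) *\<^sub>R b))"
      by simp
    also have "\<dots> \<le> of_nat (card {..<?N}) * (\<Sum>i<?N. sqn (\<lambda>x. ?w (x + (real i * k n) *\<^sub>R b)))"
      by (rule sqn_sum_le) simp_all
    also have "(\<Sum>i<?N. sqn (\<lambda>x. ?w (x + (real i * k n) *\<^sub>R b))) = (\<Sum>i<?N. sqn ?w)"
      by (rule sum.cong[OF refl], rule sqn_shift) simp
    also have "of_nat (card {..<?N}) * (\<Sum>i<?N. sqn ?w) = ennreal ((real ?N)\<^sup>2) * sqn ?w"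
      by (simp add: power2_eq_square ennreal_mult ennreal_of_nat_eq_real_of_nat mult.assoc del: of_nat_Suc)
    also have "sqn ?w = sqn (\<lambda>x. k n * (?w x / k n))" using k[of n] by simp
    also have "\<dots> = ennreal ((k n)\<^sup>2) * sqn (\<lambda>x. ?w x / k n)"
      by (rule sqn_cmult) simp
    also have "ennreal ((real ?N)\<^sup>2) * (ennreal ((k n)\<^sup>2) * sqn (\<lambda>x. ?w x / k n)) = ennreal (h\<^sup>2) * sqn (\<lambda>x. ?w x / k n)"
      by (subst hk) (simp add: power_mult_distrib ennreal_mult mult.assoc del: of_nat_Suc)
    finally show ?thesis .
  qed
  have "(\<lambda>n. sqn (\<lambda>x. (u (x + k n *\<^sub>R b) - u x) / k n)) \<longlonglongrightarrow> sqn g"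
    by (rule sqn_tendsto[OF _ g filterlim_compose[OF lim kl]]) (simp add: L2_quotient u)
  then have "(\<lambda>n. ennreal (h\<^sup>2) * sqn (\<lambda>x. (u (x + k n *\<^sub>R b) - u x) / k n)) \<longlonglongrightarrow> ennreal (h\<^sup>2) * sqn g"
    by (intro tendsto_mult_ennreal tendsto_const) (use h in auto)
  then show ?thesis
    by (rule LIMSEQ_le_const) (use step in auto)
qed

text \<open>\<open>wgrad\<close> is an arbitrary choice; this identifies it a.e. with any derivative
  that has been computed explicitly.\<close>

lemma weak_deriv_unique:
  assumes "weak_deriv u b g1" "weak_deriv u b g2"
  shows "AE x in lborel. g1 x = g2 x"
proof -
  have [measurable]: "g1 \<in> borel_measurable borel" "g2 \<in> borel_measurable borel"
    using assms by (auto simp: weak_deriv_def loc_integrable_def)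
  have "AE x in lborel. g1 x - g2 x = 0"
  proof (rule AE_eq_0_if_test_fun_orthogonal)
    show "loc_integrable (\<lambda>x. g1 x - g2 x)"
      using assms unfolding weak_deriv_def loc_integrable_def by (auto intro!: set_integral_diff)
    fix p :: "'a \<Rightarrow> real" assume "test_fun p"
    then show "(LINT x|lborel. (g1 x - g2 x) * p x) = 0"
      using assms unfolding weak_deriv_def by (auto simp: left_diff_distrib)
  qed
  then show ?thesis by eventually_elim simp
qed

text \<open>L2 convergence yields a.e. convergence only along a subsequence, so a limit in the
  continuous parameter is reduced to sequences, each of which may be thinned out.\<close>

lemma tendsto_0_at_0_if_subseq:
  fixes S :: "real \<Rightarrow> ennreal"
  assumes "\<And>X. (\<And>n. X n \<noteq> 0) \<Longrightarrow> X \<longlonglongrightarrow> 0 \<Longrightarrow> \<exists>r::nat\<Rightarrow>nat. strict_mono r \<and> (\<lambda>n. S (X (r n))) \<longlonglongrightarrow> 0"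
  shows "(S \<longlongrightarrow> 0) (at 0)"
proof (rule ennreal_tendsto_0I, rule ccontr)
  fix e :: real assume e: "e > 0" and "\<not> (\<forall>\<^sub>F h in at 0. S h \<le> ennreal e)"
  then have "\<forall>d>0. \<exists>h. h \<noteq> 0 \<and> \<bar>h\<bar> < d \<and> \<not> S h \<le> ennreal e"
    unfolding eventually_at by (auto simp: dist_real_def)
  then have "\<forall>n. \<exists>h. h \<noteq> 0 \<and> \<bar>h\<bar> < inverse (real (Suc n)) \<and> \<not> S h \<le> ennreal e"
    by simp
  then obtain X where X: "\<And>n. X n \<noteq> 0" "\<And>n. \<bar>X n\<bar> < inverse (real (Suc n))" "\<And>n. \<not> S (X n) \<le> ennreal e"
    by metis
  have "X \<longlonglongrightarrow> 0"
    by (rule Lim_null_comparison[OF _ LIMSEQ_inverse_real_of_nat]) (use X(2) in \<open>auto intro!: always_eventually less_imp_le\<close>)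
  from assms[OF X(1) this] obtain r :: "nat \<Rightarrow> nat" where "(\<lambda>n. S (X (r n))) \<longlonglongrightarrow> 0" by auto
  then have "\<forall>\<^sub>F n in sequentially. S (X (r n)) < ennreal e" by (rule tendsto_0_ennrealD[OF _ e])
  then obtain n where "S (X (r n)) < ennreal e" by (auto simp: eventually_sequentially)
  then show False using X(3)[of "r n"] by simp
qed

text \<open>Product and chain rule in one. \<open>k\<close> is Lipschitz only on \<open>I\<close>,
  which contains the values of \<open>u\<close>, so that powers are admissible when \<open>u\<close>
  is bounded; 0 \<in> I and k 0 = 0 keep \<open>k (u x)\<close> in L2.\<close>

lemma strong_deriv_mult_compose:
  fixes u :: "'a::euclidean_space \<Rightarrow> real" and k k' :: "real \<Rightarrow> real" and m :: "'a \<Rightarrow> real"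
  assumes s: "strong_deriv u b g"
    and uI: "AE x in lborel. u x \<in> I" and I0: "0 \<in> I"
    and k: "\<And>s. (k has_real_derivative k' s) (at s)" "continuous_on UNIV k'" "k 0 = 0"
    and L: "\<And>s t. s \<in> I \<Longrightarrow> t \<in> I \<Longrightarrow> \<bar>k s - k t\<bar> \<le> L * \<bar>s - t\<bar>"
    and L': "\<And>s. s \<in> I \<Longrightarrow> \<bar>k' s\<bar> \<le> L"
    and m: "C1_fun m" "\<And>x. \<bar>m x\<bar> \<le> B" "\<And>x. \<bar>frechet_derivative m (at x) b\<bar> \<le> B"
  shows "strong_deriv (\<lambda>x. m x * k (u x)) b
     (\<lambda>x. frechet_derivative m (at x) b * k (u x) + m x * k' (u x) * g x)" (is "strong_deriv ?w b ?G")
proof -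
  have u: "u \<in> L2" and g: "g \<in> L2"
    and lim: "((\<lambda>h. sqn (\<lambda>x. (u (x + h *\<^sub>R b) - u x) / h - g x)) \<longlongrightarrow> 0) (at 0)"
    using s by (auto simp: strong_deriv_def)
  have ck: "continuous_on UNIV k" using k(1) by (meson DERIV_continuous_on continuous_on_eq_continuous_at has_field_derivative_at_within)
  note [measurable] = u[THEN L2_measurable] g[THEN L2_measurable] C1_fun_measurable[OF m(1)]
    C1_fun_measurable_deriv[OF m(1)] borel_measurable_continuous_onI[OF ck] borel_measurable_continuous_onI[OF k(2)]
  have B0: "B \<ge> 0" using m(2)[of 0] by linarith
  have L0: "L \<ge> 0" using L'[OF I0] by linarith
  have kle: "\<bar>k s\<bar> \<le> L * \<bar>s\<bar>" if "s \<in> I" for s using L[OF that I0] k(3) by simp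
  have kuL: "(\<lambda>x. k (u x)) \<in> L2"
    by (rule L2_dominated[OF u, where B = L]) (use uI kle in \<open>auto elim!: eventually_mono\<close>)
  have wL: "?w \<in> L2"
    by (rule L2_dominated[OF kuL, where B = B]) (auto simp: abs_mult intro!: mult_right_mono m)
  have k'gL: "(\<lambda>x. k' (u x) * g x) \<in> L2"
    by (rule L2_dominated[OF g, where B = L]) (use uI L' in \<open>auto simp: abs_mult elim!: eventually_mono intro!: mult_right_mono\<close>)
  have GL: "?G \<in> L2"
    unfolding mult.assoc
    by (intro L2_add L2_dominated[OF kuL, where B = B] L2_dominated[OF k'gL, where B = B] AE_I2)
      (auto simp: abs_mult intro!: mult_right_mono m)
  have "((\<lambda>h. sqn (\<lambda>x. (?w (x + h *\<^sub>R b) - ?w x) / h - ?G x)) \<longlongrightarrow> 0) (at 0)"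
  proof (rule tendsto_0_at_0_if_subseq)
    fix X :: "nat \<Rightarrow> real" assume X: "\<And>n. X n \<noteq> 0" "X \<longlonglongrightarrow> 0"
    have Xat: "filterlim X (at 0) sequentially" using X by (simp add: filterlim_at)
    obtain r :: "nat \<Rightarrow> nat" where r: "strict_mono r"
      and ae: "AE x in lborel. (\<lambda>n. u (x + X (r n) *\<^sub>R b) - u x) \<longlonglongrightarrow> 0"
      using sqn_AE_subseq[of "\<lambda>n x. u (x + X n *\<^sub>R b) - u x", OF L2_diff[OF L2_shift[OF u] u]
          filterlim_compose[OF sqn_translation_tendsto[OF u] Xat]] by auto
    define h where "h n = X (r n)" for n
    have h0: "h n \<noteq> 0" for n using X by (simp add: h_def)
    have hl: "h \<longlonglongrightarrow> 0" unfolding h_def using LIMSEQ_subseq_LIMSEQ[OF X(2) r] by (simp add: comp_def)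
    then have hat: "filterlim h (at 0) sequentially" using h0 by (simp add: filterlim_at)
    \<comment> \<open>The slope of \<open>k\<close>, completed by \<open>k'\<close> on the diagonal.
      It writes the increment of k(u) as a multiple of that of \<open>u\<close> without a division,
      is bounded by \<open>L\<close> on \<open>I\<close>, and is continuous at the diagonal.\<close>
    define S where "S s t = (if t = s then k' s else (k t - k s) / (t - s))" for s t
    have S_eq: "k t - k s = S s t * (t - s)" for s t by (simp add: S_def)
    have S_le: "\<bar>S s t\<bar> \<le> L" if "s \<in> I" "t \<in> I" for s t
      using L[OF that(2,1)] L'[OF that(1)] by (auto simp: S_def field_simps)
    have S_lim: "((\<lambda>t. S s t) \<longlongrightarrow> k' s) (at s)" for s
    proof (rule Lim_transform_eventually)
      show "((\<lambda>t. (k t - k s) / (t - s)) \<longlongrightarrow> k' s) (at s)"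
        using k(1)[of s] by (simp add: has_field_derivative_iff)
      show "\<forall>\<^sub>F t in at s. (k t - k s) / (t - s) = S s t"
        by (auto simp: eventually_at S_def intro!: exI[of _ 1])
    qed
    have S_lim': "(\<lambda>n. S s (t n)) \<longlonglongrightarrow> k' s" if "t \<longlonglongrightarrow> s" for s t
    proof -
      have "isCont (S s) s" using S_lim[of s] by (simp add: isCont_def S_def[of s s])
      from isCont_tendsto_compose[OF this that] show ?thesis by (simp add: S_def)
    qed
    have S_meas[measurable]: "(\<lambda>x. S (u x) (u (x + v))) \<in> borel_measurable borel" for v
      unfolding S_def by measurable
    let ?q = "\<lambda>n x. (u (x + h n *\<^sub>R b) - u x) / h n"
    let ?S = "\<lambda>n x. S (u x) (u (x + h n *\<^sub>R b))"
    let ?m = "\<lambda>n x. m (x + h n *\<^sub>R b)"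
    let ?d = "\<lambda>x. frechet_derivative m (at x) b"
    \<comment> \<open>\<open>?A\<close> is the L2 error of the quotient of \<open>u\<close> with a
      bounded factor, \<open>?B\<close> the error of the slopes, which tends to 0 a.e. and is
      dominated by a multiple of \<open>g\<close>, and \<open>?C\<close> the error of the quotient
      of \<open>m\<close>.\<close>
    let ?A = "\<lambda>n x. ?m n x * ?S n x * (?q n x - g x)"
    let ?B = "\<lambda>n x. (?m n x * ?S n x - m x * k' (u x)) * g x"
    let ?C = "\<lambda>n x. ((?m n x - m x) / h n - ?d x) * k (u x)"
    have dec: "(?w (x + h n *\<^sub>R b) - ?w x) / h n - ?G x = (?A n x + ?B n x) + ?C n x" for n x
    proof -
      have alg: "(m1 * k1 - m0 * k0) / t - (d * k0 + m0 * kk * gx)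
          = (m1 * s * ((u1 - u0) / t - gx) + (m1 * s - m0 * kk) * gx) + ((m1 - m0) / t - d) * k0"
        if "k1 - k0 = s * (u1 - u0)" for m1 k1 m0 k0 t d kk gx s u1 u0 :: real
      proof -
        have "k1 = k0 + s * (u1 - u0)" using that by simp
        show ?thesis unfolding \<open>k1 = k0 + s * (u1 - u0)\<close> by (simp add: divide_inverse algebra_simps)
      qed
      show ?thesis by (rule alg[OF S_eq])
    qed
    have uI2: "AE x in lborel. u x \<in> I \<and> u (x + h n *\<^sub>R b) \<in> I" for n
      using uI AE_lborel_shift[OF uI, of "h n *\<^sub>R b"] by eventually_elim simp
    have A: "(\<lambda>n. sqn (?A n)) \<longlonglongrightarrow> 0"
    proof (rule tendsto_sandwich[OF always_eventually always_eventually tendsto_const])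
      show "\<forall>n. sqn (?A n) \<le> ennreal ((B * L)\<^sup>2) * sqn (\<lambda>x. ?q n x - g x)"
      proof
        fix n
        have "sqn (?A n) \<le> sqn (\<lambda>x. (B * L) * (?q n x - g x))"
        proof (rule sqn_mono_AE)
          show "AE x in lborel. \<bar>?A n x\<bar> \<le> \<bar>(B * L) * (?q n x - g x)\<bar>"
            using uI2[of n]
          proof eventually_elim
            case (elim x)
            then have "\<bar>?m n x\<bar> * \<bar>?S n x\<bar> \<le> B * L" by (intro mult_mono m S_le B0) auto
            then show ?case
              using B0 L0 by (simp only: abs_mult) (intro mult_right_mono, auto)
          qed
        qed
        also have "\<dots> = ennreal ((B * L)\<^sup>2) * sqn (\<lambda>x. ?q n x - g x)"
          by (rule sqn_cmult) simp
        finally show "sqn (?A n) \<le> ennreal ((B * L)\<^sup>2) * sqn (\<lambda>x. ?q n x - g x)" .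
      qed
      have "(\<lambda>n. ennreal ((B * L)\<^sup>2) * sqn (\<lambda>x. ?q n x - g x)) \<longlonglongrightarrow> ennreal ((B * L)\<^sup>2) * 0"
        by (intro tendsto_mult_ennreal tendsto_const filterlim_compose[OF lim hat]) auto
      then show "(\<lambda>n. ennreal ((B * L)\<^sup>2) * sqn (\<lambda>x. ?q n x - g x)) \<longlonglongrightarrow> 0" by simp
    qed simp
    have mlim: "(\<lambda>n. ?m n x) \<longlonglongrightarrow> m x" for x
    proof -
      have "(\<lambda>n. ?m n x) \<longlonglongrightarrow> m (x + 0 *\<^sub>R b)"
        by (intro continuous_on_tendsto_compose[OF C1_fun_continuous[OF m(1), of UNIV]] tendsto_intros hl) auto
      then show ?thesis by simp
    qed
    have B: "(\<lambda>n. sqn (?B n)) \<longlonglongrightarrow> 0"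
    proof (rule sqn_tendsto_0_dominated[OF _ L2_cmult[OF g, of "2 * (B * L)"]])
      show "AE x in lborel. \<bar>?B n x\<bar> \<le> \<bar>2 * (B * L) * g x\<bar>" for n
        using uI2[of n]
      proof eventually_elim
        case (elim x)
        have "\<bar>?m n x * ?S n x\<bar> \<le> B * L" "\<bar>m x * k' (u x)\<bar> \<le> B * L"
          using elim B0 L0 by (auto simp: abs_mult intro!: mult_mono m S_le L')
        then have "\<bar>?m n x * ?S n x - m x * k' (u x)\<bar> \<le> 2 * (B * L)" by linarith
        then show ?case
          using B0 L0 by (simp only: abs_mult) (intro mult_right_mono, auto simp: abs_mult)
      qed
      show "AE x in lborel. (\<lambda>n. ?B n x) \<longlonglongrightarrow> 0"
        using ae
      proof eventually_elim
        case (elim x)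
        then have "(\<lambda>n. u (x + h n *\<^sub>R b)) \<longlonglongrightarrow> u x" by (simp add: h_def LIM_zero_cancel)
        then have "(\<lambda>n. ?B n x) \<longlonglongrightarrow> (m x * k' (u x) - m x * k' (u x)) * g x"
          by (intro tendsto_intros mlim S_lim')
        then show ?case by simp
      qed
    qed measurable
    have C: "(\<lambda>n. sqn (?C n)) \<longlonglongrightarrow> 0"
    proof (rule sqn_tendsto_0_dominated[OF _ L2_cmult[OF kuL, of "2 * B"]])
      show "AE x in lborel. \<bar>?C n x\<bar> \<le> \<bar>2 * B * k (u x)\<bar>" for n
      proof (rule AE_I2)
        fix x
        have "\<bar>(?m n x - m x) / h n\<bar> \<le> B"
          using C1_fun_increment_le[OF m(1,3), of x "h n"] h0[of n] by (simp add: field_simps)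
        then have "\<bar>(?m n x - m x) / h n - ?d x\<bar> \<le> 2 * B" using m(3)[of x] by linarith
        then show "\<bar>?C n x\<bar> \<le> \<bar>2 * B * k (u x)\<bar>"
          using B0 by (simp only: abs_mult) (intro mult_right_mono, auto simp: abs_mult)
      qed
      show "AE x in lborel. (\<lambda>n. ?C n x) \<longlonglongrightarrow> 0"
      proof (rule AE_I2)
        fix x
        have "((\<lambda>h. (m (x + h *\<^sub>R b) - m x) / h) \<longlongrightarrow> ?d x) (at 0)"
          using C1_fun_line_derivative[OF m(1), of x b 0] by (simp add: DERIV_def)
        from filterlim_compose[OF this hat]
        have "(\<lambda>n. ?C n x) \<longlonglongrightarrow> (?d x - ?d x) * k (u x)"
          by (intro tendsto_intros)
        then show "(\<lambda>n. ?C n x) \<longlonglongrightarrow> 0" by simp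
      qed
    qed measurable
    have "(\<lambda>n. sqn (\<lambda>x. (?A n x + ?B n x) + ?C n x)) \<longlonglongrightarrow> 0"
      by (intro sqn_tendsto_0_add A B C always_eventually allI) measurable
    then show "\<exists>r::nat\<Rightarrow>nat. strict_mono r \<and> (\<lambda>n. sqn (\<lambda>x. (?w (x + X (r n) *\<^sub>R b) - ?w x) / X (r n) - ?G x)) \<longlonglongrightarrow> 0"
      using r dec unfolding h_def by (intro exI[of _ r]) simp
  qed
  then show ?thesis unfolding strong_deriv_def using wL GL by simp
qed

section \<open>The Nash inequality\<close>

lemma sqn_increment_add:
  fixes V :: "'a::euclidean_space \<Rightarrow> real"
  assumes [measurable]: "V \<in> borel_measurable borel"
  shows "sqn (\<lambda>x. V (x + (v + w)) - V x) \<le> 2 * sqn (\<lambda>x. V (x + v) - V x) + 2 * sqn (\<lambda>x. V (x + w) - V x)"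
proof -
  let ?d = "\<lambda>x. V (x + v) - V x"
  have "sqn (\<lambda>x. V (x + (v + w)) - V x) = sqn (\<lambda>x. ?d (x + w) + (V (x + w) - V x))"
    by (simp add: add.assoc add.commute[of v w])
  also have "\<dots> \<le> 2 * sqn (\<lambda>x. ?d (x + w)) + 2 * sqn (\<lambda>x. V (x + w) - V x)"
    by (rule sqn_add_le) measurable
  also have "sqn (\<lambda>x. ?d (x + w)) = sqn ?d" by (rule sqn_shift) measurable
  finally show ?thesis .
qed

text \<open>Each added summand doubles the bound accumulated so far, hence 2 ^ card S. Applied to
  the coordinates of a vector it reduces an arbitrary translation to translations along the
  axes.\<close>

lemma sqn_increment_sum:
  fixes V :: "'a::euclidean_space \<Rightarrow> real"
  assumes [measurable]: "V \<in> borel_measurable borel" and "finite S"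
  shows "sqn (\<lambda>x. V (x + (\<Sum>b\<in>S. w b)) - V x) \<le> 2 ^ card S * (\<Sum>b\<in>S. sqn (\<lambda>x. V (x + w b) - V x))"
  using assms(2)
proof (induction S)
  case empty
  show ?case by (simp add: sqn_def)
next
  case (insert a S)
  let ?D = "\<lambda>v. sqn (\<lambda>x. V (x + v) - V x)"
  have "?D (\<Sum>b\<in>insert a S. w b) = ?D (w a + (\<Sum>b\<in>S. w b))" using insert by simp
  also have "\<dots> \<le> 2 * ?D (w a) + 2 * ?D (\<Sum>b\<in>S. w b)" by (rule sqn_increment_add) simp
  also have "\<dots> \<le> 2 * (2 ^ card S * ?D (w a)) + 2 * (2 ^ card S * (\<Sum>b\<in>S. ?D (w b)))"
  proof (intro add_mono mult_left_mono insert.IH)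
    show "?D (w a) \<le> 2 ^ card S * ?D (w a)"
      using mult_right_mono[of 1 "2 ^ card S :: ennreal" "?D (w a)"] by (simp add: one_le_power)
  qed auto
  also have "\<dots> = 2 ^ card (insert a S) * (\<Sum>b\<in>insert a S. ?D (w b))"
    using insert by (simp add: algebra_simps)
  finally show ?case .
qed

text \<open>Averaging this over translations \<open>v\<close> in a box turns the last integral into the square of the
  \<open>L1\<close> norm divided by the volume of the box.\<close>

lemma sqn_le_increment:
  fixes V :: "'a::euclidean_space \<Rightarrow> real"
  assumes [measurable]: "V \<in> borel_measurable borel"
  shows "2 * sqn V \<le> sqn (\<lambda>x. V (x + v) - V x) + 2 * (\<integral>\<^sup>+x. ennreal \<bar>V x\<bar> * ennreal \<bar>V (x + v)\<bar> \<partial>lborel)"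
proof -
  have "2 * sqn V = sqn (\<lambda>x. V (x + v)) + sqn V"
    by (simp add: sqn_shift mult_2)
  also have "\<dots> = (\<integral>\<^sup>+x. ennreal ((V (x + v))\<^sup>2) + ennreal ((V x)\<^sup>2) \<partial>lborel)"
    unfolding sqn_def by (rule nn_integral_add[symmetric]) auto
  also have "\<dots> \<le> (\<integral>\<^sup>+x. ennreal ((V (x + v) - V x)\<^sup>2) + 2 * (ennreal \<bar>V x\<bar> * ennreal \<bar>V (x + v)\<bar>) \<partial>lborel)"
  proof (rule nn_integral_mono)
    fix x
    have "V (x + v) * V x \<le> \<bar>V x\<bar> * \<bar>V (x + v)\<bar>"
      using abs_ge_self[of "V (x + v) * V x"] by (simp add: abs_mult mult.commute)
    then have "(V (x + v))\<^sup>2 + (V x)\<^sup>2 \<le> (V (x + v) - V x)\<^sup>2 + 2 * (\<bar>V x\<bar> * \<bar>V (x + v)\<bar>)"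
      by (simp add: power2_diff)
    then show "ennreal ((V (x + v))\<^sup>2) + ennreal ((V x)\<^sup>2)
        \<le> ennreal ((V (x + v) - V x)\<^sup>2) + 2 * (ennreal \<bar>V x\<bar> * ennreal \<bar>V (x + v)\<bar>)"
      by (simp flip: ennreal_numeral ennreal_mult ennreal_plus add: ennreal_leI)
  qed
  also have "\<dots> = sqn (\<lambda>x. V (x + v) - V x) + 2 * (\<integral>\<^sup>+x. ennreal \<bar>V x\<bar> * ennreal \<bar>V (x + v)\<bar> \<partial>lborel)"
    unfolding sqn_def by (simp add: nn_integral_add nn_integral_cmult)
  finally show ?thesis .
qed

text \<open>The integrand is a product over the coordinates, so the integral factors; only the
  factor of \<open>b\<close> contains \<open>F\<close>, every other one is the length of its
  side.\<close>

lemma nn_integral_box_coordinate: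
  fixes b :: "'a::euclidean_space" and F :: "real \<Rightarrow> ennreal"
  assumes b: "b \<in> Basis" and [measurable]: "F \<in> borel_measurable borel" and \<rho>: "\<And>c. c \<in> Basis \<Longrightarrow> \<rho> c \<ge> 0"
  shows "(\<integral>\<^sup>+v. (\<Prod>c\<in>Basis. indicator {0..\<rho> c} (v \<bullet> c)) * F (v \<bullet> b) \<partial>lborel)
    = ennreal (\<Prod>c\<in>Basis - {b}. \<rho> c) * (\<integral>\<^sup>+h. indicator {0..\<rho> b} h * F h \<partial>lborel)"
proof -
  let ?f = "\<lambda>c h. indicator {0..\<rho> c} h * (if c = b then F h else 1) :: ennreal"
  have "(\<integral>\<^sup>+v. (\<Prod>c\<in>Basis. indicator {0..\<rho> c} (v \<bullet> c)) * F (v \<bullet> b) \<partial>lborel)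
      = (\<integral>\<^sup>+v. (\<Prod>c\<in>Basis. ?f c (v \<bullet> c)) \<partial>lborel)"
  proof (rule nn_integral_cong)
    fix v :: 'a
    show "(\<Prod>c\<in>Basis. indicator {0..\<rho> c} (v \<bullet> c)) * F (v \<bullet> b) = (\<Prod>c\<in>Basis. ?f c (v \<bullet> c))"
      using b by (simp add: prod.distrib)
  qed
  also have "\<dots> = (\<Prod>c\<in>Basis. (\<integral>\<^sup>+h. ?f c h \<partial>lborel))"
    by (rule nn_integral_lborel_prod) auto
  also have "\<dots> = (\<integral>\<^sup>+h. ?f b h \<partial>lborel) * (\<Prod>c\<in>Basis - {b}. (\<integral>\<^sup>+h. ?f c h \<partial>lborel))"
    using b by (simp add: prod.remove)
  also have "(\<Prod>c\<in>Basis - {b}. (\<integral>\<^sup>+h. ?f c h \<partial>lborel)) = (\<Prod>c\<in>Basis - {b}. ennreal (\<rho> c))"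
    by (rule prod.cong) (auto simp: \<rho>)
  also have "\<dots> = ennreal (\<Prod>c\<in>Basis - {b}. \<rho> c)"
    by (rule prod_ennreal) (auto simp: \<rho>)
  finally show ?thesis by (simp add: mult.commute)
qed

text \<open>The hypothesis concerns averages along the single sides of the box, scaled so that one r
  serves all directions; the sides may therefore differ between directions of different order. The
  factor 2 ^ DIM('a) comes from \<open>sqn_increment_sum\<close>.\<close>

lemma sqn_le_box_average:
  fixes V :: "'a::euclidean_space \<Rightarrow> real"
  assumes V[measurable]: "V \<in> borel_measurable borel" and \<rho>: "\<And>c. c \<in> Basis \<Longrightarrow> \<rho> c > 0" and r: "r \<ge> 0"
    and E: "\<And>b. b \<in> Basis \<Longrightarrow>
      (\<integral>\<^sup>+h. indicator {0..\<rho> b} h * sqn (\<lambda>x. V (x + h *\<^sub>R b) - V x) \<partial>lborel) \<le> ennreal (\<rho> b * r) * E b"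
  shows "sqn V \<le> ennreal (2 ^ DIM('a) * r) * (\<Sum>b\<in>Basis. E b)
    + ennreal (1 / (\<Prod>b\<in>Basis. \<rho> b)) * (\<integral>\<^sup>+x. ennreal \<bar>V x\<bar> \<partial>lborel)\<^sup>2"
proof -
  let ?Q = "\<lambda>v. (\<Prod>c\<in>Basis. indicator {0..\<rho> c} (v \<bullet> c)) :: ennreal"
  let ?vol = "\<Prod>b\<in>Basis. \<rho> b"
  let ?D = "\<lambda>v. sqn (\<lambda>x. V (x + v) - V x)"
  let ?Y = "\<integral>\<^sup>+x. ennreal \<bar>V x\<bar> \<partial>lborel"
  let ?P = "\<lambda>v. \<integral>\<^sup>+x. ennreal \<bar>V x\<bar> * ennreal \<bar>V (x + v)\<bar> \<partial>lborel"
  have vol: "?vol > 0" using \<rho> by (rule prod_pos)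
  have [measurable]: "(\<lambda>v. ?D (k v)) \<in> borel_measurable M" if [measurable]: "k \<in> borel_measurable M" for k :: "'c \<Rightarrow> 'a" and M
    unfolding sqn_def by measurable
  have [measurable]: "?P \<in> borel_measurable borel" by measurable
  have [measurable]: "?Q \<in> borel_measurable borel" by measurable
  have Q: "(\<integral>\<^sup>+v. ?Q v \<partial>lborel) = ennreal ?vol"
    by (subst nn_integral_lborel_prod) (auto simp: prod_ennreal less_imp_le[OF \<rho>])
  have "ennreal ?vol * (2 * sqn V) = (\<integral>\<^sup>+v. ?Q v * (2 * sqn V) \<partial>lborel)"
    by (subst nn_integral_multc) (simp_all add: Q)
  also have "\<dots> \<le> (\<integral>\<^sup>+v. ?Q v * ?D v + 2 * ?P v \<partial>lborel)"
  proof (rule nn_integral_mono)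
    fix v :: 'a
    have "?Q v * (2 * sqn V) \<le> ?Q v * (?D v + 2 * ?P v)"
      by (intro mult_left_mono sqn_le_increment) auto
    also have "\<dots> = ?Q v * ?D v + ?Q v * (2 * ?P v)" by (simp add: distrib_left)
    \<comment> \<open>Only this term gives up the box indicator: its integral over all v is, by
      Fubini, exactly the square of the L1 norm.\<close>
    also have "?Q v * (2 * ?P v) \<le> 1 * (2 * ?P v)"
      by (intro mult_right_mono prod_le_1) (auto simp: indicator_def)
    finally show "?Q v * (2 * sqn V) \<le> ?Q v * ?D v + 2 * ?P v" by (simp add: add_left_mono)
  qed
  also have "\<dots> = (\<integral>\<^sup>+v. ?Q v * ?D v \<partial>lborel) + 2 * (\<integral>\<^sup>+v. ?P v \<partial>lborel)"
    by (simp add: nn_integral_add nn_integral_cmult)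
  also have "(\<integral>\<^sup>+v. ?P v \<partial>lborel) = ?Y\<^sup>2"
  proof -
    have "(\<integral>\<^sup>+v. ?P v \<partial>lborel) = (\<integral>\<^sup>+x. (\<integral>\<^sup>+v. ennreal \<bar>V x\<bar> * ennreal \<bar>V (x + v)\<bar> \<partial>lborel) \<partial>lborel)"
      by (rule lborel_pair.Fubini') measurable
    also have "\<dots> = (\<integral>\<^sup>+x. ennreal \<bar>V x\<bar> * ?Y \<partial>lborel)"
    proof (rule nn_integral_cong)
      fix x
      have "(\<integral>\<^sup>+v. ennreal \<bar>V (x + v)\<bar> \<partial>lborel) = ?Y"
        using nn_integral_lborel_shift[of "\<lambda>v. ennreal \<bar>V v\<bar>" x] by (simp add: add.commute)
      then show "(\<integral>\<^sup>+v. ennreal \<bar>V x\<bar> * ennreal \<bar>V (x + v)\<bar> \<partial>lborel) = ennreal \<bar>V x\<bar> * ?Y"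
        by (simp add: nn_integral_cmult)
    qed
    also have "\<dots> = ?Y\<^sup>2" by (simp add: nn_integral_multc power2_eq_square)
    finally show ?thesis .
  qed
  also have "(\<integral>\<^sup>+v. ?Q v * ?D v \<partial>lborel) \<le> ennreal (?vol * (2 ^ DIM('a) * r)) * (\<Sum>b\<in>Basis. E b)"
  proof -
    have "(\<integral>\<^sup>+v. ?Q v * ?D v \<partial>lborel)
        \<le> (\<integral>\<^sup>+v. (\<Sum>b\<in>Basis. 2 ^ DIM('a) * (?Q v * ?D ((v \<bullet> b) *\<^sub>R b))) \<partial>lborel)"
    proof (rule nn_integral_mono)
      fix v :: 'a
      have "?D v \<le> 2 ^ DIM('a) * (\<Sum>b\<in>Basis. ?D ((v \<bullet> b) *\<^sub>R b))"
        using sqn_increment_sum[OF V, of "Basis" "\<lambda>b. (v \<bullet> b) *\<^sub>R b"] by (simp add: euclidean_representation)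
      then have "?Q v * ?D v \<le> ?Q v * (2 ^ DIM('a) * (\<Sum>b\<in>Basis. ?D ((v \<bullet> b) *\<^sub>R b)))"
        by (rule mult_left_mono) simp
      then show "?Q v * ?D v \<le> (\<Sum>b\<in>Basis. 2 ^ DIM('a) * (?Q v * ?D ((v \<bullet> b) *\<^sub>R b)))"
        by (simp add: sum_distrib_left mult_ac)
    qed
    also have "\<dots> = (\<Sum>b\<in>Basis. 2 ^ DIM('a) * (\<integral>\<^sup>+v. ?Q v * ?D ((v \<bullet> b) *\<^sub>R b) \<partial>lborel))"
      by (subst nn_integral_sum) (auto simp: nn_integral_cmult)
    also have "\<dots> \<le> (\<Sum>b\<in>Basis. 2 ^ DIM('a) * (ennreal (?vol * r) * E b))"
    proof (intro sum_mono mult_left_mono)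
      fix b :: 'a assume b: "b \<in> Basis"
      have "(\<integral>\<^sup>+v. ?Q v * ?D ((v \<bullet> b) *\<^sub>R b) \<partial>lborel)
          = ennreal (\<Prod>c\<in>Basis - {b}. \<rho> c) * (\<integral>\<^sup>+h. indicator {0..\<rho> b} h * ?D (h *\<^sub>R b) \<partial>lborel)"
        by (rule nn_integral_box_coordinate[OF b]) (use \<rho> in \<open>auto intro: less_imp_le\<close>)
      also have "\<dots> \<le> ennreal (\<Prod>c\<in>Basis - {b}. \<rho> c) * (ennreal (\<rho> b * r) * E b)"
        by (intro mult_left_mono E b) auto
      also have "\<dots> = ennreal ((\<Prod>c\<in>Basis - {b}. \<rho> c) * (\<rho> b * r)) * E b"
      proof -
        have P: "0 \<le> (\<Prod>c\<in>Basis - {b}. \<rho> c)" by (rule prod_nonneg) (auto intro: less_imp_le[OF \<rho>])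
        have Q: "0 \<le> \<rho> b * r" using \<rho>[OF b] r by simp
        show ?thesis by (simp only: ennreal_mult[OF P Q] mult.assoc)
      qed
      also have "(\<Prod>c\<in>Basis - {b}. \<rho> c) * (\<rho> b * r) = ?vol * r"
        using b by (simp add: prod.remove[of Basis b])
      finally show "(\<integral>\<^sup>+v. ?Q v * ?D ((v \<bullet> b) *\<^sub>R b) \<partial>lborel) \<le> ennreal (?vol * r) * E b" .
    qed auto
    also have "\<dots> = 2 ^ DIM('a) * ennreal (?vol * r) * (\<Sum>b\<in>Basis. E b)"
      by (simp add: sum_distrib_left mult.assoc)
    also have "2 ^ DIM('a) * ennreal (?vol * r) = ennreal (?vol * (2 ^ DIM('a) * r))"
      using vol r by (simp add: ennreal_mult ennreal_power flip: ennreal_numeral) (simp add: mult_ac)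
    finally show ?thesis .
  qed
  finally have *: "ennreal ?vol * (2 * sqn V) \<le> ennreal (?vol * (2 ^ DIM('a) * r)) * (\<Sum>b\<in>Basis. E b) + 2 * ?Y\<^sup>2"
    by simp
  have "sqn V = ennreal (1 / (2 * ?vol)) * (ennreal ?vol * (2 * sqn V))"
  proof -
    have "X = ennreal (1 / (2 * v)) * (ennreal v * (2 * X))" if "v > 0" for v X
    proof -
      have "ennreal (1 / (2 * v)) * (ennreal v * (2 * X)) = ennreal (1 / (2 * v) * v * 2) * X"
        using that by (simp only: ennreal_mult ennreal_numeral mult.assoc zero_le_divide_iff
            mult_nonneg_nonneg less_imp_le zero_le_numeral zero_le_one simp_thms)
      then show ?thesis using that by simp
    qed
    then show ?thesis using vol by blast
  qed
  also have "\<dots> \<le> ennreal (1 / (2 * ?vol)) * (ennreal (?vol * (2 ^ DIM('a) * r)) * (\<Sum>b\<in>Basis. E b) + 2 * ?Y\<^sup>2)"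
    by (rule mult_left_mono[OF *]) simp
  also have "\<dots> = ennreal (2 ^ DIM('a) * r / 2) * (\<Sum>b\<in>Basis. E b) + ennreal (1 / ?vol) * ?Y\<^sup>2"
  proof -
    have "ennreal (1 / (2 * v)) * (ennreal (v * q) * X + 2 * Y) = ennreal (q / 2) * X + ennreal (1 / v) * Y"
      if "v > 0" "q \<ge> 0" for v q X Y
    proof -
      have "ennreal (1 / (2 * v)) * ennreal (v * q) = ennreal (q / 2)" "ennreal (1 / (2 * v)) * 2 = ennreal (1 / v)"
        using that by (simp_all flip: ennreal_numeral ennreal_mult)
      then show ?thesis by (simp only: distrib_left mult.assoc[symmetric])
    qed
    then show ?thesis using vol r by simp
  qed
  also have "\<dots> \<le> ennreal (2 ^ DIM('a) * r) * (\<Sum>b\<in>Basis. E b) + ennreal (1 / ?vol) * ?Y\<^sup>2"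
    using r by (intro add_mono mult_right_mono ennreal_leI) auto
  finally show ?thesis .
qed

lemma ejump_Basis: "ejump i \<in> Basis" and ediff_Basis: "ediff j \<in> Basis"
  by (auto simp: ejump_def ediff_def Basis_prod_def axis_in_Basis_iff)

lemma inj_ejump: "inj ejump" and inj_ediff: "inj ediff"
  by (auto simp: inj_def ejump_def ediff_def axis_eq_axis)

lemma ejump_neq_ediff [simp]: "ejump i \<noteq> ediff j" "ediff j \<noteq> ejump i"
  by (simp_all add: ejump_def ediff_def axis_eq_0_iff)

lemma Basis_pt: "(Basis :: ('d::finite, 'n::finite) pt set) = range ejump \<union> range ediff"
  by (auto simp: Basis_prod_def Basis_vec_def ejump_def ediff_def)

lemma sum_Basis_pt: "(\<Sum>b\<in>Basis. f b) = (\<Sum>i\<in>UNIV. f (ejump i)) + (\<Sum>j\<in>UNIV. f (ediff j))"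
  unfolding Basis_pt
  by (subst sum.union_disjoint) (auto simp: sum.reindex inj_ejump inj_ediff)

lemma prod_Basis_pt: "(\<Prod>b\<in>Basis. f b) = (\<Prod>i\<in>UNIV. f (ejump i)) * (\<Prod>j\<in>UNIV. f (ediff j))"
  unfolding Basis_pt
  by (subst prod.union_disjoint) (auto simp: prod.reindex inj_ejump inj_ediff)

text \<open>Written with the model kernel, so that the Nash inequality can be proved before
  \<open>J\<close> enters; the passage to \<open>J\<close> later costs a factor \<kappa>.\<close>

definition jump_energy :: "real \<Rightarrow> (('d::finite, 'n::finite) pt \<Rightarrow> real) \<Rightarrow> 'd \<Rightarrow> ennreal" where
  "jump_energy \<alpha> u i = (\<integral>\<^sup>+x. (\<integral>\<^sup>+h. ennreal ((u (x + h *\<^sub>R ejump i) - u x)\<^sup>2 * \<bar>h\<bar> powr (-1 - \<alpha>)) \<partial>lborel) \<partial>lborel)"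

text \<open>The box has sides \<open>r powr (1 / \<alpha>)\<close> in the jump directions and \<open>r powr (1 / 2)\<close> in the diffusive ones.\<close>

lemma Nash_inequality:
  fixes V :: "('d::finite, 'n::finite) pt \<Rightarrow> real"
  assumes \<alpha>: "\<alpha> > 0" and r: "r > 0" and g: "\<And>j. strong_deriv V (ediff j) (g j)"
  shows "sqn V \<le> ennreal (2 ^ (CARD('d) + CARD('n)) * r) * ((\<Sum>i\<in>UNIV. jump_energy \<alpha> V i) + (\<Sum>j\<in>UNIV. sqn (g j)))
     + ennreal (r powr (- (real CARD('d) / \<alpha> + real CARD('n) / 2))) * (\<integral>\<^sup>+x. ennreal \<bar>V x\<bar> \<partial>lborel)\<^sup>2"
proof -
  have V[measurable]: "V \<in> borel_measurable borel" using g by (auto simp: strong_deriv_def L2_def)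
  define \<rho> where "\<rho> b = (if b \<in> range ejump then r powr (1 / \<alpha>) else r powr (1 / 2))" for b :: "('d, 'n) pt"
  define E where "E b = (if b \<in> range ejump then jump_energy \<alpha> V (the_inv ejump b) else sqn (g (the_inv ediff b)))" for b
  have \<rho>j: "\<rho> (ejump i) = r powr (1 / \<alpha>)" "E (ejump i) = jump_energy \<alpha> V i" for i
    by (auto simp: \<rho>_def E_def the_inv_f_f[OF inj_ejump])
  have nr: "ediff j \<notin> range ejump" for j by auto
  have \<rho>d: "\<rho> (ediff j) = r powr (1 / 2)" "E (ediff j) = sqn (g j)" for j
    using nr by (auto simp: \<rho>_def E_def the_inv_f_f[OF inj_ediff])
  have "(\<integral>\<^sup>+h. indicator {0..\<rho> b} h * sqn (\<lambda>x. V (x + h *\<^sub>R b) - V x) \<partial>lborel) \<le> ennreal (\<rho> b * r) * E b"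
    if b: "b \<in> Basis" for b
  proof -
    from b consider i where "b = ejump i" | j where "b = ediff j" unfolding Basis_pt by auto
    then show ?thesis
    proof cases
      case 1
      let ?R = "r powr (1 / \<alpha>)"
      have R0: "?R > 0" using r by simp
      \<comment> \<open>For 0 < h \<le> ?R this gives 1 \<le> ?R * r * h powr (-1 - \<alpha>):
        inserting the kernel into the average costs exactly the side times r that
        \<open>sqn_le_box_average\<close> allows.\<close>
      have Rr: "?R powr (1 + \<alpha>) = ?R * r" using \<alpha> r by (simp add: powr_add powr_powr)
      let ?J = "\<lambda>h. \<integral>\<^sup>+x. ennreal ((V (x + h *\<^sub>R ejump i) - V x)\<^sup>2 * \<bar>h\<bar> powr (-1 - \<alpha>)) \<partial>lborel"
      have "(\<integral>\<^sup>+h. indicator {0..?R} h * sqn (\<lambda>x. V (x + h *\<^sub>R ejump i) - V x) \<partial>lborel)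
          \<le> (\<integral>\<^sup>+h. ennreal (?R * r) * ?J h \<partial>lborel)"
      proof (rule nn_integral_mono)
        fix h :: real
        show "indicator {0..?R} h * sqn (\<lambda>x. V (x + h *\<^sub>R ejump i) - V x) \<le> ennreal (?R * r) * ?J h"
        proof (cases "0 < h \<and> h \<le> ?R")
          case True
          have "1 = h powr (1 + \<alpha>) * h powr (-1 - \<alpha>)" using True by (simp flip: powr_add)
          also have "\<dots> \<le> ?R powr (1 + \<alpha>) * h powr (-1 - \<alpha>)"
            using True \<alpha> by (intro mult_right_mono powr_mono2) auto
          finally have 1: "1 \<le> ?R * r * \<bar>h\<bar> powr (-1 - \<alpha>)" using True by (simp add: Rr)
          have "sqn (\<lambda>x. V (x + h *\<^sub>R ejump i) - V x)
             \<le> (\<integral>\<^sup>+x. ennreal (?R * r) * ennreal ((V (x + h *\<^sub>R ejump i) - V x)\<^sup>2 * \<bar>h\<bar> powr (-1 - \<alpha>)) \<partial>lborel)"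
            unfolding sqn_def
          proof (rule nn_integral_mono)
            fix x
            show "ennreal ((V (x + h *\<^sub>R ejump i) - V x)\<^sup>2) \<le> ennreal (?R * r) * ennreal ((V (x + h *\<^sub>R ejump i) - V x)\<^sup>2 * \<bar>h\<bar> powr (-1 - \<alpha>))"
              using mult_left_mono[OF 1, of "(V (x + h *\<^sub>R ejump i) - V x)\<^sup>2"] r
              by (simp add: mult_ac ennreal_leI flip: ennreal_mult)
          qed
          also have "\<dots> = ennreal (?R * r) * ?J h" by (rule nn_integral_cmult) measurable
          finally show ?thesis using True by (simp add: indicator_def)
        next
          case False
          then show ?thesis by (cases "h = 0") (auto simp: indicator_def sqn_def)
        qed
      qed
      also have "\<dots> = ennreal (?R * r) * (\<integral>\<^sup>+h. ?J h \<partial>lborel)" by (rule nn_integral_cmult) measurable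
      also have "(\<integral>\<^sup>+h. ?J h \<partial>lborel) = jump_energy \<alpha> V i"
        unfolding jump_energy_def by (rule lborel_pair.Fubini') measurable
      finally show ?thesis unfolding 1 \<rho>j .
    next
      case 2
      let ?R = "r powr (1 / 2)"
      have Rr: "?R\<^sup>2 = r" using r by (simp add: powr_half_sqrt)
      have "(\<integral>\<^sup>+h. indicator {0..?R} h * sqn (\<lambda>x. V (x + h *\<^sub>R ediff j) - V x) \<partial>lborel)
          \<le> (\<integral>\<^sup>+h. indicator {0..?R} h * (ennreal r * sqn (g j)) \<partial>lborel)"
      proof (rule nn_integral_mono)
        fix h :: real
        have "sqn (\<lambda>x. V (x + h *\<^sub>R ediff j) - V x) \<le> ennreal r * sqn (g j)" if "0 \<le> h" "h \<le> ?R"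
        proof -
          have "h\<^sup>2 \<le> r" using power_mono[OF that(2,1), of 2] Rr by simp
          then show ?thesis
            by (intro order_trans[OF strong_deriv_increment_le[OF g]] mult_right_mono ennreal_leI) auto
        qed
        then show "indicator {0..?R} h * sqn (\<lambda>x. V (x + h *\<^sub>R ediff j) - V x) \<le> indicator {0..?R} h * (ennreal r * sqn (g j))"
          by (auto simp: indicator_def)
      qed
      also have "\<dots> = ennreal (?R * r) * sqn (g j)"
        using r by (subst nn_integral_multc) (auto simp: ennreal_mult mult.assoc)
      finally show ?thesis unfolding 2 \<rho>d .
    qed
  qed
  from sqn_le_box_average[OF V _ less_imp_le[OF r] this]
  have "sqn V \<le> ennreal (2 ^ DIM(('d, 'n) pt) * r) * (\<Sum>b\<in>Basis. E b) + ennreal (1 / (\<Prod>b\<in>Basis. \<rho> b)) * (\<integral>\<^sup>+x. ennreal \<bar>V x\<bar> \<partial>lborel)\<^sup>2"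
    using r by (auto simp: \<rho>_def)
  moreover have "(\<Sum>b\<in>Basis. E b) = (\<Sum>i\<in>UNIV. jump_energy \<alpha> V i) + (\<Sum>j\<in>UNIV. sqn (g j))"
    by (simp add: sum_Basis_pt \<rho>j \<rho>d)
  moreover have "1 / (\<Prod>b\<in>Basis. \<rho> b) = r powr (- (real CARD('d) / \<alpha> + real CARD('n) / 2))"
  proof -
    have "(\<Prod>b\<in>Basis. \<rho> b) = r powr (real CARD('d) / \<alpha>) * r powr (real CARD('n) / 2)"
      using r by (simp add: prod_Basis_pt \<rho>j \<rho>d powr_powr flip: powr_realpow)
    also have "\<dots> = r powr (real CARD('d) / \<alpha> + real CARD('n) / 2)" by (simp add: powr_add)
    finally show ?thesis by (simp only: powr_minus_divide)
  qed
  ultimately show ?thesis by simp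
qed

section \<open>The Dirichlet form\<close>

text \<open>Split at |h| = R. Below R the integrand is |h|^(1-\<alpha>) / R^2, integrable at 0 since
  \<alpha> < 2; above R it is |h|^(-1-\<alpha>), integrable at infinity since \<alpha> > 0. These
  give 1 / (2 - \<alpha>) and 1 / \<alpha>, and the reflection h \<mapsto> - h gives the factor
  2.\<close>

lemma min_square_powr_integral_le:
  fixes \<alpha> R :: real
  assumes \<alpha>: "0 < \<alpha>" "\<alpha> < 2" and R: "R > 0"
  shows "(\<integral>\<^sup>+h. ennreal (min 1 ((h / R)\<^sup>2) * \<bar>h\<bar> powr (-1 - \<alpha>)) \<partial>lborel)
     \<le> ennreal (2 * (1 / (2 - \<alpha>) + 1 / \<alpha>) * R powr (- \<alpha>))"
proof -
  let ?f = "\<lambda>h. ennreal (min 1 ((h / R)\<^sup>2) * \<bar>h\<bar> powr (-1 - \<alpha>))"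
  let ?a = "\<lambda>h. ennreal (if h \<in> {0..R} then h powr (1 - \<alpha>) / R\<^sup>2 else 0)"
  let ?b = "\<lambda>h. ennreal (if h \<in> {R..} then h powr (-1 - \<alpha>) else 0)"
  let ?c = "1 / (2 - \<alpha>) * R powr (- \<alpha>)" and ?d = "1 / \<alpha> * R powr (- \<alpha>)"
  have a: "(\<integral>\<^sup>+h. ?a h \<partial>lborel) = ennreal ?c"
  proof (rule nn_integral_has_integral_lborel)
    have "((\<lambda>h. h powr (1 - \<alpha>)) has_integral (R powr (1 - \<alpha> + 1) / (1 - \<alpha> + 1))) {0..R}"
      by (rule has_integral_powr_from_0) (use \<alpha> R in auto)
    from has_integral_divide[OF this, of "R\<^sup>2"]
    have "((\<lambda>h. h powr (1 - \<alpha>) / R\<^sup>2) has_integral (R powr (1 - \<alpha> + 1) / (1 - \<alpha> + 1) / R\<^sup>2)) {0..R}" .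
    also have "R powr (1 - \<alpha> + 1) / (1 - \<alpha> + 1) / R\<^sup>2 = ?c"
    proof -
      have "R powr (2 - \<alpha>) = R\<^sup>2 * R powr (- \<alpha>)"
        using R powr_add[of R 2 "- \<alpha>"] by simp
      then show ?thesis using \<alpha> R by (simp add: field_simps)
    qed
    finally show "((\<lambda>h. if h \<in> {0..R} then h powr (1 - \<alpha>) / R\<^sup>2 else 0) has_integral ?c) UNIV"
      by (simp only: has_integral_restrict_UNIV)
  qed auto
  have b: "(\<integral>\<^sup>+h. ?b h \<partial>lborel) = ennreal ?d"
  proof (rule nn_integral_has_integral_lborel)
    have "((\<lambda>h. h powr (-1 - \<alpha>)) has_integral (- (R powr (-1 - \<alpha> + 1)) / (-1 - \<alpha> + 1))) {R..}"
      by (rule has_integral_powr_to_inf) (use \<alpha> R in auto)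
    also have "- (R powr (-1 - \<alpha> + 1)) / (-1 - \<alpha> + 1) = ?d" using \<alpha> by simp
    finally show "((\<lambda>h. if h \<in> {R..} then h powr (-1 - \<alpha>) else 0) has_integral ?d) UNIV"
      by (simp only: has_integral_restrict_UNIV)
  qed auto
  have half: "(\<integral>\<^sup>+h. indicator {0..} h * ?f h \<partial>lborel) \<le> ennreal (?c + ?d)"
  proof -
    have "(\<integral>\<^sup>+h. indicator {0..} h * ?f h \<partial>lborel) \<le> (\<integral>\<^sup>+h. ?a h + ?b h \<partial>lborel)"
    proof (rule nn_integral_mono)
      fix h :: real
      consider "h < 0" | "h = 0" | "0 < h" "h \<le> R" | "h > R" by linarith
      then show "indicator {0..} h * ?f h \<le> ?a h + ?b h"
      proof cases
        case 3
        have "(h / R)\<^sup>2 * h powr (-1 - \<alpha>) = h powr (1 - \<alpha>) / R\<^sup>2"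
          using 3 powr_add[of h 2 "-1 - \<alpha>"] by (simp add: power_divide)
        moreover have "min 1 ((h / R)\<^sup>2) * h powr (-1 - \<alpha>) \<le> (h / R)\<^sup>2 * h powr (-1 - \<alpha>)"
          by (intro mult_right_mono) auto
        ultimately have "?f h \<le> ?a h" using 3 by (simp add: ennreal_leI)
        then show ?thesis using 3 by (simp add: add_increasing2)
      next
        case 4
        have "min 1 ((h / R)\<^sup>2) * h powr (-1 - \<alpha>) \<le> 1 * h powr (-1 - \<alpha>)"
          by (intro mult_right_mono) auto
        then have "?f h \<le> ?b h" using 4 R by (simp add: ennreal_leI)
        then show ?thesis using 4 R by (simp add: add_increasing)
      qed auto
    qed
    also have "\<dots> = (\<integral>\<^sup>+h. ?a h \<partial>lborel) + (\<integral>\<^sup>+h. ?b h \<partial>lborel)" by (rule nn_integral_add) measurable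
    also have "\<dots> = ennreal ?c + ennreal ?d" by (simp only: a b)
    also have "\<dots> = ennreal (?c + ?d)" using \<alpha> by (simp flip: ennreal_plus)
    finally show ?thesis .
  qed
  have "(\<integral>\<^sup>+h. ?f h \<partial>lborel) \<le> (\<integral>\<^sup>+h. indicator {0..} h * ?f h + indicator {0..} (- h) * ?f (- h) \<partial>lborel)"
    by (rule nn_integral_mono) (auto simp: indicator_def)
  also have "\<dots> = (\<integral>\<^sup>+h. indicator {0..} h * ?f h \<partial>lborel) + (\<integral>\<^sup>+h. indicator {0..} (- h) * ?f (- h) \<partial>lborel)"
    by (rule nn_integral_add) measurable
  also have "(\<integral>\<^sup>+h. indicator {0..} (- h) * ?f (- h) \<partial>lborel) = (\<integral>\<^sup>+h. indicator {0..} h * ?f h \<partial>lborel)"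
    using nn_integral_real_affine[of "\<lambda>h. indicator {0..} h * ?f h" "-1" 0] by simp
  also have "(\<integral>\<^sup>+h. indicator {0..} h * ?f h \<partial>lborel) + (\<integral>\<^sup>+h. indicator {0..} h * ?f h \<partial>lborel)
      \<le> ennreal (?c + ?d) + ennreal (?c + ?d)" by (intro add_mono half)
  also have "\<dots> = ennreal (2 * (1 / (2 - \<alpha>) + 1 / \<alpha>) * R powr (- \<alpha>))"
    using \<alpha> by (subst ennreal_plus[symmetric]) (auto simp: algebra_simps)
  finally show ?thesis .
qed

text \<open>Distinct axes meet only in 0, so the summand k = i alone survives. At h = 0 both sides
  vanish because \<open>0 powr s = 0\<close>.\<close>

lemma Jmodel_jump:
  fixes x :: "('d::finite, 'n::finite) pt"
  shows "Jmodel \<alpha> x (x + h *\<^sub>R ejump i) = \<bar>h\<bar> powr (-1 - \<alpha>)"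
proof (cases "h = 0")
  case True
  then show ?thesis by (auto simp: Jmodel_def intro!: sum.neutral)
next
  case False
  have *: "(\<exists>a. a \<noteq> 0 \<and> (x + h *\<^sub>R ejump i) - x = a *\<^sub>R ejump k) \<longleftrightarrow> k = i" for k
  proof
    assume "\<exists>a. a \<noteq> 0 \<and> (x + h *\<^sub>R ejump i) - x = a *\<^sub>R ejump k"
    then obtain a where "h *\<^sub>R axis i 1 = a *\<^sub>R (axis k 1 :: real^'d)" by (auto simp: ejump_def)
    then have "(h *\<^sub>R axis i 1) $ i = (a *\<^sub>R (axis k 1 :: real^'d)) $ i" by simp
    then show "k = i" using False by (auto simp: axis_def split: if_splits)
  qed (use False in auto)
  have "Jmodel \<alpha> x (x + h *\<^sub>R ejump i) = (\<Sum>k\<in>UNIV. if k = i then \<bar>fst x $ k - fst (x + h *\<^sub>R ejump i) $ k\<bar> powr (-1 - \<alpha>) else 0)"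
    unfolding Jmodel_def * ..
  then show ?thesis by (simp add: ejump_def)
qed

section \<open>The form and its domain under the standing assumptions\<close>

locale dirichlet_setting =
  fixes \<alpha> \<kappa> :: real
    and J :: "('d::finite, 'n::finite) pt \<Rightarrow> ('d, 'n) pt \<Rightarrow> real"
    and a :: "('d, 'n) pt \<Rightarrow> ('d, 'n) pt \<Rightarrow> ('d, 'n) pt \<Rightarrow> real"
  assumes alpha: "0 < \<alpha>" "\<alpha> < 2"
    and kappa: "1 \<le> \<kappa>"
    and J_meas: "(\<lambda>(x, y). J x y) \<in> borel_measurable borel"
    and J_sym: "\<And>x y. J x y = J y x"
    and J_bounds: "\<And>x y. Jmodel \<alpha> x y / \<kappa> \<le> J x y \<and> J x y \<le> \<kappa> * Jmodel \<alpha> x y"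
    and a_meas: "\<And>b1 b2. (\<lambda>x. a x b1 b2) \<in> borel_measurable borel"
    and a_sym: "AE x in lborel. \<forall>b1\<in>Basis. \<forall>b2\<in>Basis. a x b1 b2 = a x b2 b1"
    and a_ellip: "\<And>x \<xi>. (norm (snd \<xi>))\<^sup>2 / \<kappa> \<le> (\<Sum>b1\<in>Basis. \<Sum>b2\<in>Basis. a x b1 b2 * (\<xi> \<bullet> b1) * (\<xi> \<bullet> b2))
                      \<and> (\<Sum>b1\<in>Basis. \<Sum>b2\<in>Basis. a x b1 b2 * (\<xi> \<bullet> b1) * (\<xi> \<bullet> b2)) \<le> \<kappa> * (norm (snd \<xi>))\<^sup>2"
begin

text \<open>The coefficient form on the diffusive block. Vectors are functions of the index, so that
  weak gradients can be inserted pointwise and rewritten by \<open>Aq_bilinear\<close>.\<close>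

definition Aq :: "('d, 'n) pt \<Rightarrow> ('n \<Rightarrow> real) \<Rightarrow> ('n \<Rightarrow> real) \<Rightarrow> real" where
  "Aq x X Y = (\<Sum>i\<in>UNIV. \<Sum>j\<in>UNIV. a x (ediff i) (ediff j) * X i * Y j)"

lemma Aq_ellip: "(\<Sum>j\<in>UNIV. (X j)\<^sup>2) / \<kappa> \<le> Aq x X X" "Aq x X X \<le> \<kappa> * (\<Sum>j\<in>UNIV. (X j)\<^sup>2)"
proof -
  let ?\<xi> = "(0, vec_lambda X) :: ('d, 'n) pt"
  have 1: "?\<xi> \<bullet> ejump i = 0" for i by (simp add: ejump_def)
  have 2: "?\<xi> \<bullet> ediff j = X j" for j by (simp add: ediff_def inner_axis)
  have 3: "(norm (snd ?\<xi>))\<^sup>2 = (\<Sum>j\<in>UNIV. (X j)\<^sup>2)"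
    by (simp add: norm_vec_def L2_set_def sum_nonneg)
  have "(\<Sum>b1\<in>Basis. \<Sum>b2\<in>Basis. a x b1 b2 * (?\<xi> \<bullet> b1) * (?\<xi> \<bullet> b2)) = Aq x X X"
    by (simp add: sum_Basis_pt 1 2 Aq_def)
  then show "(\<Sum>j\<in>UNIV. (X j)\<^sup>2) / \<kappa> \<le> Aq x X X" "Aq x X X \<le> \<kappa> * (\<Sum>j\<in>UNIV. (X j)\<^sup>2)"
    using a_ellip[of ?\<xi> x] unfolding 3 by simp_all
qed

lemma Aq_nonneg: "0 \<le> Aq x X X"
  using Aq_ellip(1)[of X x] kappa by (smt (verit) divide_nonneg_nonneg sum_nonneg zero_le_power2)

lemma Aq_sym: "AE x in lborel. \<forall>X Y. Aq x X Y = Aq x Y X"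
  using a_sym
proof eventually_elim
  case (elim x)
  show ?case
  proof (intro allI)
    fix X Y
    have "Aq x X Y = (\<Sum>j\<in>UNIV. \<Sum>i\<in>UNIV. a x (ediff i) (ediff j) * X i * Y j)"
      unfolding Aq_def by (rule sum.swap)
    also have "\<dots> = Aq x Y X"
      unfolding Aq_def using elim by (intro sum.cong refl) (simp add: ediff_Basis mult_ac)
    finally show "Aq x X Y = Aq x Y X" .
  qed
qed

lemma Aq_bilinear:
  "Aq x (\<lambda>j. X j + Y j) Z = Aq x X Z + Aq x Y Z" "Aq x Z (\<lambda>j. X j + Y j) = Aq x Z X + Aq x Z Y"
  "Aq x (\<lambda>j. c * X j) Z = c * Aq x X Z" "Aq x Z (\<lambda>j. c * X j) = c * Aq x Z X"
  unfolding Aq_def by (simp_all add: algebra_simps sum.distrib sum_distrib_left)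

lemma Aq_measurable [measurable]:
  assumes [measurable]: "\<And>j. X j \<in> borel_measurable borel" "\<And>j. Y j \<in> borel_measurable borel"
  shows "(\<lambda>x. Aq x (\<lambda>j. X j x) (\<lambda>j. Y j x)) \<in> borel_measurable borel"
proof -
  note [measurable] = a_meas
  show ?thesis unfolding Aq_def by measurable
qed

lemma J_jump_ge: "\<bar>h\<bar> powr (-1 - \<alpha>) \<le> \<kappa> * J x (x + h *\<^sub>R ejump i)"
  and J_jump_le: "J x (x + h *\<^sub>R ejump i) \<le> \<kappa> * \<bar>h\<bar> powr (-1 - \<alpha>)"
  using J_bounds[of x "x + h *\<^sub>R ejump i"] kappa by (auto simp: Jmodel_jump field_simps)

lemma J_jump_nonneg: "0 \<le> J x (x + h *\<^sub>R ejump i)"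
  using J_jump_ge[of h x i] kappa powr_ge_zero[of "\<bar>h\<bar>" "-1 - \<alpha>"]
  by (smt (verit) zero_le_mult_iff)

lemma J_jump_measurable [measurable]:
  "(\<lambda>(x, h). J x (x + h *\<^sub>R ejump i)) \<in> borel_measurable (borel \<Otimes>\<^sub>M borel)"
proof -
  have "(\<lambda>(x, y). J x y) \<in> borel_measurable (borel \<Otimes>\<^sub>M borel)"
    using J_meas by (simp add: borel_prod)
  then have "(\<lambda>z. (\<lambda>(x, y). J x y) (fst z, fst z + snd z *\<^sub>R ejump i)) \<in> borel_measurable (borel \<Otimes>\<^sub>M borel)"
    by (rule measurable_compose[rotated]) measurable
  then show ?thesis by (simp add: case_prod_beta')
qed

lemma jump_energy_eq_pair:
  fixes u :: "('d, 'n) pt \<Rightarrow> real"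
  assumes [measurable]: "u \<in> borel_measurable borel"
  shows "jump_energy \<alpha> u i = (\<integral>\<^sup>+(x, h). ennreal ((u (x + h *\<^sub>R ejump i) - u x)\<^sup>2 * \<bar>h\<bar> powr (-1 - \<alpha>)) \<partial>(lborel \<Otimes>\<^sub>M lborel))"
  unfolding jump_energy_def by (subst lborel.nn_integral_fst[symmetric]) (auto simp: case_prod_beta')

lemma energy_ge_jump_energy:
  fixes u :: "('d, 'n) pt \<Rightarrow> real"
  assumes [measurable]: "u \<in> borel_measurable borel"
  shows "jump_energy \<alpha> u i \<le> ennreal \<kappa> * energy J a u"
proof -
  let ?S = "\<integral>\<^sup>+x. (\<Sum>i\<in>UNIV. \<integral>\<^sup>+h. ennreal ((u (x + h *\<^sub>R ejump i) - u x)\<^sup>2 * J x (x + h *\<^sub>R ejump i)) \<partial>lborel) \<partial>lborel"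
  have "jump_energy \<alpha> u i \<le> (\<integral>\<^sup>+x. ennreal \<kappa> * (\<Sum>i\<in>UNIV. \<integral>\<^sup>+h. ennreal ((u (x + h *\<^sub>R ejump i) - u x)\<^sup>2 * J x (x + h *\<^sub>R ejump i)) \<partial>lborel) \<partial>lborel)"
    unfolding jump_energy_def
  proof (rule nn_integral_mono)
    fix x
    have "(\<integral>\<^sup>+h. ennreal ((u (x + h *\<^sub>R ejump i) - u x)\<^sup>2 * \<bar>h\<bar> powr (-1 - \<alpha>)) \<partial>lborel)
        \<le> (\<integral>\<^sup>+h. ennreal \<kappa> * ennreal ((u (x + h *\<^sub>R ejump i) - u x)\<^sup>2 * J x (x + h *\<^sub>R ejump i)) \<partial>lborel)"
    proof (rule nn_integral_mono)
      fix h
      have "(u (x + h *\<^sub>R ejump i) - u x)\<^sup>2 * \<bar>h\<bar> powr (-1 - \<alpha>) \<le> (u (x + h *\<^sub>R ejump i) - u x)\<^sup>2 * (\<kappa> * J x (x + h *\<^sub>R ejump i))"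
        by (intro mult_left_mono J_jump_ge) auto
      then show "ennreal ((u (x + h *\<^sub>R ejump i) - u x)\<^sup>2 * \<bar>h\<bar> powr (-1 - \<alpha>)) \<le> ennreal \<kappa> * ennreal ((u (x + h *\<^sub>R ejump i) - u x)\<^sup>2 * J x (x + h *\<^sub>R ejump i))"
        using kappa J_jump_nonneg[of x h i] by (simp add: mult_ac ennreal_leI flip: ennreal_mult)
    qed
    also have "\<dots> = ennreal \<kappa> * (\<integral>\<^sup>+h. ennreal ((u (x + h *\<^sub>R ejump i) - u x)\<^sup>2 * J x (x + h *\<^sub>R ejump i)) \<partial>lborel)"
      by (rule nn_integral_cmult) measurable
    also have "\<dots> \<le> ennreal \<kappa> * (\<Sum>i\<in>UNIV. \<integral>\<^sup>+h. ennreal ((u (x + h *\<^sub>R ejump i) - u x)\<^sup>2 * J x (x + h *\<^sub>R ejump i)) \<partial>lborel)"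
      by (intro mult_left_mono member_le_sum) auto
    finally show "(\<integral>\<^sup>+h. ennreal ((u (x + h *\<^sub>R ejump i) - u x)\<^sup>2 * \<bar>h\<bar> powr (-1 - \<alpha>)) \<partial>lborel) \<le> \<dots>" .
  qed
  also have "\<dots> = ennreal \<kappa> * ?S" by (rule nn_integral_cmult) measurable
  also have "\<dots> \<le> ennreal \<kappa> * energy J a u"
    unfolding energy_def by (intro mult_left_mono) auto
  finally show ?thesis .
qed

lemma energy_le:
  fixes u :: "('d, 'n) pt \<Rightarrow> real"
  assumes [measurable]: "u \<in> borel_measurable borel" "\<And>j. wgrad u (ediff j) \<in> borel_measurable borel"
  shows "energy J a u \<le> ennreal \<kappa> * ((\<Sum>i\<in>UNIV. jump_energy \<alpha> u i) + (\<Sum>j\<in>UNIV. sqn (wgrad u (ediff j))))"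
proof -
  have "(\<integral>\<^sup>+x. (\<Sum>i\<in>UNIV. \<integral>\<^sup>+h. ennreal ((u (x + h *\<^sub>R ejump i) - u x)\<^sup>2 * J x (x + h *\<^sub>R ejump i)) \<partial>lborel) \<partial>lborel)
     \<le> (\<integral>\<^sup>+x. (\<Sum>i\<in>UNIV. \<integral>\<^sup>+h. ennreal \<kappa> * ennreal ((u (x + h *\<^sub>R ejump i) - u x)\<^sup>2 * \<bar>h\<bar> powr (-1 - \<alpha>)) \<partial>lborel) \<partial>lborel)"
  proof (intro nn_integral_mono sum_mono)
    fix x h and i :: 'd
    have "(u (x + h *\<^sub>R ejump i) - u x)\<^sup>2 * J x (x + h *\<^sub>R ejump i) \<le> (u (x + h *\<^sub>R ejump i) - u x)\<^sup>2 * (\<kappa> * \<bar>h\<bar> powr (-1 - \<alpha>))"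
      by (intro mult_left_mono J_jump_le) auto
    then show "ennreal ((u (x + h *\<^sub>R ejump i) - u x)\<^sup>2 * J x (x + h *\<^sub>R ejump i)) \<le> ennreal \<kappa> * ennreal ((u (x + h *\<^sub>R ejump i) - u x)\<^sup>2 * \<bar>h\<bar> powr (-1 - \<alpha>))"
      using kappa by (simp add: mult_ac ennreal_leI flip: ennreal_mult)
  qed
  also have "\<dots> = ennreal \<kappa> * (\<Sum>i\<in>UNIV. jump_energy \<alpha> u i)"
    unfolding jump_energy_def
    by (simp add: nn_integral_cmult nn_integral_sum sum_distrib_left)
  finally have 1: "(\<integral>\<^sup>+x. (\<Sum>i\<in>UNIV. \<integral>\<^sup>+h. ennreal ((u (x + h *\<^sub>R ejump i) - u x)\<^sup>2 * J x (x + h *\<^sub>R ejump i)) \<partial>lborel) \<partial>lborel)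
     \<le> ennreal \<kappa> * (\<Sum>i\<in>UNIV. jump_energy \<alpha> u i)" .
  have "(\<integral>\<^sup>+x. ennreal (Aq x (\<lambda>j. wgrad u (ediff j) x) (\<lambda>j. wgrad u (ediff j) x)) \<partial>lborel)
     \<le> (\<integral>\<^sup>+x. ennreal \<kappa> * (\<Sum>j\<in>UNIV. ennreal ((wgrad u (ediff j) x)\<^sup>2)) \<partial>lborel)"
    using Aq_ellip(2) kappa by (intro nn_integral_mono) (simp add: ennreal_leI sum_nonneg flip: ennreal_mult)
  also have "\<dots> = ennreal \<kappa> * (\<Sum>j\<in>UNIV. sqn (wgrad u (ediff j)))"
    unfolding sqn_def by (simp add: nn_integral_cmult nn_integral_sum del: sum_ennreal)
  finally show ?thesis
    using 1 unfolding energy_def Aq_def by (simp add: distrib_left add_mono)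
qed

lemma weak_deriv_wgrad: "\<exists>g. weak_deriv u b g \<Longrightarrow> weak_deriv u b (wgrad u b)"
  unfolding wgrad_def using someI_ex[of "weak_deriv u b"] by simp

text \<open>Membership only provides locally integrable weak derivatives. Ellipticity bounds their
  squares by \<kappa> times the energy density, so they lie in L2 and are strong derivatives, the
  notion for which the calculus rules are proved.\<close>

lemma form_domD:
  assumes "u \<in> form_dom J a"
  shows "u \<in> L2" "strong_deriv u (ediff j) (wgrad u (ediff j))" "jump_energy \<alpha> u i < \<infinity>"
proof -
  show u: "u \<in> L2" using assms by (simp add: form_dom_def)
  note [measurable] = u[THEN L2_measurable]
  have w: "weak_deriv u (ediff j) (wgrad u (ediff j))" for j
    using assms by (intro weak_deriv_wgrad) (simp add: form_dom_def)
  then have [measurable]: "wgrad u (ediff j) \<in> borel_measurable borel" for j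
    by (simp add: weak_deriv_def loc_integrable_def)
  have e: "energy J a u < \<infinity>" using assms by (simp add: form_dom_def)
  show "jump_energy \<alpha> u i < \<infinity>"
    using energy_ge_jump_energy[of u i] e by (auto simp: ennreal_mult_less_top le_less_trans)
  have "sqn (wgrad u (ediff j)) \<le> (\<integral>\<^sup>+x. ennreal \<kappa> * ennreal (Aq x (\<lambda>j. wgrad u (ediff j) x) (\<lambda>j. wgrad u (ediff j) x)) \<partial>lborel)"
    unfolding sqn_def
  proof (rule nn_integral_mono)
    fix x
    have "(wgrad u (ediff j) x)\<^sup>2 \<le> (\<Sum>j\<in>UNIV. (wgrad u (ediff j) x)\<^sup>2)" by (rule member_le_sum) auto
    also have "\<dots> \<le> \<kappa> * Aq x (\<lambda>j. wgrad u (ediff j) x) (\<lambda>j. wgrad u (ediff j) x)"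
      using Aq_ellip(1)[of "\<lambda>j. wgrad u (ediff j) x" x] kappa by (simp add: field_simps)
    finally show "ennreal ((wgrad u (ediff j) x)\<^sup>2) \<le> ennreal \<kappa> * ennreal (Aq x (\<lambda>j. wgrad u (ediff j) x) (\<lambda>j. wgrad u (ediff j) x))"
      using kappa by (simp add: ennreal_leI Aq_nonneg flip: ennreal_mult)
  qed
  also have "\<dots> = ennreal \<kappa> * (\<integral>\<^sup>+x. ennreal (Aq x (\<lambda>j. wgrad u (ediff j) x) (\<lambda>j. wgrad u (ediff j) x)) \<partial>lborel)"
    by (rule nn_integral_cmult) measurable
  also have "\<dots> \<le> ennreal \<kappa> * energy J a u"
    unfolding energy_def Aq_def by (intro mult_left_mono) auto
  also have "\<dots> < \<infinity>" using e by (simp add: ennreal_mult_less_top)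
  finally have "wgrad u (ediff j) \<in> L2" by (simp add: L2_iff_sqn)
  then show "strong_deriv u (ediff j) (wgrad u (ediff j))"
    by (rule weak_deriv_imp_strong_deriv[OF u _ w])
qed

text \<open>The energy is defined through the chosen \<open>wgrad\<close>, so uniqueness of weak
  derivatives is what allows an explicitly known derivative \<open>g\<close> to take its
  place.\<close>

lemma form_domI:
  assumes g: "\<And>j. strong_deriv u (ediff j) (g j)" and J: "\<And>i. jump_energy \<alpha> u i < \<infinity>"
  shows "u \<in> form_dom J a" "AE x in lborel. \<forall>j. wgrad u (ediff j) x = g j x"
proof -
  have u: "u \<in> L2" using g by (auto simp: strong_deriv_def)
  note [measurable] = u[THEN L2_measurable]
  have wg: "weak_deriv u (ediff j) (g j)" for j by (rule strong_deriv_imp_weak_deriv[OF g])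
  then have w: "weak_deriv u (ediff j) (wgrad u (ediff j))" for j by (intro weak_deriv_wgrad) blast
  then have [measurable]: "wgrad u (ediff j) \<in> borel_measurable borel" for j
    by (simp add: weak_deriv_def loc_integrable_def)
  have ae: "AE x in lborel. wgrad u (ediff j) x = g j x" for j by (rule weak_deriv_unique[OF w wg])
  then show "AE x in lborel. \<forall>j. wgrad u (ediff j) x = g j x"
    using AE_finite_allI[of UNIV "\<lambda>j x. wgrad u (ediff j) x = g j x" lborel] by simp
  have "sqn (wgrad u (ediff j)) = sqn (g j)" for j by (rule sqn_cong_AE[OF ae])
  also have "sqn (g j) < \<infinity>" for j using g by (auto simp: strong_deriv_def L2_iff_sqn)
  finally have "energy J a u < \<infinity>"
    using J by (intro le_less_trans[OF energy_le]) (auto simp: ennreal_mult_less_top ennreal_sum_less_top)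
  then show "u \<in> form_dom J a" using u wg by (auto simp: form_dom_def)
qed

text \<open>The gradient is \<open>strong_deriv_mult_compose\<close>. For a jump from x to y the
  increment of m k(u) splits into m(y) (k(u(y)) - k(u(x))) and (m(y) - m(x)) k(u(x)). The first part
  is controlled by the energy of \<open>u\<close>; the second by a multiple of min 1 |h| times
  |u(x)|, whose square is integrable against the kernel.\<close>

lemma form_dom_mult_compose:
  fixes k k' :: "real \<Rightarrow> real" and m :: "('d, 'n) pt \<Rightarrow> real"
  assumes u: "u \<in> form_dom J a" and uI: "AE x in lborel. u x \<in> I" and I0: "0 \<in> I"
    and k: "\<And>s. (k has_real_derivative k' s) (at s)" "continuous_on UNIV k'" "k 0 = 0"
    and L: "\<And>s t. s \<in> I \<Longrightarrow> t \<in> I \<Longrightarrow> \<bar>k s - k t\<bar> \<le> L * \<bar>s - t\<bar>"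
    and L': "\<And>s. s \<in> I \<Longrightarrow> \<bar>k' s\<bar> \<le> L"
    and m: "C1_fun m" "\<And>x. \<bar>m x\<bar> \<le> B" "\<And>x b. b \<in> Basis \<Longrightarrow> \<bar>frechet_derivative m (at x) b\<bar> \<le> B"
  defines "w \<equiv> \<lambda>x. m x * k (u x)"
    and "G \<equiv> \<lambda>j x. frechet_derivative m (at x) (ediff j) * k (u x) + m x * k' (u x) * wgrad u (ediff j) x"
  shows "strong_deriv w (ediff j) (G j)" "jump_energy \<alpha> w i < \<infinity>" "w \<in> form_dom J a"
    "AE x in lborel. \<forall>j. wgrad w (ediff j) x = G j x"
proof -
  have ck: "continuous_on UNIV k" using k(1) by (meson DERIV_continuous_on has_field_derivative_at_within)
  have uL: "u \<in> L2" by (rule form_domD[OF u])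
  note [measurable] = uL[THEN L2_measurable] C1_fun_measurable[OF m(1)] borel_measurable_continuous_onI[OF ck]
  have B0: "B \<ge> 0" using m(2)[of 0] by linarith
  have L0: "L \<ge> 0" using L'[OF I0] by linarith
  have sd: "strong_deriv w (ediff j) (G j)" for j
    unfolding w_def G_def
    by (rule strong_deriv_mult_compose[OF form_domD(2)[OF u] uI I0 k L L' m(1,2) m(3)[OF ediff_Basis]])
  have je: "jump_energy \<alpha> w i < \<infinity>" for i
  proof -
    let ?p = "\<lambda>h. \<bar>h\<bar> powr (-1 - \<alpha>)"
    let ?c = "8 * B\<^sup>2 * L\<^sup>2" and ?d = "2 * B\<^sup>2 * L\<^sup>2"
    let ?P = "\<lambda>x h. ennreal ?d * ennreal ((u (x + h *\<^sub>R ejump i) - u x)\<^sup>2 * ?p h)"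
    let ?R = "\<lambda>x h. ennreal ?c * (ennreal ((u x)\<^sup>2) * ennreal (min 1 ((h / 1)\<^sup>2) * ?p h))"
    have pw: "ennreal ((w (x + h *\<^sub>R ejump i) - w x)\<^sup>2 * ?p h) \<le> ?P x h + ?R x h"
      if "u x \<in> I" "u (x + h *\<^sub>R ejump i) \<in> I" for x h
    proof -
      let ?y = "x + h *\<^sub>R ejump i"
      have "w ?y - w x = m ?y * (k (u ?y) - k (u x)) + (m ?y - m x) * k (u x)"
        by (simp add: w_def algebra_simps)
      then have "(w ?y - w x)\<^sup>2 \<le> 2 * (m ?y * (k (u ?y) - k (u x)))\<^sup>2 + 2 * ((m ?y - m x) * k (u x))\<^sup>2"
        using sum_squares_bound[of "m ?y * (k (u ?y) - k (u x))" "(m ?y - m x) * k (u x)"]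
        by (simp add: power2_sum)
      also have "(m ?y * (k (u ?y) - k (u x)))\<^sup>2 \<le> (B * (L * \<bar>u ?y - u x\<bar>))\<^sup>2"
        using L[OF that(2,1)] by (intro abs_le_square_iff[THEN iffD1]) (auto simp: abs_mult B0 L0 intro!: mult_mono m)
      also have "((m ?y - m x) * k (u x))\<^sup>2 \<le> (2 * B * min 1 \<bar>h\<bar> * (L * \<bar>u x\<bar>))\<^sup>2"
      proof -
        have "\<bar>m ?y - m x\<bar> \<le> B * \<bar>h\<bar>" by (rule C1_fun_increment_le[OF m(1) m(3)[OF ejump_Basis]])
        also have "\<dots> \<le> 2 * B * \<bar>h\<bar>" using B0 by (simp add: mult_right_mono)
        finally have "\<bar>m ?y - m x\<bar> \<le> 2 * B * min 1 \<bar>h\<bar>"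
          using m(2)[of x] m(2)[of ?y] by (simp add: min_def) linarith
        moreover have "\<bar>k (u x)\<bar> \<le> L * \<bar>u x\<bar>" using L[OF that(1) I0] k(3) by simp
        ultimately show ?thesis
          by (intro abs_le_square_iff[THEN iffD1]) (auto simp: abs_mult B0 L0 intro!: mult_mono)
      qed
      also have "2 * (B * (L * \<bar>u ?y - u x\<bar>))\<^sup>2 + 2 * (2 * B * min 1 \<bar>h\<bar> * (L * \<bar>u x\<bar>))\<^sup>2
          = ?d * (u ?y - u x)\<^sup>2 + ?c * ((u x)\<^sup>2 * (min 1 \<bar>h\<bar>)\<^sup>2)"
        by (simp add: power_mult_distrib)
      also have "(min 1 \<bar>h\<bar>)\<^sup>2 = min 1 (h\<^sup>2)"
        using abs_square_le_1[of h] by (auto simp: min_def power2_eq_iff abs_square_eq_1)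
      finally have "(w ?y - w x)\<^sup>2 \<le> ?d * (u ?y - u x)\<^sup>2 + ?c * ((u x)\<^sup>2 * min 1 (h\<^sup>2))" by simp
      then have "(w ?y - w x)\<^sup>2 * ?p h \<le> (?d * (u ?y - u x)\<^sup>2 + ?c * ((u x)\<^sup>2 * min 1 (h\<^sup>2))) * ?p h"
        by (rule mult_right_mono) simp
      also have "\<dots> = ?d * ((u ?y - u x)\<^sup>2 * ?p h) + ?c * ((u x)\<^sup>2 * (min 1 ((h / 1)\<^sup>2) * ?p h))"
        by (simp add: algebra_simps)
      finally show ?thesis
        by (simp flip: ennreal_mult ennreal_plus add: ennreal_leI mult_nonneg_nonneg)
    qed
    have "jump_energy \<alpha> w i = (\<integral>\<^sup>+h. (\<integral>\<^sup>+x. ennreal ((w (x + h *\<^sub>R ejump i) - w x)\<^sup>2 * ?p h) \<partial>lborel) \<partial>lborel)"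
      unfolding jump_energy_def by (rule lborel_pair.Fubini'[symmetric]) (simp add: w_def)
    also have "\<dots> \<le> (\<integral>\<^sup>+h. (\<integral>\<^sup>+x. ?P x h + ?R x h \<partial>lborel) \<partial>lborel)"
    proof (rule nn_integral_mono, rule nn_integral_mono_AE)
      fix h
      show "AE x in lborel. ennreal ((w (x + h *\<^sub>R ejump i) - w x)\<^sup>2 * ?p h) \<le> ?P x h + ?R x h"
        using uI AE_lborel_shift[OF uI, of "h *\<^sub>R ejump i"] by eventually_elim (rule pw)
    qed
    also have "\<dots> = (\<integral>\<^sup>+x. (\<integral>\<^sup>+h. ?P x h + ?R x h \<partial>lborel) \<partial>lborel)"
      by (rule lborel_pair.Fubini') measurable
    also have "\<dots> = ennreal ?d * jump_energy \<alpha> u i + ennreal ?c * (sqn u * (\<integral>\<^sup>+h. ennreal (min 1 ((h / 1)\<^sup>2) * ?p h) \<partial>lborel))"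
      unfolding jump_energy_def sqn_def
      by (simp add: nn_integral_add nn_integral_cmult nn_integral_multc)
    also have "\<dots> < \<infinity>"
      using form_domD(3)[OF u, of i] uL min_square_powr_integral_le[OF alpha, of 1]
      by (auto simp: ennreal_mult_less_top L2_iff_sqn intro: le_less_trans)
    finally show ?thesis .
  qed
  show "strong_deriv w (ediff j) (G j)" "jump_energy \<alpha> w i < \<infinity>" by fact+
  show "w \<in> form_dom J a" "AE x in lborel. \<forall>j. wgrad w (ediff j) x = G j x"
    by (rule form_domI[OF sd je])+
qed

text \<open>Turns the iterated integral into integrals over pairs (x, h), so that lower bounds for
  the form can be proved pointwise and then integrated. Integrability follows from |A B| \<le> A^2 +
  B^2 and the upper bound on \<open>J\<close>.\<close>

lemma form_jump_pair:
  assumes u: "u \<in> form_dom J a" and w: "w \<in> form_dom J a"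
  defines "F \<equiv> \<lambda>i (x, h). (u (x + h *\<^sub>R ejump i) - u x) * (w (x + h *\<^sub>R ejump i) - w x) * J x (x + h *\<^sub>R ejump i)"
  shows "integrable (lborel \<Otimes>\<^sub>M lborel) (F i)"
    and "form_jump J u w = (\<Sum>i\<in>UNIV. LINT z|(lborel \<Otimes>\<^sub>M lborel). F i z)"
proof -
  note [measurable] = form_domD(1)[OF u, THEN L2_measurable] form_domD(1)[OF w, THEN L2_measurable]
  have int: "integrable (lborel \<Otimes>\<^sub>M lborel) (F i)" for i
    unfolding integrable_iff_bounded
  proof
    show "F i \<in> borel_measurable (lborel \<Otimes>\<^sub>M lborel)"
      unfolding F_def by measurable
    let ?p = "\<lambda>h. \<bar>h\<bar> powr (-1 - \<alpha>)"
    have "(\<integral>\<^sup>+z. ennreal (norm (F i z)) \<partial>(lborel \<Otimes>\<^sub>M lborel))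
        \<le> (\<integral>\<^sup>+z. ennreal \<kappa> * ((\<lambda>(x, h). ennreal ((u (x + h *\<^sub>R ejump i) - u x)\<^sup>2 * ?p h)) z
            + (\<lambda>(x, h). ennreal ((w (x + h *\<^sub>R ejump i) - w x)\<^sup>2 * ?p h)) z) \<partial>(lborel \<Otimes>\<^sub>M lborel))"
    proof (rule nn_integral_mono, clarify)
      fix x h
      let ?A = "u (x + h *\<^sub>R ejump i) - u x" and ?B = "w (x + h *\<^sub>R ejump i) - w x"
      have "\<bar>?A * ?B\<bar> \<le> ?A\<^sup>2 + ?B\<^sup>2"
        using sum_squares_bound[of "\<bar>?A\<bar>" "\<bar>?B\<bar>"] mult_nonneg_nonneg[of "\<bar>?A\<bar>" "\<bar>?B\<bar>"]
        unfolding abs_mult power2_abs by linarith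
      then have "\<bar>?A * ?B\<bar> * J x (x + h *\<^sub>R ejump i) \<le> (?A\<^sup>2 + ?B\<^sup>2) * (\<kappa> * ?p h)"
        by (intro mult_mono J_jump_le J_jump_nonneg) auto
      also have "\<dots> = \<kappa> * (?A\<^sup>2 * ?p h + ?B\<^sup>2 * ?p h)" by (simp add: algebra_simps)
      finally have "norm (F i (x, h)) \<le> \<kappa> * (?A\<^sup>2 * ?p h + ?B\<^sup>2 * ?p h)"
        using J_jump_nonneg[of x h i] by (simp add: F_def abs_mult)
      then show "ennreal (norm (F i (x, h))) \<le> ennreal \<kappa> * (ennreal (?A\<^sup>2 * ?p h) + ennreal (?B\<^sup>2 * ?p h))"
        using kappa by (simp flip: ennreal_mult ennreal_plus add: ennreal_leI)
    qed
    also have "\<dots> = ennreal \<kappa> * (jump_energy \<alpha> u i + jump_energy \<alpha> w i)"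
      by (subst nn_integral_cmult) (auto simp: nn_integral_add jump_energy_eq_pair)
    also have "\<dots> < \<infinity>"
      using form_domD(3)[OF u, of i] form_domD(3)[OF w, of i] by (simp add: ennreal_mult_less_top)
    finally show "(\<integral>\<^sup>+z. ennreal (norm (F i z)) \<partial>(lborel \<Otimes>\<^sub>M lborel)) < \<infinity>" .
  qed
  then show "integrable (lborel \<Otimes>\<^sub>M lborel) (F i)" .
  have "form_jump J u w = (LINT x|lborel. (\<Sum>i\<in>UNIV. LINT h|lborel. F i (x, h)))"
    unfolding form_jump_def F_def by simp
  also have "\<dots> = (\<Sum>i\<in>UNIV. LINT x|lborel. LINT h|lborel. F i (x, h))"
    by (rule Bochner_Integration.integral_sum) (rule lborel_pair.integrable_fst'[OF int])
  also have "\<dots> = (\<Sum>i\<in>UNIV. LINT z|(lborel \<Otimes>\<^sub>M lborel). F i z)"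
    by (rule sum.cong[OF refl], rule lborel_pair.integral_fst'[OF int])
  finally show "form_jump J u w = (\<Sum>i\<in>UNIV. LINT z|(lborel \<Otimes>\<^sub>M lborel). F i z)" .
qed

text \<open>Nonnegativity of the form at X + Y and X - Y bounds 2 |A(X,Y)| by A(X,X) + A(Y,Y)
  wherever the coefficients are symmetric, that is, almost everywhere.\<close>

lemma form_diff_Aq:
  assumes u: "u \<in> form_dom J a" and w: "w \<in> form_dom J a"
  defines "F \<equiv> \<lambda>x. Aq x (\<lambda>j. wgrad u (ediff j) x) (\<lambda>j. wgrad w (ediff j) x)"
  shows "integrable lborel F" "form_diff a u w = (LINT x|lborel. F x)"
proof -
  have gu: "wgrad u (ediff j) \<in> L2" and gw: "wgrad w (ediff j) \<in> L2" for j
    using form_domD(2)[OF u] form_domD(2)[OF w] by (auto simp: strong_deriv_def)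
  note [measurable] = gu[THEN L2_measurable] gw[THEN L2_measurable] a_meas
  show "form_diff a u w = (LINT x|lborel. F x)" unfolding form_diff_def F_def Aq_def by simp
  let ?X = "\<lambda>x j. wgrad u (ediff j) x" and ?Y = "\<lambda>x j. wgrad w (ediff j) x"
  show "integrable lborel F"
  proof (rule Bochner_Integration.integrable_bound)
    show "integrable lborel (\<lambda>x. \<kappa> * ((\<Sum>j\<in>UNIV. (?X x j)\<^sup>2) + (\<Sum>j\<in>UNIV. (?Y x j)\<^sup>2)))"
      using gu gw by (auto simp: L2_def)
    show "F \<in> borel_measurable lborel" unfolding F_def by simp
    show "AE x in lborel. norm (F x) \<le> norm (\<kappa> * ((\<Sum>j\<in>UNIV. (?X x j)\<^sup>2) + (\<Sum>j\<in>UNIV. (?Y x j)\<^sup>2)))"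
      using Aq_sym
    proof eventually_elim
      case (elim x)
      have "0 \<le> Aq x (\<lambda>j. ?X x j + ?Y x j) (\<lambda>j. ?X x j + ?Y x j)" by (rule Aq_nonneg)
      moreover have "0 \<le> Aq x (\<lambda>j. ?X x j + (-1) * ?Y x j) (\<lambda>j. ?X x j + (-1) * ?Y x j)" by (rule Aq_nonneg)
      moreover have "Aq x (?Y x) (?X x) = Aq x (?X x) (?Y x)" using elim by blast
      ultimately have "2 * \<bar>Aq x (?X x) (?Y x)\<bar> \<le> Aq x (?X x) (?X x) + Aq x (?Y x) (?Y x)"
        unfolding Aq_bilinear by linarith
      then have "\<bar>F x\<bar> \<le> Aq x (?X x) (?X x) + Aq x (?Y x) (?Y x)"
        unfolding F_def using Aq_nonneg[of x "?X x"] Aq_nonneg[of x "?Y x"] by linarith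
      also have "\<dots> \<le> \<kappa> * (\<Sum>j\<in>UNIV. (?X x j)\<^sup>2) + \<kappa> * (\<Sum>j\<in>UNIV. (?Y x j)\<^sup>2)"
        by (intro add_mono Aq_ellip)
      finally show ?case by (simp add: distrib_left)
    qed
  qed
qed

lemma form_E_sym:
  assumes u: "u \<in> form_dom J a" and w: "w \<in> form_dom J a"
  shows "form_E J a u w = form_E J a w u"
proof -
  have "form_jump J u w = form_jump J w u"
    unfolding form_jump_def by (simp add: mult.commute)
  moreover have "form_diff a u w = form_diff a w u"
    unfolding form_diff_Aq(2)[OF u w] form_diff_Aq(2)[OF w u]
    by (rule integral_cong_AE) (use form_diff_Aq(1)[OF u w] form_diff_Aq(1)[OF w u] Aq_sym in auto)
  ultimately show ?thesis by (simp add: form_E_def)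
qed

end

section \<open>Orbits of the semigroup\<close>

text \<open>\<open>I\<close> is an interval that contains the values of the solution; \<open>k = \<Phi>'\<close> and \<open>k' = \<Phi>''\<close>.\<close>

definition C2_pair :: "real set \<Rightarrow> real \<Rightarrow> (real \<Rightarrow> real) \<Rightarrow> (real \<Rightarrow> real) \<Rightarrow> (real \<Rightarrow> real) \<Rightarrow> bool" where
  "C2_pair I L \<Phi> k k' \<longleftrightarrow> convex I \<and> 0 \<in> I \<and> (\<forall>s. (\<Phi> has_real_derivative k s) (at s)) \<and>
     (\<forall>s. (k has_real_derivative k' s) (at s)) \<and> continuous_on UNIV k' \<and> \<Phi> 0 = 0 \<and> k 0 = 0 \<and> (\<forall>s\<in>I. \<bar>k' s\<bar> \<le> L)"

lemma C2_pairD: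
  assumes "C2_pair I L \<Phi> k k'"
  shows "0 \<in> I" "(\<Phi> has_real_derivative k s) (at s)" "(k has_real_derivative k' s) (at s)"
    "continuous_on UNIV k'" "\<Phi> 0 = 0" "k 0 = 0" "s \<in> I \<Longrightarrow> \<bar>k' s\<bar> \<le> L" "0 \<le> L"
proof -
  show "0 \<in> I" "(\<Phi> has_real_derivative k s) (at s)" "(k has_real_derivative k' s) (at s)"
    "continuous_on UNIV k'" "\<Phi> 0 = 0" "k 0 = 0" "s \<in> I \<Longrightarrow> \<bar>k' s\<bar> \<le> L"
    using assms unfolding C2_pair_def by blast+
  have "\<bar>k' 0\<bar> \<le> L" using assms unfolding C2_pair_def by blast
  then show "0 \<le> L" by linarith
qed

lemma C2_pair_Lipschitz:
  assumes "C2_pair I L \<Phi> k k'" "s \<in> I" "t \<in> I"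
  shows "\<bar>k s - k t\<bar> \<le> L * \<bar>s - t\<bar>"
proof -
  have "norm (k s - k t) \<le> L * norm (s - t)"
  proof (rule field_differentiable_bound)
    show "convex I" using assms by (simp add: C2_pair_def)
    show "(k has_field_derivative k' z) (at z within I)" for z
      using C2_pairD(3)[OF assms(1)] by (rule has_field_derivative_at_within)
  qed (use assms C2_pairD(7)[OF assms(1)] in auto)
  then show ?thesis by simp
qed

lemma C2_pair_Taylor:
  assumes c: "C2_pair I L \<Phi> k k'" and "s \<in> I" "t \<in> I"
  shows "\<bar>\<Phi> t - \<Phi> s - k s * (t - s)\<bar> \<le> L * (t - s)\<^sup>2"
proof -
  have cv: "convex I" using c by (simp add: C2_pair_def)
  have "\<exists>z. z \<in> I \<and> \<bar>z - s\<bar> \<le> \<bar>t - s\<bar> \<and> \<Phi> t - \<Phi> s = k z * (t - s)"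
  proof (cases s t rule: linorder_cases)
    case less
    obtain z where z: "s < z" "z < t" "\<Phi> t - \<Phi> s = (t - s) * k z" using MVT2[OF less C2_pairD(2)[OF c]] by blast
    have "z \<in> I" using cv[unfolded is_interval_convex_1[symmetric] is_interval_1] assms(2,3) z by (metis less_imp_le)
    with z show ?thesis by (intro exI[of _ z]) auto
  next
    case greater
    obtain z where z: "t < z" "z < s" "\<Phi> s - \<Phi> t = (s - t) * k z" using MVT2[OF greater C2_pairD(2)[OF c]] by blast
    have "z \<in> I" using cv[unfolded is_interval_convex_1[symmetric] is_interval_1] assms(2,3) z by (metis less_imp_le)
    with z show ?thesis by (intro exI[of _ z]) (auto simp: algebra_simps)
  qed (use assms in auto)
  then obtain z where z: "z \<in> I" "\<bar>z - s\<bar> \<le> \<bar>t - s\<bar>" "\<Phi> t - \<Phi> s = k z * (t - s)" by blast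
  have "\<bar>\<Phi> t - \<Phi> s - k s * (t - s)\<bar> = \<bar>k z - k s\<bar> * \<bar>t - s\<bar>"
    unfolding z(3) by (simp add: left_diff_distrib flip: abs_mult)
  also have "\<dots> \<le> (L * \<bar>t - s\<bar>) * \<bar>t - s\<bar>"
    using C2_pair_Lipschitz[OF c z(1) assms(2)] mult_left_mono[OF z(2) C2_pairD(8)[OF c]]
    by (intro mult_right_mono) auto
  also have "\<dots> = L * (t - s)\<^sup>2" by (simp add: power2_eq_square)
  finally show ?thesis .
qed

lemma C2_pair_growth:
  assumes c: "C2_pair I L \<Phi> k k'" and s: "s \<in> I"
  shows "\<bar>k s\<bar> \<le> L * \<bar>s\<bar>" "\<bar>\<Phi> s\<bar> \<le> L * s\<^sup>2"
  using C2_pair_Lipschitz[OF c s C2_pairD(1)[OF c]] C2_pair_Taylor[OF c C2_pairD(1)[OF c] s] C2_pairD(5,6)[OF c]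
  by simp_all

lemma C2_pair_measurable:
  assumes c: "C2_pair I L \<Phi> k k'"
  shows "\<Phi> \<in> borel_measurable borel" "k \<in> borel_measurable borel"
  by (rule borel_measurable_continuous_onI, rule DERIV_continuous_on, rule has_field_derivative_at_within,
      rule C2_pairD(2)[OF c])
    (rule borel_measurable_continuous_onI, rule DERIV_continuous_on, rule has_field_derivative_at_within,
      rule C2_pairD(3)[OF c])

lemma functional_integrable:
  assumes c: "C2_pair I L \<Phi> k k'" and u: "u \<in> L2" "AE x in lborel. u x \<in> I"
    and m: "m \<in> borel_measurable borel" "\<And>x. \<bar>m x\<bar> \<le> B"
  shows "integrable lborel (\<lambda>x. m x * \<Phi> (u x))" "(\<lambda>x. m x * k (u x)) \<in> L2"
proof -
  note [measurable] = u(1)[THEN L2_measurable] m(1) C2_pair_measurable[OF c]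
  have B0: "B \<ge> 0" using m(2) order_trans[OF abs_ge_zero] by blast
  show "integrable lborel (\<lambda>x. m x * \<Phi> (u x))"
  proof (rule Bochner_Integration.integrable_bound)
    show "integrable lborel (\<lambda>x. B * L * (u x)\<^sup>2)" using u by (simp add: L2_def)
    show "AE x in lborel. norm (m x * \<Phi> (u x)) \<le> norm (B * L * (u x)\<^sup>2)"
      using u(2)
    proof eventually_elim
      case (elim x)
      have "\<bar>m x\<bar> * \<bar>\<Phi> (u x)\<bar> \<le> B * (L * (u x)\<^sup>2)"
        by (intro mult_mono m C2_pair_growth[OF c elim] B0) auto
      then show ?case using B0 C2_pairD(8)[OF c] by (simp add: abs_mult mult.assoc)
    qed
  qed auto
  show "(\<lambda>x. m x * k (u x)) \<in> L2"
  proof (rule L2_dominated[OF u(1), where B = "B * L"])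
    show "AE x in lborel. \<bar>m x * k (u x)\<bar> \<le> B * L * \<bar>u x\<bar>"
      using u(2)
    proof eventually_elim
      case (elim x)
      have "\<bar>m x\<bar> * \<bar>k (u x)\<bar> \<le> B * (L * \<bar>u x\<bar>)"
        by (intro mult_mono m C2_pair_growth[OF c elim] B0) auto
      then show ?case by (simp add: abs_mult mult.assoc)
    qed
  qed simp
qed

text \<open>First-order expansion of u \<mapsto> \<integral> m \<Phi>(u) with a remainder quadratic
  in the L2 distance. After division by the time step this remainder vanishes along a path that is
  differentiable in L2.\<close>

lemma functional_expansion:
  assumes c: "C2_pair I L \<Phi> k k'" and u: "u \<in> L2" "AE x in lborel. u x \<in> I" and v: "v \<in> L2" "AE x in lborel. v x \<in> I"
    and m: "m \<in> borel_measurable borel" "\<And>x. \<bar>m x\<bar> \<le> B"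
  shows "\<bar>(LINT x|lborel. m x * \<Phi> (v x)) - (LINT x|lborel. m x * \<Phi> (u x)) - (LINT x|lborel. (v x - u x) * (m x * k (u x)))\<bar>
     \<le> B * L * (LINT x|lborel. (v x - u x)\<^sup>2)"
proof -
  note [measurable] = u(1)[THEN L2_measurable] v(1)[THEN L2_measurable] m(1) C2_pair_measurable[OF c]
  have B0: "B \<ge> 0" using m(2) order_trans[OF abs_ge_zero] by blast
  let ?R = "\<lambda>x. m x * \<Phi> (v x) - m x * \<Phi> (u x) - (v x - u x) * (m x * k (u x))"
  have i: "integrable lborel (\<lambda>x. m x * \<Phi> (v x))" "integrable lborel (\<lambda>x. m x * \<Phi> (u x))"
    "integrable lborel (\<lambda>x. (v x - u x) * (m x * k (u x)))"
    by (intro functional_integrable[OF c _ _ m] integrable_mult_L2 L2_diff u v)+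
  have i2: "integrable lborel (\<lambda>x. B * L * (v x - u x)\<^sup>2)"
    using L2_diff[OF v(1) u(1)] by (simp add: L2_def)
  have "\<bar>LINT x|lborel. ?R x\<bar> \<le> (LINT x|lborel. B * L * (v x - u x)\<^sup>2)"
  proof (rule order_trans[OF integral_abs_bound], rule integral_mono_AE)
    show "AE x in lborel. \<bar>?R x\<bar> \<le> B * L * (v x - u x)\<^sup>2"
      using u(2) v(2)
    proof eventually_elim
      case (elim x)
      have "?R x = m x * (\<Phi> (v x) - \<Phi> (u x) - k (u x) * (v x - u x))" by (simp add: algebra_simps)
      then have "\<bar>?R x\<bar> = \<bar>m x\<bar> * \<bar>\<Phi> (v x) - \<Phi> (u x) - k (u x) * (v x - u x)\<bar>" by (simp add: abs_mult)
      also have "\<dots> \<le> B * (L * (v x - u x)\<^sup>2)"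
        by (intro mult_mono m C2_pair_Taylor[OF c elim] B0) auto
      finally show ?case by (simp add: mult.assoc)
    qed
  qed (use i i2 in auto)
  then show ?thesis using i i2 by simp
qed

text \<open>Derivatives exist only at positive times, so the initial value enters as a right limit.
  The Gronwall arguments below are brought into this form by integrating factors.\<close>

lemma nonincreasing_from_limit:
  fixes y :: "real \<Rightarrow> real"
  assumes d: "\<And>t. t > 0 \<Longrightarrow> t \<le> T \<Longrightarrow> \<exists>D. (y has_real_derivative D) (at t) \<and> D \<le> 0" and l: "(y \<longlongrightarrow> l) (at_right 0)"
    and T: "T > 0"
  shows "y T \<le> l"
proof -
  have "y T \<le> y s" if "0 < s" "s < T" for s
    by (rule DERIV_nonpos_imp_nonincreasing) (use d that in \<open>auto intro: less_imp_le\<close>)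
  then have "\<forall>\<^sub>F s in at_right 0. y T \<le> y s"
    unfolding eventually_at_right_field using T by (intro exI[of _ T]) auto
  then show ?thesis by (rule tendsto_lowerbound[OF l]) simp
qed

section \<open>Functionals along an orbit, the Markov property and duality\<close>

context dirichlet_setting
begin

lemma orbitD:
  assumes "semigroup_orbit J a f U"
  shows orbit_initial: "((\<lambda>t. sqn (\<lambda>x. U t x - f x)) \<longlongrightarrow> 0) (at_right 0)"
    and orbit_form_dom: "t > 0 \<Longrightarrow> U t \<in> form_dom J a"
  using assms unfolding semigroup_orbit_def sqn_def by auto

lemma orbit_L2: "semigroup_orbit J a f U \<Longrightarrow> t > 0 \<Longrightarrow> U t \<in> L2"
  using form_domD(1) orbit_form_dom by blast

text \<open>Names the time derivative that is hidden under the existential quantifier of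
  \<open>semigroup_orbit\<close>.\<close>

definition orbit_deriv :: "(real \<Rightarrow> ('d, 'n) pt \<Rightarrow> real) \<Rightarrow> (real \<Rightarrow> ('d, 'n) pt \<Rightarrow> real) \<Rightarrow> bool" where
  "orbit_deriv U U' \<longleftrightarrow> (\<forall>t>0. U' t \<in> L2 \<and>
        ((\<lambda>s. sqn (\<lambda>x. (U s x - U t x) / (s - t) - U' t x)) \<longlongrightarrow> 0) (at t) \<and>
        (\<forall>v\<in>form_dom J a. L2_inner (U' t) v + form_E J a (U t) v = 0))"

lemma orbit_deriv_exists: "semigroup_orbit J a f U \<Longrightarrow> \<exists>U'. orbit_deriv U U'"
  unfolding semigroup_orbit_def orbit_deriv_def sqn_def by blast

lemma orbit_derivD:
  assumes "orbit_deriv U U'" "t > 0"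
  shows "U' t \<in> L2" "((\<lambda>s. sqn (\<lambda>x. (U s x - U t x) / (s - t) - U' t x)) \<longlongrightarrow> 0) (at t)"
    "v \<in> form_dom J a \<Longrightarrow> (LINT x|lborel. U' t x * v x) = - form_E J a (U t) v"
proof -
  show "U' t \<in> L2" "((\<lambda>s. sqn (\<lambda>x. (U s x - U t x) / (s - t) - U' t x)) \<longlongrightarrow> 0) (at t)"
    using assms unfolding orbit_deriv_def by blast+
  assume "v \<in> form_dom J a"
  then have "L2_inner (U' t) v + form_E J a (U t) v = 0" using assms unfolding orbit_deriv_def by blast
  then show "(LINT x|lborel. U' t x * v x) = - form_E J a (U t) v" by (simp add: L2_inner_def)
qed

lemma orbit_quotient_L2:
  assumes orb: "semigroup_orbit J a f U" and t: "t > 0"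
  shows "\<forall>\<^sub>F s in at t. (\<lambda>x. (U s x - U t x) / (s - t)) \<in> L2" "\<forall>\<^sub>F s in at t. U s \<in> L2"
proof -
  have "\<forall>\<^sub>F s in at t. s > 0"
    using t eventually_at_in_open'[of "{0<..}" t] by simp
  then show "\<forall>\<^sub>F s in at t. U s \<in> L2" by eventually_elim (rule orbit_L2[OF orb])
  then show "\<forall>\<^sub>F s in at t. (\<lambda>x. (U s x - U t x) / (s - t)) \<in> L2"
  proof eventually_elim
    case (elim s)
    from L2_cmult[OF L2_diff[OF elim orbit_L2[OF orb t]], of "1 / (s - t)"] show ?case by simp
  qed
qed

lemma orbit_continuous:
  assumes orb: "semigroup_orbit J a f U" and t: "t > 0"
  shows "((\<lambda>s. sqn (\<lambda>x. U s x - U t x)) \<longlongrightarrow> 0) (at t)"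
proof -
  obtain U' where Ud: "orbit_deriv U U'" using orbit_deriv_exists[OF orb] by blast
  note U' = orbit_derivD(1,2)[OF Ud t]
  let ?q = "\<lambda>s x. (U s x - U t x) / (s - t)"
  have "((\<lambda>s. sqn (?q s)) \<longlongrightarrow> sqn (U' t)) (at t)"
    by (rule sqn_tendsto[OF orbit_quotient_L2(1)[OF orb t] U'])
  moreover have "((\<lambda>s. ennreal ((s - t)\<^sup>2)) \<longlongrightarrow> ennreal ((t - t)\<^sup>2)) (at t)"
    by (intro tendsto_ennrealI tendsto_intros)
  ultimately have "((\<lambda>s. ennreal ((s - t)\<^sup>2) * sqn (?q s)) \<longlongrightarrow> ennreal ((t - t)\<^sup>2) * sqn (U' t)) (at t)"
    using U'(1) by (intro tendsto_mult_ennreal) (auto simp: L2_iff_sqn)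
  then have "((\<lambda>s. ennreal ((s - t)\<^sup>2) * sqn (?q s)) \<longlongrightarrow> 0) (at t)" by simp
  then show ?thesis
  proof (rule Lim_transform_eventually)
    show "\<forall>\<^sub>F s in at t. ennreal ((s - t)\<^sup>2) * sqn (?q s) = sqn (\<lambda>x. U s x - U t x)"
      using orbit_quotient_L2(1)[OF orb t] eventually_neq_at_within[of t t UNIV]
    proof eventually_elim
      case (elim s)
      have "sqn (\<lambda>x. (s - t) * ?q s x) = ennreal ((s - t)\<^sup>2) * sqn (?q s)"
        by (rule sqn_cmult) (use elim L2_measurable in blast)
      then show ?case using elim by simp
    qed
  qed
qed

text \<open>By \<open>functional_expansion\<close> the difference quotient is the pairing of (U s -
  U t) / (s - t) with m k(U t), up to an error of order |s - t|. In the limit this pairs the time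
  derivative with m k(U t), and \<open>dom\<close> says that the equation may be tested with this
  function.\<close>

lemma functional_deriv:
  assumes orb: "semigroup_orbit J a f U" and t: "t > 0" and c: "C2_pair I L \<Phi> k k'"
    and UI: "\<And>s. s > 0 \<Longrightarrow> AE x in lborel. U s x \<in> I"
    and m: "m \<in> borel_measurable borel" "\<And>x. \<bar>m x\<bar> \<le> B"
    and dom: "(\<lambda>x. m x * k (U t x)) \<in> form_dom J a"
  shows "((\<lambda>s. LINT x|lborel. m x * \<Phi> (U s x)) has_real_derivative - form_E J a (U t) (\<lambda>x. m x * k (U t x))) (at t)"
proof -
  obtain U' where Ud: "orbit_deriv U U'" using orbit_deriv_exists[OF orb] by blast
  note U' = orbit_derivD(1,2)[OF Ud t] and eq = orbit_derivD(3)[OF Ud t]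
  let ?q = "\<lambda>s x. (U s x - U t x) / (s - t)"
  let ?w = "\<lambda>x. m x * k (U t x)"
  let ?y = "\<lambda>s. LINT x|lborel. m x * \<Phi> (U s x)"
  have w: "?w \<in> L2" by (rule form_domD(1)[OF dom])
  have q: "\<forall>\<^sub>F s in at t. ?q s \<in> L2" by (rule orbit_quotient_L2[OF orb t])
  have l1: "((\<lambda>s. LINT x|lborel. ?q s x * ?w x) \<longlongrightarrow> (LINT x|lborel. U' t x * ?w x)) (at t)"
    by (rule L2_inner_tendsto[OF q _ U'(1) w U'(2)]) (simp_all add: w sqn_def)
  have l2: "((\<lambda>s. LINT x|lborel. ?q s x * ?q s x) \<longlongrightarrow> (LINT x|lborel. U' t x * U' t x)) (at t)"
    by (rule L2_inner_tendsto[OF q q U'(1) U'(1) U'(2) U'(2)])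
  have l3: "((\<lambda>s. (?y s - ?y t) / (s - t) - (LINT x|lborel. ?q s x * ?w x)) \<longlongrightarrow> 0) (at t)"
  proof (rule Lim_null_comparison)
    have "((\<lambda>s. B * L * (LINT x|lborel. ?q s x * ?q s x) * \<bar>s - t\<bar>) \<longlongrightarrow> B * L * (LINT x|lborel. U' t x * U' t x) * \<bar>t - t\<bar>) (at t)"
      by (intro tendsto_intros l2)
    then show "((\<lambda>s. B * L * (LINT x|lborel. ?q s x * ?q s x) * \<bar>s - t\<bar>) \<longlongrightarrow> 0) (at t)" by simp
    have pos: "\<forall>\<^sub>F s in at t. s > 0"
      using t eventually_at_in_open'[of "{0<..}" t] by simp
    show "\<forall>\<^sub>F s in at t. norm ((?y s - ?y t) / (s - t) - (LINT x|lborel. ?q s x * ?w x))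
        \<le> B * L * (LINT x|lborel. ?q s x * ?q s x) * \<bar>s - t\<bar>"
      using pos eventually_neq_at_within[of t t UNIV]
    proof eventually_elim
      case (elim s)
      have e1: "(LINT x|lborel. (U s x - U t x) * ?w x) = (s - t) * (LINT x|lborel. ?q s x * ?w x)"
      proof -
        have "(LINT x|lborel. (U s x - U t x) * ?w x) = (LINT x|lborel. (s - t) * (?q s x * ?w x))"
          using elim by (intro Bochner_Integration.integral_cong) auto
        then show ?thesis by (simp only: integral_mult_right_zero)
      qed
      have e2: "(LINT x|lborel. (U s x - U t x)\<^sup>2) = (s - t)\<^sup>2 * (LINT x|lborel. ?q s x * ?q s x)"
      proof -
        have "(LINT x|lborel. (U s x - U t x)\<^sup>2) = (LINT x|lborel. (s - t)\<^sup>2 * (?q s x * ?q s x))"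
          using elim by (intro Bochner_Integration.integral_cong) (auto simp: power2_eq_square)
        then show ?thesis by (simp only: integral_mult_right_zero)
      qed
      have "\<bar>?y s - ?y t - (s - t) * (LINT x|lborel. ?q s x * ?w x)\<bar> \<le> B * L * ((s - t)\<^sup>2 * (LINT x|lborel. ?q s x * ?q s x))"
        using functional_expansion[OF c orbit_L2[OF orb t] UI[OF t] orbit_L2[OF orb elim(1)] UI[OF elim(1)] m]
        unfolding e1 e2 .
      then have "\<bar>?y s - ?y t - (s - t) * (LINT x|lborel. ?q s x * ?w x)\<bar> / \<bar>s - t\<bar>
          \<le> B * L * ((s - t)\<^sup>2 * (LINT x|lborel. ?q s x * ?q s x)) / \<bar>s - t\<bar>"
        by (rule divide_right_mono) simp
      also have "B * L * ((s - t)\<^sup>2 * (LINT x|lborel. ?q s x * ?q s x)) / \<bar>s - t\<bar> = B * L * (LINT x|lborel. ?q s x * ?q s x) * \<bar>s - t\<bar>"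
      proof -
        have "(s - t)\<^sup>2 * X / \<bar>s - t\<bar> = X * \<bar>s - t\<bar>" for X
          using elim by (simp add: power2_eq_square abs_mult_self_eq[of "s - t", symmetric] del: abs_mult_self_eq)
        then show ?thesis by (simp only: times_divide_eq_right[symmetric] mult.assoc)
      qed
      also have "\<bar>?y s - ?y t - (s - t) * (LINT x|lborel. ?q s x * ?w x)\<bar> / \<bar>s - t\<bar>
          = norm ((?y s - ?y t) / (s - t) - (LINT x|lborel. ?q s x * ?w x))"
        using elim by (simp add: diff_divide_distrib flip: abs_divide)
      finally show ?case .
    qed
  qed
  from tendsto_add[OF l1 l3] show ?thesis
    unfolding has_field_derivative_iff eq[OF dom] by simp
qed

lemma functional_initial:
  assumes orb: "semigroup_orbit J a f U" and c: "C2_pair I L \<Phi> k k'"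
    and UI: "\<And>s. s > 0 \<Longrightarrow> AE x in lborel. U s x \<in> I" and f: "f \<in> L2" "AE x in lborel. f x \<in> I"
    and m: "m \<in> borel_measurable borel" "\<And>x. \<bar>m x\<bar> \<le> B"
  shows "((\<lambda>s. LINT x|lborel. m x * \<Phi> (U s x)) \<longlongrightarrow> (LINT x|lborel. m x * \<Phi> (f x))) (at_right 0)"
proof -
  let ?d = "\<lambda>s x. U s x - f x" and ?w = "\<lambda>x. m x * k (f x)"
  let ?y = "\<lambda>s. LINT x|lborel. m x * \<Phi> (U s x)" and ?yf = "LINT x|lborel. m x * \<Phi> (f x)"
  have pos: "\<forall>\<^sub>F s in at_right (0::real). s > 0" by (simp add: eventually_at_right_less)
  have w: "?w \<in> L2" by (rule functional_integrable[OF c f m])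
  have d: "\<forall>\<^sub>F s in at_right 0. ?d s \<in> L2"
    using pos by eventually_elim (intro L2_diff orbit_L2[OF orb] f)
  have l1: "((\<lambda>s. LINT x|lborel. ?d s x * ?w x) \<longlongrightarrow> 0) (at_right 0)"
    by (rule L2_inner_tendsto_0[OF d _ orbit_initial[OF orb] tendsto_const]) (simp add: w)
  have l2: "((\<lambda>s. LINT x|lborel. (?d s x)\<^sup>2) \<longlongrightarrow> 0) (at_right 0)"
    by (rule integral_sq_tendsto_0[OF d orbit_initial[OF orb]])
  have l3: "((\<lambda>s. ?y s - ?yf - (LINT x|lborel. ?d s x * ?w x)) \<longlongrightarrow> 0) (at_right 0)"
  proof (rule Lim_null_comparison)
    show "\<forall>\<^sub>F s in at_right 0. norm (?y s - ?yf - (LINT x|lborel. ?d s x * ?w x)) \<le> B * L * (LINT x|lborel. (?d s x)\<^sup>2)"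
      using pos by eventually_elim (simp add: functional_expansion[OF c f orbit_L2[OF orb] UI m])
    show "((\<lambda>s. B * L * (LINT x|lborel. (?d s x)\<^sup>2)) \<longlongrightarrow> 0) (at_right 0)"
      using tendsto_mult[OF tendsto_const l2, of "B * L"] by simp
  qed
  from tendsto_add[OF tendsto_add[OF l1 l3] tendsto_const[of ?yf]] show ?thesis by simp
qed

text \<open>The Markov property in infinitesimal form. For nondecreasing \<open>k\<close> the
  product of the increments of u and k(u) is nonnegative at every jump, and the gradient part is
  k'(u) times a nonnegative form. Hence \<integral> \<Phi>(U t) is nonincreasing for convex
  \<Phi>.\<close>

lemma form_E_monotone_nonneg:
  assumes u: "u \<in> form_dom J a" and c: "C2_pair UNIV L \<Phi> k k'" and k': "\<And>s. k' s \<ge> 0"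
  shows "(\<lambda>x. k (u x)) \<in> form_dom J a" "0 \<le> form_E J a u (\<lambda>x. k (u x))"
proof -
  let ?w = "\<lambda>x. 1 * k (u x)"
  have d0: "frechet_derivative (\<lambda>x. 1 :: real) (at x) b = 0" for x b :: "('d, 'n) pt" by (rule C1_fun_const)
  have L: "\<bar>k s - k t\<bar> \<le> L * \<bar>s - t\<bar>" for s t by (rule C2_pair_Lipschitz[OF c]) auto
  have L': "\<bar>k' s\<bar> \<le> L" for s by (rule C2_pairD[OF c]) auto
  note F = form_dom_mult_compose(3,4)[OF u _ UNIV_I C2_pairD(3,4,6)[OF c] L L' C1_fun_const(1)[of 1], of 1, unfolded d0, simplified]
  show w: "(\<lambda>x. k (u x)) \<in> form_dom J a" by (rule F)
  have mono: "mono k"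
  proof (rule monoI)
    fix s t :: real assume "s \<le> t"
    then show "k s \<le> k t"
      by (rule DERIV_nonneg_imp_nondecreasing) (use C2_pairD(3)[OF c] k' in blast)
  qed
  have "0 \<le> (t - s) * (k t - k s)" for s t
    using monoD[OF mono, of s t] monoD[OF mono, of t s]
    by (cases "s \<le> t") (auto simp: mult_nonpos_nonpos)
  then have "0 \<le> form_jump J u (\<lambda>x. k (u x))"
    unfolding form_jump_def
    by (intro Bochner_Integration.integral_nonneg sum_nonneg) (rule mult_nonneg_nonneg[OF _ J_jump_nonneg])
  moreover have "0 \<le> form_diff a u (\<lambda>x. k (u x))"
    unfolding form_diff_Aq(2)[OF u w]
  proof (rule integral_nonneg_AE)
    show "AE x in lborel. 0 \<le> Aq x (\<lambda>j. wgrad u (ediff j) x) (\<lambda>j. wgrad (\<lambda>x. k (u x)) (ediff j) x)"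
      using F(2)
    proof eventually_elim
      case (elim x)
      have "Aq x (\<lambda>j. wgrad u (ediff j) x) (\<lambda>j. wgrad (\<lambda>x. k (u x)) (ediff j) x)
          = k' (u x) * Aq x (\<lambda>j. wgrad u (ediff j) x) (\<lambda>j. wgrad u (ediff j) x)"
        using elim by (simp flip: Aq_bilinear(4))
      then show ?case using k' Aq_nonneg by simp
    qed
  qed
  ultimately show "0 \<le> form_E J a u (\<lambda>x. k (u x))" by (simp add: form_E_def)
qed

text \<open>The convex function \<open>\<Phi>\<close> of the proof vanishes exactly where \<open>\<sigma> s \<le> M\<close>. The squared positive part
  would be simpler, but its derivative is not \<open>C1\<close>, which the chain rule requires.\<close>

lemma orbit_one_sided_bound:
  assumes orb: "semigroup_orbit J a f U" and f: "f \<in> L2" "AE x in lborel. \<sigma> * f x \<le> M" and M: "M \<ge> 0"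
    and \<sigma>: "\<sigma> = 1 \<or> \<sigma> = (-1::real)" and t: "t > 0"
  shows "AE x in lborel. \<sigma> * U t x \<le> M"
proof -
  have \<sigma>2: "\<sigma> * \<sigma> = 1" using \<sigma> by auto
  let ?h = "\<lambda>s. max 0 (\<sigma> * s - M)"
  \<comment> \<open>Built by integrating twice: on h \<ge> 0, \<open>?F'\<close> is continuous,
    vanishes at 0 and is at most 1, and \<open>?F\<close> and \<open>?G\<close> are its successive
    primitives vanishing at 0. Evaluated at the excess \<open>?h\<close> of \<sigma> s over
    \<open>M\<close> they give a \<open>C2_pair\<close> on the whole line with constant 1.\<close>
  let ?F = "\<lambda>h::real. h - ln (1 + h)" and ?F' = "\<lambda>h::real. h / (1 + h)"
  let ?G = "\<lambda>h::real. h\<^sup>2 / 2 - (1 + h) * ln (1 + h) + h"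
  let ?\<Phi> = "\<lambda>s. ?G (?h s)" and ?k = "\<lambda>s. \<sigma> * ?F (?h s)" and ?k' = "\<lambda>s. ?F' (?h s)"
  have dF: "(?F has_real_derivative ?F' s) (at s)" if "s \<ge> 0" for s
    using that by (auto intro!: derivative_eq_intros simp: field_simps)
  have dG: "(?G has_real_derivative ?F s) (at s)" if "s \<ge> 0" for s
  proof -
    have "(?G has_real_derivative (s - (ln (1 + s) + (1 + s) * (1 / (1 + s))) + 1)) (at s)"
      using that by (auto intro!: derivative_eq_intros)
    then show ?thesis using that by simp
  qed
  have lin: "((\<lambda>s. \<sigma> * s - M) has_real_derivative \<sigma>) (at s)" for s by (auto intro!: derivative_eq_intros)
  have dk: "(?k has_real_derivative ?k' s) (at s)" for s
  proof -
    have "((\<lambda>s. ?F (?h s)) has_real_derivative ?F' (?h s) * \<sigma>) (at s)"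
      using DERIV_chain2[OF has_real_derivative_positive_part[OF dF] lin, of s] by simp
    moreover have "\<sigma> * (?F' (?h s) * \<sigma>) = ?F' (?h s)" using \<sigma> by auto
    ultimately show ?thesis by (rule DERIV_cong[OF DERIV_cmult])
  qed
  have d\<Phi>: "(?\<Phi> has_real_derivative ?k s) (at s)" for s
    using DERIV_chain2[OF has_real_derivative_positive_part[OF dG] lin, of s] by (simp add: mult.commute)
  have ck': "continuous_on UNIV ?k'"
    by (intro continuous_intros) (simp add: add_nonneg_eq_0_iff)
  have k'0: "?k' s \<ge> 0" for s by simp
  have k'1: "\<bar>?k' s\<bar> \<le> 1" for s by simp
  have c: "C2_pair UNIV 1 ?\<Phi> ?k ?k'"
    unfolding C2_pair_def using d\<Phi> dk ck' k'1 M by (simp add: max_def)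
  have G0: "?G h > 0" if "h > 0" for h
  proof -
    have "?G 0 < ?G h"
    proof (rule DERIV_pos_imp_increasing_open[OF that])
      fix x :: real assume "0 < x" "x < h"
      then show "\<exists>y. (?G has_real_derivative y) (at x) \<and> 0 < y"
        using dG[of x] ln_add_one_self_less_self[of x] by (intro exI[of _ "?F x"]) auto
    next
      show "continuous_on {0..h} ?G" by (intro continuous_intros) auto
    qed
    then show ?thesis by simp
  qed
  have \<Phi>0: "?\<Phi> s \<ge> 0" for s
    using G0[of "?h s"] by (cases "?h s = 0") (auto simp: less_imp_le)
  let ?y = "\<lambda>s. LINT x|lborel. 1 * ?\<Phi> (U s x)"
  have "?y t \<le> (LINT x|lborel. 1 * ?\<Phi> (f x))"
  proof (rule nonincreasing_from_limit[OF _ _ t])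
    show "(?y \<longlongrightarrow> (LINT x|lborel. 1 * ?\<Phi> (f x))) (at_right 0)"
      by (rule functional_initial[OF orb c _ f(1), where B = 1]) auto
    fix s :: real assume s: "s > 0" "s \<le> t"
    have "(\<lambda>x. 1 * ?k (U s x)) \<in> form_dom J a" "0 \<le> form_E J a (U s) (\<lambda>x. 1 * ?k (U s x))"
      using form_E_monotone_nonneg[OF orbit_form_dom[OF orb s(1)] c k'0] by simp_all
    moreover from this(1) have "(?y has_real_derivative - form_E J a (U s) (\<lambda>x. 1 * ?k (U s x))) (at s)"
      by (intro functional_deriv[OF orb s(1) c, where B = 1]) auto
    ultimately show "\<exists>D. (?y has_real_derivative D) (at s) \<and> D \<le> 0" by (intro exI conjI) auto
  qed
  also have "(LINT x|lborel. 1 * ?\<Phi> (f x)) = 0"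
    by (rule integral_eq_zero_AE) (use f(2) in eventually_elim, simp add: max_absorb1)
  finally have "?y t \<le> 0" by simp
  moreover have "0 \<le> ?y t" by (intro Bochner_Integration.integral_nonneg) (use \<Phi>0 in simp)
  ultimately have "(LINT x|lborel. 1 * ?\<Phi> (U t x)) = 0" by linarith
  moreover have "integrable lborel (\<lambda>x. 1 * ?\<Phi> (U t x))"
    by (rule functional_integrable[OF c orbit_L2[OF orb t], where B = 1]) auto
  ultimately have "AE x in lborel. 1 * ?\<Phi> (U t x) = 0"
    using \<Phi>0 by (subst (asm) integral_nonneg_eq_0_iff_AE) auto
  then show ?thesis
  proof eventually_elim
    case (elim x)
    then show ?case using G0[of "?h (U t x)"] by (cases "\<sigma> * U t x \<le> M") auto
  qed
qed

text \<open>The two signs of the one-sided bound. Confining the values of the orbit to [-M, M],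
  where powers are Lipschitz, is what puts weighted powers of the orbit into the form
  domain.\<close>

lemma orbit_bounded:
  assumes orb: "semigroup_orbit J a f U" and f: "f \<in> L2" "AE x in lborel. \<bar>f x\<bar> \<le> M" and M: "M \<ge> 0" and t: "t > 0"
  shows "AE x in lborel. \<bar>U t x\<bar> \<le> M"
proof -
  have b: "AE x in lborel. 1 * f x \<le> M" "AE x in lborel. -1 * f x \<le> M"
    using f(2) by (eventually_elim, simp)+
  have "AE x in lborel. 1 * U t x \<le> M" "AE x in lborel. -1 * U t x \<le> M"
    by (rule orbit_one_sided_bound[OF orb f(1) b(1) M _ t], simp)
      (rule orbit_one_sided_bound[OF orb f(1) b(2) M _ t], simp)
  then show ?thesis by eventually_elim auto
qed

text \<open>The derivative of \<open>s \<mapsto> \<integral> U s * W (T - s)\<close> vanishes by the symmetry of the form.\<close>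

lemma orbit_duality:
  assumes U: "semigroup_orbit J a f U" and W: "semigroup_orbit J a g W" and f: "f \<in> L2" and g: "g \<in> L2"
    and s: "0 < s" "s < T"
  shows "(LINT x|lborel. U s x * W (T - s) x) = (LINT x|lborel. f x * W T x)"
    and "(LINT x|lborel. U s x * W (T - s) x) = (LINT x|lborel. U T x * g x)"
proof -
  let ?y = "\<lambda>s. LINT x|lborel. U s x * W (T - s) x"
  obtain U' where Ud: "orbit_deriv U U'" using orbit_deriv_exists[OF U] by blast
  note U' = orbit_derivD[OF Ud]
  obtain W' where Wd: "orbit_deriv W W'" using orbit_deriv_exists[OF W] by blast
  note W' = orbit_derivD[OF Wd]
  have der: "(?y has_real_derivative 0) (at r)" if r: "0 < r" "r < T" for r
  proof -
    have r': "T - r > 0" using r by simp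
    have fl: "filterlim (\<lambda>z. T - z) (at (T - r)) (at r)"
      unfolding filterlim_at by (auto intro!: tendsto_intros simp: eventually_at exI[of _ 1])
    have Wc: "((\<lambda>z. sqn (\<lambda>x. W (T - z) x - W (T - r) x)) \<longlongrightarrow> 0) (at r)"
      by (rule filterlim_compose[OF orbit_continuous[OF W r'] fl])
    have Wq: "((\<lambda>z. sqn (\<lambda>x. (W (T - z) x - W (T - r) x) / ((T - z) - (T - r)) - W' (T - r) x)) \<longlongrightarrow> 0) (at r)"
      by (rule filterlim_compose[OF W'(2)[OF r'] fl])
    have WL: "\<forall>\<^sub>F z in at r. W (T - z) \<in> L2"
      using filterlim_iff[THEN iffD1, OF fl] orbit_quotient_L2(2)[OF W r'] by blast
    have WqL: "\<forall>\<^sub>F z in at r. (\<lambda>x. (W (T - z) x - W (T - r) x) / ((T - z) - (T - r))) \<in> L2"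
      using filterlim_iff[THEN iffD1, OF fl] orbit_quotient_L2(1)[OF W r'] by blast
    have UL: "U r \<in> L2" by (rule orbit_L2[OF U r(1)])
    have l1: "((\<lambda>z. LINT x|lborel. (U z x - U r x) / (z - r) * W (T - z) x) \<longlongrightarrow> (LINT x|lborel. U' r x * W (T - r) x)) (at r)"
      by (rule L2_inner_tendsto[OF orbit_quotient_L2(1)[OF U r(1)] WL U'(1)[OF r(1)] orbit_L2[OF W r'] U'(2)[OF r(1)] Wc])
    have l2: "((\<lambda>z. LINT x|lborel. (W (T - z) x - W (T - r) x) / ((T - z) - (T - r)) * U r x) \<longlongrightarrow> (LINT x|lborel. W' (T - r) x * U r x)) (at r)"
      by (rule L2_inner_tendsto[OF WqL _ W'(1)[OF r'] UL Wq]) (simp_all add: UL sqn_def)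
    have "((\<lambda>z. (?y z - ?y r) / (z - r)) \<longlongrightarrow> (LINT x|lborel. U' r x * W (T - r) x) - (LINT x|lborel. W' (T - r) x * U r x)) (at r)"
    proof (rule Lim_transform_eventually[OF tendsto_diff[OF l1 l2]])
      show "\<forall>\<^sub>F z in at r. (LINT x|lborel. (U z x - U r x) / (z - r) * W (T - z) x)
          - (LINT x|lborel. (W (T - z) x - W (T - r) x) / ((T - z) - (T - r)) * U r x) = (?y z - ?y r) / (z - r)"
        using WL orbit_quotient_L2[OF U r(1)] WqL eventually_neq_at_within[of r r UNIV]
      proof eventually_elim
        case (elim z)
        have "(LINT x|lborel. (U z x - U r x) / (z - r) * W (T - z) x)
          - (LINT x|lborel. (W (T - z) x - W (T - r) x) / ((T - z) - (T - r)) * U r x)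
          = (LINT x|lborel. (U z x - U r x) / (z - r) * W (T - z) x - (W (T - z) x - W (T - r) x) / ((T - z) - (T - r)) * U r x)"
          using elim UL by (intro Bochner_Integration.integral_diff[symmetric] integrable_mult_L2)
        also have "\<dots> = (LINT x|lborel. (U z x * W (T - z) x - U r x * W (T - r) x) / (z - r))"
        proof (rule Bochner_Integration.integral_cong[OF refl])
          fix x
          have alg: "(a1 - a0) / e * b1 - (b1 - b0) / (- e) * a0 = (a1 * b1 - a0 * b0) / e" if "e \<noteq> 0" for a1 a0 b1 b0 e :: real
            using that by (simp add: field_simps)
          show "(U z x - U r x) / (z - r) * W (T - z) x - (W (T - z) x - W (T - r) x) / ((T - z) - (T - r)) * U r x
             = (U z x * W (T - z) x - U r x * W (T - r) x) / (z - r)"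
            using alg[of "z - r"] elim by simp
        qed
        also have "\<dots> = (?y z - ?y r) / (z - r)"
          using integrable_mult_L2[OF elim(3,1)] integrable_mult_L2[OF UL orbit_L2[OF W r']] by simp
        finally show ?case .
      qed
    qed
    moreover have "(LINT x|lborel. U' r x * W (T - r) x) - (LINT x|lborel. W' (T - r) x * U r x) = 0"
      using U'(3)[OF r(1) orbit_form_dom[OF W r']] W'(3)[OF r' orbit_form_dom[OF U r(1)]]
        form_E_sym[OF orbit_form_dom[OF U r(1)] orbit_form_dom[OF W r']] by simp
    ultimately show ?thesis by (simp add: has_field_derivative_iff)
  qed
  have const: "?y r = ?y s" if "0 < r" "r < T" for r
    by (rule DERIV_isconst3[where a = 0 and b = T and x = r and y = s and f = ?y]) (use that s der in auto)
  have T: "T > 0" using s by simp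
  \<comment> \<open>The constant value is identified at both ends: at 0 as the pairing of f with W
    T, at T as the pairing of U T with g. Each time one orbit contributes its continuity and the
    other its initial condition.\<close>
  have "(?y \<longlongrightarrow> (LINT x|lborel. f x * W T x)) (at_right 0)"
  proof (rule L2_inner_tendsto[OF _ _ f orbit_L2[OF W T] orbit_initial[OF U]])
    have fl: "filterlim (\<lambda>z. T - z) (at T) (at_right 0)"
      unfolding filterlim_at using T
      by (auto intro!: tendsto_eq_intros simp: eventually_at_right_field exI[of _ 1])
    show "((\<lambda>z. sqn (\<lambda>x. W (T - z) x - W T x)) \<longlongrightarrow> 0) (at_right 0)"
      by (rule filterlim_compose[OF orbit_continuous[OF W T] fl])
    show "\<forall>\<^sub>F z in at_right 0. W (T - z) \<in> L2"
      using filterlim_iff[THEN iffD1, OF fl] orbit_quotient_L2(2)[OF W T] by blast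
    show "\<forall>\<^sub>F z in at_right 0. U z \<in> L2"
      using orbit_L2[OF U] by (auto simp: eventually_at_right_field intro!: exI[of _ 1])
  qed
  moreover have "(?y \<longlongrightarrow> ?y s) (at_right 0)"
    by (rule Lim_transform_eventually[OF tendsto_const])
      (use const T in \<open>auto simp: eventually_at_right_field intro!: exI[of _ T]\<close>)
  ultimately show "?y s = (LINT x|lborel. f x * W T x)"
    by (rule tendsto_unique[OF trivial_limit_at_right_real, rotated])
  have "(?y \<longlongrightarrow> (LINT x|lborel. U T x * g x)) (at_left T)"
  proof (rule L2_inner_tendsto[OF _ _ orbit_L2[OF U T] g])
    have fl: "filterlim (\<lambda>z. T - z) (at_right 0) (at_left T)"
      unfolding filterlim_at using T
      by (auto intro!: tendsto_eq_intros simp: eventually_at_left_field exI[of _ 0])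
    show "((\<lambda>z. sqn (\<lambda>x. W (T - z) x - g x)) \<longlongrightarrow> 0) (at_left T)"
      by (rule filterlim_compose[OF orbit_initial[OF W] fl])
    show "((\<lambda>z. sqn (\<lambda>x. U z x - U T x)) \<longlongrightarrow> 0) (at_left T)"
      using orbit_continuous[OF U T] by (rule tendsto_within_subset) simp
    show "\<forall>\<^sub>F z in at_left T. W (T - z) \<in> L2" "\<forall>\<^sub>F z in at_left T. U z \<in> L2"
      using orbit_L2[OF W] orbit_L2[OF U] T by (auto simp: eventually_at_left_field intro!: exI[of _ 0])
  qed
  moreover have "(?y \<longlongrightarrow> ?y s) (at_left T)"
    by (rule Lim_transform_eventually[OF tendsto_const])
      (use const T in \<open>auto simp: eventually_at_left_field intro!: exI[of _ 0]\<close>)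
  ultimately show "?y s = (LINT x|lborel. U T x * g x)"
    by (rule tendsto_unique[OF trivial_limit_at_left_real, rotated])
qed

end

section \<open>The energy inequality for weighted powers\<close>

text \<open>b^(q+1) - a^(q+1) is b - a times the sum of the q + 1 monomials a^(q-i) b^i. By
  Cauchy-Schwarz the squared sum is at most q + 1 times the sum of squares. These squares are the
  even-indexed monomials in the same factorisation of b^(2q+1) - a^(2q+1), and the other monomials
  are nonnegative.\<close>

lemma power_increment_product_ge:
  fixes a b :: real
  assumes "0 \<le> a" "0 \<le> b"
  shows "(b ^ (q + 1) - a ^ (q + 1))\<^sup>2 \<le> real (q + 1) * ((b ^ (2 * q + 1) - a ^ (2 * q + 1)) * (b - a))"
proof -
  let ?g = "\<lambda>i. a ^ (2 * q + 1 - Suc i) * b ^ i"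
  let ?S = "\<Sum>i<q + 1. a ^ (q + 1 - Suc i) * b ^ i"
  have "?S\<^sup>2 \<le> real (q + 1) * (\<Sum>i<q + 1. (a ^ (q + 1 - Suc i) * b ^ i)\<^sup>2)"
    using sum_square_le_card[of "{..<q + 1}" "\<lambda>i. a ^ (q + 1 - Suc i) * b ^ i"] by simp
  also have "(\<Sum>i<q + 1. (a ^ (q + 1 - Suc i) * b ^ i)\<^sup>2) = (\<Sum>i<q + 1. ?g (2 * i))"
  proof (rule sum.cong[OF refl])
    fix i assume "i \<in> {..<q + 1}"
    then have "2 * q + 1 - Suc (2 * i) = 2 * (q + 1 - Suc i)" by auto
    then show "(a ^ (q + 1 - Suc i) * b ^ i)\<^sup>2 = ?g (2 * i)"
      by (simp only: power_mult_distrib power_mult[symmetric] mult.commute[of _ 2])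
  qed
  also have "\<dots> = sum ?g ((\<lambda>i. 2 * i) ` {..<q + 1})"
    by (subst sum.reindex) (auto simp: inj_on_def)
  also have "\<dots> \<le> sum ?g {..<2 * q + 1}"
    by (rule sum_mono2) (use assms in auto)
  finally have S: "?S\<^sup>2 \<le> real (q + 1) * sum ?g {..<2 * q + 1}" by simp
  have "(b ^ (q + 1) - a ^ (q + 1))\<^sup>2 = (b - a)\<^sup>2 * ?S\<^sup>2"
    using power_diff_sumr2[of b "q + 1" a] by (simp only: power_mult_distrib)
  also have "\<dots> \<le> (b - a)\<^sup>2 * (real (q + 1) * sum ?g {..<2 * q + 1})"
    by (rule mult_left_mono[OF S]) simp
  also have "\<dots> = real (q + 1) * (((b - a) * sum ?g {..<2 * q + 1}) * (b - a))"
    by (simp add: power2_eq_square mult_ac)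
  also have "(b - a) * sum ?g {..<2 * q + 1} = b ^ (2 * q + 1) - a ^ (2 * q + 1)"
    using power_diff_sumr2[of b "2 * q + 1" a] by simp
  finally show ?thesis .
qed

text \<open>The left side is even in z, and for w \<ge> 0 it equals exp (- w) (exp w - 1)^2.\<close>

lemma exp_sum_le: "exp z + exp (- z) - 2 \<le> (exp \<bar>z\<bar> - 1)\<^sup>2" for z :: real
proof -
  have "exp w + exp (- w) - 2 \<le> (exp w - 1)\<^sup>2" if "w \<ge> 0" for w :: real
  proof -
    have "exp w + exp (- w) - 2 = exp (- w) * (exp w - 1)\<^sup>2"
      by (simp add: power2_eq_square algebra_simps flip: exp_add)
    also have "\<dots> \<le> 1 * (exp w - 1)\<^sup>2" by (rule mult_right_mono) (use that in auto)
    finally show ?thesis by simp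
  qed
  from this[of "\<bar>z\<bar>"] show ?thesis by (cases "z \<ge> 0") auto
qed

lemma exp_minus_one_abs_le: "\<bar>exp z - 1\<bar> \<le> exp \<bar>z\<bar> - 1" for z :: real
proof (cases "z \<ge> 0")
  case False
  have "1 \<le> exp (- z) " using False by simp
  moreover have "2 \<le> exp z + exp (- z)"
  proof -
    have "exp z + exp (- z) - 2 = exp (- z) * (exp z - 1)\<^sup>2"
      by (simp add: power2_eq_square algebra_simps flip: exp_add)
    then show ?thesis by (metis diff_ge_0_iff_ge exp_ge_zero mult_nonneg_nonneg zero_le_power2)
  qed
  ultimately show ?thesis using False by simp
qed simp

text \<open>Davies' inequality, where \<open>a = exp (\<psi> x) * u x\<close>, \<open>b = exp (\<psi> y) * u y\<close> and \<open>z = \<psi> y - \<psi> x\<close>: the right-hand side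
  is then the product of the increments of \<open>u\<close> and of \<open>exp ((2 q + 2) \<psi>) u ^ (2 q + 1)\<close>.\<close>

lemma twisted_increment_ge_ordered:
  fixes a b z :: real and q :: nat
  assumes "0 \<le> a" "a \<le> b"
  defines "p \<equiv> real (q + 1)"
  shows "(b ^ (q + 1) - a ^ (q + 1))\<^sup>2 / (2 * p) - 4 * p * (exp \<bar>z\<bar> - 1)\<^sup>2 * (a ^ (2 * q + 2) + b ^ (2 * q + 2))
    \<le> b ^ (2 * q + 2) + a ^ (2 * q + 2) - exp z * (a * b ^ (2 * q + 1)) - exp (- z) * (a ^ (2 * q + 1) * b)"
proof -
  define A B D e where "A = a ^ (q + 1)" and "B = b ^ (q + 1)" and "D = B - A" and "e = exp \<bar>z\<bar> - 1"
  have p1: "p \<ge> 1" by (simp add: p_def)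
  have e0: "e \<ge> 0" by (simp add: e_def)
  have b0: "0 \<le> b" using assms by simp
  have A0: "0 \<le> A" using assms by (simp add: A_def)
  have AB: "A \<le> B" unfolding A_def B_def by (rule power_mono[OF assms(2,1)])
  have sq: "a ^ (2 * q + 2) = A\<^sup>2" "b ^ (2 * q + 2) = B\<^sup>2"
    by (simp_all add: A_def B_def power_mult[symmetric] mult.commute del: power_Suc)
  \<comment> \<open>The two cross terms. The twisted product equals the untwisted one, (b^(2q+1) -
    a^(2q+1)) (b - a), minus (exp z - 1) (X - Y) and minus (exp z + exp (- z) - 2) Y, which are of
    first and second order in z.\<close>
  define X Y where "X = a * b ^ (2 * q + 1)" and "Y = a ^ (2 * q + 1) * b"
  have Xq: "X = a * b ^ q * B" and Yq: "Y = A * (a ^ q * b)"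
  proof -
    have "x ^ (2 * q + 1) = x ^ q * x ^ (q + 1)" for x :: real
      by (simp only: power_add[symmetric] mult_2 add.assoc)
    then show "X = a * b ^ q * B" "Y = A * (a ^ q * b)"
      unfolding X_def Y_def A_def B_def by (simp_all only: mult_ac)
  qed
  have i1: "a * b ^ q \<le> B" unfolding B_def using assms(2) b0 by (simp add: mult_right_mono)
  have i2: "A \<le> a ^ q * b" unfolding A_def using mult_left_mono[OF assms(2), of "a ^ q"] assms(1) by (simp add: mult.commute)
  have i3: "a ^ q * b \<le> B" unfolding B_def using assms b0 by (simp add: mult.commute mult_left_mono power_mono)
  have "X - A * B \<le> B * D"
  proof -
    have "B * D - (X - A * B) = B * (B - a * b ^ q)" by (simp add: Xq D_def algebra_simps)
    also have "\<dots> \<ge> 0" using i1 A0 AB by simp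
    finally show ?thesis by simp
  qed
  moreover have "A * B - Y \<le> B * D"
  proof -
    have "A * B - Y = A * (B - a ^ q * b)" by (simp add: Yq algebra_simps)
    also have "\<dots> \<le> A * D" using i2 A0 by (intro mult_left_mono) (auto simp: D_def)
    also have "\<dots> \<le> B * D" using AB by (intro mult_right_mono) (auto simp: D_def)
    finally show ?thesis .
  qed
  ultimately have XY: "X - Y \<le> 2 * (B * D)" by simp
  have YX: "Y \<le> X"
  proof -
    have "Y = a * b * a ^ (2 * q)" "X = a * b * b ^ (2 * q)" by (simp_all add: X_def Y_def mult_ac)
    then show ?thesis using assms b0 by (auto intro!: mult_left_mono power_mono)
  qed
  have YB: "Y \<le> B\<^sup>2"
    using mult_mono[OF AB i3] A0 AB assms b0 by (simp add: Yq power2_eq_square)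
  have Y0: "0 \<le> Y" using assms b0 by (simp add: Y_def)
  \<comment> \<open>Young's inequality with weight 2 p: of the amount D^2 / p supplied by
    \<open>t3\<close>, one half is spent on the first-order term.\<close>
  have t1: "(exp z - 1) * (X - Y) \<le> D\<^sup>2 / (2 * p) + 2 * p * (e\<^sup>2 * B\<^sup>2)"
  proof -
    have "(exp z - 1) * (X - Y) \<le> \<bar>exp z - 1\<bar> * (X - Y)"
      using YX by (intro mult_right_mono) auto
    also have "\<dots> \<le> e * (2 * (B * D))"
      using XY YX e0 exp_minus_one_abs_le[of z] by (intro mult_mono) (auto simp: e_def)
    also have "\<dots> \<le> D\<^sup>2 / (2 * p) + 2 * p * (e\<^sup>2 * B\<^sup>2)"
    proof -
      have "0 \<le> (D - 2 * p * (e * B))\<^sup>2 / (2 * p)" using p1 by simp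
      also have "\<dots> = D\<^sup>2 / (2 * p) + 2 * p * (e\<^sup>2 * B\<^sup>2) - e * (2 * (B * D))"
        using p1 by (simp add: power2_diff field_simps power2_eq_square)
      finally show ?thesis by simp
    qed
    finally show ?thesis .
  qed
  have t2: "(exp z + exp (- z) - 2) * Y \<le> e\<^sup>2 * B\<^sup>2"
    using exp_sum_le[of z] YB Y0 unfolding e_def by (intro mult_mono) auto
  have t3: "D\<^sup>2 / p \<le> (b ^ (2 * q + 1) - a ^ (2 * q + 1)) * (b - a)"
    using power_increment_product_ge[OF assms(1) b0, of q] p1
    by (simp add: D_def A_def B_def p_def divide_le_eq mult.commute del: power_Suc of_nat_add)
  have t4: "(b ^ (2 * q + 1) - a ^ (2 * q + 1)) * (b - a) = B\<^sup>2 + A\<^sup>2 - X - Y"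
    by (simp add: X_def Y_def sq[symmetric] algebra_simps)
  have "e\<^sup>2 * B\<^sup>2 \<le> p * (e\<^sup>2 * B\<^sup>2)" using p1 mult_right_mono[of 1 p "e\<^sup>2 * B\<^sup>2"] by simp
  moreover have "0 \<le> p * (e\<^sup>2 * A\<^sup>2)" "0 \<le> p * (e\<^sup>2 * B\<^sup>2)" using p1 by simp_all
  moreover have "D\<^sup>2 / p = D\<^sup>2 / (2 * p) + D\<^sup>2 / (2 * p)" using p1 by (simp add: field_simps)
  ultimately have "D\<^sup>2 / (2 * p) - (4 * (p * (e\<^sup>2 * A\<^sup>2)) + 4 * (p * (e\<^sup>2 * B\<^sup>2))) \<le> B\<^sup>2 + A\<^sup>2 - X - Y - (exp z - 1) * (X - Y) - (exp z + exp (- z) - 2) * Y"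
    using t1 t2 t3 t4 by linarith
  also have "\<dots> = B\<^sup>2 + A\<^sup>2 - exp z * X - exp (- z) * Y" by (simp add: algebra_simps)
  finally show ?thesis
    unfolding sq X_def[symmetric] Y_def[symmetric] A_def[symmetric] B_def[symmetric] D_def[symmetric] e_def[symmetric]
    by (simp add: distrib_left mult.assoc)
qed

text \<open>The orbit has no sign. Exchanging a and b together with z and - z, or flipping both
  signs, reduces to 0 \<le> a \<le> b. If a b \<le> 0, both cross terms have the favourable sign,
  and half the square of the difference is at most the sum of the squares.\<close>

lemma twisted_increment_ge:
  fixes a b z :: real and q :: nat
  defines "p \<equiv> real (q + 1)"
  shows "(b ^ (q + 1) - a ^ (q + 1))\<^sup>2 / (2 * p) - 4 * p * (exp \<bar>z\<bar> - 1)\<^sup>2 * (a ^ (2 * q + 2) + b ^ (2 * q + 2))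
    \<le> b ^ (2 * q + 2) + a ^ (2 * q + 2) - exp z * (a * b ^ (2 * q + 1)) - exp (- z) * (a ^ (2 * q + 1) * b)"
    (is "?P a b z")
proof -
  have nn: "?P a b z" if "0 \<le> a" "0 \<le> b" for a b z
  proof (cases "a \<le> b")
    case True
    then show ?thesis unfolding p_def by (rule twisted_increment_ge_ordered[OF that(1)])
  next
    case False
    then have "b \<le> a" by simp
    from twisted_increment_ge_ordered[OF that(2) this, of q "- z"] show ?thesis
      unfolding p_def by (simp add: power2_commute algebra_simps)
  qed
  have p1: "p \<ge> 1" by (simp add: p_def)
  consider "0 \<le> a" "0 \<le> b" | "a \<le> 0" "b \<le> 0" | "a * b \<le> 0" using linear[of 0 a] linear[of 0 b]
    by (auto simp: mult_le_0_iff)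
  then show ?thesis
  proof cases
    case 2
    have s: "((- b) ^ (q + 1) - (- a) ^ (q + 1))\<^sup>2 = (b ^ (q + 1) - a ^ (q + 1))\<^sup>2"
      by (cases "even q") (simp_all add: power2_commute)
    have o: "(- x) ^ (2 * q + 1) = - (x ^ (2 * q + 1))" "(- x) ^ (2 * q + 2) = x ^ (2 * q + 2)" for x :: real
      by simp_all
    from nn[of "- a" "- b" z] 2 show ?thesis unfolding s o by simp
  next
    case 3
    have pw: "x ^ (2 * q + 2) = (x ^ (q + 1))\<^sup>2" for x :: real
      by (simp add: power_mult[symmetric] mult.commute del: power_Suc)
    have ev: "0 \<le> x ^ (2 * q)" for x :: real by simp
    have "a * b ^ (2 * q + 1) = (a * b) * b ^ (2 * q)" "a ^ (2 * q + 1) * b = (a * b) * a ^ (2 * q)" by simp_all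
    then have "a * b ^ (2 * q + 1) \<le> 0" "a ^ (2 * q + 1) * b \<le> 0"
      using 3 ev by (simp_all only: mult_nonpos_nonneg)
    then have "exp z * (a * b ^ (2 * q + 1)) \<le> 0" "exp (- z) * (a ^ (2 * q + 1) * b) \<le> 0"
      by (simp_all only: mult_nonneg_nonpos exp_ge_zero)
    moreover have "(b ^ (q + 1) - a ^ (q + 1))\<^sup>2 / (2 * p) \<le> (b ^ (q + 1))\<^sup>2 + (a ^ (q + 1))\<^sup>2"
    proof -
      have "(b ^ (q + 1) - a ^ (q + 1))\<^sup>2 / (2 * p) \<le> (b ^ (q + 1) - a ^ (q + 1))\<^sup>2 / 2"
        using p1 by (intro divide_left_mono) auto
      also have "\<dots> \<le> (b ^ (q + 1))\<^sup>2 + (a ^ (q + 1))\<^sup>2"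
      proof -
        have "(y - x)\<^sup>2 / 2 \<le> y\<^sup>2 + x\<^sup>2" for x y :: real
          using zero_le_power2[of "y + x"] unfolding power2_sum power2_diff by (simp add: field_simps)
        then show ?thesis .
      qed
      finally show ?thesis .
    qed
    moreover have "0 \<le> 4 * p * (exp \<bar>z\<bar> - 1)\<^sup>2 * (a ^ (2 * q + 2) + b ^ (2 * q + 2))"
      unfolding pw using p1 by simp
    ultimately show ?thesis unfolding pw by linarith
  qed (rule nn)
qed

text \<open>The factor 1 / (n + 2) makes the derivative a pure power. The second derivative is
  bounded only on [-M, M], which is where the boundedness of the orbit enters.\<close>

lemma C2_pair_power:
  assumes "M \<ge> 0"
  shows "C2_pair {-M..M} (real (n + 1) * M ^ n) (\<lambda>s. s ^ (n + 2) / real (n + 2)) (\<lambda>s. s ^ (n + 1)) (\<lambda>s. real (n + 1) * s ^ n)"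
  unfolding C2_pair_def
proof (intro conjI allI ballI)
  show "((\<lambda>s. s ^ (n + 2) / real (n + 2)) has_real_derivative s ^ (n + 1)) (at s)" for s
    using DERIV_cdivide[OF DERIV_pow[of "n + 2" s], of "real (n + 2)"] by (simp del: power_Suc)
  show "((\<lambda>s. s ^ (n + 1)) has_real_derivative real (n + 1) * s ^ n) (at s)" for s
    by (rule derivative_eq_intros refl | simp add: field_simps)+
  show "\<bar>real (n + 1) * s ^ n\<bar> \<le> real (n + 1) * M ^ n" if "s \<in> {-M..M}" for s
    using that power_mono[of "\<bar>s\<bar>" M n] by (simp add: abs_mult power_abs mult_left_mono abs_le_iff)
qed (use assms in \<open>auto intro!: continuous_intros\<close>)

lemma C1_fun_exp_mult:
  assumes "C1_fun \<psi>"
  shows "C1_fun (\<lambda>x. exp (c * \<psi> x))"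
    "frechet_derivative (\<lambda>x. exp (c * \<psi> x)) (at x) b = c * frechet_derivative \<psi> (at x) b * exp (c * \<psi> x)"
proof -
  have d: "((\<lambda>s. exp (c * s)) has_real_derivative c * exp (c * s)) (at s)" for s
    by (auto intro!: derivative_eq_intros)
  have ct: "continuous_on UNIV (\<lambda>s. c * exp (c * s))" by (intro continuous_intros)
  show "C1_fun (\<lambda>x. exp (c * \<psi> x))"
    by (rule C1_fun_compose(1)[OF assms d ct])
  show "frechet_derivative (\<lambda>x. exp (c * \<psi> x)) (at x) b = c * frechet_derivative \<psi> (at x) b * exp (c * \<psi> x)"
    using C1_fun_compose(2)[OF assms d ct] by simp
qed

section \<open>Admissible weights and lower bounds for the twisted form\<close>

context dirichlet_setting
begin

text \<open>\<open>B\<close> keeps weighted powers in the form domain, while \<Gamma> carries the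
  estimates. The jump increment occurs as exp |\<psi> y - \<psi> x| - 1, which is unchanged when x
  and y are exchanged or \<psi> is replaced by - \<psi>; \<open>weight_error_le\<close> and
  \<open>weight_uminus\<close> rely on these symmetries.\<close>

definition weight :: "(('d, 'n) pt \<Rightarrow> real) \<Rightarrow> real \<Rightarrow> real \<Rightarrow> bool" where
  "weight \<psi> B \<Gamma> \<longleftrightarrow> C1_fun \<psi> \<and> (\<forall>x. \<bar>\<psi> x\<bar> \<le> B) \<and> (\<forall>x. \<forall>b\<in>Basis. \<bar>frechet_derivative \<psi> (at x) b\<bar> \<le> B) \<and>
     0 \<le> \<Gamma> \<and> (\<forall>x. (\<Sum>j\<in>UNIV. (frechet_derivative \<psi> (at x) (ediff j))\<^sup>2) \<le> \<Gamma>) \<and>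
     (\<forall>x. (\<Sum>i\<in>UNIV. \<integral>\<^sup>+h. ennreal ((exp \<bar>\<psi> (x + h *\<^sub>R ejump i) - \<psi> x\<bar> - 1)\<^sup>2 * \<bar>h\<bar> powr (-1 - \<alpha>)) \<partial>lborel) \<le> ennreal \<Gamma>)"

lemma form_dom_exp_mult_power:
  assumes u: "u \<in> form_dom J a" and M: "M \<ge> 0" "AE x in lborel. \<bar>u x\<bar> \<le> M" and \<psi>: "weight \<psi> B \<Gamma>"
  shows "(\<lambda>x. exp (c * \<psi> x) * u x ^ (n + 1)) \<in> form_dom J a"
    "AE x in lborel. \<forall>j. wgrad (\<lambda>x. exp (c * \<psi> x) * u x ^ (n + 1)) (ediff j) x
      = exp (c * \<psi> x) * (c * frechet_derivative \<psi> (at x) (ediff j) * u x ^ (n + 1) + real (n + 1) * u x ^ n * wgrad u (ediff j) x)"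
proof -
  have C: "C1_fun \<psi>" and B: "\<And>x. \<bar>\<psi> x\<bar> \<le> B" "\<And>x b. b \<in> Basis \<Longrightarrow> \<bar>frechet_derivative \<psi> (at x) b\<bar> \<le> B"
    using \<psi> by (auto simp: weight_def)
  have B0: "B \<ge> 0" using B(1)[of 0] by linarith
  let ?B = "(1 + \<bar>c\<bar> * B) * exp (\<bar>c\<bar> * B)"
  have e: "exp (c * \<psi> x) \<le> exp (\<bar>c\<bar> * B)" for x
  proof -
    have "c * \<psi> x \<le> \<bar>c\<bar> * \<bar>\<psi> x\<bar>" using abs_ge_self[of "c * \<psi> x"] by (simp add: abs_mult)
    also have "\<dots> \<le> \<bar>c\<bar> * B" by (intro mult_left_mono B) simp
    finally show ?thesis by simp
  qed
  have cB: "0 \<le> \<bar>c\<bar> * B" using B0 by simp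
  have b1: "\<bar>exp (c * \<psi> x)\<bar> \<le> ?B" for x
    using order_trans[OF e[of x], of ?B] mult_right_mono[of 1 "1 + \<bar>c\<bar> * B" "exp (\<bar>c\<bar> * B)"] cB
    by (simp del: exp_le_cancel_iff)
  have b2: "\<bar>frechet_derivative (\<lambda>x. exp (c * \<psi> x)) (at x) b\<bar> \<le> ?B" if "b \<in> Basis" for x b
  proof -
    have "\<bar>c\<bar> * \<bar>frechet_derivative \<psi> (at x) b\<bar> \<le> 1 + \<bar>c\<bar> * B"
      using mult_left_mono[OF B(2)[OF that, of x], of "\<bar>c\<bar>"] by simp
    then show ?thesis
      using e[of x] cB by (simp add: C1_fun_exp_mult[OF C] abs_mult mult_mono)
  qed
  have uI: "AE x in lborel. u x \<in> {-M..M}" using M(2) by eventually_elim auto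
  note c2 = C2_pair_power[OF M(1), of n]
  note R = form_dom_mult_compose[OF u uI C2_pairD(1)[OF c2] C2_pairD(3,4,6)[OF c2] C2_pair_Lipschitz[OF c2] C2_pairD(7)[OF c2]
      C1_fun_exp_mult(1)[OF C] b1 b2]
  show "(\<lambda>x. exp (c * \<psi> x) * u x ^ (n + 1)) \<in> form_dom J a" by (rule R(3))
  show "AE x in lborel. \<forall>j. wgrad (\<lambda>x. exp (c * \<psi> x) * u x ^ (n + 1)) (ediff j) x
      = exp (c * \<psi> x) * (c * frechet_derivative \<psi> (at x) (ediff j) * u x ^ (n + 1) + real (n + 1) * u x ^ n * wgrad u (ediff j) x)"
  proof -
    have "AE x in lborel. \<forall>j. wgrad (\<lambda>x. exp (c * \<psi> x) * u x ^ (n + 1)) (ediff j) x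
      = frechet_derivative (\<lambda>x. exp (c * \<psi> x)) (at x) (ediff j) * u x ^ (n + 1)
        + exp (c * \<psi> x) * (real (n + 1) * u x ^ n) * wgrad u (ediff j) x"
      by (rule R(4))
    then show ?thesis
    proof eventually_elim
      case (elim x)
      show ?case
      proof
        fix j
        show "wgrad (\<lambda>x. exp (c * \<psi> x) * u x ^ (n + 1)) (ediff j) x
          = exp (c * \<psi> x) * (c * frechet_derivative \<psi> (at x) (ediff j) * u x ^ (n + 1) + real (n + 1) * u x ^ n * wgrad u (ediff j) x)"
          unfolding elim[rule_format, of j] C1_fun_exp_mult(2)[OF C] by (simp add: algebra_simps)
      qed
    qed
  qed
qed

text \<open>A real number: on the form domain the jump energies are finite, so
  \<open>enn2real\<close> loses nothing there.\<close>

definition model_energy :: "(('d, 'n) pt \<Rightarrow> real) \<Rightarrow> real" where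
  "model_energy V = (\<Sum>i\<in>UNIV. enn2real (jump_energy \<alpha> V i)) + (\<Sum>j\<in>UNIV. LINT x|lborel. (wgrad V (ediff j) x)\<^sup>2)"

lemma model_energy_nonneg: "0 \<le> model_energy V"
  unfolding model_energy_def by (intro add_nonneg_nonneg sum_nonneg integral_sq_nonneg) simp

text \<open>The half with V at x is integrated over h and summed over the directions, which gives at
  most \<Gamma>. The half with V at the landing point becomes the same integral after the
  translation x \<mapsto> x - h e_i and the reflection h \<mapsto> - h, because the weight increment
  is symmetric. Hence 2 \<Gamma>.\<close>

lemma weight_error_le:
  fixes V :: "('d, 'n) pt \<Rightarrow> real"
  assumes V[measurable]: "V \<in> borel_measurable borel" and \<psi>: "weight \<psi> B \<Gamma>"
  shows "(\<Sum>i\<in>UNIV. \<integral>\<^sup>+z. (\<lambda>(x, h). ennreal ((exp \<bar>\<psi> (x + h *\<^sub>R ejump i) - \<psi> x\<bar> - 1)\<^sup>2 * ((V x)\<^sup>2 + (V (x + h *\<^sub>R ejump i))\<^sup>2) * \<bar>h\<bar> powr (-1 - \<alpha>))) z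
      \<partial>(lborel \<Otimes>\<^sub>M lborel)) \<le> ennreal (2 * \<Gamma>) * sqn V"
proof -
  have C: "C1_fun \<psi>" and G: "0 \<le> \<Gamma>" using \<psi> by (auto simp: weight_def)
  note [measurable] = C1_fun_measurable[OF C]
  define E where "E i x h = (exp \<bar>\<psi> (x + h *\<^sub>R ejump i) - \<psi> x\<bar> - 1)\<^sup>2 * \<bar>h\<bar> powr (-1 - \<alpha>)" for i :: 'd and x and h :: real
  have E0: "0 \<le> E i x h" for i x h by (simp add: E_def)
  have [measurable]: "(\<lambda>z. E i (f z) (g z)) \<in> borel_measurable N"
    if [measurable]: "f \<in> borel_measurable N" "g \<in> borel_measurable N" for i f g and N :: "'z measure"
    unfolding E_def by measurable
  define A where "A i x = (\<integral>\<^sup>+h. ennreal (E i x h) \<partial>lborel)" for i x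
  have [measurable]: "A i \<in> borel_measurable borel" for i unfolding A_def by measurable
  have one: "(\<integral>\<^sup>+x. (\<integral>\<^sup>+h. ennreal ((V x)\<^sup>2) * ennreal (E i x h) \<partial>lborel) \<partial>lborel) = (\<integral>\<^sup>+x. ennreal ((V x)\<^sup>2) * A i x \<partial>lborel)" for i
    unfolding A_def by (simp add: nn_integral_cmult)
  have two: "(\<integral>\<^sup>+x. (\<integral>\<^sup>+h. ennreal ((V (x + h *\<^sub>R ejump i))\<^sup>2) * ennreal (E i x h) \<partial>lborel) \<partial>lborel) = (\<integral>\<^sup>+x. ennreal ((V x)\<^sup>2) * A i x \<partial>lborel)" for i
  proof -
    have "(\<integral>\<^sup>+x. (\<integral>\<^sup>+h. ennreal ((V (x + h *\<^sub>R ejump i))\<^sup>2) * ennreal (E i x h) \<partial>lborel) \<partial>lborel)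
        = (\<integral>\<^sup>+h. (\<integral>\<^sup>+x. ennreal ((V (x + h *\<^sub>R ejump i))\<^sup>2) * ennreal (E i x h) \<partial>lborel) \<partial>lborel)"
      by (rule lborel_pair.Fubini'[symmetric]) measurable
    also have "\<dots> = (\<integral>\<^sup>+h. (\<integral>\<^sup>+x. ennreal ((V x)\<^sup>2) * ennreal (E i (x - h *\<^sub>R ejump i) h) \<partial>lborel) \<partial>lborel)"
    proof (rule nn_integral_cong)
      fix h
      show "(\<integral>\<^sup>+x. ennreal ((V (x + h *\<^sub>R ejump i))\<^sup>2) * ennreal (E i x h) \<partial>lborel) = (\<integral>\<^sup>+x. ennreal ((V x)\<^sup>2) * ennreal (E i (x - h *\<^sub>R ejump i) h) \<partial>lborel)"
        using nn_integral_lborel_shift[of "\<lambda>x. ennreal ((V x)\<^sup>2) * ennreal (E i (x - h *\<^sub>R ejump i) h)" "h *\<^sub>R ejump i"] by simp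
    qed
    also have "\<dots> = (\<integral>\<^sup>+x. (\<integral>\<^sup>+h. ennreal ((V x)\<^sup>2) * ennreal (E i (x - h *\<^sub>R ejump i) h) \<partial>lborel) \<partial>lborel)"
      by (rule lborel_pair.Fubini') measurable
    also have "\<dots> = (\<integral>\<^sup>+x. ennreal ((V x)\<^sup>2) * A i x \<partial>lborel)"
    proof (rule nn_integral_cong)
      fix x
      have "(\<integral>\<^sup>+h. ennreal (E i (x - h *\<^sub>R ejump i) h) \<partial>lborel) = (\<integral>\<^sup>+h. ennreal (E i (x + h *\<^sub>R ejump i) (- h)) \<partial>lborel)"
        using nn_integral_real_affine[of "\<lambda>h. ennreal (E i (x - h *\<^sub>R ejump i) h)" "-1" 0] by simp
      also have "\<dots> = A i x" unfolding A_def by (simp add: E_def abs_minus_commute)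
      finally show "(\<integral>\<^sup>+h. ennreal ((V x)\<^sup>2) * ennreal (E i (x - h *\<^sub>R ejump i) h) \<partial>lborel) = ennreal ((V x)\<^sup>2) * A i x"
        by (simp add: nn_integral_cmult)
    qed
    finally show ?thesis .
  qed
  have "(\<integral>\<^sup>+z. (\<lambda>(x, h). ennreal ((exp \<bar>\<psi> (x + h *\<^sub>R ejump i) - \<psi> x\<bar> - 1)\<^sup>2 * ((V x)\<^sup>2 + (V (x + h *\<^sub>R ejump i))\<^sup>2) * \<bar>h\<bar> powr (-1 - \<alpha>))) z \<partial>(lborel \<Otimes>\<^sub>M lborel))
      = 2 * (\<integral>\<^sup>+x. ennreal ((V x)\<^sup>2) * A i x \<partial>lborel)" for i
  proof -
    have "(\<integral>\<^sup>+z. (\<lambda>(x, h). ennreal ((exp \<bar>\<psi> (x + h *\<^sub>R ejump i) - \<psi> x\<bar> - 1)\<^sup>2 * ((V x)\<^sup>2 + (V (x + h *\<^sub>R ejump i))\<^sup>2) * \<bar>h\<bar> powr (-1 - \<alpha>))) z \<partial>(lborel \<Otimes>\<^sub>M lborel))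
        = (\<integral>\<^sup>+x. (\<integral>\<^sup>+h. ennreal ((exp \<bar>\<psi> (x + h *\<^sub>R ejump i) - \<psi> x\<bar> - 1)\<^sup>2 * ((V x)\<^sup>2 + (V (x + h *\<^sub>R ejump i))\<^sup>2) * \<bar>h\<bar> powr (-1 - \<alpha>)) \<partial>lborel) \<partial>lborel)"
      by (subst lborel.nn_integral_fst[symmetric]) (auto simp: case_prod_beta')
    also have "\<dots> = (\<integral>\<^sup>+x. (\<integral>\<^sup>+h. ennreal ((V x)\<^sup>2) * ennreal (E i x h) + ennreal ((V (x + h *\<^sub>R ejump i))\<^sup>2) * ennreal (E i x h) \<partial>lborel) \<partial>lborel)"
      by (intro nn_integral_cong) (simp add: E_def algebra_simps flip: ennreal_mult ennreal_plus)
    also have "\<dots> = (\<integral>\<^sup>+x. ennreal ((V x)\<^sup>2) * A i x \<partial>lborel) + (\<integral>\<^sup>+x. ennreal ((V x)\<^sup>2) * A i x \<partial>lborel)"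
      by (simp add: nn_integral_add one two)
    finally show ?thesis by (simp add: mult_2)
  qed
  then have "(\<Sum>i\<in>UNIV. \<integral>\<^sup>+z. (\<lambda>(x, h). ennreal ((exp \<bar>\<psi> (x + h *\<^sub>R ejump i) - \<psi> x\<bar> - 1)\<^sup>2 * ((V x)\<^sup>2 + (V (x + h *\<^sub>R ejump i))\<^sup>2) * \<bar>h\<bar> powr (-1 - \<alpha>))) z
      \<partial>(lborel \<Otimes>\<^sub>M lborel)) = 2 * (\<integral>\<^sup>+x. ennreal ((V x)\<^sup>2) * (\<Sum>i\<in>UNIV. A i x) \<partial>lborel)"
    by (simp add: sum_distrib_left nn_integral_sum)
  also have "\<dots> \<le> 2 * (\<integral>\<^sup>+x. ennreal ((V x)\<^sup>2) * ennreal \<Gamma> \<partial>lborel)"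
    using \<psi> unfolding weight_def A_def E_def by (intro mult_left_mono nn_integral_mono) auto
  also have "\<dots> = ennreal (2 * \<Gamma>) * sqn V"
    using G by (simp add: nn_integral_multc sqn_def ennreal_mult) (simp add: mult_ac)
  finally show ?thesis .
qed

text \<open>\<open>twisted_increment_ge\<close> is applied at every (x, h), with the values of
  exp(\<psi>) u at the two ends of the jump, and integrated. \<open>J\<close> is bounded below in
  the good term and above in the error term, each time at the cost of \<kappa>. The 8 is the 4 of
  the pointwise inequality times the 2 of \<open>weight_error_le\<close>.\<close>

lemma form_jump_twisted_ge:
  fixes q :: nat
  assumes u: "u \<in> form_dom J a" and M: "M \<ge> 0" "AE x in lborel. \<bar>u x\<bar> \<le> M" and \<psi>: "weight \<psi> B \<Gamma>"
  defines "p \<equiv> real (q + 1)"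
  defines "w \<equiv> \<lambda>x. exp (2 * p * \<psi> x) * u x ^ (2 * q + 1)" and "V \<equiv> \<lambda>x. exp (p * \<psi> x) * u x ^ (q + 1)"
  shows "form_jump J u w \<ge> (\<Sum>i\<in>UNIV. enn2real (jump_energy \<alpha> V i)) / (2 * p * \<kappa>) - 8 * p * \<kappa> * \<Gamma> * (LINT x|lborel. (V x)\<^sup>2)"
proof -
  have p1: "p \<ge> 1" by (simp add: p_def)
  have G: "\<Gamma> \<ge> 0" and C: "C1_fun \<psi>" using \<psi> by (auto simp: weight_def)
  have w: "w \<in> form_dom J a" unfolding w_def by (rule form_dom_exp_mult_power[OF u M \<psi>])
  have V: "V \<in> form_dom J a" unfolding V_def by (rule form_dom_exp_mult_power[OF u M \<psi>])
  have VL: "V \<in> L2" by (rule form_domD(1)[OF V])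
  note [measurable] = VL[THEN L2_measurable] C1_fun_measurable[OF C]
  define F where "F i z = (\<lambda>(x, h). (u (x + h *\<^sub>R ejump i) - u x) * (w (x + h *\<^sub>R ejump i) - w x) * J x (x + h *\<^sub>R ejump i)) z" for i :: 'd and z
  define G1 where "G1 i z = (\<lambda>(x, h). (V (x + h *\<^sub>R ejump i) - V x)\<^sup>2 * \<bar>h\<bar> powr (-1 - \<alpha>)) z" for i :: 'd and z
  define G2 where "G2 i z = (\<lambda>(x, h). (exp \<bar>\<psi> (x + h *\<^sub>R ejump i) - \<psi> x\<bar> - 1)\<^sup>2 * ((V x)\<^sup>2 + (V (x + h *\<^sub>R ejump i))\<^sup>2) * \<bar>h\<bar> powr (-1 - \<alpha>)) z" for i :: 'd and z
  have [measurable]: "G1 i \<in> borel_measurable (lborel \<Otimes>\<^sub>M lborel)" "G2 i \<in> borel_measurable (lborel \<Otimes>\<^sub>M lborel)" for i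
    unfolding G1_def G2_def by measurable
  have F: "integrable (lborel \<Otimes>\<^sub>M lborel) (F i)" "form_jump J u w = (\<Sum>i\<in>UNIV. LINT z|(lborel \<Otimes>\<^sub>M lborel). F i z)" for i
    unfolding F_def using form_jump_pair[OF u w] by (simp_all add: case_prod_beta')
  have G10: "0 \<le> G1 i z" and G20: "0 \<le> G2 i z" for i z by (auto simp: G1_def G2_def case_prod_beta')
  have n1: "(\<integral>\<^sup>+z. ennreal (G1 i z) \<partial>(lborel \<Otimes>\<^sub>M lborel)) = jump_energy \<alpha> V i" for i
    unfolding G1_def by (subst jump_energy_eq_pair) (simp_all add: case_prod_beta')
  have n2: "(\<Sum>i\<in>UNIV. \<integral>\<^sup>+z. ennreal (G2 i z) \<partial>(lborel \<Otimes>\<^sub>M lborel)) \<le> ennreal (2 * \<Gamma>) * sqn V"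
    using weight_error_le[OF _ \<psi>, of V] unfolding G2_def by (simp add: case_prod_beta')
  have fin: "ennreal (2 * \<Gamma>) * sqn V < \<infinity>"
    using VL by (simp add: L2_iff_sqn ennreal_mult_less_top)
  have n2f: "(\<integral>\<^sup>+z. ennreal (G2 i z) \<partial>(lborel \<Otimes>\<^sub>M lborel)) < \<infinity>" for i
    by (rule le_less_trans[OF member_le_sum le_less_trans[OF n2 fin]]) auto
  have I1: "integrable (lborel \<Otimes>\<^sub>M lborel) (G1 i)" for i
    by (rule integrableI_nonneg) (use G10 n1 form_domD(3)[OF V] in auto)
  have I2: "integrable (lborel \<Otimes>\<^sub>M lborel) (G2 i)" for i
    by (rule integrableI_nonneg) (use G20 n2f in auto)
  have e1: "(LINT z|(lborel \<Otimes>\<^sub>M lborel). G1 i z) = enn2real (jump_energy \<alpha> V i)" for i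
    unfolding n1[symmetric] by (rule integral_eq_nn_integral) (use G10 in auto)
  have e2: "(\<Sum>i\<in>UNIV. LINT z|(lborel \<Otimes>\<^sub>M lborel). G2 i z) \<le> 2 * \<Gamma> * (LINT x|lborel. (V x)\<^sup>2)"
  proof -
    have "ennreal (\<Sum>i\<in>UNIV. LINT z|(lborel \<Otimes>\<^sub>M lborel). G2 i z) = (\<Sum>i\<in>UNIV. ennreal (LINT z|(lborel \<Otimes>\<^sub>M lborel). G2 i z))"
      by (rule sum_ennreal[symmetric]) (use G20 in \<open>auto intro: Bochner_Integration.integral_nonneg\<close>)
    also have "\<dots> = (\<Sum>i\<in>UNIV. \<integral>\<^sup>+z. ennreal (G2 i z) \<partial>(lborel \<Otimes>\<^sub>M lborel))"
      by (intro sum.cong refl nn_integral_eq_integral[symmetric] I2) (use G20 in auto)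
    also have "\<dots> \<le> ennreal (2 * \<Gamma> * (LINT x|lborel. (V x)\<^sup>2))"
      using n2 G by (simp add: sqn_eq_integral[OF VL] integral_sq_nonneg ennreal_mult)
    finally show ?thesis
      using G by (subst (asm) ennreal_le_iff) (auto simp: integral_sq_nonneg)
  qed
  have pw: "F i z \<ge> G1 i z / (2 * p * \<kappa>) - 4 * p * \<kappa> * G2 i z" for i z
  proof (cases z)
    case (Pair x h)
    let ?y = "x + h *\<^sub>R ejump i"
    let ?J = "J x ?y" and ?h = "\<bar>h\<bar> powr (-1 - \<alpha>)"
    define a b zz where "a = exp (\<psi> x) * u x" and "b = exp (\<psi> ?y) * u ?y" and "zz = \<psi> ?y - \<psi> x"
    let ?e = "(exp \<bar>zz\<bar> - 1)\<^sup>2"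
    have ex: "exp (real k * s) = exp s ^ k" for k and s :: real by (rule exp_of_nat_mult)
    have Va: "V x = a ^ (q + 1)" "V ?y = b ^ (q + 1)"
      unfolding V_def a_def b_def p_def ex power_mult_distrib by simp_all
    have sq: "s ^ (2 * q + 2) = (s ^ (q + 1))\<^sup>2" for s :: real
      by (simp add: power_mult[symmetric] mult.commute del: power_Suc)
    have e2p: "exp (2 * p * s) = exp s * exp s ^ (2 * q + 1)" for s
    proof -
      have "2 * p * s = real (Suc (2 * q + 1)) * s" by (simp add: p_def algebra_simps)
      then show ?thesis by (simp only: ex power_Suc)
    qed
    have wa: "w x = exp (\<psi> x) * a ^ (2 * q + 1)" "w ?y = exp (\<psi> ?y) * b ^ (2 * q + 1)"
      unfolding w_def a_def b_def e2p power_mult_distrib by (simp_all only: mult.assoc)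
    have ua: "u x = exp (- \<psi> x) * a" "u ?y = exp (- \<psi> ?y) * b"
      unfolding a_def b_def by (simp_all add: mult.assoc[symmetric] flip: exp_add)
    \<comment> \<open>Since 2 p = 2 q + 2, one factor exp(\<psi>) of \<open>w\<close> is left over
      besides the power of exp(\<psi>) u. It cancels against the exp(- \<psi>) of \<open>u\<close>
      in the two terms at equal points and leaves exp zz and exp (- zz) in the cross terms.\<close>
    have "(u ?y - u x) * (w ?y - w x) = b ^ (2 * q + 2) + a ^ (2 * q + 2) - exp zz * (a * b ^ (2 * q + 1)) - exp (- zz) * (a ^ (2 * q + 1) * b)"
    proof -
      have m: "s ^ (2 * q + 2) = s * s ^ (2 * q + 1)" for s :: real by simp
      have alg: "(ey' * b - ex' * a) * (ey * bq - ex * aq) = (ey' * ey) * (b * bq) + (ex' * ex) * (a * aq) - (ey * ex') * (a * bq) - (ex * ey') * (aq * b)"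
        for ey' ey ex' ex b a bq aq :: real by (simp add: algebra_simps)
      have "exp (- \<psi> ?y) * exp (\<psi> ?y) = 1" "exp (- \<psi> x) * exp (\<psi> x) = 1"
        "exp (\<psi> ?y) * exp (- \<psi> x) = exp zz" "exp (\<psi> x) * exp (- \<psi> ?y) = exp (- zz)"
        by (simp_all add: zz_def flip: exp_add)
      then show ?thesis unfolding wa ua alg m by simp
    qed
    also have "\<dots> \<ge> (V ?y - V x)\<^sup>2 / (2 * p) - 4 * p * ?e * ((V x)\<^sup>2 + (V ?y)\<^sup>2)"
      using twisted_increment_ge[of b q a zz] unfolding Va sq p_def .
    finally have "F i z \<ge> ((V ?y - V x)\<^sup>2 / (2 * p) - 4 * p * ?e * ((V x)\<^sup>2 + (V ?y)\<^sup>2)) * ?J"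
      unfolding F_def Pair by (simp add: mult_right_mono J_jump_nonneg)
    moreover have "(V ?y - V x)\<^sup>2 / (2 * p) * ?J \<ge> G1 i z / (2 * p * \<kappa>)"
    proof -
      have "?h / \<kappa> \<le> ?J" using J_jump_ge[of h x i] kappa by (simp add: field_simps)
      then have "(V ?y - V x)\<^sup>2 / (2 * p) * (?h / \<kappa>) \<le> (V ?y - V x)\<^sup>2 / (2 * p) * ?J"
        using p1 by (intro mult_left_mono) auto
      then show ?thesis unfolding G1_def Pair by simp
    qed
    moreover have "4 * p * ?e * ((V x)\<^sup>2 + (V ?y)\<^sup>2) * ?J \<le> 4 * p * \<kappa> * G2 i z"
    proof -
      have "4 * p * ?e * ((V x)\<^sup>2 + (V ?y)\<^sup>2) * ?J \<le> 4 * p * ?e * ((V x)\<^sup>2 + (V ?y)\<^sup>2) * (\<kappa> * ?h)"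
        using p1 by (intro mult_left_mono J_jump_le) auto
      then show ?thesis unfolding G2_def Pair zz_def by (simp add: mult_ac)
    qed
    ultimately show ?thesis unfolding left_diff_distrib by linarith
  qed
  have "(\<Sum>i\<in>UNIV. LINT z|(lborel \<Otimes>\<^sub>M lborel). G1 i z / (2 * p * \<kappa>) - 4 * p * \<kappa> * G2 i z) \<le> form_jump J u w"
    unfolding F(2) by (intro sum_mono integral_mono pw F(1) Bochner_Integration.integrable_diff integrable_divide_zero integrable_mult_right I1 I2)
  moreover have "(\<Sum>i\<in>UNIV. LINT z|(lborel \<Otimes>\<^sub>M lborel). G1 i z / (2 * p * \<kappa>) - 4 * p * \<kappa> * G2 i z)
      = (\<Sum>i\<in>UNIV. enn2real (jump_energy \<alpha> V i)) / (2 * p * \<kappa>) - 4 * p * \<kappa> * (\<Sum>i\<in>UNIV. LINT z|(lborel \<Otimes>\<^sub>M lborel). G2 i z)"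
    using I1 I2 by (simp add: sum_subtractf sum_divide_distrib sum_distrib_left e1)
  moreover have "4 * p * \<kappa> * (\<Sum>i\<in>UNIV. LINT z|(lborel \<Otimes>\<^sub>M lborel). G2 i z) \<le> 4 * p * \<kappa> * (2 * \<Gamma> * (LINT x|lborel. (V x)\<^sup>2))"
    using p1 kappa by (intro mult_left_mono e2) auto
  ultimately show ?thesis by (simp add: mult_ac)
qed

text \<open>With X = exp(p \<psi>) u^q grad u and Y = V grad \<psi> one has grad V = p (X + Y), and
  the integrand is (2 p - 1) A(X,X) + 2 p A(X,Y). The mixed term is absorbed by nonnegativity of the
  form at X + 2 Y and X - Y, at the price of 3 p A(Y,Y) \<le> 3 p \<kappa> \<Gamma> V^2.\<close>

lemma form_diff_twisted_ge:
  fixes q :: nat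
  assumes u: "u \<in> form_dom J a" and M: "M \<ge> 0" "AE x in lborel. \<bar>u x\<bar> \<le> M" and \<psi>: "weight \<psi> B \<Gamma>"
  defines "p \<equiv> real (q + 1)"
  defines "w \<equiv> \<lambda>x. exp (2 * p * \<psi> x) * u x ^ (2 * q + 1)" and "V \<equiv> \<lambda>x. exp (p * \<psi> x) * u x ^ (q + 1)"
  shows "form_diff a u w \<ge> (\<Sum>j\<in>UNIV. LINT x|lborel. (wgrad V (ediff j) x)\<^sup>2) / (4 * p * \<kappa>) - 3 * p * \<kappa> * \<Gamma> * (LINT x|lborel. (V x)\<^sup>2)"
proof -
  have p1: "p \<ge> 1" by (simp add: p_def)
  have G: "\<Gamma> \<ge> 0" and g: "\<And>x. (\<Sum>j\<in>UNIV. (frechet_derivative \<psi> (at x) (ediff j))\<^sup>2) \<le> \<Gamma>" using \<psi> by (auto simp: weight_def)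
  have w: "w \<in> form_dom J a" unfolding w_def by (rule form_dom_exp_mult_power[OF u M \<psi>])
  have V: "V \<in> form_dom J a" unfolding V_def by (rule form_dom_exp_mult_power[OF u M \<psi>])
  have VL: "V \<in> L2" by (rule form_domD(1)[OF V])
  have gV: "wgrad V (ediff j) \<in> L2" for j using form_domD(2)[OF V] by (auto simp: strong_deriv_def)
  let ?gu = "\<lambda>x j. wgrad u (ediff j) x" and ?gw = "\<lambda>x j. wgrad w (ediff j) x" and ?gV = "\<lambda>x j. wgrad V (ediff j) x"
  have AEw: "AE x in lborel. \<forall>j. ?gw x j = exp (2 * p * \<psi> x) * (2 * p * frechet_derivative \<psi> (at x) (ediff j) * u x ^ (2 * q + 1) + real (2 * q + 1) * u x ^ (2 * q) * ?gu x j)"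
    unfolding w_def by (rule form_dom_exp_mult_power[OF u M \<psi>])
  have AEV: "AE x in lborel. \<forall>j. ?gV x j = exp (p * \<psi> x) * (p * frechet_derivative \<psi> (at x) (ediff j) * u x ^ (q + 1) + p * u x ^ q * ?gu x j)"
    unfolding V_def p_def by (rule form_dom_exp_mult_power[OF u M \<psi>])
  have "(LINT x|lborel. (\<Sum>j\<in>UNIV. (?gV x j)\<^sup>2) / (4 * p * \<kappa>) - 3 * p * \<kappa> * \<Gamma> * (V x)\<^sup>2) \<le> form_diff a u w"
    unfolding form_diff_Aq(2)[OF u w]
  proof (rule integral_mono_AE)
    show "integrable lborel (\<lambda>x. (\<Sum>j\<in>UNIV. (?gV x j)\<^sup>2) / (4 * p * \<kappa>) - 3 * p * \<kappa> * \<Gamma> * (V x)\<^sup>2)"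
      using gV VL by (auto simp: L2_def)
    show "integrable lborel (\<lambda>x. Aq x (\<lambda>j. ?gu x j) (\<lambda>j. ?gw x j))" by (rule form_diff_Aq(1)[OF u w])
    show "AE x in lborel. (\<Sum>j\<in>UNIV. (?gV x j)\<^sup>2) / (4 * p * \<kappa>) - 3 * p * \<kappa> * \<Gamma> * (V x)\<^sup>2 \<le> Aq x (\<lambda>j. ?gu x j) (\<lambda>j. ?gw x j)"
      using AEw AEV Aq_sym
    proof eventually_elim
      case (elim x)
      let ?d = "\<lambda>j. frechet_derivative \<psi> (at x) (ediff j)"
      define X Y where "X j = exp (p * \<psi> x) * u x ^ q * ?gu x j" and "Y j = V x * ?d j" for j
      have sym: "Aq x Y X = Aq x X Y" using elim(3) by blast
      have gV_eq: "?gV x = (\<lambda>j. p * (X j + Y j))"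
      proof
        fix j
        have "V x = exp (p * \<psi> x) * u x ^ (q + 1)" by (simp add: V_def)
        then show "?gV x j = p * (X j + Y j)"
          unfolding elim(2)[rule_format, of j] X_def Y_def by (simp add: algebra_simps)
      qed
      have ee: "exp (2 * p * \<psi> x) = exp (p * \<psi> x) * exp (p * \<psi> x)"
        by (simp add: algebra_simps flip: exp_add)
      have uu: "u x ^ (2 * q + 1) = u x ^ q * u x ^ (q + 1)" "u x ^ (2 * q) = u x ^ q * u x ^ q"
        by (simp_all only: power_add[symmetric] mult_2 add.assoc)
      have r2: "real (2 * q + 1) = 2 * p - 1" by (simp add: p_def)
      define c where "c = exp (p * \<psi> x) * u x ^ q"
      have gw_eq: "?gw x = (\<lambda>j. c * ((2 * p - 1) * X j + 2 * p * Y j))"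
      proof
        fix j
        have "V x = exp (p * \<psi> x) * u x ^ (q + 1)" by (simp add: V_def)
        then show "?gw x j = c * ((2 * p - 1) * X j + 2 * p * Y j)"
          unfolding elim(1)[rule_format, of j] X_def Y_def ee uu r2 c_def by (simp add: algebra_simps)
      qed
      have X_eq: "X = (\<lambda>j. c * ?gu x j)" by (simp add: X_def c_def fun_eq_iff)
      have AX: "Aq x X Z = c * Aq x (?gu x) Z" for Z unfolding X_eq by (rule Aq_bilinear(3))
      have A1: "Aq x (?gu x) (?gw x) = (2 * p - 1) * Aq x X X + 2 * p * Aq x X Y"
        unfolding gw_eq AX Aq_bilinear by (simp add: algebra_simps)
      have A2: "Aq x (?gV x) (?gV x) = p\<^sup>2 * (Aq x X X + 2 * Aq x X Y + Aq x Y Y)"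
        unfolding gV_eq Aq_bilinear sym by (simp add: power2_eq_square algebra_simps)
      have nX: "0 \<le> Aq x X X" and nY: "0 \<le> Aq x Y Y" by (rule Aq_nonneg)+
      \<comment> \<open>Multiplied by p / 2 this bounds 2 p A(X,Y) from below by - p A(X,X) / 2 - 2
        p A(Y,Y), using up half of p A(X,X); the other half pays for A(grad V, grad V) / (4
        p).\<close>
      have q1: "0 \<le> Aq x X X + 4 * Aq x X Y + 4 * Aq x Y Y"
        using Aq_nonneg[of x "\<lambda>j. X j + 2 * Y j"] unfolding Aq_bilinear sym by simp
      have q2: "0 \<le> Aq x X X - 2 * Aq x X Y + Aq x Y Y"
        using Aq_nonneg[of x "\<lambda>j. X j + (-1) * Y j"] unfolding Aq_bilinear sym by simp
      have low: "Aq x (?gu x) (?gw x) \<ge> Aq x (?gV x) (?gV x) / (4 * p) - 3 * p * Aq x Y Y"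
      proof -
        have "Aq x (?gV x) (?gV x) / (4 * p) = (p / 4) * (Aq x X X + 2 * Aq x X Y + Aq x Y Y)"
          unfolding A2 using p1 by (simp add: power2_eq_square field_simps)
        also have "\<dots> \<le> (p / 4) * (2 * Aq x X X + 2 * Aq x Y Y)"
          using q2 p1 by (intro mult_left_mono) auto
        finally have 1: "Aq x (?gV x) (?gV x) / (4 * p) \<le> p * Aq x X X / 2 + p * Aq x Y Y / 2" by (simp add: algebra_simps)
        have 2: "0 \<le> p * (Aq x X X + 4 * Aq x X Y + 4 * Aq x Y Y)" using q1 p1 by simp
        have 3: "p * Aq x X X \<le> (2 * p - 1) * Aq x X X" using p1 nX by (intro mult_right_mono) auto
        have 4: "0 \<le> p * Aq x Y Y" using p1 nY by simp
        show ?thesis unfolding A1 using 1 2 3 4 by (simp add: algebra_simps)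
      qed
      have "(\<Sum>j\<in>UNIV. (?gV x j)\<^sup>2) / (4 * p * \<kappa>) = (\<Sum>j\<in>UNIV. (?gV x j)\<^sup>2) / \<kappa> / (4 * p)" by simp
      also have "\<dots> \<le> Aq x (?gV x) (?gV x) / (4 * p)"
        using p1 by (intro divide_right_mono Aq_ellip) auto
      finally have 5: "(\<Sum>j\<in>UNIV. (?gV x j)\<^sup>2) / (4 * p * \<kappa>) \<le> Aq x (?gV x) (?gV x) / (4 * p)" .
      have "Aq x Y Y \<le> \<kappa> * (\<Sum>j\<in>UNIV. (Y j)\<^sup>2)" by (rule Aq_ellip)
      also have "(\<Sum>j\<in>UNIV. (Y j)\<^sup>2) = (V x)\<^sup>2 * (\<Sum>j\<in>UNIV. (?d j)\<^sup>2)"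
        by (simp add: Y_def power_mult_distrib sum_distrib_left)
      also have "\<kappa> * ((V x)\<^sup>2 * (\<Sum>j\<in>UNIV. (?d j)\<^sup>2)) \<le> \<kappa> * ((V x)\<^sup>2 * \<Gamma>)"
        using kappa by (intro mult_left_mono g) auto
      finally have "3 * p * Aq x Y Y \<le> 3 * p * (\<kappa> * ((V x)\<^sup>2 * \<Gamma>))"
        using p1 by (intro mult_left_mono) auto
      with low 5 show ?case by (simp add: mult_ac)
    qed
  qed
  moreover have "(LINT x|lborel. (\<Sum>j\<in>UNIV. (?gV x j)\<^sup>2) / (4 * p * \<kappa>) - 3 * p * \<kappa> * \<Gamma> * (V x)\<^sup>2)
      = (\<Sum>j\<in>UNIV. LINT x|lborel. (?gV x j)\<^sup>2) / (4 * p * \<kappa>) - 3 * p * \<kappa> * \<Gamma> * (LINT x|lborel. (V x)\<^sup>2)"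
    using gV VL by (simp add: L2_def)
  ultimately show ?thesis by simp
qed

text \<open>Both parts keep the smaller factor 1 / (4 p \<kappa>), and the errors add up: 11 = 8 +
  3.\<close>

lemma form_E_twisted_ge:
  fixes q :: nat
  assumes u: "u \<in> form_dom J a" and M: "M \<ge> 0" "AE x in lborel. \<bar>u x\<bar> \<le> M" and \<psi>: "weight \<psi> B \<Gamma>"
  defines "p \<equiv> real (q + 1)"
  defines "w \<equiv> \<lambda>x. exp (2 * p * \<psi> x) * u x ^ (2 * q + 1)" and "V \<equiv> \<lambda>x. exp (p * \<psi> x) * u x ^ (q + 1)"
  shows "form_E J a u w \<ge> model_energy V / (4 * p * \<kappa>) - 11 * p * \<kappa> * \<Gamma> * (LINT x|lborel. (V x)\<^sup>2)"
proof -
  have p1: "p \<ge> 1" by (simp add: p_def)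
  have "(\<Sum>i\<in>UNIV. enn2real (jump_energy \<alpha> V i)) / (4 * p * \<kappa>) \<le> (\<Sum>i\<in>UNIV. enn2real (jump_energy \<alpha> V i)) / (2 * p * \<kappa>)"
    using p1 kappa by (intro divide_left_mono sum_nonneg) auto
  moreover have "form_jump J u w \<ge> (\<Sum>i\<in>UNIV. enn2real (jump_energy \<alpha> V i)) / (2 * p * \<kappa>) - 8 * p * \<kappa> * \<Gamma> * (LINT x|lborel. (V x)\<^sup>2)"
    unfolding p_def w_def V_def by (rule form_jump_twisted_ge[OF u M \<psi>])
  moreover have "form_diff a u w \<ge> (\<Sum>j\<in>UNIV. LINT x|lborel. (wgrad V (ediff j) x)\<^sup>2) / (4 * p * \<kappa>) - 3 * p * \<kappa> * \<Gamma> * (LINT x|lborel. (V x)\<^sup>2)"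
    unfolding p_def w_def V_def by (rule form_diff_twisted_ge[OF u M \<psi>])
  ultimately show ?thesis
    unfolding form_E_def model_energy_def add_divide_distrib by linarith
qed

end

section \<open>Iteration of the Nash inequality\<close>

text \<open>Markov's inequality at the level Q (1 + e): the set where \<open>w\<close> reaches it
  has measure at most c (1 + e)^(-2^k), and this tends to 0 because \<open>c\<close> does not depend
  on k.\<close>

lemma AE_le_if_power_integrals_le:
  fixes w :: "'a \<Rightarrow> real"
  assumes [measurable]: "w \<in> borel_measurable M" and Q: "Q > 0"
    and le: "\<And>k::nat. (\<integral>\<^sup>+x. ennreal (w x ^ (2 ^ k)) \<partial>M) \<le> ennreal (c * Q ^ (2 ^ k))" and c: "c \<ge> 0"
  shows "AE x in M. w x \<le> Q"
proof -
  have "AE x in M. w x < Q * (1 + e)" if e: "e > 0" for e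
  proof -
    let ?S = "{x \<in> space M. w x \<ge> Q * (1 + e)}"
    let ?r = "inverse (1 + e)"
    have Qe: "Q * (1 + e) > 0" using Q e by simp
    have b: "emeasure M ?S \<le> ennreal (c * ?r ^ (2 ^ k))" for k :: nat
    proof -
      let ?N = "2 ^ k :: nat"
      have "ennreal ((Q * (1 + e)) ^ ?N) * emeasure M ?S = (\<integral>\<^sup>+x. ennreal ((Q * (1 + e)) ^ ?N) * indicator ?S x \<partial>M)"
        by (rule nn_integral_cmult_indicator[symmetric]) measurable
      also have "\<dots> \<le> (\<integral>\<^sup>+x. ennreal (w x ^ ?N) \<partial>M)"
        using Qe by (intro nn_integral_mono) (auto simp: indicator_def intro!: ennreal_leI power_mono)
      also have "\<dots> \<le> ennreal (c * Q ^ ?N)" by (rule le)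
      finally have *: "ennreal ((Q * (1 + e)) ^ ?N) * emeasure M ?S \<le> ennreal (c * Q ^ ?N)" .
      have "emeasure M ?S = ennreal (inverse ((Q * (1 + e)) ^ ?N)) * (ennreal ((Q * (1 + e)) ^ ?N) * emeasure M ?S)"
      proof -
        have "ennreal (inverse ((Q * (1 + e)) ^ ?N)) * ennreal ((Q * (1 + e)) ^ ?N) = 1"
        proof -
          have "inverse v * v = 1" "0 \<le> v" if "v > 0" for v :: real using that by simp_all
          from this[OF zero_less_power[OF Qe, of ?N]] show ?thesis
            by (simp only: ennreal_mult[symmetric] inverse_nonnegative_iff_nonnegative ennreal_1)
        qed
        then show ?thesis by (simp only: mult.assoc[symmetric] mult_1)
      qed
      also have "\<dots> \<le> ennreal (inverse ((Q * (1 + e)) ^ ?N)) * ennreal (c * Q ^ ?N)"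
        by (rule mult_left_mono[OF *]) simp
      also have "\<dots> = ennreal (inverse ((Q * (1 + e)) ^ ?N) * (c * Q ^ ?N))"
        using Qe c Q by (simp add: ennreal_mult)
      also have "inverse ((Q * (1 + e)) ^ ?N) * (c * Q ^ ?N) = c * ?r ^ ?N"
      proof -
        have "inverse ((Q * v) ^ ?N) * (c * Q ^ ?N) = c * inverse v ^ ?N" if "v > 0" for v
          using Q that by (simp add: power_mult_distrib field_simps)
        then show ?thesis using e by simp
      qed
      finally show ?thesis .
    qed
    have "(\<lambda>k::nat. c * ?r ^ (2 ^ k)) \<longlonglongrightarrow> c * 0"
    proof (intro tendsto_mult tendsto_const)
      have "(\<lambda>n. ?r ^ n) \<longlonglongrightarrow> 0" using e by (intro LIMSEQ_power_zero) (simp add: field_simps)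
      then show "(\<lambda>k::nat. ?r ^ (2 ^ k)) \<longlonglongrightarrow> 0"
        by (rule filterlim_compose) (rule filterlim_subseq, simp add: strict_mono_def)
    qed
    then have "(\<lambda>k::nat. ennreal (c * ?r ^ (2 ^ k))) \<longlonglongrightarrow> 0"
      using tendsto_ennrealI by fastforce
    then have "emeasure M ?S \<le> 0" by (rule LIMSEQ_le_const) (use b in auto)
    then have "AE x in M. \<not> (w x \<ge> Q * (1 + e))"
      by (subst AE_iff_measurable[where N = ?S]) auto
    then show ?thesis by eventually_elim simp
  qed
  then have "AE x in M. \<forall>n::nat. w x < Q * (1 + inverse (real (Suc n)))"
    by (subst AE_all_countable) simp
  then show ?thesis
  proof eventually_elim
    case (elim x)
    have "(\<lambda>n. Q * (1 + inverse (real (Suc n)))) \<longlonglongrightarrow> Q * (1 + 0)"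
      by (intro tendsto_intros LIMSEQ_inverse_real_of_nat)
    then have "w x \<le> Q * (1 + 0)"
      by (rule LIMSEQ_le_const) (use elim in \<open>auto intro: less_imp_le\<close>)
    then show ?case by simp
  qed
qed

section \<open>Differential inequalities for the weighted moments\<close>

context dirichlet_setting
begin

text \<open>The box of parameter r in the Nash inequality has volume r powr \<open>hom_dim\<close>,
  so this is also the exponent of the decay in t.\<close>

definition hom_dim :: real where "hom_dim = real CARD('d) / \<alpha> + real CARD('n) / 2"

lemma hom_dim_pos: "hom_dim > 0"
  unfolding hom_dim_def using alpha by (intro add_pos_pos) (auto simp: card_gt_0_iff)

definition nash_const :: real where "nash_const = 2 ^ (CARD('d) + CARD('n))"

lemma nash_const_ge_1: "nash_const \<ge> 1"
  unfolding nash_const_def by (rule one_le_power) simp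

lemma Nash_form_dom:
  assumes V: "V \<in> form_dom J a" and i: "integrable lborel V" and r: "r > 0"
  shows "(LINT x|lborel. (V x)\<^sup>2) \<le> nash_const * r * model_energy V + r powr (- hom_dim) * (LINT x|lborel. \<bar>V x\<bar>)\<^sup>2"
proof -
  have VL: "V \<in> L2" by (rule form_domD(1)[OF V])
  have gL: "wgrad V (ediff j) \<in> L2" for j using form_domD(2)[OF V] by (auto simp: strong_deriv_def)
  have e1: "(\<Sum>i\<in>UNIV. jump_energy \<alpha> V i) + (\<Sum>j\<in>UNIV. sqn (wgrad V (ediff j))) = ennreal (model_energy V)"
  proof -
    have "jump_energy \<alpha> V i = ennreal (enn2real (jump_energy \<alpha> V i))" for i
      using form_domD(3)[OF V, of i] by simp
    then have "(\<Sum>i\<in>UNIV. jump_energy \<alpha> V i) = ennreal (\<Sum>i\<in>UNIV. enn2real (jump_energy \<alpha> V i))"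
      by (subst sum_ennreal[symmetric]) auto
    moreover have "(\<Sum>j\<in>UNIV. sqn (wgrad V (ediff j))) = ennreal (\<Sum>j\<in>UNIV. LINT x|lborel. (wgrad V (ediff j) x)\<^sup>2)"
      by (subst sum_ennreal[symmetric]) (auto simp: sqn_eq_integral[OF gL] integral_sq_nonneg)
    ultimately show ?thesis
      unfolding model_energy_def by (simp add: sum_nonneg integral_sq_nonneg ennreal_plus)
  qed
  have e2: "(\<integral>\<^sup>+x. ennreal \<bar>V x\<bar> \<partial>lborel) = ennreal (LINT x|lborel. \<bar>V x\<bar>)"
    using i by (intro nn_integral_eq_integral) auto
  have l1: "0 \<le> (LINT x|lborel. \<bar>V x\<bar>)" by (rule Bochner_Integration.integral_nonneg) simp
  have n0: "0 \<le> nash_const * r" using nash_const_ge_1 r by simp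
  have "sqn V \<le> ennreal (nash_const * r) * ennreal (model_energy V) + ennreal (r powr (- hom_dim)) * (ennreal (LINT x|lborel. \<bar>V x\<bar>))\<^sup>2"
    using Nash_inequality[OF alpha(1) r form_domD(2)[OF V]] unfolding e1 e2 hom_dim_def nash_const_def .
  also have "\<dots> = ennreal (nash_const * r * model_energy V + r powr (- hom_dim) * (LINT x|lborel. \<bar>V x\<bar>)\<^sup>2)"
    using n0 model_energy_nonneg[of V] l1 by (simp add: ennreal_power flip: ennreal_mult ennreal_plus)
  finally show ?thesis
    unfolding sqn_eq_integral[OF VL] using n0 model_energy_nonneg[of V] by (subst (asm) ennreal_le_iff) auto
qed

text \<open>Collects the constants of \<open>weighted_moment_double_deriv\<close>: 2 \<kappa>
  \<open>nash_const\<close> comes from the choice of r, and the sum times p^2 (1 + \<Gamma> T) / t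
  bounds the rate that has to be absorbed.\<close>

definition rate_const :: real where "rate_const = 2 * \<kappa> * nash_const * (hom_dim + 1 + 22 * \<kappa>)"

lemma rate_const_ge_1: "rate_const \<ge> 1"
proof -
  have "1 * 1 * 1 \<le> (2 * \<kappa>) * nash_const * (hom_dim + 1 + 22 * \<kappa>)"
    using kappa nash_const_ge_1 hom_dim_pos by (intro mult_mono) auto
  then show ?thesis by (simp add: rate_const_def)
qed

definition weighted_moment :: "(('d, 'n) pt \<Rightarrow> real) \<Rightarrow> (real \<Rightarrow> ('d, 'n) pt \<Rightarrow> real) \<Rightarrow> nat \<Rightarrow> real \<Rightarrow> real" where
  "weighted_moment \<psi> U p t = (LINT x|lborel. (exp (\<psi> x) * U t x) ^ (2 * p))"

context
  fixes f U M \<psi> B \<Gamma>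
  assumes orb: "semigroup_orbit J a f U" and f: "f \<in> L2" "AE x in lborel. \<bar>f x\<bar> \<le> M" and M0: "M \<ge> 0"
    and \<psi>: "weight \<psi> B \<Gamma>"
begin

lemma weight_facts: "C1_fun \<psi>" "\<And>x. \<bar>\<psi> x\<bar> \<le> B" "\<Gamma> \<ge> 0"
  using \<psi> by (auto simp: weight_def)

lemma exp_weight_bound: "\<bar>exp (real k * \<psi> x)\<bar> \<le> exp (real k * B)"
  using mult_left_mono[OF abs_le_D1[OF weight_facts(2)[of x]], of "real k"] by simp

text \<open>Brings the moment into the form \<integral> m \<Phi>(U t) with m = exp((2 q + 2) \<psi>)
  and the \<Phi> of \<open>C2_pair_power\<close> for n = 2 q, to which
  \<open>functional_deriv\<close> and \<open>functional_initial\<close> apply.\<close>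

lemma weighted_moment_functional:
  "weighted_moment \<psi> U (q + 1) t = real (2 * q + 2) * (LINT x|lborel. exp (real (2 * q + 2) * \<psi> x) * (U t x ^ (2 * q + 2) / real (2 * q + 2)))"
  and power_functional: "(LINT x|lborel. (exp (\<psi> x) * f x) ^ (2 * (q + 1)))
    = real (2 * q + 2) * (LINT x|lborel. exp (real (2 * q + 2) * \<psi> x) * (f x ^ (2 * q + 2) / real (2 * q + 2)))"
proof -
  have "(LINT x|lborel. (exp (\<psi> x) * g x) ^ (2 * (q + 1)))
      = (LINT x|lborel. real (2 * q + 2) * (exp (real (2 * q + 2) * \<psi> x) * (g x ^ (2 * q + 2) / real (2 * q + 2))))" for g
  proof (rule Bochner_Integration.integral_cong[OF refl])
    fix x
    have "2 * (q + 1) = 2 * q + 2" by simp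
    then show "(exp (\<psi> x) * g x) ^ (2 * (q + 1)) = real (2 * q + 2) * (exp (real (2 * q + 2) * \<psi> x) * (g x ^ (2 * q + 2) / real (2 * q + 2)))"
      by (simp only: power_mult_distrib exp_of_nat_mult[symmetric]) simp
  qed
  then show "weighted_moment \<psi> U (q + 1) t = real (2 * q + 2) * (LINT x|lborel. exp (real (2 * q + 2) * \<psi> x) * (U t x ^ (2 * q + 2) / real (2 * q + 2)))"
    "(LINT x|lborel. (exp (\<psi> x) * f x) ^ (2 * (q + 1)))
    = real (2 * q + 2) * (LINT x|lborel. exp (real (2 * q + 2) * \<psi> x) * (f x ^ (2 * q + 2) / real (2 * q + 2)))"
    unfolding weighted_moment_def by simp_all
qed

lemma orbit_in_interval: "t > 0 \<Longrightarrow> AE x in lborel. U t x \<in> {-M..M}"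
  by (drule orbit_bounded[OF orb f M0], erule eventually_mono) auto

lemma exp_weight_measurable: "(\<lambda>x. exp (c * \<psi> x)) \<in> borel_measurable borel"
  using C1_fun_measurable[OF weight_facts(1)] by measurable

lemma weighted_moment_initial: "(weighted_moment \<psi> U (q + 1) \<longlongrightarrow> (LINT x|lborel. (exp (\<psi> x) * f x) ^ (2 * (q + 1)))) (at_right 0)"
proof -
  have fI: "AE x in lborel. f x \<in> {-M..M}" using f(2) by eventually_elim auto
  have "((\<lambda>t. LINT x|lborel. exp (real (2 * q + 2) * \<psi> x) * (U t x ^ (2 * q + 2) / real (2 * q + 2)))
     \<longlongrightarrow> (LINT x|lborel. exp (real (2 * q + 2) * \<psi> x) * (f x ^ (2 * q + 2) / real (2 * q + 2)))) (at_right 0)"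
    by (rule functional_initial[OF orb C2_pair_power[OF M0] orbit_in_interval f(1) fI exp_weight_measurable exp_weight_bound])
  from tendsto_mult[OF tendsto_const[of "real (2 * q + 2)"] this] show ?thesis
    unfolding power_functional weighted_moment_functional[abs_def] .
qed

lemma power_form_dom:
  assumes t: "t > 0"
  shows "(\<lambda>x. (exp (\<psi> x) * U t x) ^ (q + 1)) \<in> form_dom J a"
proof -
  have "(\<lambda>x. exp (real (q + 1) * \<psi> x) * U t x ^ (q + 1)) \<in> form_dom J a"
    by (rule form_dom_exp_mult_power[OF orbit_form_dom[OF orb t] M0 orbit_bounded[OF orb f M0 t] \<psi>])
  then show ?thesis by (simp only: power_mult_distrib exp_of_nat_mult)
qed

text \<open>2 p times \<open>form_E_twisted_ge\<close>: the p cancels in the dissipation, 2 p / (4 p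
  \<kappa>) = 1 / (2 \<kappa>), and is squared in the error, 2 p * 11 p = 22 p^2.\<close>

lemma weighted_moment_deriv:
  assumes t: "t > 0"
  shows "\<exists>D. (weighted_moment \<psi> U (q + 1) has_real_derivative D) (at t) \<and>
     D \<le> - model_energy (\<lambda>x. (exp (\<psi> x) * U t x) ^ (q + 1)) / (2 * \<kappa>) + 22 * (real (q + 1))\<^sup>2 * \<kappa> * \<Gamma> * weighted_moment \<psi> U (q + 1) t"
proof -
  let ?p = "real (q + 1)"
  let ?w = "\<lambda>x. exp (2 * ?p * \<psi> x) * U t x ^ (2 * q + 1)"
  have u: "U t \<in> form_dom J a" and b: "AE x in lborel. \<bar>U t x\<bar> \<le> M"
    by (rule orbit_form_dom[OF orb t], rule orbit_bounded[OF orb f M0 t])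
  have pe: "real (2 * q + 2) = 2 * ?p" by simp
  have w: "?w \<in> form_dom J a" by (rule form_dom_exp_mult_power[OF u M0 b \<psi>])
  have "((\<lambda>s. LINT x|lborel. exp (real (2 * q + 2) * \<psi> x) * (U s x ^ (2 * q + 2) / real (2 * q + 2))) has_real_derivative
      - form_E J a (U t) (\<lambda>x. exp (real (2 * q + 2) * \<psi> x) * U t x ^ (2 * q + 1))) (at t)"
  proof -
    have w': "(\<lambda>x. exp (real (2 * q + 2) * \<psi> x) * U t x ^ (2 * q + 1)) \<in> form_dom J a" unfolding pe by (rule w)
    show ?thesis
      by (rule functional_deriv[OF orb t C2_pair_power[OF M0] orbit_in_interval exp_weight_measurable exp_weight_bound w'])
  qed
  from DERIV_cmult[OF this, of "real (2 * q + 2)"]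
  have d: "(weighted_moment \<psi> U (q + 1) has_real_derivative 2 * ?p * (- form_E J a (U t) ?w)) (at t)"
    unfolding weighted_moment_functional[abs_def] by (simp only: pe)
  have V: "(\<lambda>x. exp (?p * \<psi> x) * U t x ^ (q + 1)) = (\<lambda>x. (exp (\<psi> x) * U t x) ^ (q + 1))"
    by (simp only: power_mult_distrib exp_of_nat_mult)
  have Y: "(LINT x|lborel. (exp (?p * \<psi> x) * U t x ^ (q + 1))\<^sup>2) = weighted_moment \<psi> U (q + 1) t"
    unfolding weighted_moment_def
    by (simp only: power_mult_distrib exp_of_nat_mult power_mult[symmetric] mult.commute[of 2])
  have "model_energy (\<lambda>x. (exp (\<psi> x) * U t x) ^ (q + 1)) / (4 * ?p * \<kappa>) - 11 * ?p * \<kappa> * \<Gamma> * weighted_moment \<psi> U (q + 1) t \<le> form_E J a (U t) ?w"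
    using form_E_twisted_ge[OF u M0 b \<psi>, of q] unfolding V Y .
  then have sc: "2 * ?p * (model_energy (\<lambda>x. (exp (\<psi> x) * U t x) ^ (q + 1)) / (4 * ?p * \<kappa>) - 11 * ?p * \<kappa> * \<Gamma> * weighted_moment \<psi> U (q + 1) t)
      \<le> 2 * ?p * form_E J a (U t) ?w" by (rule mult_left_mono) simp
  have scale: "2 * P * (X / (4 * P * \<kappa>) - 11 * P * \<kappa> * \<Gamma> * Z) = X / (2 * \<kappa>) - 22 * P\<^sup>2 * \<kappa> * \<Gamma> * Z" if "P > 0" for P X Z
    using that kappa by (simp add: field_simps power2_eq_square)
  have "?p > 0" by simp
  from sc[unfolded scale[OF this]]
  have "2 * ?p * (- form_E J a (U t) ?w) \<le> - model_energy (\<lambda>x. (exp (\<psi> x) * U t x) ^ (q + 1)) / (2 * \<kappa>) + 22 * ?p\<^sup>2 * \<kappa> * \<Gamma> * weighted_moment \<psi> U (q + 1) t"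
    by linarith
  with d show ?thesis by blast
qed

lemma weighted_moment_nonneg: "0 \<le> weighted_moment \<psi> U p t"
  unfolding weighted_moment_def by (rule Bochner_Integration.integral_nonneg) (simp add: power_mult)

text \<open>The start of the iteration: for p = 1 the dissipation is dropped, and Gronwall's
  argument with the integrating factor exp (- 22 \<kappa> \<Gamma> t) remains.\<close>

lemma weighted_moment_1_le:
  assumes T: "T > 0"
  shows "weighted_moment \<psi> U 1 T \<le> exp (22 * \<kappa> * \<Gamma> * T) * (LINT x|lborel. (exp (\<psi> x) * f x)\<^sup>2)"
proof -
  let ?c = "22 * \<kappa> * \<Gamma>"
  let ?y = "\<lambda>t. exp (- ?c * t) * weighted_moment \<psi> U 1 t"
  have "?y T \<le> (LINT x|lborel. (exp (\<psi> x) * f x)\<^sup>2)"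
  proof (rule nonincreasing_from_limit[OF _ _ T])
    have "(?y \<longlongrightarrow> exp (- ?c * 0) * (LINT x|lborel. (exp (\<psi> x) * f x) ^ (2 * (0 + 1)))) (at_right 0)"
      using weighted_moment_initial[of 0] by (intro tendsto_intros) simp_all
    then show "(?y \<longlongrightarrow> (LINT x|lborel. (exp (\<psi> x) * f x)\<^sup>2)) (at_right 0)" by simp
    fix t :: real assume t: "t > 0" "t \<le> T"
    obtain D where D: "(weighted_moment \<psi> U 1 has_real_derivative D) (at t)"
      "D \<le> - model_energy (\<lambda>x. (exp (\<psi> x) * U t x) ^ 1) / (2 * \<kappa>) + ?c * weighted_moment \<psi> U 1 t"
      using weighted_moment_deriv[OF t(1), of 0] by auto
    have "model_energy (\<lambda>x. (exp (\<psi> x) * U t x) ^ 1) / (2 * \<kappa>) \<ge> 0" using model_energy_nonneg kappa by simp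
    then have D0: "D - ?c * weighted_moment \<psi> U 1 t \<le> 0" using D(2) by linarith
    have "(?y has_real_derivative exp (- ?c * t) * (D - ?c * weighted_moment \<psi> U 1 t)) (at t)"
      by (rule derivative_eq_intros D(1) refl)+ (simp add: algebra_simps)
    moreover have "exp (- ?c * t) * (D - ?c * weighted_moment \<psi> U 1 t) \<le> 0"
      using D0 by (simp add: mult_nonneg_nonpos)
    ultimately show "\<exists>D. (?y has_real_derivative D) (at t) \<and> D \<le> 0" by blast
  qed
  then have "exp (?c * T) * ?y T \<le> exp (?c * T) * (LINT x|lborel. (exp (\<psi> x) * f x)\<^sup>2)"
    by (rule mult_left_mono) simp
  then show ?thesis by (simp add: mult.assoc[symmetric] flip: exp_add)
qed

text \<open>The radius \<open>r\<close> in the Nash inequality is chosen so that the dissipation absorbs the error term with \<open>\<Gamma>\<close>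
  and leaves the factor \<open>(hom_dim + 1) p / t\<close>.\<close>

lemma weighted_moment_double_deriv:
  fixes q :: nat
  assumes t: "t > 0" "t \<le> T"
  defines "p \<equiv> 2 * (q + 1)"
  shows "\<exists>D. (weighted_moment \<psi> U p has_real_derivative D) (at t) \<and>
     D \<le> - ((hom_dim + 1) * real p / t) * weighted_moment \<psi> U p t
       + (rate_const * (real p)\<^sup>2 * (1 + \<Gamma> * T) / t) powr (hom_dim + 1) * (weighted_moment \<psi> U (q + 1) t)\<^sup>2"
proof -
  let ?V = "\<lambda>x. (exp (\<psi> x) * U t x) ^ p"
  let ?\<theta> = hom_dim
  have p1: "real p \<ge> 1" by (simp add: p_def)
  have pq: "p = (2 * q + 1) + 1" by (simp add: p_def)
  have V: "?V \<in> form_dom J a" using power_form_dom[OF t(1), of "2 * q + 1"] by (simp only: pq)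
  have V0: "?V x \<ge> 0" for x by (rule zero_le_even_power) (simp add: p_def)
  have Vint: "integrable lborel ?V"
  proof -
    have "(\<lambda>x. (exp (\<psi> x) * U t x) ^ (q + 1)) \<in> L2" by (rule form_domD(1)[OF power_form_dom[OF t(1)]])
    then have "integrable lborel (\<lambda>x. ((exp (\<psi> x) * U t x) ^ (q + 1))\<^sup>2)" by (simp add: L2_def)
    then show ?thesis by (simp only: p_def power_mult[symmetric] mult.commute[of 2])
  qed
  have Vl1: "(LINT x|lborel. \<bar>?V x\<bar>) = weighted_moment \<psi> U (q + 1) t"
    using V0 by (simp add: weighted_moment_def p_def)
  have Vl2: "(LINT x|lborel. (?V x)\<^sup>2) = weighted_moment \<psi> U p t"
    unfolding weighted_moment_def by (simp only: power_mult[symmetric] mult.commute[of 2])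
  define y where "y = weighted_moment \<psi> U p t"
  define z where "z = weighted_moment \<psi> U (q + 1) t"
  have y0: "y \<ge> 0" unfolding y_def by (rule weighted_moment_nonneg)
  obtain D where D: "(weighted_moment \<psi> U p has_real_derivative D) (at t)"
    "D \<le> - model_energy ?V / (2 * \<kappa>) + 22 * (real p)\<^sup>2 * \<kappa> * \<Gamma> * y"
    using weighted_moment_deriv[OF t(1), of "2 * q + 1"] unfolding pq[symmetric] y_def by blast
  \<comment> \<open>\<open>b\<close> is the total rate to be absorbed: the wanted decay plus the
    error from \<Gamma>. With r = 1 / (c b), b times the energy term of the Nash inequality is
    exactly the available dissipation.\<close>
  define b where "b = (?\<theta> + 1) * real p / t + 22 * (real p)\<^sup>2 * \<kappa> * \<Gamma>"
  define c where "c = 2 * \<kappa> * nash_const"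
  have c1: "c \<ge> 1" unfolding c_def using kappa nash_const_ge_1 mult_mono[of 1 "2 * \<kappa>" 1 nash_const] by simp
  have b0: "b > 0"
    unfolding b_def using hom_dim_pos p1 t kappa weight_facts(3) by (intro add_pos_nonneg) auto
  have nash: "y \<le> nash_const * (1 / (c * b)) * model_energy ?V + (1 / (c * b)) powr (- ?\<theta>) * z\<^sup>2"
    using Nash_form_dom[OF V Vint, of "1 / (c * b)"] b0 c1 unfolding Vl1 Vl2 y_def z_def by simp
  have e1: "(1 / (c * b)) powr (- ?\<theta>) = (c * b) powr ?\<theta>"
    using b0 c1 by (simp add: powr_minus powr_divide)
  have e2: "nash_const * (1 / (c * b)) * model_energy ?V * b = model_energy ?V / (2 * \<kappa>)"
    using b0 kappa nash_const_ge_1 by (simp add: c_def)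
  have "b * y \<le> b * (nash_const * (1 / (c * b)) * model_energy ?V + (c * b) powr ?\<theta> * z\<^sup>2)"
    by (rule mult_left_mono[OF nash[unfolded e1] less_imp_le[OF b0]])
  also have "\<dots> = nash_const * (1 / (c * b)) * model_energy ?V * b + b * (c * b) powr ?\<theta> * z\<^sup>2"
    by (simp only: distrib_left mult_ac)
  finally have "b * y \<le> model_energy ?V / (2 * \<kappa>) + b * (c * b) powr ?\<theta> * z\<^sup>2" unfolding e2 .
  then have D2: "D \<le> - ((?\<theta> + 1) * real p / t) * y + b * (c * b) powr ?\<theta> * z\<^sup>2"
    using D(2) unfolding b_def by (simp add: algebra_simps)
  have "b * (c * b) powr ?\<theta> \<le> (c * b) * (c * b) powr ?\<theta>"
    using c1 b0 by (intro mult_right_mono) auto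
  also have "\<dots> = (c * b) powr (?\<theta> + 1)" using c1 b0 by (simp add: powr_add)
  also have "\<dots> \<le> (rate_const * (real p)\<^sup>2 * (1 + \<Gamma> * T) / t) powr (?\<theta> + 1)"
  proof (rule powr_mono2)
    have pp: "real p \<le> (real p)\<^sup>2" using p1 by (simp add: power2_eq_square)
    have "b * t = (?\<theta> + 1) * real p + 22 * \<kappa> * (real p)\<^sup>2 * (\<Gamma> * t)"
      using t by (simp add: b_def field_simps)
    also have "\<dots> \<le> (?\<theta> + 1) * (real p)\<^sup>2 * (1 + \<Gamma> * T) + 22 * \<kappa> * (real p)\<^sup>2 * (1 + \<Gamma> * T)"
    proof (intro add_mono)
      have "(?\<theta> + 1) * real p * 1 \<le> (?\<theta> + 1) * (real p)\<^sup>2 * (1 + \<Gamma> * T)"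
        using pp hom_dim_pos weight_facts(3) t by (intro mult_mono) auto
      then show "(?\<theta> + 1) * real p \<le> (?\<theta> + 1) * (real p)\<^sup>2 * (1 + \<Gamma> * T)" by simp
      have "\<Gamma> * t \<le> 1 + \<Gamma> * T" using mult_left_mono[OF t(2) weight_facts(3)] by simp
      then show "22 * \<kappa> * (real p)\<^sup>2 * (\<Gamma> * t) \<le> 22 * \<kappa> * (real p)\<^sup>2 * (1 + \<Gamma> * T)"
        using kappa by (intro mult_left_mono) auto
    qed
    finally have "b * t \<le> (?\<theta> + 1 + 22 * \<kappa>) * (real p)\<^sup>2 * (1 + \<Gamma> * T)" by (simp add: algebra_simps)
    then have "c * (b * t) \<le> c * ((?\<theta> + 1 + 22 * \<kappa>) * (real p)\<^sup>2 * (1 + \<Gamma> * T))"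
      using c1 by (intro mult_left_mono) auto
    then show "c * b \<le> rate_const * (real p)\<^sup>2 * (1 + \<Gamma> * T) / t"
      using t by (simp add: pos_le_divide_eq rate_const_def c_def mult_ac)
  qed (use c1 b0 hom_dim_pos in auto)
  finally have "b * (c * b) powr ?\<theta> * z\<^sup>2 \<le> (rate_const * (real p)\<^sup>2 * (1 + \<Gamma> * T) / t) powr (?\<theta> + 1) * z\<^sup>2"
    by (rule mult_right_mono) simp
  then show ?thesis using D(1) D2 unfolding y_def z_def by (intro exI[of _ D]) auto
qed

text \<open>The decay rate L / s calls for the integrating factor s powr L, which also kills the
  initial value. L = (hom_dim + 1) p is so large that, with the bound for the smaller moment
  inserted, the source becomes A * s powr (e - 1) with e = p + hom_dim \<ge> 1, integrable at 0. So
  s powr L times the moment, minus A * s powr e / e, starts at 0 and does not increase.\<close>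

lemma weighted_moment_double_le:
  fixes q :: nat
  assumes t: "t > 0" "t \<le> T"
    and IH: "\<And>s. 0 < s \<Longrightarrow> s \<le> T \<Longrightarrow> weighted_moment \<psi> U (q + 1) s \<le> K * s powr (- hom_dim * (real (q + 1) - 1))" and K: "K \<ge> 0"
  defines "p \<equiv> 2 * (q + 1)"
  shows "weighted_moment \<psi> U p t \<le> (rate_const * (real p)\<^sup>2 * (1 + \<Gamma> * T)) powr (hom_dim + 1) * K\<^sup>2 * t powr (- hom_dim * (real p - 1))"
proof -
  let ?\<theta> = hom_dim
  define L where "L = (?\<theta> + 1) * real p"
  define R where "R = rate_const * (real p)\<^sup>2 * (1 + \<Gamma> * T)"
  define A where "A = R powr (?\<theta> + 1) * K\<^sup>2"
  define e where "e = real p + ?\<theta>"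
  have p1: "real p \<ge> 2" by (simp add: p_def)
  have e1: "e \<ge> 1" using p1 hom_dim_pos by (simp add: e_def)
  have L0: "L > 0" using hom_dim_pos p1 by (simp add: L_def)
  have T0: "T > 0" using t by simp
  have R0: "R > 0" unfolding R_def using rate_const_ge_1 p1 weight_facts(3) T0
    by (intro mult_pos_pos) (auto intro: add_pos_nonneg)
  have A0: "A \<ge> 0" by (simp add: A_def)
  let ?z = "\<lambda>s. s powr L * weighted_moment \<psi> U p s - A * s powr e / e"
  have "?z t \<le> 0"
  proof (rule nonincreasing_from_limit[OF _ _ t(1)])
    have pq: "p = (2 * q + 1) + 1" by (simp add: p_def)
    have "(?z \<longlongrightarrow> 0 * (LINT x|lborel. (exp (\<psi> x) * f x) ^ (2 * p)) - A * 0 / e) (at_right 0)"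
    proof (intro tendsto_intros)
      show "(weighted_moment \<psi> U p \<longlongrightarrow> (LINT x|lborel. (exp (\<psi> x) * f x) ^ (2 * p))) (at_right 0)"
        unfolding pq by (rule weighted_moment_initial)
      have "((\<lambda>s. s powr r) \<longlongrightarrow> 0) (at_right 0)" if "r > 0" for r :: real
      proof -
        have "((\<lambda>s. s powr r) \<longlongrightarrow> 0 powr r) (at_right 0)"
          by (rule tendsto_powr') (use that in \<open>auto intro!: tendsto_intros simp: eventually_at_right_field exI[of _ 1]\<close>)
        then show ?thesis by simp
      qed
      from this[OF L0] this[of e] show "((\<lambda>s. s powr L) \<longlongrightarrow> 0) (at_right 0)" "((\<lambda>s. s powr e) \<longlongrightarrow> 0) (at_right 0)"
        using e1 by auto
    qed (use e1 in auto)
    then show "(?z \<longlongrightarrow> 0) (at_right 0)" by simp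
    fix s :: real assume s: "s > 0" "s \<le> t"
    then have sT: "s \<le> T" using t by simp
    obtain D where D: "(weighted_moment \<psi> U p has_real_derivative D) (at s)"
      "D \<le> - (L / s) * weighted_moment \<psi> U p s + (R / s) powr (?\<theta> + 1) * (weighted_moment \<psi> U (q + 1) s)\<^sup>2"
      using weighted_moment_double_deriv[OF s(1) sT, of q] unfolding p_def[symmetric] L_def R_def by blast
    define y where "y = weighted_moment \<psi> U p s"
    have dp: "((\<lambda>s. s powr r) has_real_derivative r * s powr (r - 1)) (at s)" for r
      using s(1) by (rule has_real_derivative_powr)
    have "(?z has_real_derivative (s powr L * D + L * s powr (L - 1) * y) - A * (e * s powr (e - 1)) / e) (at s)"
      unfolding y_def by (rule DERIV_cong[OF DERIV_diff[OF DERIV_mult[OF dp D(1)] DERIV_cdivide[OF DERIV_cmult[OF dp]]]]) simp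
    moreover have "(s powr L * D + L * s powr (L - 1) * y) - A * (e * s powr (e - 1)) / e \<le> 0"
    proof -
      have sq: "(weighted_moment \<psi> U (q + 1) s)\<^sup>2 \<le> K\<^sup>2 * s powr (- ?\<theta> * (real p - 2))"
      proof -
        have "(weighted_moment \<psi> U (q + 1) s)\<^sup>2 \<le> (K * s powr (- ?\<theta> * (real (q + 1) - 1)))\<^sup>2"
          using IH[OF s(1) sT] weighted_moment_nonneg by (rule power_mono)
        also have "\<dots> = K\<^sup>2 * s powr (- ?\<theta> * (real p - 2))"
        proof -
          have "(s powr (- ?\<theta> * (real (q + 1) - 1)))\<^sup>2 = s powr (- ?\<theta> * (real p - 2))"
            unfolding power2_eq_square powr_add[symmetric] by (rule arg_cong[where f = "(powr) s"]) (simp add: p_def algebra_simps)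
          then show ?thesis by (simp only: power_mult_distrib)
        qed
        finally show ?thesis .
      qed
      have sL: "s powr (L - 1) = s powr L / s" using s by (simp add: powr_diff)
      have "s powr L * D \<le> s powr L * (- (L / s) * y + (R / s) powr (?\<theta> + 1) * (K\<^sup>2 * s powr (- ?\<theta> * (real p - 2))))"
        using D(2) mult_left_mono[OF sq, of "(R / s) powr (?\<theta> + 1)"] unfolding y_def by (intro mult_left_mono) auto
      also have "\<dots> = - (L * s powr (L - 1) * y) + A * (s powr L * s powr (- (?\<theta> + 1)) * s powr (- ?\<theta> * (real p - 2)))"
      proof -
        have Rs: "(R / s) powr (?\<theta> + 1) = R powr (?\<theta> + 1) * s powr (- (?\<theta> + 1))"
        proof -
          have "(R / s) powr l = R powr l * s powr (- l)" for l
            using s R0 by (simp add: powr_divide powr_minus_divide)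
          then show ?thesis .
        qed
        show ?thesis unfolding sL A_def Rs by (simp add: divide_inverse algebra_simps)
      qed
      also have "s powr L * s powr (- (?\<theta> + 1)) * s powr (- ?\<theta> * (real p - 2)) = s powr (e - 1)"
        unfolding powr_add[symmetric] by (rule arg_cong[where f = "(powr) s"]) (simp add: L_def e_def algebra_simps)
      finally show ?thesis using e1 by simp
    qed
    ultimately show "\<exists>D. (?z has_real_derivative D) (at s) \<and> D \<le> 0" by blast
  qed
  then have "t powr L * weighted_moment \<psi> U p t \<le> A * t powr e / e" by simp
  also have "\<dots> \<le> A * t powr e / 1" using e1 A0 by (intro divide_left_mono) auto
  finally have "t powr (- L) * (t powr L * weighted_moment \<psi> U p t) \<le> t powr (- L) * (A * t powr e)"
    by (intro mult_left_mono) auto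
  moreover have "t powr (- L) * (t powr L * weighted_moment \<psi> U p t) = weighted_moment \<psi> U p t"
    using t by (simp add: powr_minus)
  moreover have "t powr (- L) * (A * t powr e) = A * t powr (- ?\<theta> * (real p - 1))"
  proof -
    have "t powr (- L) * t powr e = t powr (- ?\<theta> * (real p - 1))"
      unfolding powr_add[symmetric] by (rule arg_cong[where f = "(powr) t"]) (simp add: L_def e_def algebra_simps)
    then show ?thesis by (simp only: mult.left_commute)
  qed
  ultimately show ?thesis unfolding A_def R_def by simp
qed

text \<open>The bound solves the recursion \<open>K (k + 1) = \<beta> * \<gamma> ^ k * (K k)\<^sup>2\<close>.\<close>

lemma weighted_moment_iterate:
  fixes k :: nat
  assumes T: "T > 0" and N: "(LINT x|lborel. (exp (\<psi> x) * f x)\<^sup>2) \<le> N" "N > 0"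
  defines "\<beta> \<equiv> (4 * rate_const * (1 + \<Gamma> * T)) powr (hom_dim + 1)" and "\<gamma> \<equiv> 4 powr (hom_dim + 1)"
  defines "Z \<equiv> \<beta> * \<gamma> * (exp (22 * \<kappa> * \<Gamma> * T) * N)"
  assumes t: "0 < t" "t \<le> T"
  shows "weighted_moment \<psi> U (2 ^ k) t \<le> Z ^ (2 ^ k) / (\<beta> * \<gamma> ^ (k + 1)) * t powr (- hom_dim * (2 ^ k - 1))"
  using t
proof (induction k arbitrary: t)
  case 0
  have b0: "\<beta> > 0" and g0: "\<gamma> > 0"
    unfolding \<beta>_def \<gamma>_def using rate_const_ge_1 add_pos_nonneg[OF zero_less_one mult_nonneg_nonneg[OF weight_facts(3) less_imp_le[OF T]]]
    by auto
  have "weighted_moment \<psi> U 1 t \<le> exp (22 * \<kappa> * \<Gamma> * t) * (LINT x|lborel. (exp (\<psi> x) * f x)\<^sup>2)"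
    by (rule weighted_moment_1_le) (use 0 in simp)
  also have "\<dots> \<le> exp (22 * \<kappa> * \<Gamma> * T) * N"
    using 0 N kappa weight_facts(3) by (intro mult_mono) (auto intro!: mult_left_mono mult_nonneg_nonneg integral_sq_nonneg)
  also have "\<dots> = Z / (\<beta> * \<gamma>)" using b0 g0 by (simp add: Z_def)
  finally show ?case using 0 by simp
next
  case (Suc k)
  have b0: "\<beta> > 0" and g0: "\<gamma> > 0"
    unfolding \<beta>_def \<gamma>_def using rate_const_ge_1 add_pos_nonneg[OF zero_less_one mult_nonneg_nonneg[OF weight_facts(3) less_imp_le[OF T]]]
    by auto
  have Z0: "Z > 0" unfolding Z_def using b0 g0 N by simp
  \<comment> \<open>\<open>weighted_moment_double_le\<close> passes from order q + 1 to 2 (q + 1),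
    so 2 ^ k is written as q + 1.\<close>
  define q where "q = (2::nat) ^ k - 1"
  have q: "q + 1 = 2 ^ k" by (simp add: q_def)
  have p: "2 * (q + 1) = 2 ^ Suc k" using q by simp
  define K where "K = Z ^ (2 ^ k) / (\<beta> * \<gamma> ^ (k + 1))"
  have K0: "K \<ge> 0" using b0 g0 Z0 by (simp add: K_def)
  have IH: "weighted_moment \<psi> U (q + 1) s \<le> K * s powr (- hom_dim * (real (q + 1) - 1))" if "0 < s" "s \<le> T" for s
    using Suc.IH[OF that] unfolding q K_def by simp
  have "weighted_moment \<psi> U (2 ^ Suc k) t \<le> (rate_const * (real (2 ^ Suc k))\<^sup>2 * (1 + \<Gamma> * T)) powr (hom_dim + 1) * K\<^sup>2 * t powr (- hom_dim * (real (2 ^ Suc k) - 1))"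
    using weighted_moment_double_le[OF Suc.prems IH K0] unfolding p .
  \<comment> \<open>The square of 2 ^ Suc k is 4 * 4 ^ k: the single 4 belongs to \<beta>, and 4 ^ k
    becomes \<gamma> ^ k.\<close>
  also have "(rate_const * (real (2 ^ Suc k))\<^sup>2 * (1 + \<Gamma> * T)) powr (hom_dim + 1) = \<beta> * \<gamma> ^ k"
  proof -
    have "rate_const * (real (2 ^ Suc k))\<^sup>2 * (1 + \<Gamma> * T) = (4 * rate_const * (1 + \<Gamma> * T)) * 4 ^ k"
      by (simp add: power_mult_distrib power2_eq_square flip: power_mult_distrib)
    also have "\<dots> powr (hom_dim + 1) = \<beta> * (4 ^ k) powr (hom_dim + 1)"
      unfolding \<beta>_def by (rule powr_mult)
    also have "(4 ^ k :: real) powr (hom_dim + 1) = \<gamma> ^ k"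
      unfolding \<gamma>_def by (simp add: powr_powr powr_realpow[symmetric] mult.commute)
    finally show ?thesis .
  qed
  also have "\<beta> * \<gamma> ^ k * K\<^sup>2 = Z ^ (2 ^ Suc k) / (\<beta> * \<gamma> ^ (Suc k + 1))"
  proof -
    have "(Z ^ (2 ^ k))\<^sup>2 = Z ^ (2 ^ Suc k)" by (simp add: power_mult[symmetric] mult.commute)
    moreover have "(\<gamma> ^ (k + 1))\<^sup>2 = \<gamma> ^ k * \<gamma> ^ (Suc k + 1)"
    proof -
      have "(k + 1) * 2 = k + (Suc k + 1)" by simp
      then show ?thesis by (simp only: power_mult[symmetric] power_add[symmetric])
    qed
    ultimately show ?thesis
      unfolding K_def power_divide power_mult_distrib using b0 g0 by (simp add: power2_eq_square field_simps)
  qed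
  finally show ?case by simp
qed

text \<open>Because \<beta> \<gamma>^(k+1) \<ge> 1, the moment of order 2^k is at most T powr
  hom_dim times the 2^k-th power of Z * T powr (- hom_dim), and
  \<open>AE_le_if_power_integrals_le\<close> takes k to infinity. The factor (1 + \<Gamma> T) powr
  (hom_dim + 1) is absorbed into the exponential.\<close>

lemma orbit_weighted_L2_Linf:
  assumes T: "T > 0" and N: "(LINT x|lborel. (exp (\<psi> x) * f x)\<^sup>2) \<le> N" "N > 0"
  shows "AE x in lborel. (exp (\<psi> x) * U T x)\<^sup>2
    \<le> (16 * rate_const) powr (hom_dim + 1) * T powr (- hom_dim) * exp ((hom_dim + 1 + 22 * \<kappa>) * \<Gamma> * T) * N"
proof -
  define \<beta> where "\<beta> = (4 * rate_const * (1 + \<Gamma> * T)) powr (hom_dim + 1)"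
  define \<gamma> :: real where "\<gamma> = 4 powr (hom_dim + 1)"
  define Z where "Z = \<beta> * \<gamma> * (exp (22 * \<kappa> * \<Gamma> * T) * N)"
  define Q where "Q = Z * T powr (- hom_dim)"
  have GT: "0 \<le> \<Gamma> * T" using weight_facts(3) T by simp
  have r4: "1 \<le> 4 * rate_const * (1 + \<Gamma> * T)"
    using mult_mono[of 1 "4 * rate_const" 1 "1 + \<Gamma> * T"] rate_const_ge_1 GT by simp
  have b1: "\<beta> \<ge> 1" and g1: "\<gamma> \<ge> 1"
    unfolding \<beta>_def \<gamma>_def using r4 hom_dim_pos by (auto intro!: ge_one_powr_ge_zero)
  have Z0: "Z > 0" using b1 g1 N by (simp add: Z_def)
  have Q0: "Q > 0" using Z0 T by (simp add: Q_def)
  note [measurable] = L2_measurable[OF orbit_L2[OF orb T]] C1_fun_measurable[OF weight_facts(1)]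
  have "AE x in lborel. (exp (\<psi> x) * U T x)\<^sup>2 \<le> Q"
  proof (rule AE_le_if_power_integrals_le[where c = "T powr hom_dim"])
    fix k :: nat
    have eq: "((exp (\<psi> x) * U T x)\<^sup>2) ^ (2 ^ k) = (exp (\<psi> x) * U T x) ^ (2 * 2 ^ k)" for x by (simp add: power_mult)
    have int: "integrable lborel (\<lambda>x. (exp (\<psi> x) * U T x) ^ (2 * 2 ^ k))"
    proof -
      define q where "q = (2::nat) ^ k - 1"
      have "(\<lambda>x. (exp (\<psi> x) * U T x) ^ (q + 1)) \<in> L2" by (rule form_domD(1)[OF power_form_dom[OF T]])
      then have "integrable lborel (\<lambda>x. ((exp (\<psi> x) * U T x) ^ (q + 1))\<^sup>2)" by (simp add: L2_def)
      moreover have "q + 1 = 2 ^ k" by (simp add: q_def)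
      ultimately show ?thesis by (simp only: power_mult[symmetric] mult.commute[of 2])
    qed
    have "weighted_moment \<psi> U (2 ^ k) T \<le> Z ^ (2 ^ k) / (\<beta> * \<gamma> ^ (k + 1)) * T powr (- hom_dim * (2 ^ k - 1))"
      unfolding Z_def \<beta>_def \<gamma>_def using weighted_moment_iterate[OF T N T order_refl] .
    also have "\<dots> \<le> Z ^ (2 ^ k) / 1 * T powr (- hom_dim * (2 ^ k - 1))"
    proof (intro mult_right_mono divide_left_mono)
      show "1 \<le> \<beta> * \<gamma> ^ (k + 1)"
        using mult_mono[OF b1 one_le_power[OF g1, of "k + 1"]] b1 by simp
    qed (use Z0 b1 g1 in auto)
    also have "T powr (- hom_dim * (2 ^ k - 1)) = T powr hom_dim * (T powr (- hom_dim)) ^ (2 ^ k)"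
    proof -
      have "(T powr (- hom_dim)) ^ (2 ^ k) = T powr (- hom_dim * 2 ^ k)"
        using T by (subst powr_realpow[symmetric]) (auto simp: powr_powr)
      then show ?thesis by (simp add: algebra_simps flip: powr_add)
    qed
    also have "Z ^ (2 ^ k) / 1 * (T powr hom_dim * (T powr (- hom_dim)) ^ (2 ^ k)) = T powr hom_dim * Q ^ (2 ^ k)"
      by (simp add: Q_def power_mult_distrib)
    finally have Y: "weighted_moment \<psi> U (2 ^ k) T \<le> T powr hom_dim * Q ^ (2 ^ k)" .
    have "(\<integral>\<^sup>+x. ennreal (((exp (\<psi> x) * U T x)\<^sup>2) ^ (2 ^ k)) \<partial>lborel) = ennreal (weighted_moment \<psi> U (2 ^ k) T)"
      unfolding eq weighted_moment_def by (rule nn_integral_eq_integral[OF int]) (simp add: power_mult)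
    also have "\<dots> \<le> ennreal (T powr hom_dim * Q ^ (2 ^ k))" by (rule ennreal_leI[OF Y])
    finally show "(\<integral>\<^sup>+x. ennreal (((exp (\<psi> x) * U T x)\<^sup>2) ^ (2 ^ k)) \<partial>lborel) \<le> ennreal (T powr hom_dim * Q ^ (2 ^ k))" .
  qed (use Q0 in auto)
  moreover have "Q \<le> (16 * rate_const) powr (hom_dim + 1) * T powr (- hom_dim) * exp ((hom_dim + 1 + 22 * \<kappa>) * \<Gamma> * T) * N"
  proof -
    have "\<beta> * \<gamma> = (16 * rate_const) powr (hom_dim + 1) * (1 + \<Gamma> * T) powr (hom_dim + 1)"
    proof -
      have "\<beta> * \<gamma> = (4 * rate_const * (1 + \<Gamma> * T) * 4) powr (hom_dim + 1)"
        unfolding \<beta>_def \<gamma>_def by (rule powr_mult[symmetric])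
      also have "4 * rate_const * (1 + \<Gamma> * T) * 4 = (16 * rate_const) * (1 + \<Gamma> * T)" by simp
      also have "\<dots> powr (hom_dim + 1) = (16 * rate_const) powr (hom_dim + 1) * (1 + \<Gamma> * T) powr (hom_dim + 1)"
        by (rule powr_mult)
      finally show ?thesis .
    qed
    also have "\<dots> \<le> (16 * rate_const) powr (hom_dim + 1) * exp (\<Gamma> * T) powr (hom_dim + 1)"
      using GT hom_dim_pos exp_ge_add_one_self[of "\<Gamma> * T"] by (intro mult_left_mono powr_mono2) auto
    also have "exp (\<Gamma> * T) powr (hom_dim + 1) = exp ((hom_dim + 1) * (\<Gamma> * T))"
      by (simp add: powr_def)
    finally have "\<beta> * \<gamma> \<le> (16 * rate_const) powr (hom_dim + 1) * exp ((hom_dim + 1) * (\<Gamma> * T))" .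
    then have "\<beta> * \<gamma> * (exp (22 * \<kappa> * \<Gamma> * T) * N) * T powr (- hom_dim)
        \<le> (16 * rate_const) powr (hom_dim + 1) * exp ((hom_dim + 1) * (\<Gamma> * T)) * (exp (22 * \<kappa> * \<Gamma> * T) * N) * T powr (- hom_dim)"
      using N by (intro mult_right_mono) auto
    also have "\<dots> = (16 * rate_const) powr (hom_dim + 1) * T powr (- hom_dim) * (exp ((hom_dim + 1) * (\<Gamma> * T)) * exp (22 * \<kappa> * \<Gamma> * T)) * N"
      by (simp only: mult_ac)
    also have "exp ((hom_dim + 1) * (\<Gamma> * T)) * exp (22 * \<kappa> * \<Gamma> * T) = exp ((hom_dim + 1 + 22 * \<kappa>) * \<Gamma> * T)"
      by (simp add: algebra_simps flip: exp_add)
    finally show ?thesis by (simp only: Q_def Z_def)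
  qed
  ultimately show ?thesis by (auto elim!: eventually_mono)
qed

end

end

section \<open>Off-diagonal bounds\<close>

lemma C1_fun_sin_affine:
  assumes g: "bounded_linear g"
  shows "C1_fun (\<lambda>x. A * sin (g x + c))"
    "frechet_derivative (\<lambda>x. A * sin (g x + c)) (at x) b = A * cos (g x + c) * g b"
proof -
  have d: "((\<lambda>s. A * sin (s + c)) has_real_derivative A * cos (s + c)) (at s)" for s
    by (auto intro!: derivative_eq_intros)
  have ct: "continuous_on UNIV (\<lambda>s. A * cos (s + c))" by (intro continuous_intros)
  show "C1_fun (\<lambda>x. A * sin (g x + c))"
    by (rule C1_fun_compose(1)[OF C1_fun_linear(1)[OF g] d ct])
  show "frechet_derivative (\<lambda>x. A * sin (g x + c)) (at x) b = A * cos (g x + c) * g b"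
    using C1_fun_compose(2)[OF C1_fun_linear(1)[OF g] d ct] C1_fun_linear(2)[OF g] by simp
qed

lemma C1_fun_sum:
  assumes "finite S" "\<And>i. i \<in> S \<Longrightarrow> C1_fun (f i)"
  shows "C1_fun (\<lambda>x. \<Sum>i\<in>S. f i x) \<and>
    (\<forall>x b. frechet_derivative (\<lambda>x. \<Sum>i\<in>S. f i x) (at x) b = (\<Sum>i\<in>S. frechet_derivative (f i) (at x) b))"
  using assms
proof (induction S)
  case empty
  then show ?case by (simp add: C1_fun_const)
next
  case (insert i S)
  then have "C1_fun (f i)" "C1_fun (\<lambda>x. \<Sum>i\<in>S. f i x)" by auto
  from C1_fun_add[OF this] insert show ?case by simp
qed

lemma sin_increment_le: "\<bar>sin (s + r) - sin s\<bar> \<le> min 2 \<bar>r\<bar>" for s r :: real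
proof -
  have "norm (sin (s + r) - sin s) \<le> 1 * norm ((s + r) - s)"
    by (rule field_differentiable_bound[where S = UNIV and f' = cos]) (auto intro!: derivative_eq_intros)
  moreover have "\<bar>sin (s + r) - sin s\<bar> \<le> 2"
    using abs_sin_le_one[of "s + r"] abs_sin_le_one[of s] by linarith
  ultimately show ?thesis by simp
qed

text \<open>Two regimes. For large h, D \<le> l gives exp (2 l). For small h, exp D - 1 \<le> D exp
  D \<le> 2 l (|h| / R) exp l, and squaring produces l^2, paid for by l^2 \<le> 2 exp l. This raises
  exp (2 l) to exp (3 l).\<close>

lemma exp_minus_one_square_le:
  fixes D l h R :: real
  assumes l: "l \<ge> 0" and R: "R > 0" and D: "0 \<le> D" "D \<le> l" "D \<le> l / 2 * (pi * \<bar>h\<bar> / R)"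
  shows "(exp D - 1)\<^sup>2 \<le> 8 * exp (3 * l) * min 1 ((h / R)\<^sup>2)"
proof -
  have e3: "exp (2 * l) \<le> exp (3 * l)" using l by simp
  have a: "(exp D - 1)\<^sup>2 \<le> 8 * exp (3 * l)"
  proof -
    have "(exp D - 1)\<^sup>2 \<le> (exp l)\<^sup>2" using D l by (intro power_mono) (auto intro: order_trans[of _ "exp D"])
    also have "\<dots> = exp (2 * l)" by (simp add: exp_double)
    also have "\<dots> \<le> 8 * exp (3 * l)" using e3 exp_ge_zero[of "3 * l"] by linarith
    finally show ?thesis .
  qed
  have b: "(exp D - 1)\<^sup>2 \<le> 8 * exp (3 * l) * (h / R)\<^sup>2"
  proof -
    have "exp D - 1 \<le> D * exp D"
    proof -
      have "1 - D \<le> exp (- D)" using exp_ge_add_one_self[of "- D"] by simp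
      then have "(1 - D) * exp D \<le> exp (- D) * exp D" by (rule mult_right_mono) simp
      then show ?thesis by (simp add: algebra_simps flip: exp_add)
    qed
    also have "\<dots> \<le> (l / 2 * (pi * \<bar>h\<bar> / R)) * exp l"
      using D l R by (intro mult_mono) auto
    also have "\<dots> \<le> (2 * l * (\<bar>h\<bar> / R)) * exp l"
    proof (rule mult_right_mono)
      have "pi * (l * \<bar>h\<bar> / R / 2) \<le> 4 * (l * \<bar>h\<bar> / R / 2)"
        using pi_less_4 l R by (intro mult_right_mono) auto
      then show "l / 2 * (pi * \<bar>h\<bar> / R) \<le> 2 * l * (\<bar>h\<bar> / R)" by (simp add: field_simps)
    qed simp
    finally have "(exp D - 1)\<^sup>2 \<le> ((2 * l * (\<bar>h\<bar> / R)) * exp l)\<^sup>2"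
      using D by (intro power_mono) auto
    also have "\<dots> = 4 * (l\<^sup>2 * exp (2 * l)) * (h / R)\<^sup>2"
      by (simp add: power_mult_distrib power_divide exp_double)
    also have "\<dots> \<le> 4 * (2 * exp l * exp (2 * l)) * (h / R)\<^sup>2"
      using exp_lower_Taylor_quadratic[OF l] l by (intro mult_right_mono mult_left_mono) auto
    also have "2 * exp l * exp (2 * l) = 2 * exp (3 * l)" by (simp flip: exp_add)
    finally show ?thesis by simp
  qed
  from a b show ?thesis by (simp add: min_def)
qed

lemma half_le_sin_1: "1 / 2 \<le> sin (1 :: real)"
proof -
  have "sin (pi / 6) \<le> sin (1 :: real)"
    using pi_less_4 pi_gt3 by (intro sin_monotone_2pi_le) auto
  then show ?thesis by (simp add: sin_30)
qed

section \<open>From weighted orbit bounds to the kernel\<close>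

context dirichlet_setting
begin

lemma weight_uminus:
  assumes "weight \<psi> B \<Gamma>"
  shows "weight (\<lambda>x. - \<psi> x) B \<Gamma>"
proof -
  have C: "C1_fun \<psi>" using assms by (simp add: weight_def)
  have m: "(\<lambda>x. - \<psi> x) = (\<lambda>x. -1 * \<psi> x)" by simp
  have C': "C1_fun (\<lambda>x. - \<psi> x)"
    unfolding m by (rule C1_fun_mult(1)[OF C1_fun_const(1) C])
  have fr: "frechet_derivative (\<lambda>x. - \<psi> x) (at x) b = - frechet_derivative \<psi> (at x) b" for x b
    unfolding m C1_fun_mult(2)[OF C1_fun_const(1) C] by (simp add: C1_fun_const)
  have eq: "\<bar>- \<psi> y - - \<psi> x\<bar> = \<bar>\<psi> y - \<psi> x\<bar>" for x y by simp
  show ?thesis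
    using assms C' unfolding weight_def fr eq abs_minus_cancel power2_minus by blast
qed

definition rate_prefactor :: "real \<Rightarrow> real \<Rightarrow> real" where
  "rate_prefactor \<Gamma> T = (16 * rate_const) powr (hom_dim + 1) * T powr (- hom_dim) * exp ((hom_dim + 1 + 22 * \<kappa>) * \<Gamma> * T)"

lemma rate_prefactor_nonneg: "0 \<le> rate_prefactor \<Gamma> T"
  by (simp add: rate_prefactor_def)

lemma weight_L2:
  assumes \<psi>: "weight \<psi> B \<Gamma>" and u: "u \<in> L2"
  shows "(\<lambda>x. exp (\<psi> x) * u x) \<in> L2"
proof -
  have C: "C1_fun \<psi>" and b: "\<And>x. \<bar>\<psi> x\<bar> \<le> B" using \<psi> by (auto simp: weight_def)
  note [measurable] = C1_fun_measurable[OF C] L2_measurable[OF u]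
  have e: "exp (\<psi> x) \<le> exp B" for x using abs_le_D1[OF b[of x]] by simp
  show ?thesis
    by (rule L2_dominated[OF u, where B = "exp B"])
      (auto simp: abs_mult simp del: exp_le_cancel_iff intro!: mult_right_mono e)
qed

text \<open>Dual to the bound from \<open>L2\<close> to the essential supremum, applied with the weight \<open>- \<psi>\<close>.\<close>

lemma orbit_weighted_L1_L2:
  assumes ex: "\<And>f. f \<in> L2 \<Longrightarrow> \<exists>U. semigroup_orbit J a f U"
    and orb: "semigroup_orbit J a f U" and f: "f \<in> L2" "AE x in lborel. \<bar>f x\<bar> \<le> M" and M0: "M \<ge> 0"
    and \<psi>: "weight \<psi> B \<Gamma>" and T: "T > 0" and i: "integrable lborel (\<lambda>x. exp (\<psi> x) * f x)"
  shows "(LINT x|lborel. (exp (\<psi> x) * U T x)\<^sup>2) \<le> rate_prefactor \<Gamma> T * (LINT x|lborel. \<bar>exp (\<psi> x) * f x\<bar>)\<^sup>2"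
proof -
  have b: "\<And>x. \<bar>\<psi> x\<bar> \<le> B" using \<psi> by (auto simp: weight_def)
  \<comment> \<open>The dual datum exp(2 \<psi>) U T: its pairing with U T is the quantity X to be
    bounded, and so is its squared L2 norm with the weight - \<psi>. The resulting inequality X
    \<le> ?I * sqrt (A * X) can be solved for X.\<close>
  let ?h = "\<lambda>x. exp (\<psi> x) * (exp (\<psi> x) * U T x)"
  let ?I = "LINT x|lborel. \<bar>exp (\<psi> x) * f x\<bar>"
  define X where "X = (LINT x|lborel. (exp (\<psi> x) * U T x)\<^sup>2)"
  define A where "A = rate_prefactor \<Gamma> T"
  have A0: "A \<ge> 0" unfolding A_def by (rule rate_prefactor_nonneg)
  have I0: "?I \<ge> 0" by (rule Bochner_Integration.integral_nonneg) simp
  have UT: "U T \<in> L2" by (rule orbit_L2[OF orb T])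
  have h: "?h \<in> L2" by (intro weight_L2[OF \<psi>] UT)
  have hb: "AE x in lborel. \<bar>?h x\<bar> \<le> exp B * (exp B * M)"
    using orbit_bounded[OF orb f M0 T]
  proof eventually_elim
    case (elim x)
    have "\<bar>exp (\<psi> x)\<bar> * (\<bar>exp (\<psi> x)\<bar> * \<bar>U T x\<bar>) \<le> exp B * (exp B * M)"
      using elim b[of x] by (intro mult_mono) auto
    then show ?case by (simp add: abs_mult)
  qed
  obtain W where W: "semigroup_orbit J a ?h W" using ex[OF h] by blast
  have WT: "W T \<in> L2" by (rule orbit_L2[OF W T])
  have X0: "X \<ge> 0" unfolding X_def by (rule integral_sq_nonneg)
  have "X \<le> A * ?I\<^sup>2"
  proof (cases "X = 0")
    case True
    then show ?thesis using A0 by simp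
  next
    case False
    then have Xp: "X > 0" using X0 by simp
    have "(LINT x|lborel. (exp (- \<psi> x) * ?h x)\<^sup>2) = X"
      unfolding X_def by (rule Bochner_Integration.integral_cong) (simp_all add: mult.assoc[symmetric] flip: exp_add)
    then have "AE x in lborel. (exp (- \<psi> x) * W T x)\<^sup>2 \<le> A * X"
      using orbit_weighted_L2_Linf[OF W h hb _ weight_uminus[OF \<psi>] T _ Xp] M0
      unfolding A_def rate_prefactor_def by simp
    then have Wb: "AE x in lborel. \<bar>exp (- \<psi> x) * W T x\<bar> \<le> sqrt (A * X)"
      by eventually_elim (metis real_sqrt_abs real_sqrt_le_mono)
    have "X = (LINT x|lborel. U T x * ?h x)"
      unfolding X_def by (rule Bochner_Integration.integral_cong) (simp_all add: power2_eq_square mult_ac)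
    also have "\<dots> = (LINT x|lborel. f x * W T x)"
      using orbit_duality[OF orb W f(1) h, of "T / 2" T] T by simp
    also have "\<dots> \<le> (LINT x|lborel. \<bar>exp (\<psi> x) * f x\<bar> * sqrt (A * X))"
    proof (rule integral_mono_AE)
      show "integrable lborel (\<lambda>x. f x * W T x)" by (rule integrable_mult_L2[OF f(1) WT])
      show "integrable lborel (\<lambda>x. \<bar>exp (\<psi> x) * f x\<bar> * sqrt (A * X))" using i by simp
      show "AE x in lborel. f x * W T x \<le> \<bar>exp (\<psi> x) * f x\<bar> * sqrt (A * X)"
        using Wb
      proof eventually_elim
        case (elim x)
        have "f x * W T x = (exp (\<psi> x) * f x) * (exp (- \<psi> x) * W T x)"
        proof -
          have "exp (\<psi> x) * exp (- \<psi> x) = 1" by (simp flip: exp_add)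
          then have "(exp (\<psi> x) * exp (- \<psi> x)) * (f x * W T x) = f x * W T x" by simp
          then show ?thesis by (simp only: mult_ac)
        qed
        also have "\<dots> \<le> \<bar>exp (\<psi> x) * f x\<bar> * \<bar>exp (- \<psi> x) * W T x\<bar>"
          by (metis abs_ge_self abs_mult)
        also have "\<dots> \<le> \<bar>exp (\<psi> x) * f x\<bar> * sqrt (A * X)" by (rule mult_left_mono[OF elim]) simp
        finally show ?case .
      qed
    qed
    also have "\<dots> = ?I * sqrt (A * X)" by simp
    finally have "X\<^sup>2 \<le> (?I * sqrt (A * X))\<^sup>2" using X0 by (rule power_mono)
    also have "\<dots> = (A * ?I\<^sup>2) * X" using A0 X0 by (simp add: power_mult_distrib)
    finally have "X * X \<le> (A * ?I\<^sup>2) * X" by (simp add: power2_eq_square)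
    then show ?thesis using Xp by (rule mult_right_le_imp_le)
  qed
  then show ?thesis unfolding X_def A_def .
qed

text \<open>The time 2 T is shared equally: U (2 T) paired with g is U T paired with W T.
  Cauchy-Schwarz, with \<psi> on U and - \<psi> on W, takes the square root of the prefactor from
  each half.\<close>

lemma orbit_bilinear_bound:
  assumes ex: "\<And>f. f \<in> L2 \<Longrightarrow> \<exists>U. semigroup_orbit J a f U"
    and U: "semigroup_orbit J a f U" and W: "semigroup_orbit J a g W"
    and f: "f \<in> L2" "AE x in lborel. \<bar>f x\<bar> \<le> M" and g: "g \<in> L2" "AE x in lborel. \<bar>g x\<bar> \<le> M" and M0: "M \<ge> 0"
    and \<psi>: "weight \<psi> B \<Gamma>" and T: "T > 0"
    and fi: "integrable lborel (\<lambda>x. exp (\<psi> x) * f x)" and gi: "integrable lborel (\<lambda>x. exp (- \<psi> x) * g x)"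
  shows "(LINT x|lborel. U (2 * T) x * g x)
     \<le> rate_prefactor \<Gamma> T * (LINT x|lborel. \<bar>exp (\<psi> x) * f x\<bar>) * (LINT x|lborel. \<bar>exp (- \<psi> x) * g x\<bar>)"
proof -
  let ?F = "LINT x|lborel. \<bar>exp (\<psi> x) * f x\<bar>" and ?G = "LINT x|lborel. \<bar>exp (- \<psi> x) * g x\<bar>"
  define A where "A = rate_prefactor \<Gamma> T"
  have A0: "A \<ge> 0" unfolding A_def by (rule rate_prefactor_nonneg)
  have F0: "?F \<ge> 0" and G0: "?G \<ge> 0" by (rule Bochner_Integration.integral_nonneg, simp)+
  have u: "(\<lambda>x. exp (\<psi> x) * U T x) \<in> L2" and w: "(\<lambda>x. exp (- \<psi> x) * W T x) \<in> L2"
    by (intro weight_L2[OF \<psi>] weight_L2[OF weight_uminus[OF \<psi>]] orbit_L2[OF U T] orbit_L2[OF W T])+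
  have bu: "(LINT x|lborel. (exp (\<psi> x) * U T x)\<^sup>2) \<le> A * ?F\<^sup>2"
    unfolding A_def by (rule orbit_weighted_L1_L2[OF ex U f M0 \<psi> T fi])
  have bw: "(LINT x|lborel. (exp (- \<psi> x) * W T x)\<^sup>2) \<le> A * ?G\<^sup>2"
    unfolding A_def by (rule orbit_weighted_L1_L2[OF ex W g M0 weight_uminus[OF \<psi>] T gi])
  have "(LINT x|lborel. U (2 * T) x * g x) = (LINT x|lborel. U T x * W T x)"
    using orbit_duality(2)[OF U W f(1) g(1) T, of "2 * T"] T by simp
  also have "\<dots> = (LINT x|lborel. (exp (\<psi> x) * U T x) * (exp (- \<psi> x) * W T x))"
  proof (rule Bochner_Integration.integral_cong[OF refl])
    fix x
    have "exp (\<psi> x) * exp (- \<psi> x) = 1" by (simp flip: exp_add)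
    then have "(exp (\<psi> x) * exp (- \<psi> x)) * (U T x * W T x) = U T x * W T x" by simp
    then show "U T x * W T x = (exp (\<psi> x) * U T x) * (exp (- \<psi> x) * W T x)" by (simp only: mult_ac)
  qed
  also have "\<dots> \<le> sqrt (LINT x|lborel. (exp (\<psi> x) * U T x)\<^sup>2) * sqrt (LINT x|lborel. (exp (- \<psi> x) * W T x)\<^sup>2)"
    using L2_inner_abs_le[OF u w] by linarith
  also have "\<dots> \<le> sqrt (A * ?F\<^sup>2) * sqrt (A * ?G\<^sup>2)"
    using bu bw by (intro mult_mono real_sqrt_le_mono) (auto simp: integral_sq_nonneg A0)
  also have "\<dots> = A * ?F * ?G"
    using A0 F0 G0 by (simp add: real_sqrt_mult)
  finally show ?thesis unfolding A_def .
qed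

text \<open>The bilinear bound is the integrated form of the claim. A failure at (x0, y0) would, by
  continuity of the kernel, be a failure by a margin c on a product of two balls; testing with their
  indicators then contradicts the bilinear bound by c times the product of the volumes.\<close>

lemma heat_kernel_le_weight:
  assumes hk: "is_heat_kernel J a p" and \<psi>: "weight \<psi> B \<Gamma>" and T: "T > 0"
  shows "p (2 * T) x0 y0 \<le> rate_prefactor \<Gamma> T * exp (\<psi> y0 - \<psi> x0)"
proof (rule ccontr)
  define A where "A = rate_prefactor \<Gamma> T"
  have A0: "A \<ge> 0" unfolding A_def by (rule rate_prefactor_nonneg)
  let ?t = "2 * T"
  assume "\<not> ?thesis"
  then have big: "p ?t x0 y0 - A * exp (\<psi> y0 - \<psi> x0) > 0" by (simp add: A_def)
  have C: "C1_fun \<psi>" using \<psi> by (simp add: weight_def)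
  note [measurable] = C1_fun_measurable[OF C]
  define c where "c = (p ?t x0 y0 - A * exp (\<psi> y0 - \<psi> x0)) / 2"
  have c0: "c > 0" using big by (simp add: c_def)
  let ?q = "\<lambda>z. p ?t (fst z) (snd z) - A * exp (\<psi> (snd z) - \<psi> (fst z))"
  have "continuous_on UNIV (\<lambda>z. p ?t (fst z) (snd z))"
  proof -
    have "continuous_on UNIV (\<lambda>z :: ('d, 'n) pt \<times> ('d, 'n) pt. (\<lambda>(t, x, y). p t x y) (?t, z))"
    proof (rule continuous_on_compose2[where g = "\<lambda>(t, x, y). p t x y" and f = "\<lambda>z. (?t, z)" and t = "{0<..} \<times> UNIV"])
      show "continuous_on ({0<..} \<times> UNIV) (\<lambda>(t, x, y). p t x y)" using hk by (simp add: is_heat_kernel_def)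
    qed (use T in \<open>auto intro!: continuous_intros\<close>)
    then show ?thesis by (simp add: case_prod_beta')
  qed
  then have cq: "continuous_on UNIV ?q"
    by (intro continuous_intros continuous_on_compose2[OF C1_fun_continuous[OF C, of UNIV]]) auto
  have o: "open (?q -` {c<..})"
    using cq open_vimage[of "{c<..}" ?q] by (simp add: continuous_on_eq_continuous_at)
  have "(x0, y0) \<in> ?q -` {c<..}" using c0 big by (simp add: c_def)
  with o obtain S1 S2 where S: "open S1" "open S2" "(x0, y0) \<in> S1 \<times> S2" "S1 \<times> S2 \<subseteq> ?q -` {c<..}"
    by (rule open_prod_elim)
  have xy: "x0 \<in> S1" "y0 \<in> S2" using S(3) by auto
  obtain \<delta>1 where d1: "\<delta>1 > 0" "ball x0 \<delta>1 \<subseteq> S1" using S(1) xy(1) by (rule openE)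
  obtain \<delta>2 where d2: "\<delta>2 > 0" "ball y0 \<delta>2 \<subseteq> S2" using S(2) xy(2) by (rule openE)
  \<comment> \<open>The kernel integrates the datum in its second variable, so the datum
    \<open>?f\<close> sits near y0 and the test function \<open>?g\<close> near x0.\<close>
  let ?f = "indicator (ball y0 \<delta>2) :: ('d, 'n) pt \<Rightarrow> real" and ?g = "indicator (ball x0 \<delta>1) :: ('d, 'n) pt \<Rightarrow> real"
  have ind_L2: "(indicator (ball z r) :: ('d, 'n) pt \<Rightarrow> real) \<in> L2" for z r
  proof (rule L2_dominated[OF indicator_ball_L2[of "norm z + r"], where B = 1])
    show "AE x in lborel. \<bar>indicator (ball z r) x :: real\<bar> \<le> 1 * \<bar>indicator (cball 0 (norm z + r)) x\<bar>"
    proof (rule AE_I2)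
      fix x :: "('d, 'n) pt"
      have "norm x \<le> norm z + r" if "x \<in> ball z r"
        using that norm_triangle_ineq2[of x z] by (simp add: dist_norm norm_minus_commute)
      then show "\<bar>indicator (ball z r) x :: real\<bar> \<le> 1 * \<bar>indicator (cball 0 (norm z + r)) x\<bar>"
        by (auto simp: indicator_def)
    qed
  qed (auto intro!: borel_measurable_indicator)
  have f: "?f \<in> L2" and g: "?g \<in> L2" by (rule ind_L2)+
  have idem: "indicator S x * indicator S x = (indicator S x :: real)" for S and x :: "('d, 'n) pt"
    by (simp add: indicator_def)
  have fi: "integrable lborel (\<lambda>x. exp (\<psi> x) * ?f x)"
    using integrable_mult_L2[OF weight_L2[OF \<psi> f] f] by (simp only: mult.assoc idem)
  have gi: "integrable lborel (\<lambda>x. exp (- \<psi> x) * ?g x)"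
    using integrable_mult_L2[OF weight_L2[OF weight_uminus[OF \<psi>] g] g] by (simp only: mult.assoc idem)
  have f1: "integrable lborel ?f" and g1: "integrable lborel ?g"
    using f g by (simp_all only: L2_def mem_Collect_eq power2_eq_square idem)
  have ex: "\<exists>U. semigroup_orbit J a f U" if "f \<in> L2" for f
    using hk that unfolding is_heat_kernel_def by blast
  obtain U where U: "semigroup_orbit J a ?f U"
    and U_all: "\<forall>t>0. AE x in lborel. integrable lborel (\<lambda>y. p t x y * ?f y) \<and> U t x = (LINT y|lborel. p t x y * ?f y)"
    using hk f unfolding is_heat_kernel_def by blast
  have Up: "AE x in lborel. integrable lborel (\<lambda>y. p ?t x y * ?f y) \<and> U ?t x = (LINT y|lborel. p ?t x y * ?f y)"
    using U_all T by simp
  obtain W where W: "semigroup_orbit J a ?g W" using ex[OF g] by blast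
  define F where "F = (LINT x|lborel. exp (\<psi> x) * ?f x)"
  define G where "G = (LINT x|lborel. exp (- \<psi> x) * ?g x)"
  have "(LINT x|lborel. U ?t x * ?g x) \<le> A * (LINT x|lborel. \<bar>exp (\<psi> x) * ?f x\<bar>) * (LINT x|lborel. \<bar>exp (- \<psi> x) * ?g x\<bar>)"
    unfolding A_def
    by (rule orbit_bilinear_bound[OF ex U W f _ g _ _ \<psi> T fi gi, where M = 1]) (auto simp: indicator_def)
  then have up: "(LINT x|lborel. U ?t x * ?g x) \<le> A * F * G"
    by (simp add: F_def G_def abs_mult)
  define V1 where "V1 = (LINT y|lborel. ?f y)"
  define V2 where "V2 = (LINT x|lborel. ?g x)"
  have V: "V1 > 0" "V2 > 0"
    unfolding V1_def V2_def using d1 d2 content_ball_pos by auto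
  have "(LINT x|lborel. A * F * (exp (- \<psi> x) * ?g x) + c * V1 * ?g x) \<le> (LINT x|lborel. U ?t x * ?g x)"
  proof (rule integral_mono_AE)
    show "integrable lborel (\<lambda>x. A * F * (exp (- \<psi> x) * ?g x) + c * V1 * ?g x)"
      using gi g1 by (intro Bochner_Integration.integrable_add integrable_mult_right)
    show "integrable lborel (\<lambda>x. U ?t x * ?g x)"
      using T by (intro integrable_mult_L2 orbit_L2[OF U] g) simp
    show "AE x in lborel. A * F * (exp (- \<psi> x) * ?g x) + c * V1 * ?g x \<le> U ?t x * ?g x"
      using Up
    proof eventually_elim
      case (elim x)
      show ?case
      proof (cases "x \<in> ball x0 \<delta>1")
        case True
        have "(LINT y|lborel. A * exp (- \<psi> x) * (exp (\<psi> y) * ?f y) + c * ?f y) \<le> (LINT y|lborel. p ?t x y * ?f y)"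
        proof (rule integral_mono)
          show "integrable lborel (\<lambda>y. A * exp (- \<psi> x) * (exp (\<psi> y) * ?f y) + c * ?f y)"
            using fi f1 by (intro Bochner_Integration.integrable_add integrable_mult_right)
          show "integrable lborel (\<lambda>y. p ?t x y * ?f y)" using elim by blast
          fix y
          show "A * exp (- \<psi> x) * (exp (\<psi> y) * ?f y) + c * ?f y \<le> p ?t x y * ?f y"
          proof (cases "y \<in> ball y0 \<delta>2")
            case yb: True
            have "(x, y) \<in> S1 \<times> S2" using True yb d1(2) d2(2) by blast
            then have "c < ?q (x, y)" using S(4) by blast
            then show ?thesis using yb by (simp add: exp_diff exp_minus field_simps)
          qed simp
        qed
        also have "(LINT y|lborel. A * exp (- \<psi> x) * (exp (\<psi> y) * ?f y) + c * ?f y) = A * exp (- \<psi> x) * F + c * V1"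
          unfolding F_def V1_def using fi f1 by (subst Bochner_Integration.integral_add) (auto simp only: integrable_mult_right integral_mult_right_zero)
        finally show ?thesis using elim True by (simp add: mult_ac)
      qed simp
    qed
  qed
  also have "(LINT x|lborel. A * F * (exp (- \<psi> x) * ?g x) + c * V1 * ?g x) = A * F * G + c * V1 * V2"
    unfolding G_def V2_def using gi g1 by (subst Bochner_Integration.integral_add) (auto simp only: integrable_mult_right integral_mult_right_zero)
  finally have "A * F * G + c * V1 * V2 \<le> A * F * G" using up by linarith
  then show False using c0 V by (simp add: mult_le_0_iff)
qed

text \<open>16 = 8 * 2, from \<open>exp_minus_one_square_le\<close> and
  \<open>min_square_powr_integral_le\<close>.\<close>

definition levy_const :: real where "levy_const = 16 * (1 / (2 - \<alpha>) + 1 / \<alpha>)"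

lemma levy_const_nonneg: "0 \<le> levy_const"
  unfolding levy_const_def using alpha by simp

text \<open>A sine with half period \<delta> and oscillation l has increments at most l and at most
  l \<pi> |h| / (2 |\<delta>|), the two inputs of \<open>exp_minus_one_square_le\<close>; the
  remaining kernel integral scales like |\<delta>|^(-\<alpha>).\<close>

lemma sin_weight_jump_le:
  assumes l: "l \<ge> 0" and \<delta>: "\<delta> \<noteq> 0"
  shows "(\<integral>\<^sup>+h. ennreal ((exp \<bar>l / 2 * sin (s + h * (pi / \<delta>)) - l / 2 * sin s\<bar> - 1)\<^sup>2 * \<bar>h\<bar> powr (-1 - \<alpha>)) \<partial>lborel)
    \<le> ennreal (levy_const * exp (3 * l) * \<bar>\<delta>\<bar> powr (- \<alpha>))"
proof -
  let ?D = "\<lambda>h. \<bar>l / 2 * sin (s + h * (pi / \<delta>)) - l / 2 * sin s\<bar>"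
  have \<delta>0: "\<bar>\<delta>\<bar> > 0" using \<delta> by simp
  have D: "?D h \<le> l / 2 * min 2 (pi * \<bar>h\<bar> / \<bar>\<delta>\<bar>)" for h
  proof -
    have "?D h = l / 2 * \<bar>sin (s + h * (pi / \<delta>)) - sin s\<bar>"
      using l by (simp only: right_diff_distrib[symmetric] abs_mult)
    also have "\<dots> \<le> l / 2 * min 2 \<bar>h * (pi / \<delta>)\<bar>"
      using l by (intro mult_left_mono sin_increment_le) auto
    also have "\<bar>h * (pi / \<delta>)\<bar> = pi * \<bar>h\<bar> / \<bar>\<delta>\<bar>" by (simp add: abs_mult mult.commute)
    finally show ?thesis .
  qed
  have D1: "?D h \<le> l" for h
    using D[of h] l mult_left_mono[of "min 2 (pi * \<bar>h\<bar> / \<bar>\<delta>\<bar>)" 2 "l / 2"] by simp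
  have D2: "?D h \<le> l / 2 * (pi * \<bar>h\<bar> / \<bar>\<delta>\<bar>)" for h
    by (rule order_trans[OF D mult_left_mono]) (use l in auto)
  have "(\<integral>\<^sup>+h. ennreal ((exp (?D h) - 1)\<^sup>2 * \<bar>h\<bar> powr (-1 - \<alpha>)) \<partial>lborel)
      \<le> (\<integral>\<^sup>+h. ennreal (8 * exp (3 * l)) * ennreal (min 1 ((h / \<bar>\<delta>\<bar>)\<^sup>2) * \<bar>h\<bar> powr (-1 - \<alpha>)) \<partial>lborel)"
  proof (rule nn_integral_mono)
    fix h :: real
    have "(exp (?D h) - 1)\<^sup>2 * \<bar>h\<bar> powr (-1 - \<alpha>) \<le> 8 * exp (3 * l) * min 1 ((h / \<bar>\<delta>\<bar>)\<^sup>2) * \<bar>h\<bar> powr (-1 - \<alpha>)"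
      by (intro mult_right_mono exp_minus_one_square_le[OF l \<delta>0 abs_ge_zero D1 D2]) simp
    then show "ennreal ((exp (?D h) - 1)\<^sup>2 * \<bar>h\<bar> powr (-1 - \<alpha>)) \<le> ennreal (8 * exp (3 * l)) * ennreal (min 1 ((h / \<bar>\<delta>\<bar>)\<^sup>2) * \<bar>h\<bar> powr (-1 - \<alpha>))"
      by (simp add: ennreal_leI mult.assoc flip: ennreal_mult)
  qed
  also have "\<dots> = ennreal (8 * exp (3 * l)) * (\<integral>\<^sup>+h. ennreal (min 1 ((h / \<bar>\<delta>\<bar>)\<^sup>2) * \<bar>h\<bar> powr (-1 - \<alpha>)) \<partial>lborel)"
    by (rule nn_integral_cmult) measurable
  also have "\<dots> \<le> ennreal (8 * exp (3 * l)) * ennreal (2 * (1 / (2 - \<alpha>) + 1 / \<alpha>) * \<bar>\<delta>\<bar> powr (- \<alpha>))"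
    by (intro mult_left_mono min_square_powr_integral_le alpha \<delta>0) simp
  also have "\<dots> = ennreal (levy_const * exp (3 * l) * \<bar>\<delta>\<bar> powr (- \<alpha>))"
    using alpha by (simp add: levy_const_def mult_ac flip: ennreal_mult)
  finally show ?thesis .
qed

section \<open>The weight adapted to a pair of points: its cost and its gain\<close>

context
  fixes x y :: "('d, 'n) pt" and t \<mu> :: real
begin

text \<open>Since \<open>exp (3 * amp i) = \<bar>gap i\<bar> powr \<alpha> / t\<close>, the jump part of the weight costs only \<open>O(1 / t)\<close>, while
  it gains the factor \<open>exp (- amp i)\<close>: this is where the exponent \<open>\<alpha> / 3\<close> comes from. Sine profiles keep the
  weight bounded and smooth and have oscillation exactly \<open>amp i\<close>. If \<open>gap i = 0\<close> or \<open>vgap = 0\<close>, division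
  by zero makes the corresponding summand vanish.\<close>

definition gap :: "'d \<Rightarrow> real" where "gap i = fst x $ i - fst y $ i"
definition amp :: "'d \<Rightarrow> real" where
  "amp i = (if gap i \<noteq> 0 \<and> t < \<bar>gap i\<bar> powr \<alpha> then ln (\<bar>gap i\<bar> powr \<alpha> / t) / 3 else 0)"
definition vgap :: "real^'n" where "vgap = snd x - snd y"

definition jump_weight :: "'d \<Rightarrow> ('d, 'n) pt \<Rightarrow> real" where
  "jump_weight i z = amp i / 2 * sin (fst z $ i * (pi / gap i) + (- (fst x $ i + fst y $ i) / 2 * (pi / gap i)))"
text \<open>The argument of the sine is 1 at x and 0 at y when vgap \<noteq> 0, and the prefactor is
  chosen so that the gradient has norm at most \<mu> |vgap| / t.\<close>

definition diff_weight :: "('d, 'n) pt \<Rightarrow> real" where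
  "diff_weight z = \<mu> * (norm vgap)\<^sup>2 / t * sin (vgap \<bullet> snd z / (norm vgap)\<^sup>2 + (- (vgap \<bullet> snd y) / (norm vgap)\<^sup>2))"
definition davies_weight :: "('d, 'n) pt \<Rightarrow> real" where
  "davies_weight z = (\<Sum>i\<in>UNIV. jump_weight i z) + diff_weight z"
text \<open>The first term adds up the jump cost \<open>levy_const / t\<close> over the d
  directions, the second is the squared slope of \<open>diff_weight\<close>.\<close>

definition davies_gamma :: real where
  "davies_gamma = real CARD('d) * levy_const / t + \<mu>\<^sup>2 * (norm vgap)\<^sup>2 / t\<^sup>2"

context
  assumes t: "t > 0" and \<mu>: "\<mu> > 0"
begin

lemma amp_nonneg: "amp i \<ge> 0"
  unfolding amp_def using t by (auto simp: field_simps intro!: ln_ge_zero)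

lemma jump_weight_C1:
  "C1_fun (jump_weight i)"
  "frechet_derivative (jump_weight i) (at z) b = amp i / 2 * cos (fst z $ i * (pi / gap i) + (- (fst x $ i + fst y $ i) / 2 * (pi / gap i))) * (fst b $ i * (pi / gap i))"
proof -
  have g: "bounded_linear (\<lambda>z :: ('d, 'n) pt. fst z $ i * (pi / gap i))"
    by (intro bounded_linear_mult_const bounded_linear_compose[OF bounded_linear_vec_nth bounded_linear_fst])
  show "C1_fun (jump_weight i)" unfolding jump_weight_def[abs_def] by (rule C1_fun_sin_affine(1)[OF g])
  show "frechet_derivative (jump_weight i) (at z) b = amp i / 2 * cos (fst z $ i * (pi / gap i) + (- (fst x $ i + fst y $ i) / 2 * (pi / gap i))) * (fst b $ i * (pi / gap i))"
    unfolding jump_weight_def[abs_def] by (rule C1_fun_sin_affine(2)[OF g])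
qed

lemma diff_weight_C1:
  "C1_fun diff_weight"
  "frechet_derivative diff_weight (at z) b = \<mu> * (norm vgap)\<^sup>2 / t * cos (vgap \<bullet> snd z / (norm vgap)\<^sup>2 + (- (vgap \<bullet> snd y) / (norm vgap)\<^sup>2)) * (vgap \<bullet> snd b / (norm vgap)\<^sup>2)"
proof -
  have g: "bounded_linear (\<lambda>z :: ('d, 'n) pt. vgap \<bullet> snd z / (norm vgap)\<^sup>2)"
    by (intro bounded_linear_divide[THEN bounded_linear_compose] bounded_linear_compose[OF bounded_linear_inner_right bounded_linear_snd])
  show "C1_fun diff_weight" unfolding diff_weight_def[abs_def] by (rule C1_fun_sin_affine(1)[OF g])
  show "frechet_derivative diff_weight (at z) b = \<mu> * (norm vgap)\<^sup>2 / t * cos (vgap \<bullet> snd z / (norm vgap)\<^sup>2 + (- (vgap \<bullet> snd y) / (norm vgap)\<^sup>2)) * (vgap \<bullet> snd b / (norm vgap)\<^sup>2)"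
    unfolding diff_weight_def[abs_def] by (rule C1_fun_sin_affine(2)[OF g])
qed

lemma davies_weight_C1:
  "C1_fun davies_weight"
  "frechet_derivative davies_weight (at z) b = (\<Sum>i\<in>UNIV. frechet_derivative (jump_weight i) (at z) b) + frechet_derivative diff_weight (at z) b"
proof -
  have s: "C1_fun (\<lambda>z. \<Sum>i\<in>UNIV. jump_weight i z)"
    "frechet_derivative (\<lambda>z. \<Sum>i\<in>UNIV. jump_weight i z) (at z) b = (\<Sum>i\<in>UNIV. frechet_derivative (jump_weight i) (at z) b)" for z b
  proof -
    have s0: "C1_fun (\<lambda>x. \<Sum>i\<in>UNIV. jump_weight i x) \<and>
      (\<forall>x b. frechet_derivative (\<lambda>x. \<Sum>i\<in>UNIV. jump_weight i x) (at x) b = (\<Sum>i\<in>UNIV. frechet_derivative (jump_weight i) (at x) b))"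
      by (rule C1_fun_sum) (simp_all add: jump_weight_C1(1))
    show "C1_fun (\<lambda>z. \<Sum>i\<in>UNIV. jump_weight i z)" by (rule s0[THEN conjunct1])
    show "frechet_derivative (\<lambda>z. \<Sum>i\<in>UNIV. jump_weight i z) (at z) b = (\<Sum>i\<in>UNIV. frechet_derivative (jump_weight i) (at z) b)"
      by (rule s0[THEN conjunct2, THEN spec, THEN spec])
  qed
  show "C1_fun davies_weight" unfolding davies_weight_def[abs_def] by (rule C1_fun_add(1)[OF s(1) diff_weight_C1(1)])
  show "frechet_derivative davies_weight (at z) b = (\<Sum>i\<in>UNIV. frechet_derivative (jump_weight i) (at z) b) + frechet_derivative diff_weight (at z) b"
    unfolding davies_weight_def[abs_def] C1_fun_add(2)[OF s(1) diff_weight_C1(1)] s(2) ..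
qed

text \<open>A jump along e_i changes only \<open>jump_weight i\<close>. Either amp i = 0 and nothing
  is paid, or exp (3 * amp i) compensates |gap i|^(-\<alpha>) up to 1 / t, so the cost no longer
  depends on the gap.\<close>

lemma davies_weight_jump_integral:
  "(\<integral>\<^sup>+h. ennreal ((exp \<bar>davies_weight (z + h *\<^sub>R ejump i) - davies_weight z\<bar> - 1)\<^sup>2 * \<bar>h\<bar> powr (-1 - \<alpha>)) \<partial>lborel)
    \<le> ennreal (levy_const / t)"
proof -
  let ?s = "fst z $ i * (pi / gap i) + (- (fst x $ i + fst y $ i) / 2 * (pi / gap i))"
  have other: "jump_weight k (z + h *\<^sub>R ejump i) = jump_weight k z" if "k \<noteq> i" for k h
    using that by (simp add: jump_weight_def ejump_def axis_def)
  have diff: "diff_weight (z + h *\<^sub>R ejump i) = diff_weight z" for h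
    by (simp add: diff_weight_def ejump_def)
  have inc: "davies_weight (z + h *\<^sub>R ejump i) - davies_weight z
      = amp i / 2 * sin (?s + h * (pi / gap i)) - amp i / 2 * sin ?s" for h
  proof -
    have "(\<Sum>k\<in>UNIV. jump_weight k w) = jump_weight i w + (\<Sum>k\<in>UNIV - {i}. jump_weight k w)" for w
      by (simp add: sum.remove[of UNIV i])
    moreover have "(\<Sum>k\<in>UNIV - {i}. jump_weight k (z + h *\<^sub>R ejump i)) = (\<Sum>k\<in>UNIV - {i}. jump_weight k z)"
      by (rule sum.cong) (auto simp: other)
    ultimately have "davies_weight (z + h *\<^sub>R ejump i) - davies_weight z = jump_weight i (z + h *\<^sub>R ejump i) - jump_weight i z"
      by (simp add: davies_weight_def diff)
    also have "jump_weight i (z + h *\<^sub>R ejump i) = amp i / 2 * sin (?s + h * (pi / gap i))"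
    proof -
      have "fst (z + h *\<^sub>R ejump i) $ i = fst z $ i + h" by (simp add: ejump_def)
      then show ?thesis unfolding jump_weight_def by (simp only: distrib_right add_ac)
    qed
    finally show ?thesis by (simp add: jump_weight_def)
  qed
  show ?thesis
  proof (cases "gap i \<noteq> 0 \<and> t < \<bar>gap i\<bar> powr \<alpha>")
    case True
    then have g: "gap i \<noteq> 0" by auto
    have gp: "\<bar>gap i\<bar> powr \<alpha> > 0" using g by simp
    have "exp (3 * amp i) = \<bar>gap i\<bar> powr \<alpha> / t"
      using True gp t by (simp add: amp_def)
    then have "levy_const * exp (3 * amp i) * \<bar>gap i\<bar> powr (- \<alpha>) = levy_const / t"
      using gp by (simp add: powr_minus field_simps)
    then show ?thesis
      unfolding inc using sin_weight_jump_le[OF amp_nonneg[of i] g, of ?s] by simp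
  next
    case False
    then have "amp i = 0" by (simp only: amp_def if_False)
    then show ?thesis unfolding inc by simp
  qed
qed

lemma davies_weight_is_weight: "\<exists>B. weight davies_weight B davies_gamma"
proof -
  define B1 where "B1 = (\<Sum>i\<in>UNIV. \<bar>amp i / 2\<bar>) + \<bar>\<mu> * (norm vgap)\<^sup>2 / t\<bar>"
  define B2 where "B2 = (\<Sum>i\<in>UNIV. \<bar>amp i / 2\<bar> * \<bar>pi / gap i\<bar>) + \<bar>\<mu> * (norm vgap)\<^sup>2 / t\<bar> * (norm vgap / (norm vgap)\<^sup>2)"
  have b1: "\<bar>davies_weight z\<bar> \<le> B1" for z
  proof -
    have "\<bar>jump_weight i z\<bar> \<le> \<bar>amp i / 2\<bar>" for i
      unfolding jump_weight_def abs_mult by (rule mult_left_le) auto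
    moreover have "\<bar>diff_weight z\<bar> \<le> \<bar>\<mu> * (norm vgap)\<^sup>2 / t\<bar>"
      unfolding diff_weight_def abs_mult[of _ "sin _"] by (rule mult_left_le) auto
    ultimately show ?thesis
      unfolding davies_weight_def B1_def
      by (intro order_trans[OF abs_triangle_ineq] add_mono order_trans[OF sum_abs] sum_mono)
  qed
  have b2: "\<bar>frechet_derivative davies_weight (at z) b\<bar> \<le> B2" if b: "b \<in> Basis" for z b
  proof -
    have nb: "norm b = 1" using b by simp
    have f1: "\<bar>fst b $ i\<bar> \<le> 1" for i
      using component_le_norm_cart[of "fst b" i] norm_fst_le[of "fst b" "snd b"] nb by simp
    have f2: "\<bar>vgap \<bullet> snd b\<bar> \<le> norm vgap"
      using Cauchy_Schwarz_ineq2[of vgap "snd b"] norm_snd_le[of "snd b" "fst b"] nb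
        mult_left_mono[of "norm (snd b)" 1 "norm vgap"] by simp
    have "\<bar>frechet_derivative (jump_weight i) (at z) b\<bar> \<le> \<bar>amp i / 2\<bar> * \<bar>pi / gap i\<bar>" for i
    proof -
      let ?c = "cos (fst z $ i * (pi / gap i) + (- (fst x $ i + fst y $ i) / 2 * (pi / gap i)))"
      have "\<bar>amp i / 2\<bar> * \<bar>?c\<bar> * (\<bar>fst b $ i\<bar> * \<bar>pi / gap i\<bar>) \<le> \<bar>amp i / 2\<bar> * 1 * (1 * \<bar>pi / gap i\<bar>)"
        using f1[of i] by (intro mult_mono) auto
      then show ?thesis unfolding jump_weight_C1(2) abs_mult by simp
    qed
    moreover have "\<bar>frechet_derivative diff_weight (at z) b\<bar> \<le> \<bar>\<mu> * (norm vgap)\<^sup>2 / t\<bar> * (norm vgap / (norm vgap)\<^sup>2)"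
    proof -
      let ?c = "cos (vgap \<bullet> snd z / (norm vgap)\<^sup>2 + (- (vgap \<bullet> snd y) / (norm vgap)\<^sup>2))"
      have "\<bar>\<mu> * (norm vgap)\<^sup>2 / t\<bar> * \<bar>?c\<bar> * \<bar>vgap \<bullet> snd b / (norm vgap)\<^sup>2\<bar> \<le> \<bar>\<mu> * (norm vgap)\<^sup>2 / t\<bar> * 1 * (norm vgap / (norm vgap)\<^sup>2)"
        using f2 by (intro mult_mono) (auto simp: abs_divide divide_right_mono)
      then show ?thesis unfolding diff_weight_C1(2) abs_mult[of _ "_ / _"] abs_mult[of _ "cos _"] by simp
    qed
    ultimately show ?thesis
      unfolding davies_weight_C1(2) B2_def
      by (intro order_trans[OF abs_triangle_ineq] add_mono order_trans[OF sum_abs] sum_mono)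
  qed
  have g0: "0 \<le> real CARD('d) * levy_const / t" using levy_const_nonneg t by simp
  have d0: "0 \<le> \<mu>\<^sup>2 * (norm vgap)\<^sup>2 / t\<^sup>2" by simp
  have grad: "(\<Sum>j\<in>UNIV. (frechet_derivative davies_weight (at z) (ediff j))\<^sup>2) \<le> davies_gamma" for z
  proof -
    let ?c = "cos (vgap \<bullet> snd z / (norm vgap)\<^sup>2 + (- (vgap \<bullet> snd y) / (norm vgap)\<^sup>2))"
    have e: "frechet_derivative davies_weight (at z) (ediff j) = \<mu> * (norm vgap)\<^sup>2 / t * ?c * (vgap $ j / (norm vgap)\<^sup>2)" for j
      unfolding davies_weight_C1(2) jump_weight_C1(2) diff_weight_C1(2) by (simp add: ediff_def inner_axis)
    have "(\<Sum>j\<in>UNIV. (frechet_derivative davies_weight (at z) (ediff j))\<^sup>2)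
        = (\<mu> * (norm vgap)\<^sup>2 / t * ?c)\<^sup>2 * ((\<Sum>j\<in>UNIV. (vgap $ j)\<^sup>2) / ((norm vgap)\<^sup>2)\<^sup>2)"
      unfolding e power_mult_distrib power_divide by (simp add: sum_distrib_left sum_divide_distrib)
    also have "(\<Sum>j\<in>UNIV. (vgap $ j)\<^sup>2) = (norm vgap)\<^sup>2"
      by (simp add: norm_vec_def L2_set_def sum_nonneg)
    also have "(\<mu> * (norm vgap)\<^sup>2 / t * ?c)\<^sup>2 * ((norm vgap)\<^sup>2 / ((norm vgap)\<^sup>2)\<^sup>2) = (\<mu>\<^sup>2 * (norm vgap)\<^sup>2 / t\<^sup>2) * ?c\<^sup>2"
      by (cases "vgap = 0") (simp_all add: power_mult_distrib power_divide power2_eq_square[of "(norm vgap)\<^sup>2"])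
    also have "\<dots> \<le> \<mu>\<^sup>2 * (norm vgap)\<^sup>2 / t\<^sup>2"
      by (rule mult_left_le) (auto simp: abs_square_le_1)
    finally show ?thesis using g0 unfolding davies_gamma_def by linarith
  qed
  have jump: "(\<Sum>i\<in>UNIV. \<integral>\<^sup>+h. ennreal ((exp \<bar>davies_weight (z + h *\<^sub>R ejump i) - davies_weight z\<bar> - 1)\<^sup>2 * \<bar>h\<bar> powr (-1 - \<alpha>)) \<partial>lborel) \<le> ennreal davies_gamma" for z
  proof -
    have "(\<Sum>i\<in>UNIV. \<integral>\<^sup>+h. ennreal ((exp \<bar>davies_weight (z + h *\<^sub>R ejump i) - davies_weight z\<bar> - 1)\<^sup>2 * \<bar>h\<bar> powr (-1 - \<alpha>)) \<partial>lborel)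
        \<le> (\<Sum>i\<in>(UNIV :: 'd set). ennreal (levy_const / t))"
      by (rule sum_mono) (rule davies_weight_jump_integral)
    also have "\<dots> = ennreal (real CARD('d) * levy_const / t)"
      using levy_const_nonneg t by (simp add: ennreal_mult ennreal_of_nat_eq_real_of_nat flip: times_divide_eq_right)
    also have "\<dots> \<le> ennreal davies_gamma"
      using d0 unfolding davies_gamma_def by (intro ennreal_leI) linarith
    finally show ?thesis .
  qed
  have "weight davies_weight (max B1 B2) davies_gamma"
    unfolding weight_def
    using davies_weight_C1(1) b1 b2 g0 d0 grad jump by (auto simp: le_max_iff_disj davies_gamma_def)
  then show ?thesis by blast
qed

text \<open>The phase of \<open>jump_weight i\<close> is centred at the midpoint of the i-th
  coordinates, so from x to y the sine runs from 1 to -1. The diffusive summand drops by \<mu>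
  |vgap|^2 sin 1 / t, and sin 1 \<ge> 1/2.\<close>

lemma davies_weight_gain:
  "davies_weight y - davies_weight x \<le> - (\<Sum>i\<in>UNIV. amp i) - \<mu> * (norm vgap)\<^sup>2 / (2 * t)"
proof -
  have j: "jump_weight i y - jump_weight i x = - amp i" for i
  proof (cases "gap i = 0")
    case True
    then have "amp i = 0" by (simp add: amp_def)
    then show ?thesis by (simp add: jump_weight_def)
  next
    case False
    have "fst x $ i * (pi / gap i) + (- (fst x $ i + fst y $ i) / 2 * (pi / gap i)) = gap i / 2 * (pi / gap i)"
      by (simp only: distrib_right[symmetric]) (simp add: gap_def field_simps)
    also have "\<dots> = pi / 2" using False by simp
    finally have sx: "fst x $ i * (pi / gap i) + (- (fst x $ i + fst y $ i) / 2 * (pi / gap i)) = pi / 2" .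
    have "fst y $ i * (pi / gap i) + (- (fst x $ i + fst y $ i) / 2 * (pi / gap i)) = - (gap i / 2) * (pi / gap i)"
    proof -
      have "fst y $ i + - (fst x $ i + fst y $ i) / 2 = - (gap i / 2)" by (simp add: gap_def field_simps)
      then show ?thesis by (simp only: distrib_right[symmetric])
    qed
    also have "\<dots> = - (pi / 2)" using False by simp
    finally have sy: "fst y $ i * (pi / gap i) + (- (fst x $ i + fst y $ i) / 2 * (pi / gap i)) = - (pi / 2)" .
    show ?thesis unfolding jump_weight_def sx sy by simp
  qed
  have d: "diff_weight y - diff_weight x \<le> - (\<mu> * (norm vgap)\<^sup>2 / (2 * t))"
  proof (cases "vgap = 0")
    case True
    then show ?thesis by (simp add: diff_weight_def)
  next
    case False
    have "vgap \<bullet> snd x / (norm vgap)\<^sup>2 + (- (vgap \<bullet> snd y) / (norm vgap)\<^sup>2) = (vgap \<bullet> vgap) / (norm vgap)\<^sup>2"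
      by (simp add: vgap_def inner_diff_right diff_divide_distrib)
    also have "\<dots> = 1" using False by (simp add: power2_norm_eq_inner)
    finally have "diff_weight x = \<mu> * (norm vgap)\<^sup>2 / t * sin 1" by (simp add: diff_weight_def)
    moreover have "diff_weight y = 0" by (simp add: diff_weight_def)
    moreover have "\<mu> * (norm vgap)\<^sup>2 / t * (1 / 2) \<le> \<mu> * (norm vgap)\<^sup>2 / t * sin 1"
      using \<mu> t by (intro mult_left_mono half_le_sin_1) auto
    ultimately show ?thesis by simp
  qed
  have "davies_weight y - davies_weight x = (\<Sum>i\<in>UNIV. jump_weight i y - jump_weight i x) + (diff_weight y - diff_weight x)"
    by (simp add: davies_weight_def sum_subtractf)
  also have "\<dots> = - (\<Sum>i\<in>UNIV. amp i) + (diff_weight y - diff_weight x)" by (simp add: j sum_negf)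
  finally show ?thesis using d by simp
qed

text \<open>For t < |gap i|^\<alpha>, equivalently t^(1/\<alpha>) / |gap i| < 1, the left side is (t
  / |gap i|^\<alpha>)^(1/3). The conditional supplies the value 1 for equal coordinates, where
  division by 0 would make the minimum 0.\<close>

lemma exp_minus_amp:
  "exp (- amp i) = (if fst x $ i = fst y $ i then 1 else min 1 (t powr (1 / \<alpha>) / \<bar>fst x $ i - fst y $ i\<bar>)) powr (\<alpha> / 3)"
proof (cases "gap i = 0")
  case True
  then have "amp i = 0" by (simp add: amp_def)
  then show ?thesis using True by (simp add: gap_def)
next
  case False
  then have g: "\<bar>gap i\<bar> > 0" by simp
  have ne: "fst x $ i \<noteq> fst y $ i" using False by (simp add: gap_def)
  have tp: "(t powr (1 / \<alpha>)) powr \<alpha> = t" using alpha t by (simp add: powr_powr)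
  show ?thesis
  proof (cases "t < \<bar>gap i\<bar> powr \<alpha>")
    case True
    have "t powr (1 / \<alpha>) < (\<bar>gap i\<bar> powr \<alpha>) powr (1 / \<alpha>)"
      using True t alpha by (intro powr_less_mono2) auto
    also have "\<dots> = \<bar>gap i\<bar>" using alpha g by (simp add: powr_powr)
    finally have lt: "t powr (1 / \<alpha>) / \<bar>gap i\<bar> < 1" using g by simp
    have "amp i = ln (\<bar>gap i\<bar> powr \<alpha> / t) / 3" using True False by (simp add: amp_def)
    also have "\<dots> = - (\<alpha> / 3 * ln (t powr (1 / \<alpha>) / \<bar>gap i\<bar>))"
      using g t alpha by (simp add: ln_div ln_powr field_simps)
    finally have "exp (- amp i) = (t powr (1 / \<alpha>) / \<bar>gap i\<bar>) powr (\<alpha> / 3)"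
      using g t by (simp add: powr_def)
    then show ?thesis using ne lt by (simp add: min_absorb2 flip: gap_def)
  next
    case nl: False
    have "\<bar>gap i\<bar> = (\<bar>gap i\<bar> powr \<alpha>) powr (1 / \<alpha>)" using alpha g by (simp add: powr_powr)
    also have "\<dots> \<le> t powr (1 / \<alpha>)" using nl alpha by (intro powr_mono2) auto
    finally have "1 \<le> t powr (1 / \<alpha>) / \<bar>gap i\<bar>" using g by simp
    moreover have "amp i = 0" using nl by (simp add: amp_def)
    ultimately show ?thesis using ne by (simp add: min_absorb1 flip: gap_def)
  qed
qed

end

end

section \<open>Choice of the constants\<close>

lemma heat_kernel_bound:
  assumes hk: "is_heat_kernel J a p"
  shows "\<exists>c C. 1 \<le> c \<and> 1 \<le> C \<and>
    (\<forall>t>0. \<forall>x y. p t x y \<le>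
       C * t powr (- real CARD('d) / \<alpha> - real CARD('n) / 2)
         * (\<Prod>i\<in>UNIV. (if fst x $ i = fst y $ i then 1
                          else min 1 (t powr (1 / \<alpha>) / \<bar>fst x $ i - fst y $ i\<bar>)) powr (\<alpha> / 3))
         * exp (- (norm (snd x - snd y))\<^sup>2 / (c * t)))"
proof -
  define K where "K = hom_dim + 1 + 22 * \<kappa>"
  \<comment> \<open>\<open>2 powr hom_dim\<close> appears because the estimates are run up to time t
    / 2; the exponential is K times the jump part of \<Gamma> times t / 2, in which t
    cancels.\<close>
  define C0 where "C0 = (16 * rate_const) powr (hom_dim + 1) * 2 powr hom_dim * exp (K * (real CARD('d) * levy_const) / 2)"
  \<comment> \<open>Cost and gain of the diffusive part combine to (K \<mu>^2 - \<mu>) v / (2 t),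
    where v is the squared distance. \<mu> = 1 / (2 K) minimises this, with value - v / (8 K t), so
    c = 8 K.\<close>
  define \<mu> where "\<mu> = 1 / (2 * K)"
  have K1: "K \<ge> 1" using hom_dim_pos kappa by (simp add: K_def)
  have \<mu>: "\<mu> > 0" using K1 by (simp add: \<mu>_def)
  have C00: "C0 \<ge> 0" by (simp add: C0_def)
  have "p t x y \<le> max 1 C0 * t powr (- real CARD('d) / \<alpha> - real CARD('n) / 2)
         * (\<Prod>i\<in>UNIV. (if fst x $ i = fst y $ i then 1
                          else min 1 (t powr (1 / \<alpha>) / \<bar>fst x $ i - fst y $ i\<bar>)) powr (\<alpha> / 3))
         * exp (- (norm (snd x - snd y))\<^sup>2 / (8 * K * t))" if t: "t > 0" for t x y
  proof -
    let ?\<psi> = "davies_weight x y t \<mu>" and ?\<Gamma> = "davies_gamma x y t \<mu>"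
    let ?P = "\<Prod>i\<in>UNIV. (if fst x $ i = fst y $ i then 1
                          else min 1 (t powr (1 / \<alpha>) / \<bar>fst x $ i - fst y $ i\<bar>)) powr (\<alpha> / 3)"
    define v where "v = (norm (snd x - snd y))\<^sup>2"
    have vg: "(norm (vgap x y))\<^sup>2 = v" by (simp add: vgap_def v_def)
    obtain B where W: "weight ?\<psi> B ?\<Gamma>" using davies_weight_is_weight[OF t \<mu>] by blast
    have "p t x y \<le> rate_prefactor ?\<Gamma> (t / 2) * exp (?\<psi> y - ?\<psi> x)"
      using heat_kernel_le_weight[OF hk W, of "t / 2" x y] t by simp
    also have "\<dots> \<le> rate_prefactor ?\<Gamma> (t / 2) * exp (- (\<Sum>i\<in>UNIV. amp x y t i) - \<mu> * v / (2 * t))"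
      using davies_weight_gain[OF t \<mu>, of x y] unfolding vg
      by (intro mult_left_mono rate_prefactor_nonneg) simp
    also have "rate_prefactor ?\<Gamma> (t / 2) = (16 * rate_const) powr (hom_dim + 1) * (t / 2) powr (- hom_dim)
        * exp (K * (real CARD('d) * levy_const) / 2 + K * \<mu>\<^sup>2 * v / (2 * t))"
    proof -
      have "K * ?\<Gamma> * (t / 2) = K * (real CARD('d) * levy_const) / 2 + K * \<mu>\<^sup>2 * v / (2 * t)"
        unfolding davies_gamma_def vg using t by (simp add: field_simps power2_eq_square)
      then show ?thesis unfolding rate_prefactor_def K_def[symmetric] by simp
    qed
    also have "(t / 2) powr (- hom_dim) = 2 powr hom_dim * t powr (- hom_dim)"
      using t by (simp add: powr_divide powr_minus divide_simps)
    also have "(16 * rate_const) powr (hom_dim + 1) * (2 powr hom_dim * t powr (- hom_dim))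
        * exp (K * (real CARD('d) * levy_const) / 2 + K * \<mu>\<^sup>2 * v / (2 * t))
        * exp (- (\<Sum>i\<in>UNIV. amp x y t i) - \<mu> * v / (2 * t))
      = C0 * t powr (- hom_dim) * exp (- (\<Sum>i\<in>UNIV. amp x y t i)) * exp (K * \<mu>\<^sup>2 * v / (2 * t) - \<mu> * v / (2 * t))"
    proof -
      have "X * (Y * Z) * exp (a + b) * exp (s - d) = X * Y * exp a * Z * exp s * exp (b - d)" for X Y Z a b s d :: real
        by (simp add: exp_add exp_diff)
      then show ?thesis unfolding C0_def .
    qed
    also have "exp (- (\<Sum>i\<in>UNIV. amp x y t i)) = ?P"
      by (simp only: sum_negf[symmetric] exp_sum[OF finite_class.finite_UNIV] exp_minus_amp[OF t \<mu>])
    also have "K * \<mu>\<^sup>2 * v / (2 * t) - \<mu> * v / (2 * t) = - v / (8 * K * t)"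
      using K1 t by (simp add: \<mu>_def field_simps power2_eq_square)
    also have "C0 * t powr (- hom_dim) * ?P * exp (- v / (8 * K * t)) \<le> max 1 C0 * t powr (- hom_dim) * ?P * exp (- v / (8 * K * t))"
      by (intro mult_right_mono prod_nonneg) auto
    also have "- hom_dim = - real CARD('d) / \<alpha> - real CARD('n) / 2" by (simp add: hom_dim_def)
    finally show ?thesis unfolding v_def .
  qed
  moreover have "1 \<le> 8 * K" "1 \<le> max 1 C0" using K1 by auto
  ultimately show ?thesis by blast
qed

end

theorem mainTheorem4:
  fixes \<alpha> \<kappa> :: real
    and J :: "('d::finite, 'n::finite) pt \<Rightarrow> ('d, 'n) pt \<Rightarrow> real"
    and a :: "('d, 'n) pt \<Rightarrow> ('d, 'n) pt \<Rightarrow> ('d, 'n) pt \<Rightarrow> real"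
    and p :: "real \<Rightarrow> ('d, 'n) pt \<Rightarrow> ('d, 'n) pt \<Rightarrow> real"
  assumes alpha: "0 < \<alpha>" "\<alpha> < 2"
    and kappa: "1 \<le> \<kappa>"
    and J_meas: "(\<lambda>(x, y). J x y) \<in> borel_measurable borel"
    and J_sym: "\<And>x y. J x y = J y x"
    and J_bounds: "\<And>x y. Jmodel \<alpha> x y / \<kappa> \<le> J x y \<and> J x y \<le> \<kappa> * Jmodel \<alpha> x y"
    and a_meas: "\<And>b1 b2. (\<lambda>x. a x b1 b2) \<in> borel_measurable borel"
    and a_sym: "AE x in lborel. \<forall>b1\<in>Basis. \<forall>b2\<in>Basis. a x b1 b2 = a x b2 b1"
    and a_ellip: "\<And>x \<xi>. (norm (snd \<xi>))\<^sup>2 / \<kappa> \<le> (\<Sum>b1\<in>Basis. \<Sum>b2\<in>Basis. a x b1 b2 * (\<xi> \<bullet> b1) * (\<xi> \<bullet> b2))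
                      \<and> (\<Sum>b1\<in>Basis. \<Sum>b2\<in>Basis. a x b1 b2 * (\<xi> \<bullet> b1) * (\<xi> \<bullet> b2)) \<le> \<kappa> * (norm (snd \<xi>))\<^sup>2"
    and hk: "is_heat_kernel J a p"
  shows "\<exists>c C. 1 \<le> c \<and> 1 \<le> C \<and>
    (\<forall>t>0. \<forall>x y. p t x y \<le>
       C * t powr (- real CARD('d) / \<alpha> - real CARD('n) / 2)
         * (\<Prod>i\<in>UNIV. (if fst x $ i = fst y $ i then 1
                          else min 1 (t powr (1 / \<alpha>) / \<bar>fst x $ i - fst y $ i\<bar>)) powr (\<alpha> / 3))
         * exp (- (norm (snd x - snd y))\<^sup>2 / (c * t)))"
proof -
  interpret dirichlet_setting \<alpha> \<kappa> J a
    by (unfold_locales) (fact alpha kappa J_meas J_sym J_bounds a_meas a_sym a_ellip)+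
  show ?thesis by (rule heat_kernel_bound[OF hk])
qed

end
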